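(* For each (large) real $t$ let $\sigma_t>1/2$ be a real number and put $s(t)=\sigma_t+it$. Assume that $\sigma_t\to\sigma_\infty$ as $t\to\infty$, where $\sigma_\infty>1/2$. Let $\nu_{s(t)}$ be the measure on $X=\mathrm{PSL}_2(\mathbb{Z})\backslash\mathbb{H}^2$ given by $$d\nu_{s(t)}(z)=\left|\frac{E(z,s(t))}{\sqrt{E(z,2\sigma_\infty)}}\right|^2 d\mu(z).$$ Let $A$ be a compact Jordan measurable subset of $X$. Then $$\nu_{s(t)}(A)\to\mu(A)$$ as $t\to\infty$.
   Context: Let $\Gamma=\mathrm{PSL}_2(\mathbb{Z})$ act on the upper half-plane $\mathbb{H}^2=\{z=x+iy: y>0\}$ by Möbius transformations, let $\Gamma_\infty$ be the cyclic subgroup generated by $z\mapsto z+1$, let $X=\Gamma\backslash\mathbb{H}^2$, and let $d\mu(z)=dx\,dy/y^2$ be the hyperbolic measure. A compact subset of $X$ is Jordan measurable if its boundary has $\mu$-measure zero. The Eisenstein series is $E(z,s)=\sum_{\gamma\in\Gamma_\infty\backslash\Gamma}\Im(\gamma z)^s$ for $\Re(s)>1$, extended by meromorphic continuation to all $s\in\mathbb{C}$. Since $2\sigma_\infty>1$, one has $E(z,2\sigma_\infty)>0$, so $\nu_{s(t)}$ is well defined. *)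

theory Defs
  imports
    "HOL-Algebra.Group_Action"
    "HOL-Algebra.Generated_Groups"
    "HOL-Complex_Analysis.Complex_Analysis"
begin

definition uhp :: "complex set" where
  "uhp = {z. Im z > 0}"

(* PSL(2,Z) acts faithfully on the upper half-plane and is identified with the group of
   Moebius transformations it induces there. *)
definition moebius :: "int \<Rightarrow> int \<Rightarrow> int \<Rightarrow> int \<Rightarrow> complex \<Rightarrow> complex" where
  "moebius a b c d =
     (\<lambda>z\<in>uhp. (of_int a * z + of_int b) / (of_int c * z + of_int d))"

definition PSL2Z :: "(complex \<Rightarrow> complex) monoid" where
  "PSL2Z = BijGroup uhp \<lparr>carrier := {moebius a b c d | a b c d. a * d - b * c = 1}\<rparr>"

definition Gamma_inf :: "(complex \<Rightarrow> complex) set" where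
  "Gamma_inf = generate PSL2Z {moebius 1 1 0 1}"

definition modular_proj :: "complex \<Rightarrow> complex set" where
  "modular_proj z = orbit PSL2Z (\<lambda>\<gamma>. \<gamma>) z"

definition modular_carrier :: "complex set set" where
  "modular_carrier = orbits PSL2Z uhp (\<lambda>\<gamma>. \<gamma>)"

(* The quotient topology; see modular_proj_quotient_map. *)
definition modular_curve :: "complex set topology" where
  "modular_curve = topology (\<lambda>U. U \<subseteq> modular_carrier \<and> open {z\<in>uhp. modular_proj z \<in> U})"

definition hyperbolic_measure :: "complex measure" where
  "hyperbolic_measure =
     density (restrict_space lborel uhp) (\<lambda>z. ennreal (1 / (Im z)\<^sup>2))"

definition fundamental_domain :: "complex set" where
  "fundamental_domain = {z\<in>uhp. \<bar>Re z\<bar> \<le> 1 / 2 \<and> cmod z \<ge> 1}"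

(* The hyperbolic measure on the quotient, on its Borel sets: the measure of a set B of orbits
   is the hyperbolic measure of the part of the fundamental domain lying over B.  The boundary
   of the domain, where the projection is not injective, is a null set. *)
definition modular_measure :: "complex set measure" where
  "modular_measure =
     distr (restrict_space hyperbolic_measure fundamental_domain)
       (sigma modular_carrier {U. openin modular_curve U}) modular_proj"

definition jordan_measurable_modular :: "complex set set \<Rightarrow> bool" where
  "jordan_measurable_modular A \<longleftrightarrow>
     compactin modular_curve A \<and> emeasure modular_measure (modular_curve frontier_of A) = 0"

(* For Re s > 1 the family is absolutely summable, and its terms do not depend on the chosen
   coset representatives, since translations preserve the imaginary part. *)
definition eisenstein_series :: "complex \<Rightarrow> complex \<Rightarrow> complex" where
  "eisenstein_series z s =
     (\<Sum>\<^sub>\<infinity>C\<in>rcosets\<^bsub>PSL2Z\<^esub> Gamma_inf. of_real (Im ((SOME \<gamma>. \<gamma> \<in> C) z)) powr s)"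

(* Meromorphic continuation in s, for fixed z in the upper half-plane.  A nicely meromorphic
   function has value 0 at its poles and no removable singularities, so that by the identity
   theorem there is at most one such continuation. *)
definition eisenstein :: "complex \<Rightarrow> complex \<Rightarrow> complex" where
  "eisenstein z =
     (THE f. f nicely_meromorphic_on UNIV \<and> (\<forall>s. Re s > 1 \<longrightarrow> f s = eisenstein_series z s))"

(* The Eisenstein series is invariant under PSL(2,Z) in z, so that it is a function on the
   quotient and the choice of the representative is immaterial. *)
definition eisenstein_modular :: "complex set \<Rightarrow> complex \<Rightarrow> complex" where
  "eisenstein_modular p = eisenstein (SOME z. z \<in> p)"

(* The first parameter is the limit of the real parts; the Eisenstein series under the root is
   evaluated at a real point > 1, where it is a positive real number. *)
definition eisenstein_measure :: "real \<Rightarrow> complex \<Rightarrow> complex set measure" where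
  "eisenstein_measure \<sigma>inf s =
     density modular_measure
       (\<lambda>p. ennreal ((cmod (eisenstein_modular p s /
          csqrt (eisenstein_modular p (of_real (2 * \<sigma>inf)))))\<^sup>2))"

lemma modular_proj_quotient_map:
  "quotient_map (top_of_set uhp) modular_curve modular_proj"
proof -
  let ?P = "\<lambda>U. U \<subseteq> modular_carrier \<and> open {z\<in>uhp. modular_proj z \<in> U}"
  have uhp: "open uhp"
    unfolding uhp_def by (rule open_halfspace_Im_gt)
  have int: "{z\<in>uhp. modular_proj z \<in> S \<inter> T} =
      {z\<in>uhp. modular_proj z \<in> S} \<inter> {z\<in>uhp. modular_proj z \<in> T}" for S T
    by auto
  have un: "{z\<in>uhp. modular_proj z \<in> \<Union>K} = (\<Union>S\<in>K. {z\<in>uhp. modular_proj z \<in> S})" for K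
    by auto
  have "istopology ?P"
    unfolding istopology_def
  proof (intro conjI allI impI)
    show "open {z\<in>uhp. modular_proj z \<in> S \<inter> T}" if "?P S" "?P T" for S T
      unfolding int using that by (intro open_Int) auto
    show "open {z\<in>uhp. modular_proj z \<in> \<Union>K}" if "\<forall>S\<in>K. ?P S" for K
      unfolding un using that by (intro open_UN) auto
  qed blast+
  then have openin: "openin modular_curve U \<longleftrightarrow> ?P U" for U
    unfolding modular_curve_def by (simp add: topology_inverse')
  have img: "modular_proj ` uhp = modular_carrier"
    unfolding modular_carrier_def orbits_def modular_proj_def by auto
  have "{z\<in>uhp. modular_proj z \<in> modular_carrier} = uhp"
    using img by auto
  then have "topspace modular_curve = modular_carrier"
    unfolding topspace_def openin using uhp by auto
  then show ?thesis
    unfolding quotient_map_def openin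
    using img by (simp add: openin_open_eq[OF uhp] Collect_conj_eq)
qed

end

theory Submission
  imports Defs "HOL-Probability.Probability" "HOL-Real_Asymp.Real_Asymp"
begin

text \<open>
  For Re s > 1 the Eisenstein series is the sum of Q(z,v) powr (-s) over the primitive pairs
  v = (c,d) up to sign, where Q(z,v) = |c z + d|^2 / Im z. Hence |E(z,\<sigma>+it)|^2 is a double sum over
  pairs (v,v') whose t-dependence is the phase t log (Q(z,v') / Q(z,v)). The diagonal
  v = v' has no phase and sums to E(z,2\<sigma>); for v ~= v' the phase is non-stationary on almost
  every vertical line, so its integral over a bounded region tends to 0 by a Riemann-Lebesgue
  argument. Dominated convergence proves the claim for exponents beyond 1
  (prim_pair_limit, eisenstein_product_limit).

  Up to the line Re s = 1/2 the series diverges, and analyticity replaces it. The integral of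
  h(z) E(z, s+u) E(z, s'+cnj u) is holomorphic in s and s', and its expected limit, the integral
  of h(z) E(z, s+s'), is holomorphic as long as both real parts exceed 1/2. Given bounds that
  are uniform as Im u tends to infinity, Vitali's theorem in each variable carries the limit from
  the half-plane of convergence to s = s' = \<sigma> (eisenstein_square_limit_bounded).

  The uniform bounds are mean square estimates over compact parts of the strip
  (eisenstein_strip_bound). The k-th Fourier coefficient of E in x is a divisor sum times
  y powr (1-s) times the Fourier transform of (1+u^2) powr (-s) at frequency k y, divided by a
  zeta value. Bessel functions and their asymptotics are avoided: integrating over y turns the sum of
  squares into an integral over frequencies, to which Plancherel applies because
  |(1+u^2) powr (-s)| does not see Im s (rest_strip_bound). The coefficient \<phi>(s) in the constant
  term y powr s + \<phi>(s) y powr (1-s) is bounded by comparing the expansions at z and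
  -1/z: the two copies of y powr (1-s) oscillate against each other, so a large
  \<phi>(s) would contradict the bound for the other terms (phi_bounded).

  The continuation comes from theta series: E(z,s) is the quotient of the Mellin transforms of
  a two-dimensional and a one-dimensional theta function, whose functional equations follow from
  Poisson summation; the denominator has no zeros for Re s > 1/2 by the Euler product. On the
  quotient, the weight h is the indicator of the part of the fundamental domain over A divided by
  y^2 E(z,2\<sigma>); it has bounded support because E(z,2\<sigma>) is an invariant continuous function that
  dominates y powr (2\<sigma>), so that it bounds the height over the compact set A.
\<close>

section \<open>Passing to limits under sums and integrals\<close>

abbreviation sqnorm :: "complex => ennreal" where
  "sqnorm z \<equiv> ennreal ((norm z)\<^sup>2)"

abbreviation borel_fun :: "('a::topological_space => 'b::topological_space) set" where
  "borel_fun \<equiv> borel_measurable borel"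

text \<open>Without the prefix these names denote facts on Henstock-Kurzweil integrals.\<close>
lemmas lint_cong = Bochner_Integration.integral_cong
lemmas lint_bound = Bochner_Integration.integrable_bound
lemmas lint_norm_bound = Bochner_Integration.integral_norm_bound_integral

text \<open>Dominated convergence for unordered sums, along an arbitrary filter.\<close>
lemma infsum_tendsto_dominated:
 fixes f :: "'b => 'i => 'c::banach"
 assumes lim: "\<And>i. i \<in> I ==> ((\<lambda>t. f t i) \<longlongrightarrow> g i) F"
  and h: "h summable_on I"
  and dom: "\<forall>\<^sub>F t in F. \<forall>i\<in>I. norm (f t i) <= h i"
  and F: "F ~= bot"
 shows "((\<lambda>t. \<Sum>\<^sub>\<infinity>i\<in>I. f t i) \<longlongrightarrow> (\<Sum>\<^sub>\<infinity>i\<in>I. g i)) F"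
proof -
 have gh: "norm (g i) <= h i" if "i \<in> I" for i
 proof (rule tendsto_upperbound[OF tendsto_norm[OF lim[OF that]] _ F])
  show "\<forall>\<^sub>F t in F. norm (f t i) <= h i"
   using dom by eventually_elim (use that in auto)
 qed
 have tail: "dist (infsum u I) (sum u X) <= infsum h I - sum h X"
  if u: "\<forall>i\<in>I. norm (u i) <= h i" and X: "finite X" "X \<subseteq> I" for u :: "'i => 'c" and X
 proof -
  have su: "(\<lambda>i. norm (u i)) summable_on I" by (rule summable_on_comparison_test[OF h]) (use u in auto)
  have su': "(\<lambda>i. norm (u i)) summable_on (I - X)" "h summable_on (I - X)"
   by (rule summable_on_subset_banach[OF su], simp, rule summable_on_subset_banach[OF h], simp)
  have "infsum u I = infsum u X + infsum u (I - X)"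
   using X su su' by (subst infsum_Un_disjoint[symmetric])
    (auto intro!: abs_summable_summable arg_cong[where f = "infsum u"])
  moreover have "infsum h I = infsum h X + infsum h (I - X)"
   using X h su' by (subst infsum_Un_disjoint[symmetric])
    (auto intro!: arg_cong[where f = "infsum h"])
  moreover have "norm (infsum u (I - X)) <= infsum h (I - X)"
   by (rule order.trans[OF norm_infsum_bound[OF su'(1)] infsum_mono[OF su']]) (use u in auto)
  ultimately show ?thesis
   using X by (simp add: dist_norm)
 qed
 show ?thesis
 proof (rule tendstoI)
  fix e :: real assume e: "e > 0"
  obtain X where X: "finite X" "X \<subseteq> I" "dist (sum h X) (infsum h I) <= e / 4"
   using infsum_finite_approximation[OF h, of "e / 4"] e by auto
  have "((\<lambda>t. sum (f t) X) \<longlongrightarrow> sum g X) F" by (rule tendsto_sum) (use X lim in auto)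
  then have "\<forall>\<^sub>F t in F. dist (sum (f t) X) (sum g X) < e / 4" by (rule tendstoD) (use e in auto)
  with dom show "\<forall>\<^sub>F t in F. dist (infsum (f t) I) (infsum g I) < e"
  proof eventually_elim
   case (elim t)
   have "dist (infsum (f t) I) (sum (f t) X) <= e / 4" "dist (infsum g I) (sum g X) <= e / 4"
   proof -
    have a: "infsum h I - sum h X <= e / 4"
     using X(3) unfolding dist_real_def by linarith
    have b: "\<forall>i\<in>I. norm (f t i) <= h i"
     using elim by blast
    show "dist (infsum (f t) I) (sum (f t) X) <= e / 4" "dist (infsum g I) (sum g X) <= e / 4"
     by (rule order.trans[OF tail[OF _ X(1,2)] a], use b gh in blast)+
   qed
   moreover have "dist (infsum (f t) I) (infsum g I) \<le>
     dist (infsum (f t) I) (sum (f t) X) + dist (sum (f t) X) (sum g X) + dist (infsum g I) (sum g X)"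
    using dist_triangle[of "infsum (f t) I" "infsum g I" "sum (f t) X"]
     dist_triangle[of "sum (f t) X" "infsum g I" "sum g X"] by (simp add: dist_commute)
   ultimately show ?case
    using elim e by linarith
  qed
 qed
qed

lemma has_sum_integral:
 fixes f :: "'i => 'a => complex"
 assumes I: "countable I"
  and int: "\<And>i. i \<in> I ==> integrable M (f i)"
  and sm: "\<And>x. x \<in> space M ==> (\<lambda>i. norm (f i x)) summable_on I"
  and si: "(\<lambda>i. \<integral>x. norm (f i x) \<partial>M) summable_on I"
 shows "integrable M (\<lambda>x. \<Sum>\<^sub>\<infinity>i\<in>I. f i x)"
  and "((\<lambda>i. \<integral>x. f i x \<partial>M) has_sum (\<integral>x. (\<Sum>\<^sub>\<infinity>i\<in>I. f i x) \<partial>M)) I"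
proof -
 have "integrable M (\<lambda>x. \<Sum>\<^sub>\<infinity>i\<in>I. f i x) \<and>
  ((\<lambda>i. \<integral>x. f i x \<partial>M) has_sum (\<integral>x. (\<Sum>\<^sub>\<infinity>i\<in>I. f i x) \<partial>M)) I"
 proof (cases "finite I")
  case True
  then show ?thesis
   using int by (auto intro!: has_sum_finiteI)
 next
  case False
  define e where "e = from_nat_into I"
  have e: "bij_betw e UNIV I"
   unfolding e_def by (rule bij_betw_from_nat_into[OF I False])
  have eI: "e n \<in> I" for n
   using e by (auto simp: bij_betw_def)
  have sm': "(\<lambda>n. norm (f (e n) x)) summable_on UNIV" if "x \<in> space M" for x
   using sm[OF that] summable_on_reindex_bij_betw[OF e, of "\<lambda>i. norm (f i x)"] by simp
  have si': "(\<lambda>n. \<integral>x. norm (f (e n) x) \<partial>M) summable_on UNIV"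
   using si summable_on_reindex_bij_betw[OF e, of "\<lambda>i. \<integral>x. norm (f i x) \<partial>M"] by simp
  have eq: "(\<Sum>\<^sub>\<infinity>i\<in>I. f i x) = (\<Sum>n. f (e n) x)" if "x \<in> space M" for x
  proof -
   have "((\<lambda>n. f (e n) x) has_sum (\<Sum>\<^sub>\<infinity>n. f (e n) x)) UNIV"
    using abs_summable_summable[OF sm'[OF that]] by simp
   from has_sum_imp_sums[OF this] show ?thesis
    using infsum_reindex_bij_betw[OF e, of "\<lambda>i. f i x"] by (simp add: sums_iff)
  qed
  have *: "integrable M (f (e n))" for n
   using int eI by auto
  have ae: "AE x in M. summable (\<lambda>n. norm (f (e n) x))"
   using sm' by (intro AE_I2 summable_on_imp_summable) auto
  have s: "summable (\<lambda>n. \<integral>x. norm (f (e n) x) \<partial>M)"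
   using si' by (rule summable_on_imp_summable)
  have 1: "integrable M (\<lambda>x. \<Sum>\<^sub>\<infinity>i\<in>I. f i x)"
   using integrable_suminf[OF * ae s] eq by (simp cong: Bochner_Integration.integrable_cong)
  have "(\<Sum>n. \<integral>x. f (e n) x \<partial>M) = (\<integral>x. (\<Sum>n. f (e n) x) \<partial>M)"
   using integral_suminf[OF * ae s] by simp
  also have "... = (\<integral>x. (\<Sum>\<^sub>\<infinity>i\<in>I. f i x) \<partial>M)"
   using eq by (intro lint_cong) auto
  finally have 2: "(\<Sum>n. \<integral>x. f (e n) x \<partial>M) = (\<integral>x. (\<Sum>\<^sub>\<infinity>i\<in>I. f i x) \<partial>M)" .
  have "(\<lambda>n. norm (\<integral>x. f (e n) x \<partial>M)) summable_on UNIV"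
   by (rule summable_on_comparison_test[OF si']) (auto intro: integral_norm_bound)
  then have sb: "(\<lambda>n. (\<integral>x. f (e n) x \<partial>M)) summable_on UNIV" by (rule abs_summable_summable)
  then have "((\<lambda>n. (\<integral>x. f (e n) x \<partial>M)) has_sum (\<Sum>n. \<integral>x. f (e n) x \<partial>M)) UNIV"
   using has_sum_imp_sums[OF has_sum_infsum[OF sb]] has_sum_infsum[OF sb] by (simp add: sums_iff)
  then show ?thesis
   using 1 2 has_sum_reindex_bij_betw[OF e, of "\<lambda>i. \<integral>x. f i x \<partial>M"] by auto
 qed
 then show "integrable M (\<lambda>x. \<Sum>\<^sub>\<infinity>i\<in>I. f i x)"
  and "((\<lambda>i. \<integral>x. f i x \<partial>M) has_sum (\<integral>x. (\<Sum>\<^sub>\<infinity>i\<in>I. f i x) \<partial>M)) I"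
  by auto
qed

text \<open>Locally dominated families can be differentiated under the integral: the difference quotients are bounded by a Cauchy estimate on a small circle, so dominated convergence applies to them.\<close>
lemma holomorphic_on_lebesgue_integral:
 fixes f :: "complex => 'a => complex"
 assumes hol: "\<And>x. x \<in> space M ==> (\<lambda>s. f s x) holomorphic_on S"
  and meas: "\<And>s. s \<in> S ==> f s \<in> borel_measurable M"
  and dom: "\<And>s. s \<in> S ==> \<exists>r>0. \<exists>g. integrable M g \<and> cball s r \<subseteq> S \<and>
        (\<forall>w\<in>cball s r. \<forall>x\<in>space M. norm (f w x) <= g x)"
 shows "(\<lambda>s. \<integral>x. f s x \<partial>M) holomorphic_on S"
proof (rule holomorphic_onI)
 fix s assume s: "s \<in> S"
 from dom[OF s] obtain r g where r: "r > 0" and g: "integrable M g" and sub: "cball s r \<subseteq> S"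
  and le: "\<And>w x. w \<in> cball s r ==> x \<in> space M ==> norm (f w x) <= g x" by blast
 have int: "integrable M (f w)" if "w \<in> cball s r" for w
  using g by (rule lint_bound) (use le that sub meas in \<open>auto intro!: AE_I2 order.trans[OF le]\<close>)
 define D where "D x = deriv (\<lambda>s. f s x) s" for x
 have der: "((\<lambda>w. (f w x - f s x) / (w - s)) \<longlongrightarrow> D x) (at s within ball s (r/2))" if "x \<in> space M" for x
 proof -
  have "(\<lambda>s. f s x) holomorphic_on ball s r"
   using hol[OF that] sub by (rule holomorphic_on_subset[OF _ order.trans[OF ball_subset_cball]])
  then have "((\<lambda>s. f s x) has_field_derivative D x) (at s)"
   unfolding D_def using r by (intro holomorphic_derivI[of _ "ball s r"]) auto
  then show ?thesis
   using tendsto_within_subset by (fastforce simp: has_field_derivative_iff)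
 qed
 have bnd: "norm ((f w x - f s x) / (w - s)) <= 2 * g x / r" if w: "w \<in> ball s (r/2)" and x: "x \<in> space M" for w x
 proof -
  have "norm (deriv (\<lambda>s. f s x) u) <= 2 * g x / r" if u: "u \<in> ball s (r/2)" for u
  proof -
   have subu: "cball u (r/2) \<subseteq> cball s r"
   proof
    fix v assume "v \<in> cball u (r/2)"
    then show "v \<in> cball s r"
     using u dist_triangle[of s v u] by (simp add: dist_commute)
   qed
   have "norm ((deriv ^^ 1) (\<lambda>s. f s x) u) <= fact 1 * g x / (r/2)^1"
   proof (rule Cauchy_inequality)
    have h: "(\<lambda>s. f s x) holomorphic_on cball u (r/2)"
     using hol[OF x] subu sub by (meson holomorphic_on_subset)
    then show "(\<lambda>s. f s x) holomorphic_on ball u (r/2)" "continuous_on (cball u (r/2)) (\<lambda>s. f s x)"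
     by (meson ball_subset_cball holomorphic_on_subset, simp add: holomorphic_on_imp_continuous_on)
    show "norm (f v x) <= g x" if "norm (u - v) = r/2" for v
     using that subu x by (intro le) (auto simp: dist_norm)
   qed (use r in auto)
   then show ?thesis by (simp add: field_simps)
  qed
  moreover have "((\<lambda>s. f s x) has_field_derivative deriv (\<lambda>s. f s x) u) (at u within ball s (r/2))" if u: "u \<in> ball s (r/2)" for u
  proof -
   have "(\<lambda>s. f s x) holomorphic_on ball s (r/2)"
    using hol[OF x] sub r by (rule_tac holomorphic_on_subset) (auto simp: subset_iff)
   from holomorphic_derivI[OF this open_ball u] show ?thesis by (rule has_field_derivative_at_within)
  qed
  ultimately have "norm (f w x - f s x) <= 2 * g x / r * norm (w - s)"
   using r w by (intro field_differentiable_bound[of "ball s (r/2)" "\<lambda>s. f s x" "\<lambda>u. deriv (\<lambda>s. f s x) u"]) auto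
  then show ?thesis
  proof (cases "w = s")
   case True
   then show ?thesis using le[of s x] r x by (simp add: order.trans[OF norm_ge_zero])
  next
   case False
   then show ?thesis using \<open>norm (f w x - f s x) <= _\<close> by (simp add: norm_divide pos_divide_le_eq mult.commute)
  qed
 qed
 have "((\<lambda>w. ((\<integral>x. f w x \<partial>M) - (\<integral>x. f s x \<partial>M)) / (w - s)) \<longlongrightarrow> (\<integral>x. D x \<partial>M)) (at s within ball s (r/2))"
  unfolding tendsto_at_iff_sequentially
 proof (intro allI impI)
  fix X assume X: "\<forall>i. X i \<in> ball s (r / 2) - {s}" and lim: "X \<longlonglongrightarrow> s"
  have XS: "X n \<in> cball s r" "X n \<in> S" for n
  proof -
   have "dist s (X n) < r / 2"
    using X by auto
   then show "X n \<in> cball s r"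
    using r by simp
   then show "X n \<in> S"
    using sub by blast
  qed
  have lim': "(\<lambda>n. (f (X n) x - f s x) / (X n - s)) \<longlonglongrightarrow> D x" if "x \<in> space M" for x
   using der[OF that] X lim unfolding tendsto_at_iff_sequentially by (auto simp: o_def)
  have m: "(\<lambda>x. (f (X n) x - f s x) / (X n - s)) \<in> borel_measurable M" for n
   using meas XS s by measurable
  have "(\<lambda>n. \<integral>x. (f (X n) x - f s x) / (X n - s) \<partial>M) \<longlonglongrightarrow> (\<integral>x. D x \<partial>M)"
  proof (rule integral_dominated_convergence)
   show "D \<in> borel_measurable M"
    using borel_measurable_LIMSEQ_metric[of "\<lambda>n x. (f (X n) x - f s x) / (X n - s)" M D] m lim' by blast
   show "integrable M (\<lambda>x. 2 * g x / r)"
    using g by auto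
   show "AE x in M. norm ((f (X n) x - f s x) / (X n - s)) <= 2 * g x / r" for n
    using bnd X by (intro AE_I2) auto
  qed (use m lim' in auto)
  moreover have "(\<lambda>n. \<integral>x. (f (X n) x - f s x) / (X n - s) \<partial>M) =
    (\<lambda>n. ((\<integral>x. f (X n) x \<partial>M) - (\<integral>x. f s x \<partial>M)) / (X n - s))"
   using Bochner_Integration.integral_diff[OF int[OF XS(1)] int[of s]] r by (intro ext) simp
  ultimately show "((\<lambda>w. ((\<integral>x. f w x \<partial>M) - (\<integral>x. f s x \<partial>M)) / (w - s)) \<circ> X) \<longlonglongrightarrow> (\<integral>x. D x \<partial>M)"
   unfolding o_def by (simp only:)
 qed
 then have "((\<lambda>s. \<integral>x. f s x \<partial>M) has_field_derivative (\<integral>x. D x \<partial>M)) (at s within ball s (r/2))"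
  by (simp add: has_field_derivative_iff)
 then have "((\<lambda>s. \<integral>x. f s x \<partial>M) has_field_derivative (\<integral>x. D x \<partial>M)) (at s)"
  using r by (subst (asm) at_within_open[of s]) auto
 then show "(\<lambda>s. \<integral>x. f s x \<partial>M) field_differentiable at s within S"
  using field_differentiable_at_within field_differentiable_def by blast
qed

text \<open>Vitali's theorem. A subsequence that stays away from the limit at one point has, by Montel, a further subsequence that converges locally uniformly; its limit agrees with g on U and hence everywhere.\<close>
lemma Vitali_tendsto:
 fixes f :: "nat => complex => complex"
 assumes S: "open S" "connected S"
  and hol: "\<And>n. f n holomorphic_on S" "g holomorphic_on S"
  and bnd: "\<And>K. compact K ==> K \<subseteq> S ==> \<exists>B. \<forall>n. \<forall>z\<in>K. norm (f n z) <= B"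
  and U: "open U" "U \<subseteq> S" "U ~= {}"
  and lim: "\<And>z. z \<in> U ==> (\<lambda>n. f n z) \<longlonglongrightarrow> g z"
  and z: "z \<in> S"
 shows "(\<lambda>n. f n z) \<longlonglongrightarrow> g z"
proof (rule ccontr)
 assume "\<not> ?thesis"
 then obtain e where e: "e > 0" "\<exists>\<^sub>F n in sequentially. \<not> dist (f n z) (g z) < e"
  unfolding tendsto_iff not_eventually[symmetric] by auto
 then have inf: "infinite {n. \<not> dist (f n z) (g z) < e}"
  by (simp add: frequently_cofinite[symmetric] cofinite_eq_sequentially)
 define r where "r = enumerate {n. \<not> dist (f n z) (g z) < e}"
 have r: "strict_mono r" "\<And>n. \<not> dist (f (r n) z) (g z) < e"
  using inf enumerate_in_set[OF inf] unfolding r_def by (auto intro: strict_mono_enumerate)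
 obtain h q where h: "h holomorphic_on S" "strict_mono (q::nat\<Rightarrow>nat)"
   "\<And>x. x \<in> S ==> ((\<lambda>n. f (r (q n)) x) \<longlongrightarrow> h x) sequentially"
 proof (rule Montel[of S "range f" "\<lambda>n. f (r n)"])
  show "\<exists>B. \<forall>h\<in>range f. \<forall>z\<in>K. cmod (h z) <= B" if "compact K" "K \<subseteq> S" for K
   using bnd[OF that] by auto
 qed (use S hol in auto)
 have "h x = g x" if "x \<in> U" for x
 proof -
  have "(\<lambda>n. f (r (q n)) x) \<longlonglongrightarrow> g x"
   using LIMSEQ_subseq_LIMSEQ[OF lim[OF that] strict_mono_o[OF r(1) h(2)]] by (simp add: o_def)
  moreover have "(\<lambda>n. f (r (q n)) x) \<longlonglongrightarrow> h x"
   using h(3) that U by auto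
  ultimately show ?thesis
   using LIMSEQ_unique by blast
 qed
 then have "h z = g z" by (rule analytic_continuation_open[OF U(1) S(1) U(3) S(2) U(2) h(1) hol(2) _ z]) auto
 then have "(\<lambda>n. f (r (q n)) z) \<longlonglongrightarrow> g z"
  using h(3)[OF z] by simp
 then have "\<forall>\<^sub>F n in sequentially. dist (f (r (q n)) z) (g z) < e" by (rule tendstoD) (use e in auto)
 then show False
  using r(2) by simp
qed

section \<open>Fourier series of periodic functions\<close>

text \<open>Periodic functions are integrated over one half-open period, so that integer translates of the period tile the line without overlap.\<close>
definition unit_leb :: "real measure" where
 "unit_leb = restrict_space lborel {0..<1}"

lemma space_unit_leb [simp]: "space unit_leb = {0..<1}" by (simp add: unit_leb_def space_restrict_space)

lemma finite_measure_unit_leb: "finite_measure unit_leb"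
 by (rule finite_measureI) (simp add: unit_leb_def space_restrict_space emeasure_restrict_space)

lemma emeasure_unit_leb [simp]: "emeasure unit_leb {0..<1} = 1"
 by (simp add: unit_leb_def space_restrict_space emeasure_restrict_space)

lemma measurable_unit_leb: "f \<in> borel_fun ==> f \<in> borel_measurable unit_leb"
 unfolding unit_leb_def by (rule measurable_restrict_space1) simp

lemma integrable_unit_leb_bounded:
 fixes f :: "real => 'b::{banach, second_countable_topology}"
 assumes "f \<in> borel_fun" "\<And>x. x \<in> {0..<1} ==> norm (f x) <= B"
 shows "integrable unit_leb f"
proof -
 interpret finite_measure unit_leb by (rule finite_measure_unit_leb)
 show ?thesis
  by (rule integrable_const_bound[of _ B]) (use assms in \<open>auto intro!: AE_I2 measurable_unit_leb\<close>)
qed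

lemma integrable_unit_leb_continuous:
 fixes f :: "real => 'b::{banach, second_countable_topology}"
 assumes "continuous_on UNIV f"
 shows "integrable unit_leb f"
proof -
 have "compact (f ` {0..1})"
  using assms by (intro compact_continuous_image) (auto intro: continuous_on_subset)
 then obtain B where "\<forall>x\<in>{0..1}. norm (f x) <= B" by (auto dest!: compact_imp_bounded simp: bounded_iff)
 then show ?thesis
  using assms by (intro integrable_unit_leb_bounded[of _ B]) (auto intro: borel_measurable_continuous_onI)
qed

lemma integral_unit_leb:
 fixes f :: "real => 'b::{banach, second_countable_topology}"
 shows "(\<integral>x. f x \<partial>unit_leb) = (LINT x:{0..<1}|lborel. f x)"
 unfolding unit_leb_def set_lebesgue_integral_def by (subst integral_restrict_space) auto

text \<open>Covers both the orthogonality of characters (purely imaginary c) and the oscillation estimate for the scattering coefficient.\<close>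
lemma integral_exp_unit_leb:
 fixes c :: complex
 assumes c: "c ~= 0"
 shows "(\<integral>x. exp (c * of_real x) \<partial>unit_leb) = (exp c - 1) / c"
proof -
 have ci: "continuous_on A (\<lambda>x. exp (c * complex_of_real x))" for A by (intro continuous_intros)
 have [measurable]: "(\<lambda>x. exp (c * complex_of_real x)) \<in> borel_fun"
  by (rule borel_measurable_continuous_onI[OF ci])
 have "(LINT x:{0..<1}|lborel. exp (c * complex_of_real x)) = (LINT x:{0..1}|lborel. exp (c * complex_of_real x))"
  unfolding set_lebesgue_integral_def
 proof (rule integral_cong_AE)
  show "AE x in lborel. indicat_real {0..<1} x *\<^sub>R exp (c * complex_of_real x) = indicat_real {0..1} x *\<^sub>R exp (c * complex_of_real x)"
   using AE_lborel_singleton[of "1::real"] by eventually_elim (auto simp: indicator_def)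
 qed measurable
 also have "... = exp (c * of_real 1) / c - exp (c * of_real 0) / c"
 proof -
  have "((\<lambda>x. exp (c * complex_of_real x) / c) has_vector_derivative exp (c * of_real x)) (at x within {0..1})" for x
  proof -
   have "((\<lambda>z. exp (c * z) / c) has_field_derivative exp (c * of_real x)) (at (of_real x))"
    using c by (auto intro!: derivative_eq_intros simp: field_simps)
   then show ?thesis by (rule has_vector_derivative_real_field)
  qed
  then show ?thesis
   unfolding set_lebesgue_integral_def by (intro integral_FTC_atLeastAtMost) (use ci in auto)
 qed
 finally show ?thesis by (simp add: integral_unit_leb diff_divide_distrib)
qed

lemma integral_cis_int:
 "(\<integral>x. cis (2 * pi * of_int k * x) \<partial>unit_leb) = (if k = 0 then 1 else 0)"
proof (cases "k = 0")
 case False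
 define c where "c = \<i> * of_real (2 * pi * of_int k)"
 have c: "c ~= 0" using False by (simp add: c_def)
 have "exp c = cis (2 * pi * of_int k)" by (simp add: c_def cis_conv_exp)
 then have "exp c = 1" by (simp add: cis_multiple_2pi)
 moreover have "cis (2 * pi * of_int k * x) = exp (c * of_real x)" for x by (simp add: c_def cis_conv_exp mult_ac)
 ultimately show ?thesis using integral_exp_unit_leb[OF c] False by simp
qed (simp add: measure_def)

inductive trig_poly :: "(complex => complex) => bool" where
 mono: "trig_poly (\<lambda>w. c * w powi k)"
| add: "trig_poly f ==> trig_poly g ==> trig_poly (\<lambda>w. f w + g w)"

lemma trig_poly_mult_mono:
 "trig_poly f ==> \<exists>h. trig_poly h \<and> (\<forall>w. w ~= 0 --> h w = c * w powi k * f w)"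
proof (induction rule: trig_poly.induct)
 case (mono d l)
 show ?case
  by (intro exI[of _ "\<lambda>w. (c * d) * w powi (k + l)"] conjI trig_poly.mono) (auto simp: power_int_add)
next
 case (add f g)
 then obtain h h' where "trig_poly h" "trig_poly h'" "\<forall>w. w ~= 0 --> h w = c * w powi k * f w"
  "\<forall>w. w ~= 0 --> h' w = c * w powi k * g w" by blast
 then show ?case by (intro exI[of _ "\<lambda>w. h w + h' w"]) (auto intro: trig_poly.add simp: distrib_left)
qed

lemma trig_poly_mult:
 "trig_poly g ==> trig_poly f ==> \<exists>h. trig_poly h \<and> (\<forall>w. w ~= 0 --> h w = g w * f w)"
proof (induction rule: trig_poly.induct)
 case (mono c k)
 then show ?case using trig_poly_mult_mono by blast
next
 case (add p q)
 then obtain h h' where "trig_poly h" "trig_poly h'" "\<forall>w. w ~= 0 --> h w = p w * f w"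
  "\<forall>w. w ~= 0 --> h' w = q w * f w" by blast
 then show ?case by (intro exI[of _ "\<lambda>w. h w + h' w"]) (auto intro: trig_poly.add simp: distrib_right)
qed

lemma trig_poly_finite_sum:
 "trig_poly f ==> \<exists>K b. finite K \<and> (\<forall>k. k \<notin> K --> b k = 0) \<and> (\<forall>w. f w = (\<Sum>k\<in>K. b k * w powi k))"
proof (induction rule: trig_poly.induct)
 case (mono c k)
 show ?case by (intro exI[of _ "{k}"] exI[of _ "\<lambda>l. if l = k then c else 0"]) auto
next
 case (add f g)
 then obtain K b L d where *: "finite K" "\<And>k. k \<notin> K ==> b k = 0" "\<And>w. f w = (\<Sum>k\<in>K. b k * w powi k)"
   "finite L" "\<And>k. k \<notin> L ==> d k = 0" "\<And>w. g w = (\<Sum>k\<in>L. d k * w powi k)" by metis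
 have "f w = (\<Sum>k\<in>K\<union>L. b k * w powi k)" "g w = (\<Sum>k\<in>K\<union>L. d k * w powi k)" for w
  unfolding *(3,6) by (rule sum.mono_neutral_left; use * in auto)+
 then show ?case
  using * by (intro exI[of _ "K \<union> L"] exI[of _ "\<lambda>k. b k + d k"]) (auto simp: sum.distrib distrib_right)
qed

text \<open>The coordinates Re w and Im w are combinations of w and 1/w on the circle, so that Stone-Weierstrass, which supplies real polynomials, yields trigonometric polynomials.\<close>
lemma real_polynomial_trig_poly:
 assumes "real_polynomial_function (p :: complex => real)"
 shows "\<exists>h. trig_poly h \<and> (\<forall>w. norm w = 1 --> h w = of_real (p w))"
 using assms
proof (induction rule: real_polynomial_function.induct)
 case (linear f)
 interpret bounded_linear f by fact
 have f: "f w = Re w * f 1 + Im w * f \<i>" for w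
  using add[of "Re w *\<^sub>R 1" "Im w *\<^sub>R \<i>"] scaleR[of "Re w" 1] scaleR[of "Im w" \<i>]
  by (simp add: complex_eq[symmetric] scaleR_conv_of_real mult.commute)
 define A where "A = (of_real (f 1) - \<i> * of_real (f \<i>)) / 2"
 define B where "B = (of_real (f 1) + \<i> * of_real (f \<i>)) / 2"
 have "A * w powi 1 + B * w powi (-1) = of_real (f w)" if "norm w = 1" for w
 proof -
  have "inverse w = cnj w"
   using that complex_norm_square[of w] by (metis divide_inverse inverse_unique mult.right_neutral of_real_1 power_one)
  then have pw: "w powi (- 1) = cnj w" by (simp add: power_int_minus)
  have "A * w + B * cnj w = of_real (f w)"
   unfolding f[of w] A_def B_def by (simp add: complex_eq_iff field_simps)
  then show ?thesis by (simp only: power_int_1_right pw)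
 qed
 then show ?case by (intro exI[of _ "\<lambda>w. A * w powi 1 + B * w powi (-1)"] conjI trig_poly.intros) auto
next
 case (const c)
 show ?case by (intro exI[of _ "\<lambda>w. of_real c * w powi 0"] conjI trig_poly.mono) auto
next
 case (add f g)
 then obtain h h' where "trig_poly h" "trig_poly h'" "\<forall>w. norm w = 1 --> h w = of_real (f w)"
  "\<forall>w. norm w = 1 --> h' w = of_real (g w)" by blast
 then show ?case by (intro exI[of _ "\<lambda>w. h w + h' w"]) (auto intro: trig_poly.add)
next
 case (mult f g)
 then obtain h h' where h: "trig_poly h" "trig_poly h'" "\<forall>w. norm w = 1 --> h w = of_real (f w)"
  "\<forall>w. norm w = 1 --> h' w = of_real (g w)" by blast
 obtain q where "trig_poly q" "\<forall>w. w ~= 0 --> q w = h w * h' w"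
  using trig_poly_mult[OF h(1,2)] by blast
 then show ?case
  using h by (intro exI[of _ q]) (auto, metis norm_zero zero_neq_one)
qed

lemma periodic_int:
 fixes f :: "real => 'a"
 assumes "\<And>x. f (x + 1) = f x"
 shows "f (x + of_int n) = f x"
proof (induction n rule: int_induct[of _ 0])
 case (step1 i)
 then show ?case using assms[of "x + of_int i"] by (simp add: add.assoc add.commute[of 1])
next
 case (step2 i)
 then show ?case using assms[of "x + of_int (i - 1)"] by simp
qed simp

lemma continuous_on_circle_of_periodic:
 fixes f :: "real => 'a::topological_space"
 assumes f: "continuous_on UNIV f" and per: "\<And>x. f (x + 1) = f x"
 obtains F where "continuous_on (sphere (0::complex) 1) F" "\<And>x. F (cis (2 * pi * x)) = f x"
proof
 define F where "F w = f (Arg w / (2 * pi))" for w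
 have same: "f x = f y" if "cis (2 * pi * x) = cis (2 * pi * y)" for x y
 proof -
  have "sin (2 * pi * x) = sin (2 * pi * y) \<and> cos (2 * pi * x) = cos (2 * pi * y)"
   using that by (simp add: complex_eq_iff)
  then obtain n :: int where "2 * pi * x = 2 * pi * y + 2 * pi * of_int n"
   unfolding sin_cos_eq_iff by (metis (no_types, opaque_lifting) mult.commute mult.assoc)
  then have "2 * pi * x = 2 * pi * (y + of_int n)" by (simp add: algebra_simps)
  then have "x = y + of_int n" by simp
  then show ?thesis using periodic_int[of f, OF per] by simp
 qed
 show "F (cis (2 * pi * x)) = f x" for x
  unfolding F_def by (rule same) (simp add: cis_Arg sgn_div_norm)
 have F2: "F w = f (Arg2pi w / (2 * pi))" if "w ~= 0" for w
 proof -
  have "cis (Arg2pi w) = sgn w"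
   using Arg2pi_eq[of w] that unfolding cis_conv_exp
   by (metis (no_types, lifting) sgn_eq mult.commute nonzero_mult_div_cancel_left norm_eq_zero of_real_eq_0_iff)
  then show ?thesis
   unfolding F_def by (intro same) (simp add: cis_Arg that)
 qed
 have "isCont F w" if w: "norm w = 1" for w
 proof (cases "w \<in> \<real>\<^sub>\<le>\<^sub>0")
  case False
  have "isCont (\<lambda>w. Arg w / (2 * pi)) w" by (intro continuous_intros continuous_at_Arg False) auto
  then show ?thesis
   unfolding F_def using f by (intro isCont_o2[of w "\<lambda>w. Arg w / (2 * pi)" f])
    (auto simp: continuous_on_eq_continuous_at)
 next
  case True
  then have "w \<notin> \<real>\<^sub>\<ge>\<^sub>0"
   using w by (auto elim!: nonpos_Reals_cases nonneg_Reals_cases)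
  then have "isCont (\<lambda>w. Arg2pi w / (2 * pi)) w" by (intro continuous_intros continuous_at_Arg2pi) auto
  then have "isCont (\<lambda>w. f (Arg2pi w / (2 * pi))) w"
   using f by (intro isCont_o2[of w "\<lambda>w. Arg2pi w / (2 * pi)" f])
    (auto simp: continuous_on_eq_continuous_at)
  moreover have "\<forall>\<^sub>F v in nhds w. f (Arg2pi v / (2 * pi)) = F v"
   using w F2 by (intro eventually_mono[OF t1_space_nhds[of w 0]]) auto
  ultimately show ?thesis
   using isCont_cong[of "\<lambda>w. f (Arg2pi w / (2 * pi))" F w] by blast
 qed
 then show "continuous_on (sphere 0 1) F" by (auto intro: continuous_at_imp_continuous_on)
qed

lemma trig_approximation:
 fixes f :: "real => complex"
 assumes f: "continuous_on UNIV f" and per: "\<And>x. f (x + 1) = f x" and e: "e > 0"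
 obtains K :: "int set" and b where "finite K" "\<And>x. norm (f x - (\<Sum>k\<in>K. b k * cis (2 * pi * of_int k * x))) < e"
proof -
 obtain F where F: "continuous_on (sphere (0::complex) 1) F" "\<And>x. F (cis (2 * pi * x)) = f x"
  by (rule continuous_on_circle_of_periodic[OF f per]) blast
 have "continuous_on (sphere (0::complex) 1) (\<lambda>w. Re (F w))" "continuous_on (sphere (0::complex) 1) (\<lambda>w. Im (F w))"
  by (intro continuous_intros F)+
 note c = this
 have e2: "0 < e / 2" using e by simp
 obtain p where p: "real_polynomial_function p" "\<And>x. x \<in> sphere (0::complex) 1 ==> \<bar>Re (F x) - p x\<bar> < e / 2"
  by (rule Stone_Weierstrass_real_polynomial_function[OF compact_sphere c(1) e2]) blast
 obtain q where q: "real_polynomial_function q" "\<And>x. x \<in> sphere (0::complex) 1 ==> \<bar>Im (F x) - q x\<bar> < e / 2"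
  by (rule Stone_Weierstrass_real_polynomial_function[OF compact_sphere c(2) e2]) blast
 obtain h h' where h: "trig_poly h" "\<forall>w. norm w = 1 --> h w = of_real (p w)"
  and h': "trig_poly h'" "\<forall>w. norm w = 1 --> h' w = of_real (q w)"
  using real_polynomial_trig_poly[OF p(1)] real_polynomial_trig_poly[OF q(1)] by blast
 have "trig_poly (\<lambda>w. \<i> * w powi 0)" by (rule trig_poly.mono)
 from trig_poly_mult[OF this h'(1)] obtain h'' where h'': "trig_poly h''" "\<forall>w. w ~= 0 --> h'' w = \<i> * h' w"
  by auto
 obtain K b where K: "finite K" "\<And>w. h w + h'' w = (\<Sum>k\<in>K. b k * w powi k)"
  using trig_poly_finite_sum[OF trig_poly.add[OF h(1) h''(1)]] by blast
 show ?thesis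
 proof (rule that[OF K(1), of b])
  fix x
  define w where "w = cis (2 * pi * x)"
  have w: "norm w = 1" "w ~= 0" by (auto simp: w_def)
  have "w powi k = cis (2 * pi * of_int k * x)" for k
   unfolding w_def by (simp add: cis_power_int mult_ac)
  then have "(\<Sum>k\<in>K. b k * cis (2 * pi * of_int k * x)) = Complex (p w) (q w)"
   using K(2)[of w] h(2) h'(2) h''(2) w by (simp add: complex_eq_iff)
  moreover have "f x = F w" by (simp add: F w_def)
  moreover have "norm (F w - Complex (p w) (q w)) <= \<bar>Re (F w) - p w\<bar> + \<bar>Im (F w) - q w\<bar>"
   using cmod_le[of "F w - Complex (p w) (q w)"] by simp
  ultimately show "norm (f x - (\<Sum>k\<in>K. b k * cis (2 * pi * of_int k * x))) < e"
   using p(2)[of w] q(2)[of w] w by simp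
 qed
qed

abbreviation char_neg :: "int => real => complex" where
  "char_neg k x \<equiv> cis (- (2 * pi * of_int k * x))"

definition fcoeff :: "(real => complex) => int => complex" where
 "fcoeff f k = (\<integral>x. f x * char_neg k x \<partial>unit_leb)"

lemma sum_le_nn_integral_count_space:
 fixes f :: "'a => ennreal"
 assumes "finite K"
 shows "(\<Sum>k\<in>K. f k) <= (\<integral>\<^sup>+k. f k \<partial>count_space UNIV)"
proof -
 have "(\<Sum>k\<in>K. f k) = (\<integral>\<^sup>+k. f k \<partial>count_space K)"
  using assms by (simp add: nn_integral_count_space_finite)
 also have "... = (\<integral>\<^sup>+k. f k * indicator K k \<partial>count_space UNIV)"
  by (rule nn_integral_count_space_indicator) simp
 also have "... <= (\<integral>\<^sup>+k. f k \<partial>count_space UNIV)"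
  by (rule nn_integral_mono) (auto simp: indicator_def)
 finally show ?thesis .
qed

text \<open>A trigonometric polynomial uniformly close to f reduces the estimate to finite orthogonality.\<close>
lemma parseval_le:
 fixes f :: "real => complex"
 assumes f: "continuous_on UNIV f" and per: "\<And>x. f (x + 1) = f x"
 shows "(\<integral>\<^sup>+x. sqnorm (f x) \<partial>unit_leb) <= (\<integral>\<^sup>+k. sqnorm (fcoeff f k) \<partial>count_space UNIV)"
proof (rule ennreal_le_epsilon)
 fix e :: real assume e: "e > 0"
 then have "sqrt e > 0" by simp
 from trig_approximation[OF f per this] obtain K :: "int set" and b where K: "finite K"
  and le: "\<And>x. norm (f x - (\<Sum>k\<in>K. b k * cis (2 * pi * of_int k * x))) < sqrt e" by blast
 define p where "p x = (\<Sum>k\<in>K. b k * cis (2 * pi * of_int k * x))" for x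
 have p: "continuous_on UNIV p"
  unfolding p_def by (intro continuous_intros)
 have int: "integrable unit_leb (\<lambda>x. f x * cnj (p x))" "integrable unit_leb (\<lambda>x. p x * cnj (p x))"
  "integrable unit_leb (\<lambda>x. (norm (f x))\<^sup>2)" "integrable unit_leb (\<lambda>x. (norm (f x - p x))\<^sup>2)"
  "integrable unit_leb (\<lambda>x. f x * char_neg k x)"
  "integrable unit_leb (\<lambda>x. p x * char_neg k x)" 
  "integrable unit_leb (\<lambda>x. (norm (p x))\<^sup>2)" for k
  by (intro integrable_unit_leb_continuous continuous_intros f p)+
 have cnjp: "cnj (p x) = (\<Sum>k\<in>K. cnj (b k) * char_neg k x)" for x by (simp add: p_def cis_cnj)
 have fp: "(\<integral>x. f x * cnj (p x) \<partial>unit_leb) = (\<Sum>k\<in>K. cnj (b k) * fcoeff f k)"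
 proof -
  have "(\<integral>x. f x * cnj (p x) \<partial>unit_leb) = (\<integral>x. (\<Sum>k\<in>K. cnj (b k) * (f x * char_neg k x)) \<partial>unit_leb)"
   unfolding cnjp by (simp add: sum_distrib_left mult_ac)
  also have "... = (\<Sum>k\<in>K. cnj (b k) * fcoeff f k)"
   unfolding fcoeff_def using int by (subst Bochner_Integration.integral_sum) auto
  finally show ?thesis .
 qed
 have pc: "fcoeff p k = b k" if "k \<in> K" for k
 proof -
  have "fcoeff p k = (\<integral>x. (\<Sum>j\<in>K. b j * cis (2 * pi * of_int (j - k) * x)) \<partial>unit_leb)"
   unfolding fcoeff_def p_def sum_distrib_right by (intro lint_cong sum.cong refl)
    (simp add: mult.assoc cis_mult left_diff_distrib right_diff_distrib)
  also have "... = (\<Sum>j\<in>K. b j * (if j = k then 1 else 0))" by (subst Bochner_Integration.integral_sum)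
    (auto intro!: integrable_unit_leb_continuous continuous_intros simp: integral_cis_int[of "_ - _", simplified])
  also have "... = (\<Sum>j\<in>K. if j = k then b j else 0)" by (intro sum.cong) auto
  finally show ?thesis using K that by simp
 qed
 have pp: "(\<integral>x. p x * cnj (p x) \<partial>unit_leb) = (\<Sum>k\<in>K. cnj (b k) * b k)"
 proof -
  have "(\<integral>x. p x * cnj (p x) \<partial>unit_leb) = (\<integral>x. (\<Sum>k\<in>K. cnj (b k) * (p x * char_neg k x)) \<partial>unit_leb)"
   unfolding cnjp by (simp add: sum_distrib_left mult_ac)
  also have "... = (\<Sum>k\<in>K. cnj (b k) * fcoeff p k)"
   unfolding fcoeff_def using int by (subst Bochner_Integration.integral_sum) auto
  finally show ?thesis using pc by simp
 qed
 have expand: "(norm (f x))\<^sup>2 = (norm (f x - p x))\<^sup>2 + 2 * Re (f x * cnj (p x)) - Re (p x * cnj (p x))" for x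
  unfolding cmod_power2 by (simp add: algebra_simps power2_eq_square)
 have "(\<integral>x. (norm (f x))\<^sup>2 \<partial>unit_leb) = (\<integral>x. (norm (f x - p x))\<^sup>2 \<partial>unit_leb)
   + 2 * Re (\<integral>x. f x * cnj (p x) \<partial>unit_leb) - Re (\<integral>x. p x * cnj (p x) \<partial>unit_leb)"
 proof -
  have gen: "(\<integral>x. (a x + 2 * b x) - c x \<partial>unit_leb) = (\<integral>x. a x \<partial>unit_leb) + 2 * (\<integral>x. b x \<partial>unit_leb) - (\<integral>x. c x \<partial>unit_leb)"
   if "integrable unit_leb a" "integrable unit_leb b" "integrable unit_leb c" for a b c :: "real => real"
   using that by simp
  show ?thesis
   unfolding expand gen[OF int(4) integrable_Re[OF int(1)] integrable_Re[OF int(2)]]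
   using int by (simp only: integral_Re)
 qed
 also have "... = (\<integral>x. (norm (f x - p x))\<^sup>2 \<partial>unit_leb) + (\<Sum>k\<in>K. 2 * Re (cnj (b k) * fcoeff f k) - Re (cnj (b k) * b k))"
  unfolding fp pp by (simp add: sum_subtractf sum_distrib_left)
 also have "(\<Sum>k\<in>K. 2 * Re (cnj (b k) * fcoeff f k) - Re (cnj (b k) * b k)) <= (\<Sum>k\<in>K. (norm (fcoeff f k))\<^sup>2)"
 proof (rule sum_mono)
  fix k
  have "(norm (fcoeff f k - b k))\<^sup>2 >= 0" by simp
  then show "2 * Re (cnj (b k) * fcoeff f k) - Re (cnj (b k) * b k) <= (norm (fcoeff f k))\<^sup>2"
   unfolding cmod_power2 by (simp add: algebra_simps power2_eq_square)
 qed
 also have "(\<integral>x. (norm (f x - p x))\<^sup>2 \<partial>unit_leb) <= (\<integral>x. e \<partial>unit_leb)"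
 proof (rule integral_mono)
  show "(norm (f x - p x))\<^sup>2 <= e" for x
   using le[of x] power_mono[of "norm (f x - p x)" "sqrt e" 2] e by (simp add: p_def)
 qed (use int in \<open>auto intro!: integrable_unit_leb_continuous\<close>)
 also have "... = e" by (simp add: measure_def)
 finally have "(\<integral>x. (norm (f x))\<^sup>2 \<partial>unit_leb) <= (\<Sum>k\<in>K. (norm (fcoeff f k))\<^sup>2) + e" by simp
 then have "(\<integral>\<^sup>+x. sqnorm (f x) \<partial>unit_leb) <= ennreal ((\<Sum>k\<in>K. (norm (fcoeff f k))\<^sup>2) + e)"
  using int by (subst nn_integral_eq_integral) (auto intro!: ennreal_leI)
 also have "... = (\<Sum>k\<in>K. sqnorm (fcoeff f k)) + ennreal e"
  using e by (simp add: ennreal_plus sum_nonneg)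
 also have "(\<Sum>k\<in>K. sqnorm (fcoeff f k)) <= (\<integral>\<^sup>+k. sqnorm (fcoeff f k) \<partial>count_space UNIV)"
  by (rule sum_le_nn_integral_count_space[OF K])
 finally show "(\<integral>\<^sup>+x. sqnorm (f x) \<partial>unit_leb) <= (\<integral>\<^sup>+k. sqnorm (fcoeff f k) \<partial>count_space UNIV) + ennreal e"
  by simp
qed

lemma fourier_unique:
 fixes f g :: "real => complex"
 assumes f: "continuous_on UNIV f" "\<And>x. f (x + 1) = f x"
  and g: "continuous_on UNIV g" "\<And>x. g (x + 1) = g x"
  and eq: "\<And>k. fcoeff f k = fcoeff g k"
 shows "f = g"
proof -
 define h where "h x = f x - g x" for x
 have h: "continuous_on UNIV h" "\<And>x. h (x + 1) = h x"
  using f g by (auto simp: h_def intro!: continuous_intros)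
 have "integrable unit_leb (\<lambda>x. f x * char_neg k x)" 
  "integrable unit_leb (\<lambda>x. g x * char_neg k x)" for k
  by (intro integrable_unit_leb_continuous continuous_intros f g)+
 then have "fcoeff h k = 0" for k
  using eq[of k] by (simp add: fcoeff_def h_def left_diff_distrib)
 then have "(\<integral>\<^sup>+x. sqnorm (h x) \<partial>unit_leb) = 0"
  using parseval_le[OF h] by simp
 then have "(\<integral>\<^sup>+x. sqnorm (h x) * indicator {0..<1} x \<partial>lborel) = 0"
  unfolding unit_leb_def by (subst (asm) nn_integral_restrict_space) auto
 moreover have "(\<lambda>x. sqnorm (h x) * indicator {0..<1} x) \<in> borel_measurable lborel"
  using borel_measurable_continuous_onI[OF h(1)] by measurable
 ultimately have "AE x in lborel. x \<in> {0<..<1} --> h x = 0"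
  by (subst (asm) nn_integral_0_iff_AE) (auto simp: indicator_def split: if_splits elim!: eventually_mono)
 then have "AE x\<in>{0<..<1} in lebesgue. h x = 0" by (rule AE_completion)
 then have ae: "AE x\<in>{0<..<1} in lebesgue. x \<in> {x. h x = 0}" by simp
 have cl: "closed {x. h x = 0}"
  using continuous_closed_preimage_constant[of UNIV h 0] h(1) by simp
 have "{0<..<1} \<subseteq> {x. h x = 0}"
  using mem_closed_if_AE_lebesgue_open[OF open_greaterThanLessThan cl ae] by blast
 from closure_minimal[OF this cl] have z: "h x = 0" if "x \<in> {0..1}" for x
  using that by auto
 have "h x = 0" for x
 proof -
  have "h x = h (frac x)"
   using periodic_int[of h "frac x" "\<lfloor>x\<rfloor>", OF h(2)] by (simp add: frac_def)
  then show ?thesis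
   using z[of "frac x"] frac_ge_0[of x] frac_lt_1[of x] by simp
 qed
 then show ?thesis by (auto simp: h_def)
qed

section \<open>Fourier transforms on the line and Plancherel\<close>

abbreviation lborel2 :: "(real \<times> real) measure" where "lborel2 \<equiv> lborel \<Otimes>\<^sub>M lborel"
abbreviation borel2 :: "(real \<times> real) measure" where "borel2 \<equiv> borel \<Otimes>\<^sub>M borel"

lemma Fubini_lborel:
 fixes f :: "real => real => complex"
 assumes "(\<lambda>p. f (fst p) (snd p)) \<in> borel_measurable lborel2"
  and "\<And>x y. norm (f x y) <= g x * h y" and "integrable lborel g" "integrable lborel h"
  and "\<And>x. g x >= 0" "\<And>y. h y >= 0"
 shows "(\<integral>x. (\<integral>y. f x y \<partial>lborel) \<partial>lborel) = (\<integral>y. (\<integral>x. f x y \<partial>lborel) \<partial>lborel)"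
  "integrable lborel (\<lambda>x. \<integral>y. f x y \<partial>lborel)"
proof -
 note [measurable] = assms(1)
 have gh: "integrable lborel2 (\<lambda>(x, y). g x * h y)"
 proof (rule lborel_pair.Fubini_integrable)
  show "(\<lambda>(x, y). g x * h y) \<in> borel_measurable lborel2"
   using borel_measurable_integrable[OF assms(3)] borel_measurable_integrable[OF assms(4)] by measurable
 qed (use assms(3,4) in \<open>auto simp: abs_mult intro!: AE_I2\<close>)
 have int: "integrable lborel2 (\<lambda>(x, y). f x y)"
  by (rule lint_bound[OF gh]) (use assms in \<open>auto simp: split_beta' intro!: AE_I2 order.trans[OF assms(2)]\<close>)
 show "(\<integral>x. (\<integral>y. f x y \<partial>lborel) \<partial>lborel) = (\<integral>y. (\<integral>x. f x y \<partial>lborel) \<partial>lborel)"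
  using lborel_pair.Fubini_integral[OF int] by simp
 show "integrable lborel (\<lambda>x. \<integral>y. f x y \<partial>lborel)"
  using lborel_pair.integrable_fst'[OF int] by simp
qed

text \<open>Cutting the line into unit intervals.\<close>
lemma has_sum_unfold_unit_leb:
 fixes F :: "real => complex"
 assumes F: "integrable lborel F"
 shows "((\<lambda>n::int. \<integral>x. F (x + of_int n) \<partial>unit_leb) has_sum (\<integral>x. F x \<partial>lborel)) UNIV"
proof -
 have shift: "(\<integral>x. G (x + of_int n) \<partial>unit_leb) = (\<integral>x. indicator {of_int n..<of_int n + 1} x *\<^sub>R G x \<partial>lborel)"
  for G :: "real => 'b::{banach, second_countable_topology}" and n :: int
 proof -
  have "(\<integral>x. indicator {of_int n..<of_int n + 1} x *\<^sub>R G x \<partial>lborel)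
    = (\<integral>x. indicator {of_int n..<of_int n + 1} (of_int n + 1 * x) *\<^sub>R G (of_int n + 1 * x) \<partial>lborel)"
   by (subst lborel_integral_real_affine[of 1 _ "of_int n"]) auto
  also have "... = (\<integral>x. indicator {0..<1} x *\<^sub>R G (x + of_int n) \<partial>lborel)"
   by (intro lint_cong) (auto simp: indicator_def add.commute)
  finally show ?thesis by (simp add: integral_unit_leb set_lebesgue_integral_def)
 qed
 define f where "f n x = indicator {of_int n..<of_int n + 1} x *\<^sub>R F x" for n :: int and x
 have one: "((\<lambda>n::int. indicator {of_int n..<of_int n + 1} x *\<^sub>R a) has_sum a) UNIV" for x :: real and a :: "'b::real_normed_vector"
 proof -
  have "((\<lambda>n::int. indicator {of_int n..<of_int n + 1} x *\<^sub>R a) has_sum (\<Sum>n\<in>{\<lfloor>x\<rfloor>}. indicator {of_int n..<of_int n + 1} x *\<^sub>R a)) UNIV"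
  proof (rule has_sum_finite_neutralI)
   show "indicat_real {of_int n..<of_int n + 1} x *\<^sub>R a = 0" if "n \<in> UNIV - {\<lfloor>x\<rfloor>}" for n
    using that floor_unique[of n x] by (auto simp: indicator_def)
  qed auto
  then show ?thesis by (simp add: indicator_def)
 qed
 have sumF: "(\<Sum>\<^sub>\<infinity>n. f n x) = F x" for x
  using one[of x "F x"] unfolding f_def by (rule infsumI)
 have fi: "integrable lborel (f n)" for n
  unfolding f_def using F by (intro integrable_mult_indicator) auto
 have nf: "norm (f n x) = indicator {of_int n..<of_int n + 1} x *\<^sub>R norm (F x)" for n x by (simp add: f_def)
 have sm: "(\<lambda>n. norm (f n x)) summable_on UNIV" for x
  unfolding nf using one has_sum_imp_summable by blast
 have si: "(\<lambda>n. \<integral>x. norm (f n x) \<partial>lborel) summable_on UNIV"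
 proof (rule nonneg_bdd_above_summable_on)
  show "bdd_above (sum (\<lambda>n. \<integral>x. norm (f n x) \<partial>lborel) ` {K. K \<subseteq> UNIV \<and> finite K})"
  proof (rule bdd_aboveI2)
   fix K :: "int set" assume "K \<in> {K. K \<subseteq> UNIV \<and> finite K}"
   then have K: "finite K" by simp
   have "(\<Sum>n\<in>K. \<integral>x. norm (f n x) \<partial>lborel) = (\<integral>x. (\<Sum>n\<in>K. norm (f n x)) \<partial>lborel)"
    using fi by (subst Bochner_Integration.integral_sum) auto
   also have "... <= (\<integral>x. norm (F x) \<partial>lborel)"
   proof (rule integral_mono)
    show "(\<Sum>n\<in>K. norm (f n x)) <= norm (F x)" for x
     unfolding nf using one[of x "norm (F x)"] K by (intro finite_sum_le_has_sum) auto
   qed (use fi F in auto)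
   finally show "(\<Sum>n\<in>K. \<integral>x. norm (f n x) \<partial>lborel) <= (\<integral>x. norm (F x) \<partial>lborel)" .
  qed
 qed auto
 have "((\<lambda>n. \<integral>x. f n x \<partial>lborel) has_sum (\<integral>x. (\<Sum>\<^sub>\<infinity>n. f n x) \<partial>lborel)) UNIV"
  by (rule has_sum_integral(2)) (use fi sm si in auto)
 then show ?thesis
  unfolding sumF unfolding f_def shift[of F] .
qed

lemma fcoeff_periodization:
 fixes F :: "real => complex"
 assumes F: "integrable lborel F"
  and sm: "\<And>x. (\<lambda>n::int. norm (F (x + of_int n))) summable_on UNIV"
 shows "fcoeff (\<lambda>x. \<Sum>\<^sub>\<infinity>n::int. F (x + of_int n)) k = (\<integral>x. F x * char_neg k x \<partial>lborel)"
  and "integrable unit_leb (\<lambda>x. \<Sum>\<^sub>\<infinity>n::int. F (x + of_int n))"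
proof -
 define G where "G x = F x * char_neg k x" for x
 have m: "(\<lambda>x. cis (c * x)) \<in> borel_fun" for c
  by (intro borel_measurable_continuous_onI continuous_intros)
 have intF: "integrable unit_leb (\<lambda>x. G (x + of_int n))" if "integrable lborel G" for G :: "real => complex" and n :: int
 proof -
  have "integrable lborel (\<lambda>x. G (of_int n + 1 * x))"
   using that by (rule lborel_integrable_real_affine) simp
  then have "integrable lborel (\<lambda>x. indicator {0..<1} x *\<^sub>R G (x + of_int n))"
   by (intro integrable_mult_indicator) (auto simp: add.commute)
  then show ?thesis
   unfolding unit_leb_def by (subst integrable_restrict_space) (auto simp: set_integrable_def)
 qed
 have "integrable lborel (\<lambda>x. complex_of_real (norm (F x)))"
  using F by auto
 from has_sum_unfold_unit_leb[OF this]
 have "(\<lambda>n::int. \<integral>x. complex_of_real (norm (F (x + of_int n))) \<partial>unit_leb) summable_on UNIV"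
  by (rule has_sum_imp_summable)
 then have nsum: "(\<lambda>n::int. \<integral>x. norm (F (x + of_int n)) \<partial>unit_leb) summable_on UNIV"
  unfolding integral_complex_of_real using summable_on_Re by fastforce
 have G: "integrable lborel G"
  unfolding G_def by (rule lint_bound[OF F])
   (use borel_measurable_integrable[OF F] m[of "- (2 * pi * of_int k)"] in \<open>auto simp: norm_mult\<close>)
 have Gn: "G (x + of_int n) = F (x + of_int n) * char_neg k x" for x and n :: int
 proof -
  have "cis (- (2 * pi * of_int k * (x + of_int n))) = char_neg k x * cis (2 * pi * of_int (- k * n))"
   by (simp add: cis_mult algebra_simps)
  also have "cis (2 * pi * of_int (- k * n)) = 1" by (rule cis_multiple_2pi) auto
  finally show ?thesis by (simp add: G_def)
 qed
 have "((\<lambda>n::int. \<integral>x. G (x + of_int n) \<partial>unit_leb) has_sum (\<integral>x. (\<Sum>\<^sub>\<infinity>n::int. G (x + of_int n)) \<partial>unit_leb)) UNIV"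
  by (rule has_sum_integral(2)) (use intF[OF G] sm nsum in \<open>auto simp: Gn norm_mult\<close>)
 moreover have "((\<lambda>n::int. \<integral>x. G (x + of_int n) \<partial>unit_leb) has_sum (\<integral>x. G x \<partial>lborel)) UNIV"
  by (rule has_sum_unfold_unit_leb[OF G])
 ultimately have "(\<integral>x. G x \<partial>lborel) = (\<integral>x. (\<Sum>\<^sub>\<infinity>n::int. G (x + of_int n)) \<partial>unit_leb)"
  by (rule has_sum_unique[symmetric])
 then show "fcoeff (\<lambda>x. \<Sum>\<^sub>\<infinity>n::int. F (x + of_int n)) k = (\<integral>x. F x * char_neg k x \<partial>lborel)"
  unfolding fcoeff_def Gn by (simp add: infsum_cmult_left' G_def)
 show "integrable unit_leb (\<lambda>x. \<Sum>\<^sub>\<infinity>n::int. F (x + of_int n))"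
  by (rule has_sum_integral(1)) (use intF[OF F] sm nsum in auto)
qed

text \<open>Read off from the characteristic function of the normal distribution.\<close>
lemma gaussian_fourier:
 assumes u: "u > 0"
 shows "(\<integral>x. of_real (exp (- (pi * u * x\<^sup>2))) * cis (- (2 * pi * k * x)) \<partial>lborel)
    = of_real (exp (- (pi * k\<^sup>2 / u)) / sqrt u)"
  and "integrable lborel (\<lambda>x. exp (- (pi * u * x\<^sup>2)))"
  and "(\<integral>x. exp (- (pi * u * x\<^sup>2)) \<partial>lborel) = 1 / sqrt u"
proof -
 define c where "c = sqrt (2 * pi * u)"
 have c: "c > 0" "c\<^sup>2 = 2 * pi * u" using u by (auto simp: c_def)
 have sc: "sqrt (2 * pi) / c = 1 / sqrt u"
  using u by (simp add: c_def real_sqrt_mult)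
 have dens: "std_normal_density (0 + c * x) = exp (- (pi * u * x\<^sup>2)) / sqrt (2 * pi)" for x
  by (simp add: normal_density_def power_mult_distrib c(2) mult_ac)
 have "integrable lborel (\<lambda>x. std_normal_density (0 + c * x))"
  using c by (intro lborel_integrable_real_affine) (auto intro: integrable_normal_density)
 then have "integrable lborel (\<lambda>x. sqrt (2 * pi) * (exp (- (pi * u * x\<^sup>2)) / sqrt (2 * pi)))"
  unfolding dens by (rule integrable_mult_right)
 then show "integrable lborel (\<lambda>x. exp (- (pi * u * x\<^sup>2)))" by simp
 define t where "t = - (2 * pi * k / c)"
 have "complex_of_real (exp (- (t\<^sup>2) / 2)) = char std_normal_distribution t"
  by (simp add: char_std_normal_distribution)
 also have "... = (\<integral>x. std_normal_density x *\<^sub>R cis (t * x) \<partial>lborel)"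
  unfolding char_def by (subst integral_density) (auto simp: cis_conv_exp)
 also have "... = \<bar>c\<bar> *\<^sub>R (\<integral>x. std_normal_density (0 + c * x) *\<^sub>R cis (t * (0 + c * x)) \<partial>lborel)"
  using c by (intro lborel_integral_real_affine) auto
 also have "... = c *\<^sub>R (\<integral>x. (1 / sqrt (2 * pi)) *\<^sub>R (of_real (exp (- (pi * u * x\<^sup>2))) * cis (- (2 * pi * k * x))) \<partial>lborel)"
  unfolding dens using c by (simp add: t_def scaleR_conv_of_real mult_ac)
 also have "... = (c / sqrt (2 * pi)) *\<^sub>R (\<integral>x. of_real (exp (- (pi * u * x\<^sup>2))) * cis (- (2 * pi * k * x)) \<partial>lborel)"
  by simp
 finally have "(\<integral>x. of_real (exp (- (pi * u * x\<^sup>2))) * cis (- (2 * pi * k * x)) \<partial>lborel)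
   = (sqrt (2 * pi) / c) *\<^sub>R complex_of_real (exp (- (t\<^sup>2) / 2))"
  using c by (simp add: field_simps)
 moreover have "- (t\<^sup>2) / 2 = - (pi * k\<^sup>2 / u)"
 proof -
  have "t\<^sup>2 = (2 * pi * k)\<^sup>2 / (2 * pi * u)"
   unfolding c(2)[symmetric] by (simp add: t_def power_divide)
  then show ?thesis
   using u by (simp add: power2_eq_square field_simps)
 qed
 ultimately show four: "(\<integral>x. of_real (exp (- (pi * u * x\<^sup>2))) * cis (- (2 * pi * k * x)) \<partial>lborel)
    = of_real (exp (- (pi * k\<^sup>2 / u)) / sqrt u)" 
  unfolding sc by (simp add: scaleR_conv_of_real)
 have "(\<integral>x. std_normal_density x \<partial>lborel) = \<bar>c\<bar> *\<^sub>R (\<integral>x. std_normal_density (0 + c * x) \<partial>lborel)"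
  using c by (intro lborel_integral_real_affine) auto
 then have "1 = c * ((\<integral>x. exp (- (pi * u * x\<^sup>2)) \<partial>lborel) / sqrt (2 * pi))"
  unfolding dens using c by auto
 then have "c * (\<integral>x. exp (- (pi * u * x\<^sup>2)) \<partial>lborel) = sqrt (2 * pi)" by simp
 then have "(\<integral>x. exp (- (pi * u * x\<^sup>2)) \<partial>lborel) = sqrt (2 * pi) / c"
  using c by (metis nonzero_mult_div_cancel_left less_irrefl)
 then show "(\<integral>x. exp (- (pi * u * x\<^sup>2)) \<partial>lborel) = 1 / sqrt u"
  unfolding sc .
qed

definition fourier :: "(real => complex) => real => complex" where
 "fourier g \<eta> = (\<integral>u. g u * cis (- (2 * pi * \<eta> * u)) \<partial>lborel)"

lemma cis_bilinear_measurable [measurable]: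
 "(\<lambda>p. cis (c * (fst p) * (snd p))) \<in> borel_measurable lborel2"
proof -
 have "cis x = exp (\<i> * of_real x)" for x by (simp add: cis_conv_exp)
 then show ?thesis by simp
qed

text \<open>The Gaussian weight makes everything absolutely convergent: by Fubini the left side becomes the double integral of g(u) cnj (g(v)) K(u-v) with a Gaussian kernel K of total mass 1, and 2 |g(u) g(v)| <= |g(u)|^2 + |g(v)|^2 bounds that by the right side.\<close>
lemma plancherel_le_gauss:
 fixes g :: "real => complex"
 assumes g: "integrable lborel g" "integrable lborel (\<lambda>u. (norm (g u))\<^sup>2)" and e: "e > 0"
 shows "(\<integral>\<eta>. (norm (fourier g \<eta>))\<^sup>2 * exp (- (pi * e * \<eta>\<^sup>2)) \<partial>lborel) <= (\<integral>u. (norm (g u))\<^sup>2 \<partial>lborel)"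
  and "integrable lborel (\<lambda>\<eta>. (norm (fourier g \<eta>))\<^sup>2 * exp (- (pi * e * \<eta>\<^sup>2)))"
  and "fourier g \<in> borel_measurable lborel"
proof -
 note gm [measurable] = borel_measurable_integrable[OF g(1)]
 define w where "w \<eta> = exp (- (pi * e * \<eta>\<^sup>2))" for \<eta>
 have [measurable]: "w \<in> borel_measurable lborel" unfolding w_def by simp
 have w: "integrable lborel w" "\<And>\<eta>. w \<eta> >= 0"
  unfolding w_def using gaussian_fourier(2)[OF e] by auto
 define K where "K u = exp (- (pi * u\<^sup>2 / e)) / sqrt e" for u
 have [measurable]: "K \<in> borel_measurable lborel" unfolding K_def by simp
 have Kint: "integrable lborel K" "(\<integral>u. K u \<partial>lborel) = 1"
  using gaussian_fourier(2,3)[of "1/e"] e unfolding K_def by (auto simp: real_sqrt_divide)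
 define B where "B = (\<integral>u. norm (g u) \<partial>lborel)"
 have gh: "norm (fourier g \<eta>) <= B" for \<eta>
  unfolding fourier_def B_def by (rule order.trans[OF integral_norm_bound]) (simp add: norm_mult)
 have [measurable]: "(\<lambda>p. g (snd p) * cis (- (2 * pi * fst p * snd p))) \<in> borel_measurable lborel2"
  using cis_bilinear_measurable[of "- (2 * pi)"] by (simp add: mult.assoc)
 have fm [measurable]: "fourier g \<in> borel_measurable lborel"
  unfolding fourier_def by (rule lborel.borel_measurable_lebesgue_integral) (simp add: split_beta')
 show "fourier g \<in> borel_measurable lborel" by (rule fm)
 have B0: "B >= 0" by (simp add: B_def)
 show int: "integrable lborel (\<lambda>\<eta>. (norm (fourier g \<eta>))\<^sup>2 * exp (- (pi * e * \<eta>\<^sup>2)))"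
 proof (rule lint_bound)
  show "integrable lborel (\<lambda>\<eta>. B\<^sup>2 * w \<eta>)" using w by simp
  show "AE \<eta> in lborel. norm ((norm (fourier g \<eta>))\<^sup>2 * exp (- (pi * e * \<eta>\<^sup>2))) <= norm (B\<^sup>2 * w \<eta>)"
   using gh by (auto intro!: AE_I2 mult_right_mono power_mono simp: w_def)
 qed simp
 have inner: "(\<integral>\<eta>. of_real (w \<eta>) * cis (- (2 * pi * \<eta> * u)) * cnj (fourier g \<eta>) \<partial>lborel)
   = (\<integral>v. cnj (g v) * of_real (K (u - v)) \<partial>lborel)" for u
 proof -
  have "(\<integral>\<eta>. of_real (w \<eta>) * cis (- (2 * pi * \<eta> * u)) * cnj (fourier g \<eta>) \<partial>lborel)
    = (\<integral>\<eta>. (\<integral>v. of_real (w \<eta>) * cis (- (2 * pi * \<eta> * u)) * cnj (g v * cis (- (2 * pi * \<eta> * v))) \<partial>lborel) \<partial>lborel)"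
  proof -
   have "cnj (fourier g \<eta>) = (\<integral>v. cnj (g v * cis (- (2 * pi * \<eta> * v))) \<partial>lborel)" for \<eta>
    unfolding fourier_def by (rule Bochner_Integration.integral_cnj[symmetric])
   then show ?thesis by (simp only: integral_mult_right_zero)
  qed
  also have "... = (\<integral>v. (\<integral>\<eta>. of_real (w \<eta>) * cis (- (2 * pi * \<eta> * u)) * cnj (g v * cis (- (2 * pi * \<eta> * v))) \<partial>lborel) \<partial>lborel)"
  proof (rule Fubini_lborel(1)[of _ w "\<lambda>v. norm (g v)"])
   have [measurable]: "(\<lambda>\<eta>. cis (- (2 * pi * \<eta> * u))) \<in> borel_measurable lborel"
    by (simp, intro borel_measurable_continuous_onI continuous_intros)
   have [measurable]: "cnj \<in> borel_fun" by (intro borel_measurable_continuous_onI continuous_intros)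
   show "(\<lambda>p. of_real (w (fst p)) * cis (- (2 * pi * fst p * u)) * cnj (g (snd p) * cis (- (2 * pi * fst p * snd p))))
     \<in> borel_measurable lborel2" by measurable
  qed (use w g in \<open>auto simp: norm_mult\<close>)
  also have "... = (\<integral>v. cnj (g v) * (\<integral>\<eta>. of_real (w \<eta>) * cis (- (2 * pi * (u - v) * \<eta>)) \<partial>lborel) \<partial>lborel)"
  proof (intro lint_cong refl)
   fix v
   have "of_real (w \<eta>) * cis (- (2 * pi * \<eta> * u)) * cnj (g v * cis (- (2 * pi * \<eta> * v)))
     = cnj (g v) * (of_real (w \<eta>) * cis (- (2 * pi * (u - v) * \<eta>)))" for \<eta>
   proof -
    have "cis (- (2 * pi * (u - v) * \<eta>)) = cis (- (2 * pi * \<eta> * u)) * cis (2 * pi * \<eta> * v)"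
     unfolding cis_mult by (simp add: algebra_simps)
    then show ?thesis by (simp add: cis_cnj mult_ac)
   qed
   then show "(\<integral>\<eta>. of_real (w \<eta>) * cis (- (2 * pi * \<eta> * u)) * cnj (g v * cis (- (2 * pi * \<eta> * v))) \<partial>lborel)
     = cnj (g v) * (\<integral>\<eta>. of_real (w \<eta>) * cis (- (2 * pi * (u - v) * \<eta>)) \<partial>lborel)"
    by (simp only: integral_mult_right_zero)
  qed
  also have "... = (\<integral>v. cnj (g v) * of_real (K (u - v)) \<partial>lborel)"
   unfolding w_def gaussian_fourier(1)[OF e] K_def ..
  finally show ?thesis .
 qed
 have "complex_of_real (\<integral>\<eta>. (norm (fourier g \<eta>))\<^sup>2 * w \<eta> \<partial>lborel)
   = (\<integral>\<eta>. of_real (w \<eta>) * cnj (fourier g \<eta>) * fourier g \<eta> \<partial>lborel)"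
  unfolding integral_complex_of_real[symmetric] by (simp only: of_real_mult complex_norm_square mult_ac)
 also have "... = (\<integral>\<eta>. (\<integral>u. of_real (w \<eta>) * cnj (fourier g \<eta>) * (g u * cis (- (2 * pi * \<eta> * u))) \<partial>lborel) \<partial>lborel)"
  by (subst (2) fourier_def) simp
 also have "... = (\<integral>u. (\<integral>\<eta>. of_real (w \<eta>) * cnj (fourier g \<eta>) * (g u * cis (- (2 * pi * \<eta> * u))) \<partial>lborel) \<partial>lborel)"
 proof (rule Fubini_lborel(1)[of _ "\<lambda>\<eta>. w \<eta> * B" "\<lambda>u. norm (g u)"])
  have [measurable]: "cnj \<in> borel_fun" by (intro borel_measurable_continuous_onI continuous_intros)
  show "(\<lambda>p. of_real (w (fst p)) * cnj (fourier g (fst p)) * (g (snd p) * cis (- (2 * pi * fst p * snd p))))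
     \<in> borel_measurable lborel2" by measurable
  show "cmod (complex_of_real (w x) * cnj (fourier g x) * (g y * cis (- (2 * pi * x * y)))) <= w x * B * cmod (g y)" for x y
   using w gh[of x] by (auto simp: norm_mult intro!: mult_right_mono mult_left_mono)
 qed (use w g B0 in auto)
 also have "... = (\<integral>u. g u * (\<integral>v. cnj (g v) * of_real (K (u - v)) \<partial>lborel) \<partial>lborel)"
  unfolding inner[symmetric] by (simp add: mult_ac flip: integral_mult_right_zero)
 finally have eq: "complex_of_real (\<integral>\<eta>. (norm (fourier g \<eta>))\<^sup>2 * w \<eta> \<partial>lborel)
   = (\<integral>u. g u * (\<integral>v. cnj (g v) * of_real (K (u - v)) \<partial>lborel) \<partial>lborel)" .
 have K0: "K u >= 0" for u using e by (simp add: K_def)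
 have Kn: "(\<integral>\<^sup>+v. ennreal (K (u - v)) \<partial>lborel) = 1" "(\<integral>\<^sup>+u. ennreal (K (u - v)) \<partial>lborel) = 1" for u v
 proof -
  have 1: "(\<integral>\<^sup>+u. ennreal (K u) \<partial>lborel) = 1"
   using Kint K0 by (subst nn_integral_eq_integral) auto
  show "(\<integral>\<^sup>+v. ennreal (K (u - v)) \<partial>lborel) = 1"
   using nn_integral_real_affine[of "\<lambda>u. ennreal (K u)" "-1" u] 1 by simp
  show "(\<integral>\<^sup>+u. ennreal (K (u - v)) \<partial>lborel) = 1"
   using nn_integral_real_affine[of "\<lambda>u. ennreal (K u)" 1 "-v"] 1 by simp
 qed
 obtain h :: real where h: "h = 1/2" by blast
 then have h0: "h >= 0" "h + h = 1" by auto
 define I where "I = (\<integral>\<^sup>+u. sqnorm (g u) \<partial>lborel)"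
 have nb: "ennreal (norm (\<integral>x. h x \<partial>M)) <= (\<integral>\<^sup>+x. ennreal (norm (h x)) \<partial>M)" for h :: "real => complex" and M
  using integral_norm_bound_ennreal[of M h] by (cases "integrable M h") (auto simp: not_integrable_integral_eq)
 have "ennreal (\<integral>\<eta>. (norm (fourier g \<eta>))\<^sup>2 * w \<eta> \<partial>lborel)
   <= ennreal (norm (complex_of_real (\<integral>\<eta>. (norm (fourier g \<eta>))\<^sup>2 * w \<eta> \<partial>lborel)))"
  by (intro ennreal_leI) (simp del: integral_complex_of_real)
 also have "... <= (\<integral>\<^sup>+u. ennreal (norm (g u * (\<integral>v. cnj (g v) * of_real (K (u - v)) \<partial>lborel))) \<partial>lborel)"
  unfolding eq by (rule nb)
 also have "... <= (\<integral>\<^sup>+u. ennreal (norm (g u)) * (\<integral>\<^sup>+v. ennreal (norm (g v) * K (u - v)) \<partial>lborel) \<partial>lborel)"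
 proof (rule nn_integral_mono)
  fix u
  have "ennreal (norm (\<integral>v. cnj (g v) * of_real (K (u - v)) \<partial>lborel)) <= (\<integral>\<^sup>+v. ennreal (norm (g v) * K (u - v)) \<partial>lborel)"
   by (rule order.trans[OF nb]) (use K0 in \<open>simp add: norm_mult\<close>)
  then show "ennreal (norm (g u * (\<integral>v. cnj (g v) * of_real (K (u - v)) \<partial>lborel)))
    <= ennreal (norm (g u)) * (\<integral>\<^sup>+v. ennreal (norm (g v) * K (u - v)) \<partial>lborel)"
   unfolding norm_mult by (subst ennreal_mult) (auto intro: mult_left_mono)
 qed
 also have "... = (\<integral>\<^sup>+u. (\<integral>\<^sup>+v. ennreal (norm (g u)) * ennreal (norm (g v) * K (u - v)) \<partial>lborel) \<partial>lborel)"
  by (intro nn_integral_cong nn_integral_cmult[symmetric]) simp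
 also have "... <= (\<integral>\<^sup>+u. (\<integral>\<^sup>+v. ennreal h * (sqnorm (g u) * ennreal (K (u - v))) +
    ennreal h * (sqnorm (g v) * ennreal (K (u - v))) \<partial>lborel) \<partial>lborel)"
 proof (intro nn_integral_mono)
  fix u v
  have "norm (g u) * norm (g v) <= ((norm (g u))\<^sup>2 + (norm (g v))\<^sup>2) / 2"
   using sum_squares_bound[of "norm (g u)" "norm (g v)"] by simp
  then have "norm (g u) * (norm (g v) * K (u - v)) <= h * ((norm (g u))\<^sup>2 * K (u - v)) + h * ((norm (g v))\<^sup>2 * K (u - v))"
   using mult_right_mono[OF _ K0[of "u - v"]] unfolding h by (fastforce simp: field_simps)
  then show "ennreal (norm (g u)) * ennreal (norm (g v) * K (u - v)) <= ennreal h * (sqnorm (g u) * ennreal (K (u - v))) +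
    ennreal h * (sqnorm (g v) * ennreal (K (u - v)))"
   using K0[of "u - v"] h0 by (simp add: ennreal_mult[symmetric] ennreal_plus[symmetric] del: ennreal_plus)
 qed
 also have "... = (\<integral>\<^sup>+u. (\<integral>\<^sup>+v. ennreal h * (sqnorm (g u) * ennreal (K (u - v))) \<partial>lborel) \<partial>lborel) +
    (\<integral>\<^sup>+u. (\<integral>\<^sup>+v. ennreal h * (sqnorm (g v) * ennreal (K (u - v))) \<partial>lborel) \<partial>lborel)"
  by (simp add: nn_integral_add lborel.borel_measurable_nn_integral)
 also have "(\<integral>\<^sup>+u. (\<integral>\<^sup>+v. ennreal h * (sqnorm (g u) * ennreal (K (u - v))) \<partial>lborel) \<partial>lborel) = ennreal h * I"
  by (simp add: nn_integral_cmult Kn I_def)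
 also have "(\<integral>\<^sup>+u. (\<integral>\<^sup>+v. ennreal h * (sqnorm (g v) * ennreal (K (u - v))) \<partial>lborel) \<partial>lborel) = 
  (\<integral>\<^sup>+v. (\<integral>\<^sup>+u. ennreal h * (sqnorm (g v) * ennreal (K (u - v))) \<partial>lborel) \<partial>lborel)"
  by (rule lborel_pair.Fubini') simp
 also have "... = ennreal h * I" by (simp add: nn_integral_cmult Kn I_def)
 also have "ennreal h * I + ennreal h * I = I"
  unfolding distrib_right[symmetric] using h0 by (simp add: ennreal_plus[symmetric] del: ennreal_plus)
 also have "I = ennreal (\<integral>u. (norm (g u))\<^sup>2 \<partial>lborel)"
  unfolding I_def using g by (intro nn_integral_eq_integral) auto
 finally show "(\<integral>\<eta>. (norm (fourier g \<eta>))\<^sup>2 * exp (- (pi * e * \<eta>\<^sup>2)) \<partial>lborel) <= (\<integral>u. (norm (g u))\<^sup>2 \<partial>lborel)"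
  unfolding w_def by (simp add: ennreal_le_iff)
qed

text \<open>Monotone convergence as the Gaussian weight tends to 1.\<close>
lemma plancherel_le:
 fixes g :: "real => complex"
 assumes g: "integrable lborel g" "integrable lborel (\<lambda>u. (norm (g u))\<^sup>2)"
 shows "(\<integral>\<^sup>+\<eta>. sqnorm (fourier g \<eta>) \<partial>lborel) <= ennreal (\<integral>u. (norm (g u))\<^sup>2 \<partial>lborel)"
proof -
 note fm [measurable] = plancherel_le_gauss(3)[OF g, of 1, simplified]
 define h where "h n \<eta> = ennreal ((norm (fourier g \<eta>))\<^sup>2 * exp (- (pi * (1 / real (Suc n)) * \<eta>\<^sup>2)))" for n \<eta>
 have lim: "(\<lambda>n. h n \<eta>) \<longlonglongrightarrow> sqnorm (fourier g \<eta>)" for \<eta>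
 proof -
  have "(\<lambda>n. 1 / real (Suc n)) \<longlonglongrightarrow> 0"
   using LIMSEQ_inverse_real_of_nat by (simp add: inverse_eq_divide)
  then have "(\<lambda>n. (norm (fourier g \<eta>))\<^sup>2 * exp (- (pi * (1 / real (Suc n)) * \<eta>\<^sup>2))) \<longlonglongrightarrow> (norm (fourier g \<eta>))\<^sup>2 * exp (- (pi * 0 * \<eta>\<^sup>2))"
   by (intro tendsto_intros)
  then show ?thesis
   unfolding h_def by (intro tendsto_ennrealI) simp
 qed
 have "(\<integral>\<^sup>+\<eta>. sqnorm (fourier g \<eta>) \<partial>lborel) = (\<integral>\<^sup>+\<eta>. liminf (\<lambda>n. h n \<eta>) \<partial>lborel)"
  using lim_imp_Liminf[OF _ lim] by simp
 also have "... <= liminf (\<lambda>n. \<integral>\<^sup>+\<eta>. h n \<eta> \<partial>lborel)"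
  by (rule nn_integral_liminf) (simp add: h_def)
 also have "... <= ennreal (\<integral>u. (norm (g u))\<^sup>2 \<partial>lborel)"
 proof -
  have "(\<integral>\<^sup>+\<eta>. h n \<eta> \<partial>lborel) <= ennreal (\<integral>u. (norm (g u))\<^sup>2 \<partial>lborel)" for n
   unfolding h_def using plancherel_le_gauss(1,2)[OF g, of "1 / real (Suc n)"]
   by (subst nn_integral_eq_integral) (auto intro!: ennreal_leI)
  then show ?thesis by (intro order.trans[OF Liminf_mono Liminf_const[THEN eq_refl]]) auto
 qed
 finally show ?thesis .
qed

section \<open>Mellin transforms of theta series\<close>

lemma summable_on_product_real:
 fixes f :: "'a => real" and g :: "'b => real"
 assumes "f summable_on A" "g summable_on B" "\<And>x. f x >= 0" "\<And>y. g y >= 0"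
 shows "(\<lambda>(x, y). f x * g y) summable_on (A \<times> B)"
proof (rule summable_on_SigmaI)
 show "((\<lambda>y. case (x, y) of (x, y) => f x * g y) has_sum f x * infsum g B) B" for x
  using assms(2) by (auto intro!: has_sum_cmult_right)
 show "(\<lambda>x. f x * infsum g B) summable_on A"
  using assms(1) by (rule summable_on_cmult_left)
qed (use assms in auto)

lemma summable_on_int_symmetric:
 fixes f :: "int => real"
 assumes "summable (\<lambda>n. f (int n))" "\<And>n. f n >= 0" "\<And>n. f (- n) = f n"
 shows "f summable_on UNIV"
proof -
 have "(\<lambda>n. f (int n)) summable_on UNIV"
  using assms by (simp add: summable_on_UNIV_nonneg_real_iff)
 then have "f summable_on range int" "f summable_on range (\<lambda>n. - int n)"
  using assms(3) by (subst summable_on_reindex; simp add: o_def inj_on_def)+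
 moreover have "UNIV = range int \<union> range (\<lambda>n. - int n)" by (auto simp: image_iff) (metis int_cases2)
 ultimately show ?thesis
  using summable_on_union by metis
qed

lemma summable_on_int_powr:
 assumes "\<sigma> > 1"
 shows "(\<lambda>n::int. (1 + \<bar>real_of_int n\<bar>) powr (- \<sigma>)) summable_on (UNIV :: int set)"
proof (rule summable_on_int_symmetric)
 have "summable (\<lambda>n. real n powr (- \<sigma>))"
  using assms by (subst summable_real_powr_iff) auto
 then have "summable (\<lambda>n. real (Suc n) powr (- \<sigma>))" by (subst summable_Suc_iff)
 then show "summable (\<lambda>n. (1 + \<bar>real_of_int (int n)\<bar>) powr (- \<sigma>))" by simp
qed auto

lemma exp_minus_le_powr:
 assumes "v > 0" "\<sigma> > (0::real)"
 shows "exp (- v) <= \<sigma> powr \<sigma> * v powr (- \<sigma>)"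
proof -
 have "v / \<sigma> <= exp (v / \<sigma>)"
  using exp_ge_add_one_self[of "v / \<sigma>"] by linarith
 then have "(v / \<sigma>) powr \<sigma> <= exp (v / \<sigma>) powr \<sigma>"
  using assms by (intro powr_mono2) auto
 also have "... = exp v"
  using assms by (simp add: powr_def)
 finally have "v powr \<sigma> <= \<sigma> powr \<sigma> * exp v"
  using assms by (simp add: powr_divide field_simps)
 then show ?thesis
  using assms by (simp add: exp_minus powr_minus field_simps)
qed

text \<open>The Gamma integral in logarithmic coordinates, in which inversion becomes reflection and the functional equations are symmetric.\<close>
lemma Gamma_log_integral:
 assumes s: "Re s > 0"
 shows "integrable lborel (\<lambda>x. of_real (exp (- exp x)) * exp (s * of_real x))"
  and "(\<integral>x. of_real (exp (- exp x)) * exp (s * of_real x) \<partial>lborel) = Gamma s"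
proof -
 define f where "f t = complex_of_real t powr (s - 1) / of_real (exp t)" for t :: real
 define g where "g x = of_real (exp (- exp x)) * exp (s * of_real x)" for x :: real
 have g: "exp x *\<^sub>R f (exp x) = g x" for x
  by (simp add: f_def g_def powr_def exp_minus scaleR_conv_of_real exp_of_real[symmetric] Ln_of_real
    exp_diff field_simps)
 have fabs: "f absolutely_integrable_on {0<..}"
  using absolutely_integrable_Gamma_integral[OF s, of 1] by (simp add: f_def[abs_def])
 have fint: "(f has_integral Gamma s) {0<..}"
 proof -
  have "(f has_integral Gamma s) {0..}"
   using Gamma_integral_complex[OF s] by (simp add: f_def[abs_def])
  moreover have "(f has_integral Gamma s) {0<..} \<longleftrightarrow> (f has_integral Gamma s) {0..}"
   by (rule has_integral_spike_set_eq; rule negligible_subset[of "{0}"]) auto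
  ultimately show ?thesis by simp
 qed
 have rng: "exp ` (UNIV :: real set) = {0<..}" by (auto simp: image_iff) (metis exp_ln)
 have "(\<lambda>x. \<bar>exp x\<bar> *\<^sub>R f (exp x)) absolutely_integrable_on UNIV \<and> integral UNIV (\<lambda>x. \<bar>exp x\<bar> *\<^sub>R f (exp x)) = Gamma s
    \<longleftrightarrow> f absolutely_integrable_on (exp ` UNIV) \<and> integral (exp ` UNIV) f = Gamma s"
  by (rule has_absolute_integral_change_of_variables_real) (auto intro!: DERIV_exp inj_onI)
 then have gi: "g absolutely_integrable_on UNIV" "integral UNIV g = Gamma s"
  unfolding rng using fabs fint g by (auto simp: integral_unique)
 have gm: "g \<in> borel_fun"
  unfolding g_def by (intro borel_measurable_continuous_onI continuous_intros)
 have "integrable lborel g"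
  using gi(1) gm by (simp add: set_integrable_def integrable_completion)
 moreover from this have "(\<integral>x. g x \<partial>lborel) = Gamma s"
  using gi(2) by (simp add: integral_lborel)
 ultimately show "integrable lborel (\<lambda>x. of_real (exp (- exp x)) * exp (s * of_real x))"
  "(\<integral>x. of_real (exp (- exp x)) * exp (s * of_real x) \<partial>lborel) = Gamma s"
  by (simp_all add: g_def[abs_def])
qed

lemma integral_exp_log_shift:
 assumes s: "Re s > 0" and q: "q > 0"
 shows "integrable lborel (\<lambda>x. of_real (exp (- (q * exp x))) * exp (s * of_real x))"
  and "(\<integral>x. of_real (exp (- (q * exp x))) * exp (s * of_real x) \<partial>lborel) = Gamma s * of_real q powr (- s)"
proof -
 define h where "h x = of_real (exp (- exp x)) * exp (s * of_real x)" for x :: real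
 have eq: "of_real (exp (- (q * exp x))) * exp (s * of_real x) = of_real q powr (- s) * h (ln q + 1 * x)" for x
  using q by (simp add: h_def exp_add powr_def Ln_of_real exp_minus distrib_left)
 have "integrable lborel (\<lambda>x. h (ln q + 1 * x))"
  by (rule lborel_integrable_real_affine) (use Gamma_log_integral(1)[OF s] in \<open>auto simp: h_def\<close>)
 then show "integrable lborel (\<lambda>x. of_real (exp (- (q * exp x))) * exp (s * of_real x))"
  unfolding eq by (rule integrable_mult_right)
 have "Gamma s = \<bar>1\<bar> *\<^sub>R (\<integral>x. h (ln q + 1 * x) \<partial>lborel)"
  using Gamma_log_integral(2)[OF s] lborel_integral_real_affine[of 1 h "ln q"] by (simp add: h_def)
 then show "(\<integral>x. of_real (exp (- (q * exp x))) * exp (s * of_real x) \<partial>lborel) = Gamma s * of_real q powr (- s)"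
  unfolding eq by simp
qed

text \<open>The argument is the logarithm of the usual theta parameter.\<close>
definition theta :: "('i => real) => 'i set => real => real" where
 "theta q I x = (\<Sum>\<^sub>\<infinity>i\<in>I. exp (- (pi * q i * exp x)))"

lemma theta_term_le:
 assumes "q > 0" "\<sigma> > 0"
 shows "exp (- (pi * q * exp x)) <= (\<sigma> powr \<sigma> * pi powr (- \<sigma>) * exp (- \<sigma> * x)) * q powr (- \<sigma>)"
 using exp_minus_le_powr[of "pi * q * exp x" \<sigma>] assms by (simp add: powr_mult powr_def[of "exp x"] mult_ac)

text \<open>Power decay of every exponent \<sigma> for which the associated Dirichlet series converges.\<close>
lemma theta_bound:
 assumes q: "\<And>i. i \<in> I ==> q i > 0" and \<sigma>: "\<sigma> > 0" and sm: "(\<lambda>i. q i powr (- \<sigma>)) summable_on I"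
 shows "(\<lambda>i. exp (- (pi * q i * exp x))) summable_on I"
  and "0 <= theta q I x"
  and "theta q I x <= \<sigma> powr \<sigma> * pi powr (- \<sigma>) * (\<Sum>\<^sub>\<infinity>i\<in>I. q i powr (- \<sigma>)) * exp (- \<sigma> * x)"
proof -
 define C where "C = \<sigma> powr \<sigma> * pi powr (- \<sigma>) * exp (- \<sigma> * x)"
 have smC: "(\<lambda>i. C * q i powr (- \<sigma>)) summable_on I"
  using sm by (rule summable_on_cmult_right)
 show smx: "(\<lambda>i. exp (- (pi * q i * exp x))) summable_on I"
  by (rule summable_on_comparison_test[OF smC]) (use theta_term_le q \<sigma> in \<open>auto simp: C_def\<close>)
 show "0 <= theta q I x"
  unfolding theta_def by (rule infsum_nonneg) simp
 have "theta q I x <= (\<Sum>\<^sub>\<infinity>i\<in>I. C * q i powr (- \<sigma>))"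
  unfolding theta_def by (rule infsum_mono[OF smx smC]) (use theta_term_le q \<sigma> in \<open>auto simp: C_def\<close>)
 then show "theta q I x <= \<sigma> powr \<sigma> * pi powr (- \<sigma>) * (\<Sum>\<^sub>\<infinity>i\<in>I. q i powr (- \<sigma>)) * exp (- \<sigma> * x)"
  by (simp add: infsum_cmult_right' C_def mult_ac)
qed

lemma theta_continuous:
 assumes q: "\<And>i. i \<in> I ==> q i > 0" and \<sigma>: "\<sigma> > 0" and sm: "(\<lambda>i. q i powr (- \<sigma>)) summable_on I"
 shows "continuous_on UNIV (theta q I)"
proof -
 have "isCont (theta q I) x" for x
  unfolding isCont_def theta_def
 proof (rule infsum_tendsto_dominated)
  show "((\<lambda>y. exp (- (pi * q i * exp y))) \<longlongrightarrow> exp (- (pi * q i * exp x))) (at x)" for i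
   by (intro tendsto_intros)
  show "(\<lambda>i. \<sigma> powr \<sigma> * pi powr (- \<sigma>) * exp (- \<sigma> * (x - 1)) * q i powr (- \<sigma>)) summable_on I"
   using sm by (rule summable_on_cmult_right)
  have "\<forall>\<^sub>F y in at x. y > x - 1" by (rule eventually_at_in_open'[of "{x - 1<..}" x, simplified])
  then show "\<forall>\<^sub>F y in at x. \<forall>i\<in>I. norm (exp (- (pi * q i * exp y))) <= \<sigma> powr \<sigma> * pi powr (- \<sigma>) * exp (- \<sigma> * (x - 1)) * q i powr (- \<sigma>)"
  proof eventually_elim
   case (elim y)
   show ?case
   proof
    fix i assume "i \<in> I"
    then have "exp (- (pi * q i * exp y)) <= exp (- (pi * q i * exp (x - 1)))"
     using q elim by auto
    also have "... <= \<sigma> powr \<sigma> * pi powr (- \<sigma>) * exp (- \<sigma> * (x - 1)) * q i powr (- \<sigma>)"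
     using theta_term_le q \<sigma> \<open>i \<in> I\<close> by blast
    finally show "norm (exp (- (pi * q i * exp y))) <= \<sigma> powr \<sigma> * pi powr (- \<sigma>) * exp (- \<sigma> * (x - 1)) * q i powr (- \<sigma>)"
     by simp
   qed
  qed
 qed auto
 then show ?thesis by (simp add: continuous_on_eq_continuous_at)
qed

text \<open>Term by term the Mellin transform of a theta series is a Gamma factor times a Dirichlet series.\<close>
lemma mellin_theta:
 fixes q :: "'i => real"
 assumes I: "countable I" and q: "\<And>i. i \<in> I ==> q i > 0"
  and s: "Re s > 0" and sm: "(\<lambda>i. q i powr (- Re s)) summable_on I"
 shows "integrable lborel (\<lambda>x. of_real (theta q I x) * exp (s * of_real x))"
  and "((\<lambda>i. of_real (q i) powr (- s)) has_sum
     (\<integral>x. of_real (theta q I x) * exp (s * of_real x) \<partial>lborel) / (Gamma s * of_real pi powr (- s))) I"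
proof -
 define f where "f i x = of_real (exp (- (pi * q i * exp x))) * exp (s * of_real x)" for i and x :: real
 have fi: "integrable lborel (f i)" "(\<integral>x. f i x \<partial>lborel) = Gamma s * of_real (pi * q i) powr (- s)" if "i \<in> I" for i
  using integral_exp_log_shift[OF s, of "pi * q i"] q[OF that] unfolding f_def by auto
 have powr: "of_real (pi * q i) powr (- s) = of_real pi powr (- s) * of_real (q i) powr (- s)" if "i \<in> I" for i
  using q[OF that] by (simp add: powr_def of_real_mult[symmetric] Ln_of_real ln_mult distrib_left exp_add del: of_real_mult) (simp add: exp_diff exp_minus divide_inverse)
 have nf: "norm (f i x) = exp (- (pi * q i * exp x)) * exp (Re s * x)" for i x by (simp add: f_def norm_mult)
 have inf: "(\<integral>x. norm (f i x) \<partial>lborel) = Gamma (Re s) * (pi * q i) powr (- Re s)" if "i \<in> I" for i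
 proof -
  have "complex_of_real (\<integral>x. norm (f i x) \<partial>lborel) = (\<integral>x. of_real (exp (- (pi * q i * exp x))) * exp (of_real (Re s) * of_real x) \<partial>lborel)"
   unfolding nf by (subst integral_complex_of_real[symmetric]) (simp add: exp_of_real[symmetric])
  also have "... = Gamma (of_real (Re s)) * of_real (pi * q i) powr (- of_real (Re s))"
   using s q[OF that] by (intro integral_exp_log_shift) auto
  also have "... = of_real (Gamma (Re s) * (pi * q i) powr (- Re s))"
   using q[OF that] by (simp add: Gamma_complex_of_real powr_of_real[symmetric])
  finally show ?thesis by (simp only: of_real_eq_iff)
 qed
 have th: "of_real (theta q I x) * exp (s * of_real x) = (\<Sum>\<^sub>\<infinity>i\<in>I. f i x)" for x
 proof -
  have "(\<lambda>i. exp (- (pi * q i * exp x))) summable_on I" by (rule theta_bound(1)[OF q s sm])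
  from has_sum_of_real[OF has_sum_infsum[OF this], where 'a = complex]
  have "((\<lambda>i. complex_of_real (exp (- (pi * q i * exp x)))) has_sum of_real (theta q I x)) I"
   by (simp add: theta_def)
  from infsumI[OF has_sum_cmult_left[OF this, of "exp (s * of_real x)"]]
  show ?thesis by (simp add: f_def)
 qed
 have A: "(\<lambda>i. norm (f i x)) summable_on I" for x
  unfolding nf using theta_bound(1)[OF q s sm] by (rule summable_on_cmult_left)
 have B: "(\<lambda>i. \<integral>x. norm (f i x) \<partial>lborel) summable_on I"
 proof -
  have "(\<lambda>i. (Gamma (Re s) * pi powr (- Re s)) * q i powr (- Re s)) summable_on I"
   using sm by (rule summable_on_cmult_right)
  then show ?thesis
   by (subst summable_on_cong[OF inf]) (auto simp: powr_mult mult_ac q less_imp_le cong: summable_on_cong)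
 qed
 show "integrable lborel (\<lambda>x. of_real (theta q I x) * exp (s * of_real x))"
  unfolding th by (rule has_sum_integral(1)[OF I fi(1) A B])
 have S: "((\<lambda>i. \<integral>x. f i x \<partial>lborel) has_sum (\<integral>x. of_real (theta q I x) * exp (s * of_real x) \<partial>lborel)) I"
  unfolding th by (rule has_sum_integral(2)[OF I fi(1) A B])
 have c: "(\<integral>x. f i x \<partial>lborel) = Gamma s * of_real pi powr (- s) * of_real (q i) powr (- s)" if "i \<in> I" for i
  unfolding fi(2)[OF that] powr[OF that] by (simp only: mult.assoc)
 have "((\<lambda>i. Gamma s * of_real pi powr (- s) * of_real (q i) powr (- s)) has_sum (\<integral>x. of_real (theta q I x) * exp (s * of_real x) \<partial>lborel)) I"
  using S has_sum_cong[OF c, of I] by (simp only:)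
 from has_sum_cmult_right[OF this, of "1 / (Gamma s * of_real pi powr (- s))"]
 show "((\<lambda>i. of_real (q i) powr (- s)) has_sum
     (\<integral>x. of_real (theta q I x) * exp (s * of_real x) \<partial>lborel) / (Gamma s * of_real pi powr (- s))) I"
  using Gamma_eq_zero_iff[of s] s by (auto elim!: nonpos_Ints_cases)
qed

lemma exp_half_line:
 assumes c: "Re c > 0"
 shows "integrable lborel (\<lambda>x. of_real (indicator {0..} x) * exp (- c * of_real x))"
  and "(\<integral>x. of_real (indicator {0..} x) * exp (- c * of_real x) \<partial>lborel) = 1 / c"
proof -
 have n: "norm (exp (- c * complex_of_real x)) = exp (- Re c * x)" for x by simp
 have int0: "integrable lborel (\<lambda>x. indicator {0..} x * exp (- Re c * x))"
 proof -
  have "(\<lambda>x. exp (- Re c * x)) integrable_on {0..}"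
   using has_integral_exp_minus_to_infinity[OF c, of 0] by (auto simp: integrable_on_def)
  then have "(\<lambda>x. exp (- Re c * x)) absolutely_integrable_on {0..}"
   by (intro nonnegative_absolutely_integrable_1) auto
  then have "integrable lebesgue (\<lambda>x. indicator {0..} x * exp (- Re c * x))" by (simp add: set_integrable_def)
  then show ?thesis by (subst (asm) integrable_completion) auto
 qed
 have m: "(\<lambda>x. exp (- c * complex_of_real x)) \<in> borel_fun"
  by (intro borel_measurable_continuous_onI continuous_intros)
 then show int: "integrable lborel (\<lambda>x. of_real (indicator {0..} x) * exp (- c * of_real x))"
  by (intro lint_bound[OF int0]) (auto simp: norm_mult)
 have "(LBINT x=ereal 0..\<infinity>. exp (- c * complex_of_real x)) = 0 - (- (1 / c))"
 proof (rule interval_integral_FTC_integrable)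
  show "((\<lambda>x. - (exp (- c * complex_of_real x) / c)) has_vector_derivative exp (- c * complex_of_real x)) (at x)" for x
  proof -
   have "((\<lambda>z. - (exp (- c * z) / c)) has_field_derivative exp (- c * of_real x)) (at (of_real x))"
    using c by (auto intro!: derivative_eq_intros simp: field_simps)
   then show ?thesis by (rule has_vector_derivative_real_field)
  qed
  show "set_integrable lborel (einterval (ereal 0) \<infinity>) (\<lambda>x. exp (- c * complex_of_real x))"
   unfolding set_integrable_def
   by (rule lint_bound[OF int]) (use m in \<open>auto simp: indicator_def einterval_def\<close>)
  show "(((\<lambda>x. - (exp (- c * complex_of_real x) / c)) \<circ> real_of_ereal) \<longlongrightarrow> - (1 / c)) (at_right (ereal 0))"
   unfolding ereal_tendsto_simps by (rule tendsto_eq_intros refl tendsto_ident_at | use c in auto)+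
  have "((\<lambda>x. exp (- Re c * x)) \<longlongrightarrow> 0) at_top"
   using c by real_asymp
  then have "((\<lambda>x. exp (- c * complex_of_real x)) \<longlongrightarrow> 0) at_top"
   unfolding n[symmetric] by (rule tendsto_norm_zero_cancel)
  from tendsto_minus[OF tendsto_divide_zero[OF this, of c]]
  show "(((\<lambda>x. - (exp (- c * complex_of_real x) / c)) \<circ> real_of_ereal) \<longlongrightarrow> 0) (at_left \<infinity>)"
   unfolding ereal_tendsto_simps by simp
 qed (auto intro!: continuous_intros)
 then have "(LBINT x:{0<..}. exp (- c * complex_of_real x)) = 1 / c"
  by (simp add: interval_lebesgue_integral_0_infty zero_ereal_def[symmetric])
 moreover have "(LBINT x:{0<..}. exp (- c * complex_of_real x)) = (\<integral>x. of_real (indicator {0..} x) * exp (- c * of_real x) \<partial>lborel)"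
  unfolding set_lebesgue_integral_def
 proof (rule integral_cong_AE)
  show "AE x in lborel. indicat_real {0<..} x *\<^sub>R exp (- c * complex_of_real x) = of_real (indicator {0..} x) * exp (- c * of_real x)"
   using AE_lborel_singleton[of "0::real"] by eventually_elim (auto simp: indicator_def)
 qed (use m in measurable)
 ultimately show "(\<integral>x. of_real (indicator {0..} x) * exp (- c * of_real x) \<partial>lborel) = 1 / c" by simp
qed

text \<open>Both halves of a Mellin integral folded onto the half-line by a functional equation with exponent \<kappa>; for rapidly decreasing G it is entire in s.\<close>
definition mellin_half :: "real => (real => real) => complex => complex" where
 "mellin_half \<kappa> G s = (\<integral>x. of_real (indicator {0..} x * G x) * (exp (s * of_real x) + exp ((of_real \<kappa> - s) * of_real x)) \<partial>lborel)"

lemma mellin_half_bound: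
 fixes G :: "real => real" and s :: complex
 assumes G: "\<And>x. x >= 0 ==> \<bar>G x\<bar> <= C * exp (- A * x)" and A: "\<bar>Re s\<bar> + \<bar>\<kappa>\<bar> + 1 <= A"
 shows "norm (of_real (indicator {0..} x * G x) * (exp (s * of_real x) + exp ((of_real \<kappa> - s) * of_real x)))
   <= 2 * C * (indicator {0..} x * exp (- x))"
proof (cases "x >= 0")
 case True
 have "norm (exp (s * of_real x) + exp ((of_real \<kappa> - s) * complex_of_real x)) <= exp (Re s * x) + exp ((\<kappa> - Re s) * x)"
  by (rule order.trans[OF norm_triangle_ineq]) simp
 also have "... <= exp ((A - 1) * x) + exp ((A - 1) * x)"
  using True A by (intro add_mono) (auto intro!: mult_right_mono)
 finally have "\<bar>G x\<bar> * norm (exp (s * of_real x) + exp ((of_real \<kappa> - s) * complex_of_real x)) <= (C * exp (- A * x)) * (2 * exp ((A - 1) * x))"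
  using G[OF True] by (intro mult_mono) (auto intro: order.trans[OF abs_ge_zero])
 also have "... = 2 * C * exp (- x)" by (simp add: exp_add[symmetric] algebra_simps)
 finally show ?thesis using True by (simp add: norm_mult)
qed simp

lemma mellin_half_holomorphic:
 assumes Gm: "G \<in> borel_fun"
  and G: "\<And>A. \<exists>C. \<forall>x\<ge>0. \<bar>G x\<bar> <= C * exp (- A * x)"
 shows "mellin_half \<kappa> G holomorphic_on UNIV"
 unfolding mellin_half_def
proof (rule holomorphic_on_lebesgue_integral)
 note [measurable] = Gm
 show "(\<lambda>x. complex_of_real (indicator {0..} x * G x) * (exp (s * of_real x) + exp ((of_real \<kappa> - s) * of_real x))) \<in> borel_measurable lborel" for s :: complex
 proof -
  have [measurable]: "(\<lambda>x. exp (s * complex_of_real x)) \<in> borel_fun" "(\<lambda>x. exp ((of_real \<kappa> - s) * complex_of_real x)) \<in> borel_fun"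
   by (intro borel_measurable_continuous_onI continuous_intros)+
  show ?thesis by measurable
 qed
 show "\<exists>r>0. \<exists>g. integrable lborel g \<and> cball s r \<subseteq> UNIV \<and> (\<forall>w\<in>cball s r. \<forall>x\<in>space lborel.
  cmod (of_real (indicator {0..} x * G x) * (exp (w * of_real x) + exp ((of_real \<kappa> - w) * of_real x))) <= g x)" for s :: complex
 proof -
  obtain C where C: "\<And>x. x >= 0 ==> \<bar>G x\<bar> <= C * exp (- (\<bar>Re s\<bar> + \<bar>\<kappa>\<bar> + 2) * x)"
   using G[of "\<bar>Re s\<bar> + \<bar>\<kappa>\<bar> + 2"] by auto
  have "integrable lborel (\<lambda>x. 2 * C * (indicator {0..} x * exp (- x)))"
   using integrable_norm[OF exp_half_line(1)[of 1]] by (simp add: norm_mult)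
  moreover have "\<bar>Re w\<bar> + \<bar>\<kappa>\<bar> + 1 <= \<bar>Re s\<bar> + \<bar>\<kappa>\<bar> + 2" if "w \<in> cball s 1" for w
   using that abs_Re_le_cmod[of "s - w"] by (simp add: dist_norm)
  ultimately show ?thesis
   using mellin_half_bound[OF C] by (intro exI[of _ 1] conjI exI[of _ "\<lambda>x. 2 * C * (indicator {0..} x * exp (- x))"]) auto
 qed
qed (intro holomorphic_intros)

text \<open>Riemann's argument: the functional equation turns the negative half-line into the positive one, and its two elementary terms integrate to the polar terms.\<close>
lemma mellin_half_eq:
 assumes Gm: "G \<in> borel_fun"
  and G: "\<And>A. \<exists>C. \<forall>x\<ge>0. \<bar>G x\<bar> <= C * exp (- A * x)"
  and fe: "\<And>x. G (- x) = exp (\<kappa> * x) * G x + exp (\<kappa> * x) - 1"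
  and \<kappa>: "\<kappa> > 0" and s: "Re s > \<kappa>"
  and int: "integrable lborel (\<lambda>x. of_real (G x) * exp (s * of_real x))"
 shows "(\<integral>x. of_real (G x) * exp (s * of_real x) \<partial>lborel) = mellin_half \<kappa> G s + 1 / (s - of_real \<kappa>) - 1 / s"
proof -
 note [measurable] = Gm
 have [measurable]: "(\<lambda>x. exp (w * complex_of_real x)) \<in> borel_fun" for w
  by (intro borel_measurable_continuous_onI continuous_intros)
 define F where "F x = complex_of_real (G x) * exp (s * of_real x)" for x
 define P where "P w x = complex_of_real (indicator {0..} x * G x) * exp (w * of_real x)" for w and x :: real
 have Pint: "integrable lborel (P w)" for w
 proof -
  obtain C where C: "\<And>x. x >= 0 ==> \<bar>G x\<bar> <= C * exp (- (\<bar>Re w\<bar> + 1) * x)"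
   using G[of "\<bar>Re w\<bar> + 1"] by auto
  have "integrable lborel (\<lambda>x. C * (indicator {0..} x * exp (- x)))"
   using integrable_norm[OF exp_half_line(1)[of 1]] by (simp add: norm_mult)
  then show ?thesis
  proof (rule lint_bound)
   show "AE x in lborel. norm (P w x) <= norm (C * (indicator {0..} x * exp (- x)))"
   proof (intro AE_I2)
    fix x
    show "norm (P w x) <= norm (C * (indicator {0..} x * exp (- x)))"
    proof (cases "x >= 0")
     case True
     have "\<bar>G x\<bar> * exp (Re w * x) <= (C * exp (- (\<bar>Re w\<bar> + 1) * x)) * exp (\<bar>Re w\<bar> * x)"
      using C[OF True] True by (intro mult_mono) (auto intro!: mult_right_mono intro: order.trans[OF abs_ge_zero])
     also have "... = C * exp (- x)" by (simp add: exp_add[symmetric] algebra_simps)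
     also have "... <= \<bar>C\<bar> * exp (- x)" by (intro mult_right_mono) auto
     finally show ?thesis using True by (simp add: P_def norm_mult abs_mult)
    qed (simp add: P_def)
   qed
  qed (unfold P_def, measurable)
 qed
 have "(\<integral>x. F x \<partial>lborel) = (\<integral>x. indicator {0..} x *\<^sub>R F x + indicator {..<0} x *\<^sub>R F x \<partial>lborel)"
  by (intro lint_cong) (auto simp: indicator_def)
 also have "... = (\<integral>x. indicator {0..} x *\<^sub>R F x \<partial>lborel) + (\<integral>x. indicator {..<0} x *\<^sub>R F x \<partial>lborel)"
  using int by (intro Bochner_Integration.integral_add integrable_mult_indicator) (auto simp: F_def)
 also have "(\<integral>x. indicator {0..} x *\<^sub>R F x \<partial>lborel) = (\<integral>x. P s x \<partial>lborel)"
  by (intro lint_cong) (auto simp: F_def P_def indicator_def)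
 also have "(\<integral>x. indicator {..<0} x *\<^sub>R F x \<partial>lborel) = \<bar>-1\<bar> *\<^sub>R (\<integral>x. indicator {..<0} (0 + (-1) * x) *\<^sub>R F (0 + (-1) * x) \<partial>lborel)"
  by (rule lborel_integral_real_affine) simp
 also have "... = (\<integral>x. P (of_real \<kappa> - s) x + (of_real (indicator {0..} x) * exp (- (s - of_real \<kappa>) * of_real x) - of_real (indicator {0..} x) * exp (- s * of_real x)) \<partial>lborel)"
  unfolding abs_minus abs_one scaleR_one
 proof (rule integral_cong_AE)
  show "AE x in lborel. indicator {..<0} (0 + (-1) * x) *\<^sub>R F (0 + (-1) * x) = P (of_real \<kappa> - s) x + (of_real (indicator {0..} x) * exp (- (s - of_real \<kappa>) * of_real x) - of_real (indicator {0..} x) * exp (- s * of_real x))"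
   using AE_lborel_singleton[of "0::real"]
  proof eventually_elim
   case (elim x)
   show ?case
   proof (cases "x > 0")
    case True
    have "F (- x) = (of_real (exp (\<kappa> * x)) * of_real (G x) + of_real (exp (\<kappa> * x)) - 1) * exp (- s * of_real x)"
     unfolding F_def fe by simp
    also have "... = of_real (G x) * exp ((of_real \<kappa> - s) * of_real x) + (exp (- (s - of_real \<kappa>) * of_real x) - exp (- s * of_real x))"
     by (simp add: exp_of_real[symmetric] algebra_simps exp_add exp_diff exp_minus divide_inverse)
    finally show ?thesis using True by (simp add: P_def indicator_def)
   qed (use elim in \<open>auto simp: P_def indicator_def\<close>)
  qed
 qed (simp_all add: F_def P_def)
 also have "... = (\<integral>x. P (of_real \<kappa> - s) x \<partial>lborel) + (1 / (s - of_real \<kappa>) - 1 / s)"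
  using Pint exp_half_line[of "s - of_real \<kappa>"] exp_half_line[of s] s \<kappa> 
  by (subst Bochner_Integration.integral_add; (subst Bochner_Integration.integral_diff)?) (auto intro!: Bochner_Integration.integrable_diff)
 finally have "(\<integral>x. F x \<partial>lborel) = (\<integral>x. P s x \<partial>lborel) + (\<integral>x. P (of_real \<kappa> - s) x \<partial>lborel) + (1 / (s - of_real \<kappa>) - 1 / s)"
  by simp
 also have "(\<integral>x. P s x \<partial>lborel) + (\<integral>x. P (of_real \<kappa> - s) x \<partial>lborel) = (\<integral>x. P s x + P (of_real \<kappa> - s) x \<partial>lborel)"
  using Pint by simp
 also have "... = mellin_half \<kappa> G s"
  unfolding mellin_half_def P_def by (simp add: distrib_left)
 finally show ?thesis by (simp add: F_def)
qed

section \<open>Poisson summation and functional equations\<close>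

lemma summable_on_int_gauss:
 assumes a: "a > (0::real)"
 shows "(\<lambda>n::int. exp (- (a * (of_int n)\<^sup>2))) summable_on (UNIV :: int set)"
proof -
 define C where "C = 2 * max 1 (1 / a)"
 have "(\<lambda>n::int. C * (1 + \<bar>real_of_int n\<bar>) powr (- 2)) summable_on UNIV"
  by (intro summable_on_cmult_right summable_on_int_powr) auto
 then show ?thesis
 proof (rule summable_on_comparison_test)
  fix n :: int
  define m where "m = \<bar>real_of_int n\<bar>"
  have m: "m >= 0" "m\<^sup>2 = (of_int n)\<^sup>2" by (auto simp: m_def)
  have C: "C >= 2" "C * a >= 2" using a by (auto simp: C_def max_def field_simps)
  have "(1 + m)\<^sup>2 <= 2 * 1 + 2 * m\<^sup>2"
   using sum_squares_bound[of 1 m] by (simp add: power2_eq_square algebra_simps)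
  also have "... <= C * 1 + (C * a) * m\<^sup>2"
   using C by (intro add_mono mult_right_mono) auto
  also have "... = C * (1 + a * m\<^sup>2)" by (simp add: algebra_simps)
  also have "... <= C * exp (a * m\<^sup>2)"
   using C exp_ge_add_one_self[of "a * m\<^sup>2"] by (intro mult_left_mono) auto
  finally have "exp (- (a * m\<^sup>2)) <= C * inverse ((1 + m)\<^sup>2)"
   using m by (simp add: exp_minus field_simps)
  also have "inverse ((1 + m)\<^sup>2) = (1 + m) powr (- 2)"
   using m by (simp add: powr_minus)
  finally show "exp (- (a * (of_int n)\<^sup>2)) <= C * (1 + \<bar>real_of_int n\<bar>) powr (- 2)"
   by (simp add: m_def)
 qed auto
qed

text \<open>Both sides are continuous periodic functions of x with the same Fourier coefficients.\<close>
lemma gaussian_poisson: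
 assumes u: "u > 0"
 shows "complex_of_real (\<Sum>\<^sub>\<infinity>n::int. exp (- (pi * u * (x + of_int n)\<^sup>2)))
  = (\<Sum>\<^sub>\<infinity>k::int. of_real (exp (- (pi * (of_int k)\<^sup>2 / u)) / sqrt u) * cis (2 * pi * of_int k * x))"
proof -
 define F where "F x = complex_of_real (exp (- (pi * u * x\<^sup>2)))" for x
 define f where "f x = (\<Sum>\<^sub>\<infinity>n::int. F (x + of_int n))" for x
 define c where "c k = complex_of_real (exp (- (pi * (of_int k)\<^sup>2 / u)) / sqrt u)" for k :: int
 define g where "g x = (\<Sum>\<^sub>\<infinity>k::int. c k * cis (2 * pi * of_int k * x))" for x
 have Fle: "norm (F (x + of_int n)) <= exp (pi * u * R\<^sup>2) * exp (- (pi * u / 2 * (of_int n)\<^sup>2))" 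
  if "\<bar>x\<bar> <= R" for x R and n :: int
 proof -
  have "x\<^sup>2 <= R\<^sup>2" using that by (metis abs_ge_zero power2_abs power_mono)
  moreover have "(of_int n)\<^sup>2 / 2 <= (x + of_int n)\<^sup>2 + x\<^sup>2"
   using sum_squares_bound[of "x + of_int n" "- x"] zero_le_power2[of "x + of_int n + x"]
   by (simp add: power2_eq_square algebra_simps)
  ultimately have "(of_int n)\<^sup>2 / 2 - R\<^sup>2 <= (x + of_int n)\<^sup>2" by linarith
  then have "pi * u * ((of_int n)\<^sup>2 / 2 - R\<^sup>2) <= pi * u * (x + of_int n)\<^sup>2"
   using u by (intro mult_left_mono) auto
  then show ?thesis by (simp add: F_def exp_add[symmetric] algebra_simps)
 qed
 have smF: "(\<lambda>n::int. exp (pi * u * R\<^sup>2) * exp (- (pi * u / 2 * (of_int n)\<^sup>2))) summable_on UNIV" for R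
  by (intro summable_on_cmult_right summable_on_int_gauss) (use u in auto)
 have smFx: "(\<lambda>n::int. norm (F (x + of_int n))) summable_on UNIV" for x
  by (rule summable_on_comparison_test[OF smF[of "\<bar>x\<bar>"]]) (use Fle[of x "\<bar>x\<bar>"] in auto)
 have near: "\<forall>\<^sub>F y in at x. \<bar>y\<bar> <= \<bar>x\<bar> + 1" for x :: real
 proof -
  have "\<forall>\<^sub>F y in at x. dist y x < 1"
   using eventually_at_ball'[of 1 x UNIV] by (auto simp: dist_commute elim!: eventually_mono)
  then show ?thesis by eventually_elim (auto simp: dist_real_def)
 qed
 have fc: "continuous_on UNIV f"
 proof -
  have "isCont f x" for x
   unfolding isCont_def f_def
  proof (rule infsum_tendsto_dominated[OF _ smF[of "\<bar>x\<bar> + 1"]])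
   show "((\<lambda>y. F (y + of_int n)) \<longlongrightarrow> F (x + of_int n)) (at x)" for n
    unfolding F_def by (intro tendsto_intros)
   show "\<forall>\<^sub>F y in at x. \<forall>n\<in>UNIV. norm (F (y + of_int n)) <= exp (pi * u * (\<bar>x\<bar> + 1)\<^sup>2) * exp (- (pi * u / 2 * (of_int n)\<^sup>2))"
    using near[of x] by eventually_elim (use Fle in auto)
  qed auto
  then show ?thesis by (simp add: continuous_on_eq_continuous_at)
 qed
 have fper: "f (x + 1) = f x" for x
  unfolding f_def by (rule infsum_reindex_bij_witness[of _ "\<lambda>n. n - 1" "\<lambda>n. n + 1"]) (auto simp: algebra_simps)
 have fco: "fcoeff f k = c k" for k
 proof -
  have "integrable lborel F"
   unfolding F_def using gaussian_fourier(2)[OF u] by simp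
  then have "fcoeff f k = (\<integral>x. F x * char_neg k x \<partial>lborel)"
   unfolding f_def using smFx by (intro fcoeff_periodization(1))
  also have "... = c k"
   unfolding F_def c_def by (rule gaussian_fourier(1)[OF u])
  finally show ?thesis .
 qed
 have smc: "(\<lambda>k. norm (c k)) summable_on UNIV"
 proof -
  have "(\<lambda>k::int. exp (- ((pi / u) * (of_int k)\<^sup>2)) * (1 / sqrt u)) summable_on UNIV"
   by (intro summable_on_cmult_left summable_on_int_gauss) (use u in auto)
  then show ?thesis using u by (simp add: c_def norm_divide)
 qed
 have gc: "continuous_on UNIV g"
 proof -
  have "isCont g x" for x
   unfolding isCont_def g_def
  proof (rule infsum_tendsto_dominated[OF _ smc])
   show "((\<lambda>y. c k * cis (2 * pi * of_int k * y)) \<longlongrightarrow> c k * cis (2 * pi * of_int k * x)) (at x)" for k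
   proof -
    have "continuous_on UNIV (\<lambda>y. c k * cis (2 * pi * of_int k * y))" by (intro continuous_intros)
    then show ?thesis by (simp add: continuous_on_eq_continuous_at isCont_def)
   qed
  qed (auto simp: norm_mult)
  then show ?thesis by (simp add: continuous_on_eq_continuous_at)
 qed
 have cisint: "cis (2 * pi * of_int k) = 1" for k :: int by (rule cis_multiple_2pi) auto
 have gper: "g (x + 1) = g x" for x
  unfolding g_def by (intro infsum_cong) (simp add: distrib_left cis_mult[symmetric] cisint)
 have gco: "fcoeff g k = c k" for k
 proof -
  have cc: "c j * cis (2 * pi * of_int j * x) * char_neg k x = c j * cis (2 * pi * of_int (j - k) * x)" for j x
   by (simp add: mult.assoc cis_mult algebra_simps)
  have "((\<lambda>j. \<integral>x. c j * cis (2 * pi * of_int (j - k) * x) \<partial>unit_leb) has_sum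
    (\<integral>x. (\<Sum>\<^sub>\<infinity>j. c j * cis (2 * pi * of_int (j - k) * x)) \<partial>unit_leb)) UNIV"
  proof (rule has_sum_integral(2))
   show "integrable unit_leb (\<lambda>x. c j * cis (2 * pi * of_int (j - k) * x))" for j
    by (intro integrable_unit_leb_continuous continuous_intros)
   show "(\<lambda>j. \<integral>x. norm (c j * cis (2 * pi * of_int (j - k) * x)) \<partial>unit_leb) summable_on UNIV"
    using smc by (simp add: norm_mult measure_def)
  qed (use smc in \<open>auto simp: norm_mult\<close>)
  moreover have "(\<integral>x. c j * cis (2 * pi * of_int (j - k) * x) \<partial>unit_leb) = (if j = k then c k else 0)" for j
   using integral_cis_int[of "j - k"] by auto
  moreover have "((\<lambda>j. if j = k then c k else 0) has_sum c k) UNIV"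
   using has_sum_finite_neutralI[of "{k}" UNIV "\<lambda>j. if j = k then c k else 0" "c k"] by auto
  ultimately have "(\<integral>x. (\<Sum>\<^sub>\<infinity>j. c j * cis (2 * pi * of_int (j - k) * x)) \<partial>unit_leb) = c k"
   using has_sum_unique by fastforce
  then show ?thesis
   unfolding fcoeff_def g_def by (simp add: infsum_cmult_left'[symmetric] cc)
 qed
 have "f = g" by (rule fourier_unique[OF fc fper gc gper]) (simp add: fco gco)
 moreover have "f x = complex_of_real (\<Sum>\<^sub>\<infinity>n::int. exp (- (pi * u * (x + of_int n)\<^sup>2)))"
 proof -
  have "(\<lambda>n::int. exp (- (pi * u * (x + of_int n)\<^sup>2))) summable_on UNIV"
   using smFx[of x] by (simp add: F_def)
  from has_sum_of_real[OF has_sum_infsum[OF this], where 'a = complex] show ?thesis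
   unfolding f_def F_def by (rule infsumI)
 qed
 ultimately show ?thesis by (metis (no_types, lifting) c_def g_def infsum_cong)
qed

lemma sqrt_exp: "sqrt (exp t) = exp (t / 2)"
 by (rule real_sqrt_unique) (simp_all add: power2_eq_square exp_add[symmetric])

abbreviation theta1 :: "real => real" where
 "theta1 \<equiv> theta (\<lambda>n::int. (of_int n)\<^sup>2) (UNIV - {0})"

lemma theta1_summable:
 assumes "\<sigma> > (1 / 2 :: real)"
 shows "(\<lambda>n::int. ((real_of_int n)\<^sup>2) powr (- \<sigma>)) summable_on (UNIV - {0})"
proof -
 have "(\<lambda>n::int. 2 powr (2 * \<sigma>) * (1 + \<bar>real_of_int n\<bar>) powr (- (2 * \<sigma>))) summable_on UNIV"
  by (intro summable_on_cmult_right summable_on_int_powr) (use assms in auto)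
 then have "(\<lambda>n::int. 2 powr (2 * \<sigma>) * (1 + \<bar>real_of_int n\<bar>) powr (- (2 * \<sigma>))) summable_on (UNIV - {0})"
  by (rule summable_on_subset_banach) auto
 then show ?thesis
 proof (rule summable_on_comparison_test)
  fix n :: int assume n: "n \<in> UNIV - {0}"
  define m where "m = \<bar>real_of_int n\<bar>"
  have m: "m >= 1" using n by (simp add: m_def)
  have "((real_of_int n)\<^sup>2) powr (- \<sigma>) = m powr (- (2 * \<sigma>))"
  proof -
   have "((of_int n)\<^sup>2 :: real) = m powr 2" using m by (simp add: m_def powr_numeral)
   then show ?thesis by (simp add: powr_powr)
  qed
  also have "... <= ((1 + m) / 2) powr (- (2 * \<sigma>))"
   using m assms by (intro powr_mono2') auto
  also have "... = 2 powr (2 * \<sigma>) * (1 + m) powr (- (2 * \<sigma>))"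
   using m by (simp add: powr_divide powr_minus field_simps)
  finally show "((real_of_int n)\<^sup>2) powr (- \<sigma>) <= 2 powr (2 * \<sigma>) * (1 + \<bar>real_of_int n\<bar>) powr (- (2 * \<sigma>))"
   by (simp add: m_def)
 qed auto
qed

lemma theta1_sum: "(\<Sum>\<^sub>\<infinity>n::int. exp (- (pi * exp t * (of_int n)\<^sup>2))) = 1 + theta1 t"
proof -
 have "(\<lambda>n::int. exp (- (pi * (of_int n)\<^sup>2 * exp t))) summable_on (UNIV - {0})"
  by (rule theta_bound(1)[of _ _ 1]) (use theta1_summable[of 1] in \<open>simp_all add: less_imp_neq\<close>)
 then have "(\<lambda>n::int. exp (- (pi * exp t * (of_int n)\<^sup>2))) summable_on (UNIV - {0})"
  by (simp add: mult_ac)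
 from infsum_insert[OF this, of 0] show ?thesis by (simp add: theta_def mult_ac insert_absorb)
qed

lemma theta1_functional: "theta1 (- t) = exp (1 / 2 * t) * theta1 t + exp (1 / 2 * t) - 1"
proof -
 have "complex_of_real (1 + theta1 t) = (\<Sum>\<^sub>\<infinity>k::int. of_real (exp (- (pi * (of_int k)\<^sup>2 / exp t)) / sqrt (exp t)) * cis (2 * pi * of_int k * 0))"
  using gaussian_poisson[of "exp t" 0] by (simp add: theta1_sum)
 also have "... = (\<Sum>\<^sub>\<infinity>k::int. of_real (exp (- (t / 2)) * exp (- (pi * exp (- t) * (of_int k)\<^sup>2))))"
  by (intro infsum_cong) (simp add: sqrt_exp exp_minus field_simps)
 also have "... = of_real (exp (- (t / 2)) * (1 + theta1 (- t)))"
 proof -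
  have "(\<lambda>k::int. exp (- (pi * exp (- t) * (of_int k)\<^sup>2))) summable_on UNIV"
   using summable_on_int_gauss[of "pi * exp (- t)"] by simp
  then have "((\<lambda>k::int. exp (- (t / 2)) * exp (- (pi * exp (- t) * (of_int k)\<^sup>2))) has_sum exp (- (t / 2)) * (1 + theta1 (- t))) UNIV"
   unfolding theta1_sum[symmetric] by (intro has_sum_cmult_right has_sum_infsum)
  from has_sum_of_real[OF this, where 'a = complex] show ?thesis by (rule infsumI)
 qed
 finally have "1 + theta1 t = exp (- (t / 2)) * (1 + theta1 (- t))" by (simp only: of_real_eq_iff)
 then have "1 + theta1 (- t) = exp (t / 2) * (1 + theta1 t)" by (simp add: exp_minus field_simps)
 then show ?thesis by (simp add: algebra_simps)
qed

text \<open>The nonzero lattice vectors, which index the full theta series and the series without coprimality condition.\<close>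
definition lat :: "(int \<times> int) set" where "lat = UNIV - {(0, 0)}"

text \<open>The positive definite binary form of discriminant -4 attached to z; equivalently 1 / Im (\<gamma> z) for a matrix \<gamma> with lower row v.\<close>
definition qform :: "complex => int \<times> int => real" where
 "qform z v = (norm (of_int (fst v) * z + of_int (snd v)))\<^sup>2 / Im z"

text \<open>A product comparison function: sums over lattice vectors of its powers factor into sums over integers.\<close>
definition lsize :: "int \<times> int => real" where
 "lsize v = (1 + \<bar>of_int (fst v)\<bar>) * (1 + \<bar>of_int (snd v)\<bar>)"

text \<open>A valid comparison constant between the two sizes for Im z >= a and norm z <= R.\<close>
definition lconst :: "real => real => real" where
 "lconst a R = 4 * (2 + (2 * R\<^sup>2 + 1) / a\<^sup>2) * R"

lemma norm_lattice_sq: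
 "(norm (of_int m * z + of_int n))\<^sup>2 = (of_int m * Re z + of_int n)\<^sup>2 + (of_int m)\<^sup>2 * (Im z)\<^sup>2"
 unfolding cmod_power2 by (simp add: power_mult_distrib)

lemma lsize_le_qform:
 assumes a: "a > 0" "Im z >= a" "norm z <= R" and v: "v \<in> lat"
 shows "lsize v <= lconst a R * qform z v" "qform z v > 0" "lsize v >= 1" "lconst a R > 0"
proof -
 obtain m n where mn: "v = (m, n)" by (cases v)
 define M N where "M = \<bar>real_of_int m\<bar>" and "N = \<bar>real_of_int n\<bar>"
 define x y where "x = Re z" and "y = Im z"
 have y: "y >= a" "y > 0" "y <= R" and x: "x\<^sup>2 <= R\<^sup>2"
  using a abs_Im_le_cmod[of z] abs_Re_le_cmod[of z] power_mono[of "\<bar>Re z\<bar>" R 2] by (auto simp: x_def y_def)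
 have R: "R > 0" using y by linarith
 have MN: "M >= 0" "N >= 0" "max M N >= 1" "M\<^sup>2 = (of_int m)\<^sup>2" "N\<^sup>2 = (of_int n)\<^sup>2"
  using v by (auto simp: M_def N_def lat_def mn)
 show K: "lconst a R > 0" using a R by (auto simp: lconst_def intro!: mult_pos_pos add_pos_nonneg divide_nonneg_pos)
 have "1 * 1 <= (1 + M) * (1 + N)"
  using MN by (intro mult_mono) auto
 then show "lsize v >= 1" by (simp add: lsize_def mn M_def N_def)
 define w where "w = (of_int m * x + of_int n)\<^sup>2 + (of_int m)\<^sup>2 * y\<^sup>2"
 have qf: "qform z v = w / y"
  unfolding qform_def mn w_def x_def y_def by (simp add: norm_lattice_sq)
 have "(1 + M) * (1 + N) <= (2 * max M N) * (2 * max M N)"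
  using MN by (intro mult_mono) auto
 also have "... = 4 * (max M N)\<^sup>2" by (simp add: power2_eq_square)
 also have "... <= 4 * (M\<^sup>2 + N\<^sup>2)" by (auto simp: max_def)
 also have "M\<^sup>2 + N\<^sup>2 <= (2 + (2 * R\<^sup>2 + 1) / a\<^sup>2) * w"
 proof -
  have "N\<^sup>2 <= 2 * (of_int m * x + of_int n)\<^sup>2 + 2 * (M\<^sup>2 * x\<^sup>2)"
   unfolding MN using zero_le_power2[of "(of_int m * x + of_int n) + of_int m * x"]
   by (simp add: power2_eq_square algebra_simps)
  also have "M\<^sup>2 * x\<^sup>2 <= M\<^sup>2 * R\<^sup>2" using x by (intro mult_left_mono) auto
  finally have "M\<^sup>2 + N\<^sup>2 <= 2 * (of_int m * x + of_int n)\<^sup>2 + (2 * R\<^sup>2 + 1) * M\<^sup>2"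
   by (simp add: algebra_simps)
  also have "M\<^sup>2 <= M\<^sup>2 * y\<^sup>2 / a\<^sup>2"
  proof -
   have "M\<^sup>2 * a\<^sup>2 <= M\<^sup>2 * y\<^sup>2" using y a by (intro mult_left_mono power_mono) auto
   then show ?thesis using a by (simp add: field_simps)
  qed
  finally have "M\<^sup>2 + N\<^sup>2 <= 2 * (of_int m * x + of_int n)\<^sup>2 + (2 * R\<^sup>2 + 1) * (M\<^sup>2 * y\<^sup>2 / a\<^sup>2)"
   by (simp add: mult_left_mono add_left_mono)
  also have "... = 2 * (of_int m * x + of_int n)\<^sup>2 + (2 * R\<^sup>2 + 1) / a\<^sup>2 * (M\<^sup>2 * y\<^sup>2)"
   by simp
  also have "... <= 2 * w + (2 * R\<^sup>2 + 1) / a\<^sup>2 * w"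
   unfolding w_def MN(4)[symmetric] by (intro add_mono mult_left_mono) (auto simp: MN)
  finally show ?thesis by (simp add: distrib_right)
 qed
 finally have 1: "(1 + M) * (1 + N) <= 4 * (2 + (2 * R\<^sup>2 + 1) / a\<^sup>2) * w" by (simp only: mult.assoc)
 have "(1 + M) * (1 + N) > 0" using MN by (intro mult_pos_pos) auto
 moreover have "4 * (2 + (2 * R\<^sup>2 + 1) / a\<^sup>2) > 0"
  using a by (auto intro!: add_pos_nonneg divide_nonneg_pos)
 ultimately have w: "w > 0" using 1 zero_less_mult_pos by (metis less_le_trans)
 then show "qform z v > 0" using y by (simp add: qf)
 have "4 * (2 + (2 * R\<^sup>2 + 1) / a\<^sup>2) * w <= 4 * (2 + (2 * R\<^sup>2 + 1) / a\<^sup>2) * (R * (w / y))"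
  using w y \<open>4 * (2 + (2 * R\<^sup>2 + 1) / a\<^sup>2) > 0\<close> by (intro mult_left_mono) (auto simp: field_simps)
 moreover have "lconst a R * qform z v = 4 * (2 + (2 * R\<^sup>2 + 1) / a\<^sup>2) * (R * (w / y))"
  by (simp only: lconst_def qf mult.assoc)
 moreover have "lsize v = (1 + M) * (1 + N)" by (simp add: lsize_def mn M_def N_def)
 ultimately show "lsize v <= lconst a R * qform z v"
  using 1 by linarith
qed

lemma lsize_summable:
 assumes "\<sigma> > 1"
 shows "(\<lambda>v. lsize v powr (- \<sigma>)) summable_on UNIV"
proof -
 have "(\<lambda>(m, n). (1 + \<bar>real_of_int m\<bar>) powr (- \<sigma>) * (1 + \<bar>real_of_int n\<bar>) powr (- \<sigma>)) summable_on (UNIV \<times> UNIV)"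
  by (intro summable_on_product_real summable_on_int_powr assms) auto
 then show ?thesis by (simp add: lsize_def powr_mult split_beta')
qed

lemma qform_powr_le:
 assumes a: "a > 0" "Im z >= a" "norm z <= R" and v: "v \<in> lat" and \<sigma>: "\<sigma> >= 0"
 shows "qform z v powr (- \<sigma>) <= lconst a R powr \<sigma> * lsize v powr (- \<sigma>)"
proof -
 note * = lsize_le_qform[OF a v]
 have "qform z v powr (- \<sigma>) <= (lsize v / lconst a R) powr (- \<sigma>)"
  using * \<sigma> by (intro powr_mono2') (auto simp: field_simps)
 also have "... = lconst a R powr \<sigma> * lsize v powr (- \<sigma>)"
  using * by (simp add: powr_divide powr_minus field_simps)
 finally show ?thesis .
qed

lemma qform_summable:
 assumes "Im z > 0" "\<sigma> > 1"
 shows "(\<lambda>v. qform z v powr (- \<sigma>)) summable_on lat"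
proof -
 have "(\<lambda>v. lconst (Im z) (norm z) powr \<sigma> * lsize v powr (- \<sigma>)) summable_on lat"
  using assms by (intro summable_on_cmult_right summable_on_subset_banach[OF lsize_summable]) auto
 then show ?thesis by (rule summable_on_comparison_test) (use qform_powr_le[of "Im z" z "norm z"] assms in auto)
qed

abbreviation theta2 :: "complex => real => real" where
 "theta2 z \<equiv> theta (qform z) lat"

abbreviation gauss_pair :: "real => real => int => int => real" where
  "gauss_pair y t m k \<equiv> exp (- (pi * y * exp t * (of_int m)\<^sup>2)) * exp (- (pi * y * exp (- t) * (of_int k)\<^sup>2))"

text \<open>Poisson summation is applied in the second coordinate only. Together with the sum over the first coordinate this gives a double series that is unchanged when t is replaced by -t and the two summation variables are exchanged.\<close>
lemma theta2_functional:
 assumes z: "Im z > 0"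
 shows "theta2 z (- t) = exp t * theta2 z t + exp t - 1"
proof -
 define x y where "x = Re z" and "y = Im z"
 have y: "y > 0" using z by (simp add: y_def)
 define T where "T t = (\<Sum>\<^sub>\<infinity>m::int. \<Sum>\<^sub>\<infinity>k::int. complex_of_real (gauss_pair y t m k) * cis (2 * pi * of_int k * (of_int m * x)))" for t
 have Tsum: "(\<lambda>(m, k). complex_of_real (gauss_pair y t m k) * cis (2 * pi * of_int k * (of_int m * x)))
   summable_on (UNIV \<times> UNIV :: (int \<times> int) set)" for t
 proof (rule abs_summable_summable)
  have "(\<lambda>(m, k). exp (- (pi * y * exp t * (of_int m)\<^sup>2)) * exp (- (pi * y * exp (- t) * (of_int k)\<^sup>2)))
   summable_on (UNIV \<times> UNIV :: (int \<times> int) set)"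
   using y by (intro summable_on_product_real summable_on_int_gauss) auto
  then show "(\<lambda>p. norm (case p of (m, k) => complex_of_real (gauss_pair y t m k) * cis (2 * pi * of_int k * (of_int m * x))))
   summable_on (UNIV \<times> UNIV :: (int \<times> int) set)" by (simp add: split_beta' norm_mult)
 qed
 have Tsym: "T (- t) = T t"
 proof -
  have "T (- t) = (\<Sum>\<^sub>\<infinity>m::int. \<Sum>\<^sub>\<infinity>k::int. complex_of_real (exp (- (pi * y * exp t * (of_int k)\<^sup>2)) * exp (- (pi * y * exp (- t) * (of_int m)\<^sup>2))) * cis (2 * pi * of_int m * (of_int k * x)))"
   unfolding T_def by (intro infsum_cong) (simp add: mult_ac)
  also have "... = T t"
   unfolding T_def by (rule infsum_swap_banach[symmetric]) (use Tsum[of t] in simp)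
  finally show ?thesis .
 qed
 have main: "complex_of_real (1 + theta2 z t) = of_real (sqrt y * exp (- (t / 2))) * T t" for t
 proof -
  have 1: "(\<lambda>v. exp (- (pi * qform z v * exp t))) summable_on lat"
   by (rule theta_bound(1)[of _ _ 2]) (use qform_summable[OF z, of 2] lsize_le_qform(2)[of "Im z" z "norm z"] z in auto)
  then have 2: "(\<lambda>v. exp (- (pi * qform z v * exp t))) summable_on (UNIV \<times> UNIV)"
   using summable_on_insert_iff[of "\<lambda>v. exp (- (pi * qform z v * exp t))" "(0,0)" lat] by (simp add: lat_def insert_absorb)
  have "1 + theta2 z t = (\<Sum>\<^sub>\<infinity>v\<in>UNIV \<times> UNIV. exp (- (pi * qform z v * exp t)))"
   using infsum_insert[OF 1, of "(0,0)"] by (simp add: theta_def lat_def qform_def insert_absorb)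
  also have "... = (\<Sum>\<^sub>\<infinity>m. \<Sum>\<^sub>\<infinity>n. exp (- (pi * qform z (m, n) * exp t)))"
   by (rule infsum_Sigma_banach[OF 2, symmetric])
  also have "complex_of_real ... = (\<Sum>\<^sub>\<infinity>m. of_real (\<Sum>\<^sub>\<infinity>n. exp (- (pi * qform z (m, n) * exp t))))"
  proof -
   have "(\<lambda>m. \<Sum>\<^sub>\<infinity>n. exp (- (pi * qform z (m, n) * exp t))) summable_on UNIV"
    using summable_on_Sigma_banach[of "\<lambda>m n. exp (- (pi * qform z (m, n) * exp t))" UNIV "\<lambda>_. UNIV"] 2
    by (simp add: case_prod_unfold)
   from has_sum_of_real[OF has_sum_infsum[OF this], where 'a = complex] show ?thesis by (rule infsumI[symmetric])
  qed
  also have "... = (\<Sum>\<^sub>\<infinity>m::int. of_real (sqrt y * exp (- (t / 2))) * (\<Sum>\<^sub>\<infinity>k::int. complex_of_real (gauss_pair y t m k) * cis (2 * pi * of_int k * (of_int m * x))))"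
  proof (intro infsum_cong)
   fix m :: int
   have q: "exp (- (pi * qform z (m, n) * exp t)) = exp (- (pi * y * exp t * (of_int m)\<^sup>2)) * exp (- (pi * (exp t / y) * (of_int m * x + of_int n)\<^sup>2))" for n
    unfolding qform_def fst_conv snd_conv norm_lattice_sq exp_add[symmetric] x_def[symmetric] y_def[symmetric]
    using y by (simp add: field_simps power2_eq_square)
   have sq: "sqrt (exp t / y) = exp (t / 2) / sqrt y" by (simp add: real_sqrt_divide sqrt_exp)
   have "complex_of_real (\<Sum>\<^sub>\<infinity>n. exp (- (pi * qform z (m, n) * exp t))) = of_real (exp (- (pi * y * exp t * (of_int m)\<^sup>2))) * complex_of_real (\<Sum>\<^sub>\<infinity>n::int. exp (- (pi * (exp t / y) * (of_int m * x + of_int n)\<^sup>2)))"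
    unfolding q by (simp add: infsum_cmult_right')
   also have "... = of_real (exp (- (pi * y * exp t * (of_int m)\<^sup>2))) * (\<Sum>\<^sub>\<infinity>k::int. of_real (exp (- (pi * (of_int k)\<^sup>2 / (exp t / y))) / sqrt (exp t / y)) * cis (2 * pi * of_int k * (of_int m * x)))"
    using y by (subst gaussian_poisson) auto
   also have "... = (\<Sum>\<^sub>\<infinity>k::int. of_real (exp (- (pi * y * exp t * (of_int m)\<^sup>2))) * (of_real (exp (- (pi * (of_int k)\<^sup>2 / (exp t / y))) / sqrt (exp t / y)) * cis (2 * pi * of_int k * (of_int m * x))))"
    by (rule infsum_cmult_right'[symmetric])
   also have "... = (\<Sum>\<^sub>\<infinity>k::int. of_real (sqrt y * exp (- (t / 2))) * (complex_of_real (gauss_pair y t m k) * cis (2 * pi * of_int k * (of_int m * x))))"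
    unfolding sq using y by (intro infsum_cong) (simp add: exp_minus field_simps)
   also have "... = of_real (sqrt y * exp (- (t / 2))) * (\<Sum>\<^sub>\<infinity>k::int. complex_of_real (gauss_pair y t m k) * cis (2 * pi * of_int k * (of_int m * x)))"
    by (rule infsum_cmult_right')
   finally show "complex_of_real (\<Sum>\<^sub>\<infinity>n. exp (- (pi * qform z (m, n) * exp t))) = ..." .
  qed
  also have "... = of_real (sqrt y * exp (- (t / 2))) * T t"
   unfolding T_def by (rule infsum_cmult_right')
  finally show ?thesis .
 qed
 have "complex_of_real (1 + theta2 z (- t)) = of_real (sqrt y * exp (t / 2)) * T t"
  using main[of "- t"] by (simp add: Tsym)
 also have "... = of_real (exp t) * complex_of_real (1 + theta2 z t)"
  unfolding main of_real_mult[symmetric] mult.assoc[symmetric]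
  by (simp add: exp_add[symmetric] mult.left_commute[of "exp t"] del: of_real_mult)
 finally have "1 + theta2 z (- t) = exp t * (1 + theta2 z t)" by (simp only: of_real_mult[symmetric] of_real_eq_iff)
 then show ?thesis by (simp add: algebra_simps)
qed

section \<open>Cosets of the translations and primitive pairs\<close>

lemma uhp_iff [simp]: "z \<in> uhp \<longleftrightarrow> Im z > 0" by (simp add: uhp_def)

lemma moebius_apply: "Im z > 0 ==> moebius a b c d z = (of_int a * z + of_int b) / (of_int c * z + of_int d)"
 by (simp add: moebius_def)

lemma moebius_denom_nonzero:
 assumes "Im z > 0" "(c, d) ~= (0, 0)"
 shows "of_int c * z + of_int d ~= 0"
 using assms by (auto simp: complex_eq_iff)

lemma det_one_nonzero: "a * d - b * c = (1::int) ==> (c, d) ~= (0, 0)" by auto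

lemma moebius_Im:
 assumes "Im z > 0" "a * d - b * c = 1"
 shows "Im (moebius a b c d z) = Im z / (norm (of_int c * z + of_int d))\<^sup>2"
proof -
 have "of_int a * of_int d - of_int b * of_int c = (1 :: real)"
  using assms(2) by (metis of_int_1 of_int_diff of_int_mult)
 then have "Im ((of_int a * z + of_int b) * cnj (of_int c * z + of_int d)) = Im z" by (simp add: algebra_simps)
 then show ?thesis
  unfolding moebius_apply[OF assms(1)]
  by (subst complex_div_cnj) (simp only: of_real_power[symmetric] Im_divide_of_real)
qed

lemma moebius_uhp:
 assumes "Im z > 0" "a * d - b * c = 1"
 shows "Im (moebius a b c d z) > 0"
 using moebius_Im[OF assms] moebius_denom_nonzero[OF assms(1) det_one_nonzero[OF assms(2)]] assms(1) by simp

lemma moebius_compose: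
 assumes "a' * d' - b' * c' = 1"
 shows "compose uhp (moebius a b c d) (moebius a' b' c' d')
  = moebius (a * a' + b * c') (a * b' + b * d') (c * a' + d * c') (c * b' + d * d')"
proof
 fix z
 show "compose uhp (moebius a b c d) (moebius a' b' c' d') z
  = moebius (a * a' + b * c') (a * b' + b * d') (c * a' + d * c') (c * b' + d * d') z"
 proof (cases "Im z > 0")
  case True
  define w where "w = of_int c' * z + of_int d'"
  have w: "w ~= 0"
   unfolding w_def by (rule moebius_denom_nonzero[OF True det_one_nonzero[OF assms]])
  have "(of_int a * ((of_int a' * z + of_int b') / w) + of_int b) / (of_int c * ((of_int a' * z + of_int b') / w) + of_int d)
   = (of_int a * (of_int a' * z + of_int b') + of_int b * w) / (of_int c * (of_int a' * z + of_int b') + of_int d * w)"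
  proof -
   have "of_int a * ((of_int a' * z + of_int b') / w) + of_int b = (of_int a * (of_int a' * z + of_int b') + of_int b * w) / w"
      "of_int c * ((of_int a' * z + of_int b') / w) + of_int d = (of_int c * (of_int a' * z + of_int b') + of_int d * w) / w"
    using w by (simp_all add: field_simps)
   then show ?thesis using w by simp
  qed
  moreover have "of_int a * (of_int a' * z + of_int b') + of_int b * w = of_int (a * a' + b * c') * z + of_int (a * b' + b * d')"
   "of_int c * (of_int a' * z + of_int b') + of_int d * w = of_int (c * a' + d * c') * z + of_int (c * b' + d * d')"
   by (simp_all add: w_def algebra_simps)
  moreover have "compose uhp (moebius a b c d) (moebius a' b' c' d') z = (of_int a * moebius a' b' c' d' z + of_int b) / (of_int c * moebius a' b' c' d' z + of_int d)"
   using True moebius_uhp[OF True assms] by (simp add: compose_def moebius_apply)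
  ultimately show ?thesis by (simp only: moebius_apply[OF True] w_def)
 qed (simp add: compose_def moebius_def)
qed

lemma moebius_one: "moebius 1 0 0 1 = (\<lambda>z\<in>uhp. z)" by (auto simp: moebius_def restrict_def)

lemma moebius_neg: "moebius (- a) (- b) (- c) (- d) = moebius a b c d"
proof -
 have "(of_int (- a) * z + of_int (- b)) / (of_int (- c) * z + of_int (- d)) = (of_int a * z + of_int b) / (of_int c * z + of_int d)" for z :: complex
 proof -
  have "of_int (- a) * z + of_int (- b) = - (of_int a * z + of_int b)" "of_int (- c) * z + of_int (- d) = - (of_int c * z + of_int d)"
   by simp_all
  then show ?thesis by (simp only: minus_divide_divide)
 qed
 then show ?thesis by (simp only: moebius_def)
qed

lemma moebius_Bij:
 assumes "a * d - b * c = 1"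
 shows "moebius a b c d \<in> Bij uhp"
proof -
 have d': "d * a - (- b) * (- c) = 1" using assms by (simp add: algebra_simps)
 have c1: "compose uhp (moebius d (-b) (-c) a) (moebius a b c d) = moebius 1 0 0 1"
  using moebius_compose[OF assms, of d "-b" "-c" a] assms by (simp add: algebra_simps)
 have c2: "compose uhp (moebius a b c d) (moebius d (-b) (-c) a) = moebius 1 0 0 1"
  using moebius_compose[OF d', of a b c d] assms by (simp add: algebra_simps)
 have inv: "moebius d (-b) (-c) a (moebius a b c d z) = z" "moebius a b c d (moebius d (-b) (-c) a z) = z"
  if "Im z > 0" for z
  using fun_cong[OF c1, of z] fun_cong[OF c2, of z] that by (simp_all add: compose_def moebius_one)
 have "bij_betw (moebius a b c d) uhp uhp" by (rule bij_betwI[of _ _ _ "moebius d (-b) (-c) a"])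
   (use inv moebius_uhp[OF _ assms] moebius_uhp[OF _ d'] in auto)
 moreover have "moebius a b c d \<in> extensional uhp" by (simp add: moebius_def)
 ultimately show ?thesis by (simp add: Bij_def)
qed

lemma carrier_PSL2Z: "carrier PSL2Z = {moebius a b c d | a b c d. a * d - b * c = 1}" by (simp add: PSL2Z_def)

lemma moebius_in_PSL2Z: "a * d - b * c = 1 ==> moebius a b c d \<in> carrier PSL2Z" by (auto simp: carrier_PSL2Z)

lemma mult_PSL2Z:
 assumes "a * d - b * c = 1" "a' * d' - b' * c' = 1"
 shows "moebius a b c d \<otimes>\<^bsub>PSL2Z\<^esub> moebius a' b' c' d'
  = moebius (a * a' + b * c') (a * b' + b * d') (c * a' + d * c') (c * b' + d * d')"
 using moebius_Bij[OF assms(1)] moebius_Bij[OF assms(2)] moebius_compose[OF assms(2)]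
 by (simp add: PSL2Z_def BijGroup_def)

lemma one_PSL2Z: "\<one>\<^bsub>PSL2Z\<^esub> = moebius 1 0 0 1" by (simp add: PSL2Z_def BijGroup_def moebius_one)

lemma det_mult:
 fixes a :: int
 assumes "a * d - b * c = 1" "a' * d' - b' * c' = 1"
 shows "(a * a' + b * c') * (c * b' + d * d') - (a * b' + b * d') * (c * a' + d * c') = 1"
proof -
 have "(a * a' + b * c') * (c * b' + d * d') - (a * b' + b * d') * (c * a' + d * c')
   = (a * d - b * c) * (a' * d' - b' * c')" by (simp add: algebra_simps)
 then show ?thesis using assms by simp
qed

lemma group_PSL2Z: "group PSL2Z"
proof (rule groupI)
 show "x \<otimes>\<^bsub>PSL2Z\<^esub> y \<in> carrier PSL2Z" if "x \<in> carrier PSL2Z" "y \<in> carrier PSL2Z" for x y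
  using that by (auto simp: carrier_PSL2Z mult_PSL2Z dest: det_mult) (metis det_mult)
 show "\<one>\<^bsub>PSL2Z\<^esub> \<in> carrier PSL2Z"
  unfolding one_PSL2Z by (rule moebius_in_PSL2Z) simp
 show "x \<otimes>\<^bsub>PSL2Z\<^esub> y \<otimes>\<^bsub>PSL2Z\<^esub> z = x \<otimes>\<^bsub>PSL2Z\<^esub> (y \<otimes>\<^bsub>PSL2Z\<^esub> z)"
  if xyz: "x \<in> carrier PSL2Z" "y \<in> carrier PSL2Z" "z \<in> carrier PSL2Z" for x y z
 proof -
  have "x \<in> Bij uhp" "y \<in> Bij uhp" "z \<in> Bij uhp"
   using xyz moebius_Bij by (auto simp: carrier_PSL2Z)
  then have "x \<otimes>\<^bsub>BijGroup uhp\<^esub> y \<otimes>\<^bsub>BijGroup uhp\<^esub> z = x \<otimes>\<^bsub>BijGroup uhp\<^esub> (y \<otimes>\<^bsub>BijGroup uhp\<^esub> z)"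
   by (intro monoid.m_assoc group.is_monoid group_BijGroup) (auto simp: BijGroup_def)
  then show ?thesis by (simp add: PSL2Z_def)
 qed
 show "\<one>\<^bsub>PSL2Z\<^esub> \<otimes>\<^bsub>PSL2Z\<^esub> x = x" if "x \<in> carrier PSL2Z" for x
  using that by (auto simp: carrier_PSL2Z one_PSL2Z mult_PSL2Z)
 show "\<exists>y\<in>carrier PSL2Z. y \<otimes>\<^bsub>PSL2Z\<^esub> x = \<one>\<^bsub>PSL2Z\<^esub>" if "x \<in> carrier PSL2Z" for x
 proof -
  obtain a b c d where x: "x = moebius a b c d" and det: "a * d - b * c = 1"
   using \<open>x \<in> carrier PSL2Z\<close> by (auto simp: carrier_PSL2Z)
  have det': "d * a - (- b) * (- c) = 1" using det by (simp add: algebra_simps)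
  have "moebius d (-b) (-c) a \<otimes>\<^bsub>PSL2Z\<^esub> x = moebius 1 0 0 1"
   unfolding x mult_PSL2Z[OF det' det] using det by (simp add: algebra_simps)
  then show ?thesis
   using moebius_in_PSL2Z[OF det'] by (auto simp: one_PSL2Z)
 qed
qed

lemma Gamma_inf_eq: "Gamma_inf = range (\<lambda>n. moebius 1 n 0 1)"
proof
 have mm: "moebius 1 m 0 1 \<otimes>\<^bsub>PSL2Z\<^esub> moebius 1 n 0 1 = moebius 1 (m + n) 0 1" for m n
  by (subst mult_PSL2Z) (simp_all add: add.commute)
 have inv: "inv\<^bsub>PSL2Z\<^esub> (moebius 1 1 0 1) = moebius 1 (-1) 0 1"
  by (rule group.inv_equality[OF group_PSL2Z]) (auto simp: mm one_PSL2Z intro!: moebius_in_PSL2Z)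
 show "Gamma_inf \<subseteq> range (\<lambda>n. moebius 1 n 0 1)"
 proof
  fix x assume "x \<in> Gamma_inf"
  then show "x \<in> range (\<lambda>n. moebius 1 n 0 1)"
   unfolding Gamma_inf_def
  proof (induction rule: generate.induct)
   case one
   then show ?case by (auto simp: one_PSL2Z)
  next
   case (incl h)
   then show ?case by auto
  next
   case (inv h)
   then show ?case using \<open>inv\<^bsub>PSL2Z\<^esub> (moebius 1 1 0 1) = moebius 1 (-1) 0 1\<close> by auto
  next
   case (eng h1 h2)
   then show ?case by (auto simp: mm)
  qed
 qed
 have "moebius 1 n 0 1 \<in> generate PSL2Z {moebius 1 1 0 1}" for n
 proof (induction n rule: int_induct[of _ 0])
  case base
  show ?case using generate.one[of PSL2Z] by (simp add: one_PSL2Z)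
 next
  case (step1 i)
  then show ?case
   using generate.eng[OF step1(2) generate.incl[of "moebius 1 1 0 1"]] by (simp add: mm)
 next
  case (step2 i)
  then show ?case
   using generate.eng[OF step2(2) generate.inv[of "moebius 1 1 0 1"]] by (simp add: mm inv)
 qed
 then show "range (\<lambda>n. moebius 1 n 0 1) \<subseteq> Gamma_inf" by (auto simp: Gamma_inf_def)
qed

text \<open>The coprime pairs modulo sign, with the representative that has nonnegative first entry.\<close>
definition prim :: "(int \<times> int) set" where
 "prim = {v. coprime (fst v) (snd v) \<and> (fst v > 0 \<or> (fst v = 0 \<and> snd v = 1))}"

text \<open>All group elements with a given lower row; left multiplication by translations changes only the upper row, so these are the cosets.\<close>
definition row_coset :: "int \<times> int => (complex => complex) set" where
 "row_coset v = {moebius a b (fst v) (snd v) | a b. a * snd v - b * fst v = 1}"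

lemma row_coset_eq:
 assumes det: "a * d - b * c = 1"
 shows "Gamma_inf #>\<^bsub>PSL2Z\<^esub> moebius a b c d = row_coset (c, d)"
proof -
 have "Gamma_inf #>\<^bsub>PSL2Z\<^esub> moebius a b c d = range (\<lambda>n. moebius (a + n * c) (b + n * d) c d)"
  unfolding r_coset_def Gamma_inf_eq by (auto simp: mult_PSL2Z[OF _ det])
 also have "... = row_coset (c, d)"
 proof
  have "(a + n * c) * d - (b + n * d) * c = 1" for n
   using det by (simp add: algebra_simps)
  then show "range (\<lambda>n. moebius (a + n * c) (b + n * d) c d) \<subseteq> row_coset (c, d)"
   by (auto simp: row_coset_def)
  show "row_coset (c, d) \<subseteq> range (\<lambda>n. moebius (a + n * c) (b + n * d) c d)"
  proof
   fix x assume "x \<in> row_coset (c, d)"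
   then obtain a' b' where x: "x = moebius a' b' c d" and det': "a' * d - b' * c = 1" by (auto simp: row_coset_def)
   define n where "n = a' * (b' * a - a' * b) * 0 + (a * b' - b * a')"
   have "a + n * c = a * (a' * d - b' * c) + n * c" using det' by simp
   also have "... = a' * (a * d - b * c)" by (simp add: n_def algebra_simps)
   finally have 1: "a + n * c = a'" using det by simp
   have "b + n * d = b * (a' * d - b' * c) + n * d" using det' by simp
   also have "... = b' * (a * d - b * c)" by (simp add: n_def algebra_simps)
   finally have 2: "b + n * d = b'" using det by simp
   show "x \<in> range (\<lambda>n. moebius (a + n * c) (b + n * d) c d)"
    unfolding x using 1 2 by (auto simp: image_iff intro!: exI[of _ n])
  qed
 qed
 finally show ?thesis .
qed

lemma coprime_obtains_det:
 assumes "coprime c (d::int)"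
 obtains a b where "a * d - b * c = 1"
proof -
 obtain u v where "u * c + v * d = 1"
  using bezout_int[of c d] assms by (metis coprime_imp_gcd_eq_1)
 then have "v * d - (- u) * c = 1" by simp
 then show ?thesis by (rule that)
qed

lemma rcosets_eq: "rcosets\<^bsub>PSL2Z\<^esub> Gamma_inf = row_coset ` prim"
proof
 show "rcosets\<^bsub>PSL2Z\<^esub> Gamma_inf \<subseteq> row_coset ` prim"
 proof
  fix C assume "C \<in> rcosets\<^bsub>PSL2Z\<^esub> Gamma_inf"
  then obtain a b c d where C: "C = Gamma_inf #>\<^bsub>PSL2Z\<^esub> moebius a b c d" and det: "a * d - b * c = 1"
   by (auto simp: RCOSETS_def carrier_PSL2Z)
  have det': "(- a) * (- d) - (- b) * (- c) = 1" using det by simp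
  have cop: "coprime c d"
  proof (rule coprimeI)
   fix q assume "q dvd c" "q dvd d"
   then have "q dvd a * d - b * c" by (intro dvd_diff dvd_mult)
   then show "is_unit q" using det by simp
  qed
  have C1: "C = row_coset (c, d)"
   using C row_coset_eq[OF det] by simp
  have C2: "C = row_coset (- c, - d)"
   using C row_coset_eq[OF det'] by (simp only: moebius_neg)
  show "C \<in> row_coset ` prim"
  proof (cases "c > 0 \<or> (c = 0 \<and> d = 1)")
   case True
   then have "(c, d) \<in> prim" using cop by (simp add: prim_def)
   then show ?thesis unfolding C1 by (rule imageI)
  next
   case False
   have "d = 1 \<or> d = -1" if "c = 0"
    using det that by (auto simp: zmult_eq_1_iff)
   with False have "- c > 0 \<or> (- c = 0 \<and> - d = 1)" by linarith
   then have "(- c, - d) \<in> prim" using cop by (simp add: prim_def)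
   then show ?thesis unfolding C2 by (rule imageI)
  qed
 qed
 show "row_coset ` prim \<subseteq> rcosets\<^bsub>PSL2Z\<^esub> Gamma_inf"
 proof
  fix C assume "C \<in> row_coset ` prim"
  then obtain c d where C: "C = row_coset (c, d)" "coprime c d" by (auto simp: prim_def)
  obtain a b where det: "a * d - b * c = 1" by (rule coprime_obtains_det[OF C(2)])
  have "C = Gamma_inf #>\<^bsub>PSL2Z\<^esub> moebius a b c d"
   unfolding C(1) by (rule row_coset_eq[OF det, symmetric])
  then show "C \<in> rcosets\<^bsub>PSL2Z\<^esub> Gamma_inf"
   unfolding RCOSETS_def using moebius_in_PSL2Z[OF det] by blast
 qed
qed

lemma row_coset_nonempty: "v \<in> prim ==> row_coset v ~= {}"
 by (cases v) (auto simp: prim_def row_coset_def elim!: coprime_obtains_det)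

lemma row_coset_Im:
 assumes "\<gamma> \<in> row_coset v" "Im z > 0"
 shows "Im (\<gamma> z) = 1 / qform z v"
 using assms moebius_Im[OF assms(2)] by (auto simp: row_coset_def qform_def)

lemma prim_lat: "v \<in> prim ==> v \<in> lat" by (cases v) (auto simp: prim_def lat_def)

lemma inj_row_coset: "inj_on row_coset prim"
proof (rule inj_onI)
 fix v w assume v: "v \<in> prim" and w: "w \<in> prim" and eq: "row_coset v = row_coset w"
 obtain c d c' d' where vw: "v = (c, d)" "w = (c', d')" by (cases v, cases w) auto
 obtain \<gamma> where "\<gamma> \<in> row_coset v" "\<gamma> \<in> row_coset w"
  using row_coset_nonempty[OF v] eq by auto
 then have "1 / qform z v = 1 / qform z w" if "Im z > 0" for z
  using row_coset_Im that by metis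
 then have q: "qform z v = qform z w" if "Im z > 0" for z
  using that by (metis divide_divide_eq_right mult_1 div_by_1 one_divide_one_divide_ennreal inverse_eq_divide inverse_inverse_eq)
 have "(c * x + d)\<^sup>2 + c\<^sup>2 * y\<^sup>2 = (c' * x + d')\<^sup>2 + c'\<^sup>2 * y\<^sup>2" if "y > 0" for x y :: int
 proof -
  have "real_of_int ((c * x + d)\<^sup>2 + c\<^sup>2 * y\<^sup>2) = real_of_int ((c' * x + d')\<^sup>2 + c'\<^sup>2 * y\<^sup>2)"
   using q[of "Complex (of_int x) (of_int y)"] that by (simp add: vw qform_def norm_lattice_sq)
  then show ?thesis by (simp only: of_int_eq_iff)
 qed
 from this[of 1 0] this[of 2 0] this[of 1 1]
 have "d\<^sup>2 + c\<^sup>2 = d'\<^sup>2 + c'\<^sup>2" "d\<^sup>2 + c\<^sup>2 * 4 = d'\<^sup>2 + c'\<^sup>2 * 4" "(c + d)\<^sup>2 + c\<^sup>2 = (c' + d')\<^sup>2 + c'\<^sup>2"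
  by auto
 then have *: "c\<^sup>2 = c'\<^sup>2" "c * d = c' * d'" by (auto simp: power2_eq_square algebra_simps)
 have "c >= 0" "c' >= 0" using v w by (auto simp: vw prim_def)
 with * have "c = c'" by (simp add: power2_eq_iff_nonneg)
 moreover have "d = d'"
  using \<open>c = c'\<close> * v w by (auto simp: vw prim_def)
 ultimately show "v = w" by (simp add: vw)
qed

lemma powr_one_divide:
 assumes "q > 0"
 shows "complex_of_real (1 / q) powr s = of_real q powr (- s)"
proof -
 have "complex_of_real (1 / q) powr s = exp (s * of_real (ln (1 / q)))"
  using assms by (simp add: powr_def Ln_of_real del: of_real_divide)
 then show ?thesis
  using assms by (simp add: powr_def Ln_of_real ln_div)
qed

lemma eisenstein_series_prim:
 assumes z: "Im z > 0"
 shows "eisenstein_series z s = (\<Sum>\<^sub>\<infinity>v\<in>prim. of_real (qform z v) powr (- s))"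
proof -
 have "eisenstein_series z s = (\<Sum>\<^sub>\<infinity>v\<in>prim. of_real (Im ((SOME \<gamma>. \<gamma> \<in> row_coset v) z)) powr s)"
  unfolding eisenstein_series_def rcosets_eq by (subst infsum_reindex[OF inj_row_coset]) (simp add: o_def)
 also have "... = (\<Sum>\<^sub>\<infinity>v\<in>prim. of_real (qform z v) powr (- s))"
 proof (rule infsum_cong)
  fix v assume v: "v \<in> prim"
  have "(SOME \<gamma>. \<gamma> \<in> row_coset v) \<in> row_coset v"
   using row_coset_nonempty[OF v] by (simp add: some_in_eq)
  then have "Im ((SOME \<gamma>. \<gamma> \<in> row_coset v) z) = 1 / qform z v"
   using z by (rule row_coset_Im)
  moreover have "qform z v > 0"
   using lsize_le_qform(2)[of "Im z" z "norm z" v] z prim_lat[OF v] by simp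
  ultimately show "complex_of_real (Im ((SOME \<gamma>. \<gamma> \<in> row_coset v) z)) powr s = of_real (qform z v) powr (- s)"
   by (simp only: powr_one_divide)
 qed
 finally show ?thesis .
qed

text \<open>Each nonzero lattice vector is a unique nonzero integer multiple of a unique normalized primitive vector.\<close>
lemma bij_prim_lat: "bij_betw (\<lambda>(n, v). (n * fst v, n * snd v)) ((UNIV - {0::int}) \<times> prim) lat"
proof (rule bij_betwI')
 fix p q assume p: "p \<in> (UNIV - {0::int}) \<times> prim" and q: "q \<in> (UNIV - {0::int}) \<times> prim"
 obtain n c d where pe: "p = (n, (c, d))" by (cases p) auto
 obtain n' c' d' where qe: "q = (n', (c', d'))" by (cases q) auto
 show "((case p of (n, v) => (n * fst v, n * snd v)) = (case q of (n, v) => (n * fst v, n * snd v))) = (p = q)"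
 proof
  assume "(case p of (n, v) => (n * fst v, n * snd v)) = (case q of (n, v) => (n * fst v, n * snd v))"
  then have eq: "n * c = n' * c'" "n * d = n' * d'" by (auto simp: pe qe)
  have nn: "n ~= 0" "n' ~= 0" and cop: "coprime c d" "coprime c' d'"
   and sgn: "c > 0 \<or> (c = 0 \<and> d = 1)" "c' > 0 \<or> (c' = 0 \<and> d' = 1)"
   using p q by (auto simp: pe qe prim_def)
  have "gcd (n * c) (n * d) = \<bar>n\<bar>" "gcd (n' * c') (n' * d') = \<bar>n'\<bar>"
   using cop by (simp_all add: gcd_mult_left)
  then have "\<bar>n\<bar> = \<bar>n'\<bar>" using eq by simp
  then have "n = n'"
  proof (rule abs_eq_iff[THEN iffD1, THEN disjE])
   assume "n = - n'"
   then have "n' * (c + c') = 0" "n' * (d + d') = 0" using eq by (simp_all add: algebra_simps)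
   then have "c = - c'" "d = - d'" using nn by auto
   then show ?thesis using sgn by auto
  qed
  then show "p = q" using eq nn by (simp add: pe qe)
 qed simp
next
 fix p assume "p \<in> (UNIV - {0::int}) \<times> prim"
 then obtain n c d where "p = (n, (c, d))" "n ~= 0" "c > 0 \<or> d = 1" by (cases p) (auto simp: prim_def)
 then show "(case p of (n, v) => (n * fst v, n * snd v)) \<in> lat" by (auto simp: lat_def)
next
 fix w assume w: "w \<in> lat"
 obtain m n where mn: "w = (m, n)" by (cases w)
 define g where "g = gcd m n"
 have g: "g > 0" using w by (auto simp: lat_def mn g_def)
 define e where "e = (if m < 0 \<or> (m = 0 \<and> n < 0) then - g else g)"
 have e: "e ~= 0" "\<bar>e\<bar> = g" using g by (auto simp: e_def)
 have dvd: "e dvd m" "e dvd n" using e by (auto simp: e_def g_def)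
 then obtain c d where cd: "m = e * c" "n = e * d" by (auto elim!: dvdE)
 have "\<bar>e\<bar> * gcd c d = \<bar>e\<bar>"
  using e(2) unfolding g_def cd by (simp add: gcd_mult_left abs_mult)
 then have "gcd c d = 1" using e(1) by simp
 then have cop: "coprime c d" by (rule gcd_eq_1_imp_coprime)
 have "c > 0 \<or> (c = 0 \<and> d = 1)"
 proof (cases "m = 0")
  case True
  with cd(1) have "e * c = 0" by (simp only:)
  then have c0: "c = 0" using e(1) by simp
  have d1: "d = 1 \<or> d = -1" using cop unfolding c0 by auto
  have n0: "n ~= 0" using w True by (auto simp: mn lat_def)
  have "d > 0"
  proof (cases "n < 0")
   case n: True
   have "e = - g" using True n by (simp add: e_def)
   then have "n = - (g * d)" using cd(2) by simp
   then have "g * d > 0" using n by linarith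
   then show ?thesis using g by (simp add: zero_less_mult_iff)
  next
   case n: False
   have "e = g" using True n by (simp add: e_def)
   then have "n = g * d" using cd(2) by simp
   then have "g * d > 0" using n n0 by linarith
   then show ?thesis using g by (simp add: zero_less_mult_iff)
  qed
  then show ?thesis using c0 d1 by auto
 next
  case False
  have "c > 0"
  proof (cases "m < 0")
   case m: True
   have "e = - g" using m by (simp add: e_def)
   then have "m = - (g * c)" using cd(1) by simp
   then have "g * c > 0" using m by linarith
   then show ?thesis using g by (simp add: zero_less_mult_iff)
  next
   case m: False
   have "e = g" using False m by (simp add: e_def)
   then have "m = g * c" using cd(1) by simp
   then have "g * c > 0" using m False by linarith
   then show ?thesis using g by (simp add: zero_less_mult_iff)
  qed
  then show ?thesis ..
 qed
 then have "(e, (c, d)) \<in> (UNIV - {0::int}) \<times> prim"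
  using e cop by (auto simp: prim_def)
 then show "\<exists>p\<in>(UNIV - {0::int}) \<times> prim. w = (case p of (n, v) => (n * fst v, n * snd v))"
  by (rule bexI[rotated]) (simp only: mn cd prod.case fst_conv snd_conv)
qed

lemma qform_scale: "qform z (n * c, n * d) = (of_int n)\<^sup>2 * qform z (c, d)"
proof -
 have "of_int (n * c) * z + of_int (n * d) = of_int n * (of_int c * z + of_int d)" by (simp add: algebra_simps)
 then show ?thesis by (simp add: qform_def norm_mult power_mult_distrib)
qed

lemma qform_moebius:
 assumes z: "Im z > 0" and det: "a * d - b * c = 1"
 shows "qform (moebius a b c d z) (m, n) = qform z (m * a + n * c, m * b + n * d)"
proof -
 define w where "w = of_int c * z + of_int d"
 have w: "w ~= 0"
  unfolding w_def by (rule moebius_denom_nonzero[OF z det_one_nonzero[OF det]])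
 define A where "A = of_int a * z + of_int b"
 have "of_int m * (A / w) + of_int n = (of_int m * A + of_int n * w) / w"
  using w by (simp add: field_simps)
 moreover have "of_int m * A + of_int n * w = of_int (m * a + n * c) * z + of_int (m * b + n * d)"
  by (simp add: A_def w_def algebra_simps)
 ultimately have "of_int m * moebius a b c d z + of_int n = (of_int (m * a + n * c) * z + of_int (m * b + n * d)) / w"
  by (simp only: moebius_apply[OF z] A_def w_def)
 then show ?thesis
  using w z by (simp add: qform_def moebius_Im[OF z det] w_def[symmetric] norm_divide power_divide)
qed

lemma det_one_inverse:
 fixes a b c d m n :: int
 assumes det: "a * d - b * c = 1"
 shows "(m * a + n * c) * d - (m * b + n * d) * c = m" "(m * b + n * d) * a - (m * a + n * c) * b = n"
  "(m * d - n * c) * a + (n * a - m * b) * c = m" "(m * d - n * c) * b + (n * a - m * b) * d = n"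
proof -
 have "(m * a + n * c) * d - (m * b + n * d) * c = m * (a * d - b * c)" "(m * b + n * d) * a - (m * a + n * c) * b = n * (a * d - b * c)"
  "(m * d - n * c) * a + (n * a - m * b) * c = m * (a * d - b * c)" "(m * d - n * c) * b + (n * a - m * b) * d = n * (a * d - b * c)"
  by (simp_all add: algebra_simps)
 then show "(m * a + n * c) * d - (m * b + n * d) * c = m" "(m * b + n * d) * a - (m * a + n * c) * b = n"
  "(m * d - n * c) * a + (n * a - m * b) * c = m" "(m * d - n * c) * b + (n * a - m * b) * d = n"
  using det by auto
qed

lemma bij_lat_moebius:
 assumes det: "a * d - b * c = (1::int)"
 shows "bij_betw (\<lambda>v. (fst v * a + snd v * c, fst v * b + snd v * d)) lat lat"
proof (rule bij_betwI[where g = "\<lambda>v. (fst v * d - snd v * c, snd v * a - fst v * b)"])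
 show "(\<lambda>v. (fst v * a + snd v * c, fst v * b + snd v * d)) \<in> lat \<rightarrow> lat"
 proof
  fix v assume v: "v \<in> lat"
  show "(fst v * a + snd v * c, fst v * b + snd v * d) \<in> lat"
  proof (rule ccontr)
   assume "\<not> ?thesis"
   then have e: "fst v * a + snd v * c = 0" "fst v * b + snd v * d = 0" by (simp_all add: lat_def)
   have "fst v = 0" "snd v = 0"
    using det_one_inverse(1,2)[OF det, of "fst v" "snd v", unfolded e] by simp_all
   with v show False by (cases v) (simp add: lat_def)
  qed
 qed
 show "(\<lambda>v. (fst v * d - snd v * c, snd v * a - fst v * b)) \<in> lat \<rightarrow> lat"
 proof
  fix v assume v: "v \<in> lat"
  show "(fst v * d - snd v * c, snd v * a - fst v * b) \<in> lat"
  proof (rule ccontr)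
   assume "\<not> ?thesis"
   then have e: "fst v * d - snd v * c = 0" "snd v * a - fst v * b = 0" by (simp_all add: lat_def)
   have "fst v = 0" "snd v = 0"
    using det_one_inverse(3,4)[OF det, of "fst v" "snd v", unfolded e] by simp_all
   with v show False by (cases v) (simp add: lat_def)
  qed
 qed
qed (rule prod_eqI; unfold fst_conv snd_conv; rule det_one_inverse[OF det])+
 

text \<open>A matrix of determinant one permutes the lattice.\<close>
lemma theta2_invariant:
 assumes z: "Im z > 0" and det: "a * d - b * c = 1"
 shows "theta2 (moebius a b c d z) = theta2 z"
proof
 fix x
 have "theta2 (moebius a b c d z) x = (\<Sum>\<^sub>\<infinity>v\<in>lat. exp (- (pi * qform z (fst v * a + snd v * c, fst v * b + snd v * d) * exp x)))"
  unfolding theta_def by (intro infsum_cong) (metis prod.collapse qform_moebius[OF z det])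
 also have "... = theta2 z x"
  unfolding theta_def by (rule infsum_reindex_bij_betw[OF bij_lat_moebius[OF det], of "\<lambda>v. exp (- (pi * qform z v * exp x))"])
 finally show "theta2 (moebius a b c d z) x = theta2 z x" .
qed

section \<open>Analytic continuation of the Eisenstein series\<close>

text \<open>The completed lattice sum, with its two poles made explicit.\<close>
definition Lam :: "complex => complex => complex" where
 "Lam z s = mellin_half 1 (theta2 z) s + 1 / (s - 1) - 1 / s"

definition Xi :: "complex => complex" where
 "Xi s = mellin_half (1 / 2) theta1 s + 1 / (s - 1 / 2) - 1 / s"

text \<open>Twice the zeta value at 2 s, as a sum over nonzero integers.\<close>
definition dzeta :: "complex => complex" where
 "dzeta s = (\<Sum>\<^sub>\<infinity>n::int\<in>UNIV - {0}. of_real ((of_int n)\<^sup>2) powr (- s))"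

definition dzeta_real :: "real => real" where
 "dzeta_real \<sigma> = (\<Sum>\<^sub>\<infinity>n::int\<in>UNIV - {0}. ((of_int n)\<^sup>2) powr (- \<sigma>))"

lemma theta_decay:
 assumes q: "\<And>i. i \<in> I ==> q i > 0" and sm: "\<And>\<sigma>. \<sigma> >= 2 ==> (\<lambda>i. q i powr (- \<sigma>)) summable_on I"
 shows "\<exists>C. \<forall>x\<ge>0. \<bar>theta q I x\<bar> <= C * exp (- A * x)"
proof -
 define \<sigma> where "\<sigma> = max A 2"
 have s: "\<sigma> > 0" "\<sigma> >= 2" "\<sigma> >= A" by (auto simp: \<sigma>_def)
 define C where "C = \<sigma> powr \<sigma> * pi powr (- \<sigma>) * (\<Sum>\<^sub>\<infinity>i\<in>I. q i powr (- \<sigma>))"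
 have C: "C >= 0" unfolding C_def by (intro mult_nonneg_nonneg infsum_nonneg) auto
 have "\<bar>theta q I x\<bar> <= C * exp (- A * x)" if "x >= 0" for x
 proof -
  have "\<bar>theta q I x\<bar> <= C * exp (- \<sigma> * x)"
   using theta_bound(2)[of I q \<sigma> x, OF q s(1) sm[OF s(2)]] theta_bound(3)[of I q \<sigma> x, OF q s(1) sm[OF s(2)]]
   by (simp add: C_def)
  also have "... <= C * exp (- A * x)"
   using C that s by (intro mult_left_mono) (auto intro: mult_right_mono)
  finally show ?thesis .
 qed
 then show ?thesis by blast
qed

lemma qform_pos: "Im z > 0 ==> v \<in> lat ==> qform z v > 0"
 using lsize_le_qform(2)[of "Im z" z "norm z" v] by simp

lemma theta1_props:
 "theta1 \<in> borel_fun" "\<exists>C. \<forall>x\<ge>0. \<bar>theta1 x\<bar> <= C * exp (- A * x)"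
proof -
 show "theta1 \<in> borel_fun"
  by (intro borel_measurable_continuous_onI theta_continuous[of _ _ 1] theta1_summable) auto
 show "\<exists>C. \<forall>x\<ge>0. \<bar>theta1 x\<bar> <= C * exp (- A * x)"
  by (intro theta_decay theta1_summable) auto
qed

lemma theta2_props:
 assumes "Im z > 0"
 shows "theta2 z \<in> borel_fun" "\<exists>C. \<forall>x\<ge>0. \<bar>theta2 z x\<bar> <= C * exp (- A * x)"
proof -
 show "theta2 z \<in> borel_fun"
  using assms by (intro borel_measurable_continuous_onI theta_continuous[of _ _ 2] qform_summable qform_pos) auto
 show "\<exists>C. \<forall>x\<ge>0. \<bar>theta2 z x\<bar> <= C * exp (- A * x)"
  using assms by (intro theta_decay qform_summable qform_pos) auto
qed

lemma countable_lat [simp]: "countable (A :: (int \<times> int) set)" by (rule countableI_type)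

lemma Lam_series:
 assumes z: "Im z > 0" and s: "Re s > 1"
 shows "((\<lambda>v. of_real (qform z v) powr (- s)) has_sum Lam z s / (Gamma s * of_real pi powr (- s))) lat"
proof -
 have s0: "Re s > 0" using s by simp
 note m = mellin_theta[OF countable_lat qform_pos[OF z] s0 qform_summable[OF z s]]
 have "(\<integral>x. of_real (theta2 z x) * exp (s * of_real x) \<partial>lborel) = Lam z s"
  unfolding Lam_def using mellin_half_eq[OF theta2_props[OF z], of 1 s] theta2_functional[OF z] m(1) s by simp
 then show ?thesis using m(2) by simp
qed

lemma Xi_series:
 assumes s: "Re s > 1 / 2"
 shows "((\<lambda>n::int. of_real ((of_int n)\<^sup>2) powr (- s)) has_sum Xi s / (Gamma s * of_real pi powr (- s))) (UNIV - {0})"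
  and "Xi s = dzeta s * (Gamma s * of_real pi powr (- s))"
proof -
 have s0: "Re s > 0" using s by simp
 have pos: "n \<in> UNIV - {0} ==> (real_of_int n)\<^sup>2 > 0" for n by simp
 note m = mellin_theta[of "UNIV - {0}" "\<lambda>n. (real_of_int n)\<^sup>2", OF _ pos s0 theta1_summable[OF s]]
 have "(\<integral>x. of_real (theta1 x) * exp (s * of_real x) \<partial>lborel) = Xi s"
  unfolding Xi_def using mellin_half_eq[OF theta1_props, of "1/2" s] theta1_functional m(1) s by simp
 then show *: "((\<lambda>n::int. of_real ((of_int n)\<^sup>2) powr (- s)) has_sum Xi s / (Gamma s * of_real pi powr (- s))) (UNIV - {0})"
  using m(2) by simp
 have "Gamma s ~= 0"
  using s0 Gamma_eq_zero_iff[of s] by (auto elim!: nonpos_Ints_cases)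
 then show "Xi s = dzeta s * (Gamma s * of_real pi powr (- s))"
  using infsumI[OF *] unfolding dzeta_def by simp
qed

lemma norm_powr_of_real: "q > 0 ==> norm (complex_of_real q powr (- s)) = q powr (- Re s)"
 by (simp add: norm_powr_real_powr)

lemma powr_of_real_mult:
 assumes "a > 0" "b > 0"
 shows "complex_of_real (a * b) powr s = of_real a powr s * of_real b powr s"
proof -
 have "complex_of_real (a * b) powr s = exp (s * of_real (ln (a * b)))"
  using assms by (simp add: powr_def Ln_of_real del: of_real_mult)
 also have "... = exp (s * of_real (ln a)) * exp (s * of_real (ln b))"
  using assms by (simp add: ln_mult distrib_left exp_add)
 finally show ?thesis
  using assms by (simp add: powr_def Ln_of_real)
qed

text \<open>Sieving by the primes in P multiplies the sum by 1 - f p for each of them, of modulus at most exp |f p|. As P exhausts the primes only n = 1 and n = -1 remain, which gives the value 2.\<close>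
lemma dzeta_lower_bound:
 assumes s: "Re s > 1 / 2"
 shows "2 <= exp (dzeta_real (Re s)) * norm (dzeta s)"
proof -
 define f where "f n = complex_of_real ((of_int n)\<^sup>2) powr (- s)" for n :: int
 define A where "A = UNIV - {0::int}"
 define S where "S P = {n \<in> A. \<forall>p\<in>P. \<not> p dvd n}" for P
 have nf: "norm (f n) = ((of_int n)\<^sup>2) powr (- Re s)" if "n \<in> A" for n
  unfolding f_def using that by (intro norm_powr_of_real) (auto simp: A_def)
 have fm: "f (m * n) = f m * f n" if "m \<in> A" "n \<in> A" for m n
 proof -
  have "f (m * n) = complex_of_real ((of_int m)\<^sup>2 * (of_int n)\<^sup>2) powr (- s)"
   by (simp add: f_def power_mult_distrib)
  also have "... = f m * f n"
   unfolding f_def by (rule powr_of_real_mult) (use that in \<open>auto simp: A_def\<close>)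
  finally show ?thesis .
 qed
 have smA: "(\<lambda>n. norm (f n)) summable_on A"
  using theta1_summable[OF s] by (subst summable_on_cong[OF nf]) (auto simp: A_def)
 have sm: "f summable_on B" "(\<lambda>n. norm (f n)) summable_on B" if "B \<subseteq> A" for B
 proof -
  show "(\<lambda>n. norm (f n)) summable_on B" by (rule summable_on_subset_banach[OF smA that])
  then show "f summable_on B" by (rule abs_summable_summable)
 qed
 have SA: "S P \<subseteq> A" for P by (auto simp: S_def)
 have step: "infsum f (S (insert p P)) = (1 - f p) * infsum f (S P)"
  if p: "prime p" "p \<notin> P" "\<And>q. q \<in> P ==> prime q" for p P
 proof -
  have p0: "p \<in> A" using p(1) by (auto simp: A_def)
  have img: "(\<lambda>n. p * n) ` S P = {n \<in> S P. p dvd n}"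
  proof (intro equalityI subsetI)
   fix n assume "n \<in> (\<lambda>n. p * n) ` S P"
   then obtain m where m: "n = p * m" "m \<in> S P" by auto
   have "\<not> q dvd p * m" if "q \<in> P" for q
   proof
    assume "q dvd p * m"
    then have "q dvd p"
     using m(2) that p(3)[OF that] prime_dvd_mult_iff by (auto simp: S_def)
    then have "q = p" using primes_dvd_imp_eq p(1) p(3)[OF that] by blast
    then show False using p(2) that by simp
   qed
   then show "n \<in> {n \<in> S P. p dvd n}" using m p0 by (auto simp: S_def A_def)
  next
   fix n assume "n \<in> {n \<in> S P. p dvd n}"
   then obtain m where "n = p * m" "n \<in> S P" by auto
   then have "m \<in> S P" by (auto simp: S_def A_def)
   with \<open>n = p * m\<close> show "n \<in> (\<lambda>n. p * n) ` S P" by blast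
  qed
  have Seq: "S P = S (insert p P) \<union> (\<lambda>n. p * n) ` S P"
   unfolding img by (auto simp: S_def)
  have Sdis: "S (insert p P) \<inter> (\<lambda>n. p * n) ` S P = {}"
   unfolding img by (auto simp: S_def)
  have Ssub: "(\<lambda>n. p * n) ` S P \<subseteq> A"
   unfolding img using SA by auto
  have "infsum f (S P) = infsum f (S (insert p P)) + infsum f ((\<lambda>n. p * n) ` S P)"
   by (subst Seq) (rule infsum_Un_disjoint[OF sm(1)[OF SA] sm(1)[OF Ssub] Sdis])
  also have "infsum f ((\<lambda>n. p * n) ` S P) = infsum (\<lambda>n. f (p * n)) (S P)"
   using p0 by (subst infsum_reindex) (auto simp: inj_on_def o_def A_def)
  also have "... = infsum (\<lambda>n. f p * f n) (S P)"
   using p0 SA by (intro infsum_cong fm) auto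
  also have "... = f p * infsum f (S P)" by (rule infsum_cmult_right')
  finally have "infsum f (S (insert p P)) = infsum f (S P) - f p * infsum f (S P)" by (metis add_diff_cancel_right')
  also have "... = (1 - f p) * infsum f (S P)" by (simp add: left_diff_distrib)
  finally show ?thesis .
 qed
 have prod: "norm (infsum f (S P)) <= exp (\<Sum>p\<in>P. norm (f p)) * norm (infsum f A)"
  if "finite P" "\<And>q. q \<in> P ==> prime q" for P
  using that
 proof (induction P rule: finite_induct)
  case empty
  then show ?case by (simp add: S_def)
 next
  case (insert p P)
  have n1: "norm (1 - f p) <= exp (norm (f p))" by (rule order.trans[OF norm_triangle_ineq4]) simp
  have n2: "norm (infsum f (S P)) <= exp (\<Sum>p\<in>P. norm (f p)) * norm (infsum f A)"
   using insert by auto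
  have "norm (infsum f (S (insert p P))) = norm (1 - f p) * norm (infsum f (S P))"
   using step[of p P] insert by (simp add: norm_mult)
  also have "... <= exp (norm (f p)) * (exp (\<Sum>p\<in>P. norm (f p)) * norm (infsum f A))"
   by (intro mult_mono n1 n2) auto
  finally show ?case
   using insert by (simp add: exp_add mult.assoc)
 qed
 define P where "P N = {p::int. prime p \<and> p <= int N}" for N
 have finP: "finite (P N)" for N by (rule finite_subset[of _ "{0..int N}"]) (auto simp: P_def prime_ge_0_int)
 have bd: "norm (infsum f (S (P N))) <= exp (dzeta_real (Re s)) * norm (dzeta s)" for N
 proof -
  have "(\<Sum>p\<in>P N. norm (f p)) <= (\<Sum>\<^sub>\<infinity>n\<in>A. norm (f n))"
   by (rule finite_sum_le_infsum[OF smA finP]) (auto simp: P_def A_def)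
  also have "... = dzeta_real (Re s)"
   unfolding dzeta_real_def A_def[symmetric] by (rule infsum_cong[OF nf])
  finally have "exp (\<Sum>p\<in>P N. norm (f p)) <= exp (dzeta_real (Re s))" by simp
  moreover have "infsum f A = dzeta s" by (simp add: dzeta_def f_def[abs_def] A_def)
  moreover have "norm (infsum f (S (P N))) <= exp (\<Sum>p\<in>P N. norm (f p)) * norm (infsum f A)"
   by (rule prod[OF finP]) (auto simp: P_def)
  ultimately show ?thesis by (metis (no_types, lifting) mult_right_mono norm_ge_zero order_trans)
 qed
 have lim: "(\<lambda>N. \<Sum>\<^sub>\<infinity>n\<in>A. if n \<in> S (P N) then f n else 0) \<longlonglongrightarrow> (\<Sum>\<^sub>\<infinity>n\<in>A. if n \<in> {1, -1} then f n else 0)"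
 proof (rule infsum_tendsto_dominated[OF _ smA])
  fix n assume n: "n \<in> A"
  show "(\<lambda>N. if n \<in> S (P N) then f n else 0) \<longlonglongrightarrow> (if n \<in> {1, -1} then f n else 0)"
  proof (cases "n \<in> {1, -1}")
   case True
   have "n \<in> S (P N)" for N
   proof -
    have "\<not> p dvd n" if "p \<in> P N" for p
     using that True not_prime_unit[of p] by (auto simp: P_def)
    then show ?thesis using n by (simp add: S_def)
   qed
   then show ?thesis using True by simp
  next
   case False
   have "\<not> is_unit n" using False by auto
   then obtain p where p: "p dvd n" "prime p"
    using prime_divisorE[of n] n by (auto simp: A_def)
   have "\<forall>\<^sub>F N in sequentially. n \<notin> S (P N)"
   proof (rule eventually_sequentiallyI[of "nat p"])
    fix N assume "nat p <= N"
    then have "p \<in> P N" using p by (simp add: P_def)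
    then show "n \<notin> S (P N)" using p by (auto simp: S_def)
   qed
   then have "\<forall>\<^sub>F N in sequentially. (if n \<in> S (P N) then f n else 0) = 0" by eventually_elim simp
   then show ?thesis using False by (simp add: tendsto_eventually)
  qed
 qed auto
 have "(\<Sum>\<^sub>\<infinity>n\<in>A. if n \<in> S (P N) then f n else 0) = infsum f (S (P N))" for N
  using SA by (intro infsum_cong_neutral) auto
 moreover have "(\<Sum>\<^sub>\<infinity>n\<in>A. if n \<in> {1, -1} then f n else 0) = (\<Sum>\<^sub>\<infinity>n\<in>{1, -1}. f n)"
  by (intro infsum_cong_neutral) (auto simp: A_def)
 moreover have "(\<Sum>\<^sub>\<infinity>n\<in>{1, -1}. f n) = 2" by (simp add: f_def)
 ultimately have "(\<lambda>N. infsum f (S (P N))) \<longlonglongrightarrow> 2" using lim by simp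
 then have "(\<lambda>N. norm (infsum f (S (P N)))) \<longlonglongrightarrow> norm (2::complex)" by (rule tendsto_norm)
 then have "norm (2::complex) <= exp (dzeta_real (Re s)) * norm (dzeta s)" by (rule LIMSEQ_le_const2) (use bd in auto)
 then show ?thesis by simp
qed

lemma dzeta_real_antimono:
 assumes "1 / 2 < \<sigma>" "\<sigma> <= \<tau>"
 shows "dzeta_real \<tau> <= dzeta_real \<sigma>"
 unfolding dzeta_real_def
proof (rule infsum_mono)
 fix n :: int assume "n \<in> UNIV - {0}"
 then have "\<bar>real_of_int n\<bar> >= 1" by auto
 then have "(real_of_int n)\<^sup>2 >= 1" by (metis one_power2 power2_abs power_mono zero_le_one)
 then show "((real_of_int n)\<^sup>2) powr (- \<tau>) <= ((real_of_int n)\<^sup>2) powr (- \<sigma>)"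
  using assms by (intro powr_mono) auto
qed (use assms theta1_summable in auto)

lemma Xi_nonzero: "Re s > 1 / 2 ==> Xi s ~= 0"
proof -
 assume s: "Re s > 1 / 2"
 have "Gamma s ~= 0"
  using s Gamma_eq_zero_iff[of s] by (auto elim!: nonpos_Ints_cases)
 moreover have "dzeta s ~= 0" using dzeta_lower_bound[OF s] by auto
 ultimately show ?thesis using Xi_series(2)[OF s] by simp
qed

text \<open>The lattice sum factors as the sum over multiples times the sum over primitive vectors.\<close>
lemma prim_sum_eq:
 assumes z: "Im z > 0" and s: "Re s > 1"
 shows "eisenstein_series z s = Lam z s / Xi s"
  and "(\<lambda>v. norm (complex_of_real (qform z v) powr (- s))) summable_on lat"
proof -
 define f where "f n = complex_of_real ((of_int n)\<^sup>2) powr (- s)" for n :: int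
 define g where "g v = complex_of_real (qform z v) powr (- s)" for v
 define c where "c = Gamma s * of_real pi powr (- s)"
 have c: "c ~= 0"
  using s Gamma_eq_zero_iff[of s] by (auto simp: c_def elim!: nonpos_Ints_cases)
 have ng: "norm (g v) = qform z v powr (- Re s)" if "v \<in> lat" for v
  unfolding g_def using qform_pos[OF z that] by (rule norm_powr_of_real)
 show nsm: "(\<lambda>v. norm (complex_of_real (qform z v) powr (- s))) summable_on lat"
 proof -
  have "(\<lambda>v. norm (g v)) summable_on lat \<longleftrightarrow> (\<lambda>v. qform z v powr - Re s) summable_on lat"
   by (rule summable_on_cong[OF ng])
  then show ?thesis using qform_summable[OF z s] by (simp only: g_def)
 qed
 have "g summable_on lat" unfolding g_def using abs_summable_summable[OF nsm] .
 then have "(\<lambda>p. g (case p of (n, v) => (n * fst v, n * snd v))) summable_on (UNIV - {0}) \<times> prim"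
  by (subst summable_on_reindex_bij_betw[OF bij_prim_lat])
 moreover have fg: "g (case p of (n, v) => (n * fst v, n * snd v)) = f (fst p) * g (snd p)" if "p \<in> (UNIV - {0}) \<times> prim" for p
 proof -
  obtain n v where p: "p = (n, v)" by (cases p)
  have nv: "n ~= 0" "v \<in> prim" using that by (auto simp: p)
  have "qform z (n * fst v, n * snd v) = (of_int n)\<^sup>2 * qform z v"
   by (cases v) (simp only: qform_scale fst_conv snd_conv)
  moreover have "complex_of_real ((of_int n)\<^sup>2 * qform z v) powr (- s) = complex_of_real ((of_int n)\<^sup>2) powr (- s) * complex_of_real (qform z v) powr (- s)"
   by (rule powr_of_real_mult) (use nv qform_pos[OF z prim_lat] in auto)
  ultimately show ?thesis
   unfolding p g_def f_def by (simp only: prod.case fst_conv snd_conv)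
 qed
 ultimately have sm: "(\<lambda>p. f (fst p) * g (snd p)) summable_on (UNIV - {0}) \<times> prim"
  using summable_on_cong[of "(UNIV - {0}) \<times> prim" "\<lambda>p. g (case p of (n, v) => (n * fst v, n * snd v))" "\<lambda>p. f (fst p) * g (snd p)", OF fg]
  by (simp only:)
 have "infsum g lat = (\<Sum>\<^sub>\<infinity>p\<in>(UNIV - {0}) \<times> prim. g (case p of (n, v) => (n * fst v, n * snd v)))"
  by (rule infsum_reindex_bij_betw[OF bij_prim_lat, symmetric])
 also have "... = (\<Sum>\<^sub>\<infinity>p\<in>(UNIV - {0}) \<times> prim. f (fst p) * g (snd p))"
  by (rule infsum_cong[OF fg])
 also have "... = (\<Sum>\<^sub>\<infinity>n\<in>UNIV - {0}. \<Sum>\<^sub>\<infinity>v\<in>prim. f n * g v)"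
  using infsum_Sigma_banach[OF sm] by simp
 also have "... = dzeta s * infsum g prim" by (simp add: infsum_cmult_right' infsum_cmult_left' dzeta_def f_def)
 finally have 1: "infsum g lat = dzeta s * infsum g prim" .
 have "infsum g lat = Lam z s / c"
  unfolding g_def c_def by (rule infsumI[OF Lam_series[OF z s]])
 moreover have "Xi s = dzeta s * c" using Xi_series(2)[of s] s by (simp add: c_def)
 moreover have "Xi s ~= 0" using Xi_nonzero[of s] s by simp
 ultimately have "infsum g prim = Lam z s / Xi s"
  using 1 c by (simp add: field_simps)
 then show "eisenstein_series z s = Lam z s / Xi s"
  unfolding eisenstein_series_prim[OF z] g_def .
qed

text \<open>Removing singularities of the difference gives a meromorphic function that vanishes on an open set.\<close>
lemma nicely_meromorphic_unique:
 assumes f: "f nicely_meromorphic_on UNIV" and g: "g nicely_meromorphic_on UNIV"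
  and U: "open U" "u \<in> U" and eq: "\<And>s. s \<in> U ==> f s = g s"
 shows "f = g"
proof
 fix p
 define D where "D = remove_sings (\<lambda>s. f s - g s)"
 have mer: "(\<lambda>s. f s - g s) meromorphic_on UNIV"
  using f g by (auto simp: nicely_meromorphic_on_def intro!: meromorphic_intros)
 have D: "D nicely_meromorphic_on UNIV"
  unfolding D_def using mer by (rule remove_sings_nicely_meromorphic)
 have iso: "isolated_singularity_at (\<lambda>s. f s - g s) w" for w
  using mer meromorphic_on_isolated_singularity meromorphic_on_subset by blast
 have evD: "\<forall>\<^sub>F w in at v. D w = f w - g w" for v
  unfolding D_def using iso by (rule eventually_remove_sings_eq_at)
 have "\<forall>\<^sub>F w in at u. w \<in> U" using U by (intro eventually_at_in_open') auto
 with evD[of u] have "\<forall>\<^sub>F w in at u. D w = 0" by eventually_elim (use eq in auto)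
 then have "\<exists>\<^sub>F w in at u. D w = 0" using eventually_frequently[of "at u"] by simp
 then have "D w = 0" for w
  by (rule frequently_eq_meromorphic_imp_constant[OF _ D open_UNIV connected_UNIV UNIV_I UNIV_I])
 then have ev: "\<forall>\<^sub>F w in at p. f w = g w"
  using evD[of p] by (auto elim: eventually_mono)
 have lf: "(is_pole f p \<and> f p = 0) \<or> f \<midarrow>p\<rightarrow> f p" and lg: "(is_pole g p \<and> g p = 0) \<or> g \<midarrow>p\<rightarrow> g p"
  using f g by (auto simp: nicely_meromorphic_on_def)
 have pe: "is_pole f p \<longleftrightarrow> is_pole g p" by (rule is_pole_cong[OF ev refl])
 have le: "f \<midarrow>p\<rightarrow> c \<longleftrightarrow> g \<midarrow>p\<rightarrow> c" for c
  by (rule tendsto_cong[OF ev])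
 have excl: "\<not> (is_pole f p \<and> f \<midarrow>p\<rightarrow> c)" for c
  unfolding is_pole_def using not_tendsto_and_filterlim_at_infinity[of "at p" f c] by auto
 show "f p = g p"
 proof (cases "is_pole f p")
  case True
  then have nf: "\<not> f \<midarrow>p\<rightarrow> c" for c using excl by blast
  then have "\<not> g \<midarrow>p\<rightarrow> c" for c using le by blast
  then show ?thesis using nf lf lg by simp
 next
  case False
  then have "f \<midarrow>p\<rightarrow> f p" "g \<midarrow>p\<rightarrow> g p" using lf lg pe by blast+
  then show ?thesis using le LIM_unique by blast
 qed
qed

lemma mellin_half_theta2_holomorphic: "Im z > 0 ==> mellin_half 1 (theta2 z) holomorphic_on UNIV"
 using mellin_half_holomorphic[OF theta2_props] .

lemma mellin_half_theta1_holomorphic: "mellin_half \<kappa> theta1 holomorphic_on UNIV"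
 using mellin_half_holomorphic[OF theta1_props] .

lemma eisenstein_quotient_holomorphic:
 assumes z: "Im z > 0"
 shows "(\<lambda>s. Lam z s / Xi s) holomorphic_on {s. Re s > 1 / 2} - {1}"
proof -
 have "mellin_half 1 (theta2 z) holomorphic_on {s. Re s > 1 / 2} - {1}" "mellin_half (1/2) theta1 holomorphic_on {s. Re s > 1 / 2} - {1}"
  using mellin_half_theta2_holomorphic[OF z] mellin_half_theta1_holomorphic holomorphic_on_subset by blast+
 moreover have "s ~= 0 \<and> s - 1 / 2 ~= 0 \<and> s - 1 ~= 0" if "s \<in> {s. Re s > 1 / 2} - {1}" for s
  using that by (auto simp: complex_eq_iff)
 ultimately show ?thesis
  using Xi_nonzero unfolding Lam_def Xi_def by (intro holomorphic_intros) auto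
qed

text \<open>The definite description is resolved: the quotient is meromorphic on the plane, its regularization is nicely meromorphic, and there is no other continuation.\<close>
lemma eisenstein_eq:
 assumes z: "Im z > 0"
 shows "eisenstein z = remove_sings (\<lambda>s. Lam z s / Xi s)"
  and "Re s > 1 / 2 ==> s ~= 1 ==> eisenstein z s = Lam z s / Xi s"
proof -
 define F where "F = remove_sings (\<lambda>s. Lam z s / Xi s)"
 have op: "open ({s. Re s > 1 / 2} - {1})" by (rule open_Diff[OF open_halfspace_Re_gt closed_singleton])
 have F: "F s = Lam z s / Xi s" if "Re s > 1 / 2" "s ~= 1" for s
 proof -
  have "(\<lambda>s. Lam z s / Xi s) analytic_on {s}"
   unfolding analytic_at using eisenstein_quotient_holomorphic[OF z] op that
   by (intro exI[of _ "{s. Re s > 1 / 2} - {1}"]) simp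
  then show ?thesis unfolding F_def by (rule remove_sings_at_analytic)
 qed
 have "mellin_half 1 (theta2 z) meromorphic_on UNIV" "mellin_half (1/2) theta1 meromorphic_on UNIV"
  using mellin_half_theta2_holomorphic[OF z] mellin_half_theta1_holomorphic
  by (auto intro!: analytic_on_imp_meromorphic_on simp: analytic_on_open)
 then have "(\<lambda>s. Lam z s / Xi s) meromorphic_on UNIV"
  unfolding Lam_def Xi_def by (intro meromorphic_intros)
 then have Fn: "F nicely_meromorphic_on UNIV"
  unfolding F_def by (rule remove_sings_nicely_meromorphic)
 have Fs: "F s = eisenstein_series z s" if "Re s > 1" for s
 proof -
  have "s ~= 1" using that by auto
  then show ?thesis using F[of s] prim_sum_eq(1)[OF z that] that by simp
 qed
 show E: "eisenstein z = remove_sings (\<lambda>s. Lam z s / Xi s)"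
  unfolding eisenstein_def F_def[symmetric]
 proof (rule the_equality)
  show "F nicely_meromorphic_on UNIV \<and> (\<forall>s. 1 < Re s --> F s = eisenstein_series z s)"
   using Fn Fs by auto
  fix g assume g: "g nicely_meromorphic_on UNIV \<and> (\<forall>s. 1 < Re s --> g s = eisenstein_series z s)"
  show "g = F" by (rule nicely_meromorphic_unique[of _ _ "{s. Re s > 1}" 2])
    (use g Fn Fs open_halfspace_Re_gt in auto)
 qed
 show "Re s > 1 / 2 ==> s ~= 1 ==> eisenstein z s = Lam z s / Xi s"
  using F unfolding E F_def .
qed

lemma eisenstein_invariant:
 assumes "Im z > 0" "a * d - b * c = 1"
 shows "eisenstein (moebius a b c d z) = eisenstein z"
 unfolding eisenstein_eq(1)[OF moebius_uhp[OF assms]] eisenstein_eq(1)[OF assms(1)]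
 by (simp add: Lam_def theta2_invariant[OF assms])

lemma mellin_half_cnj: "mellin_half \<kappa> G (cnj s) = cnj (mellin_half \<kappa> G s)"
 unfolding mellin_half_def by (subst Bochner_Integration.integral_cnj[symmetric]) (simp add: exp_cnj)

lemma eisenstein_cnj:
 assumes "Im z > 0" "Re s > 1 / 2" "s ~= 1"
 shows "eisenstein z (cnj s) = cnj (eisenstein z s)"
proof -
 have "cnj s ~= 1" using assms(3) by (metis complex_cnj_cnj complex_cnj_one)
 then show ?thesis
  using assms by (simp add: eisenstein_eq(2) Lam_def Xi_def mellin_half_cnj)
qed

lemma eisenstein_prim:
 assumes "Im z > 0" "Re s > 1"
 shows "eisenstein z s = (\<Sum>\<^sub>\<infinity>v\<in>prim. of_real (qform z v) powr (- s))"
proof -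
 have "s ~= 1" using assms by auto
 then show ?thesis
  using eisenstein_eq(2)[OF assms(1), of s] prim_sum_eq(1)[OF assms] eisenstein_series_prim[OF assms(1)] assms by simp
qed

lemma eisenstein_lat:
 assumes "Im z > 0" "Re s > 1"
 shows "((\<lambda>v. of_real (qform z v) powr (- s)) has_sum dzeta s * eisenstein z s) lat"
proof -
 have "s ~= 1" "Re s > 1 / 2" using assms by auto
 moreover have "Gamma s ~= 0"
  using assms Gamma_eq_zero_iff[of s] by (auto elim!: nonpos_Ints_cases)
 ultimately have "Lam z s / (Gamma s * of_real pi powr (- s)) = dzeta s * eisenstein z s"
  using eisenstein_eq(2)[OF assms(1), of s] Xi_series(2)[of s] Xi_nonzero[of s] by (auto simp: field_simps)
 then show ?thesis using Lam_series[OF assms] by simp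
qed

section \<open>Regularity in both variables\<close>

definition half_domain :: "complex set" where "half_domain = {s. Re s > 1 / 2} - {1}"

lemma half_domain: "open half_domain" "connected half_domain"
proof -
 show "open half_domain"
  unfolding half_domain_def by (rule open_Diff[OF open_halfspace_Re_gt closed_singleton])
 show "connected half_domain"
  unfolding half_domain_def
  by (rule connected_open_delete[OF open_halfspace_Re_gt convex_connected[OF convex_halfspace_Re_gt]]) simp
qed

lemma half_domainI: "Re s > 1 ==> s \<in> half_domain" by (auto simp: half_domain_def)

lemma holomorphic_dzeta: "dzeta holomorphic_on half_domain"
proof -
 have h: "mellin_half (1/2) theta1 holomorphic_on half_domain" 
  using mellin_half_theta1_holomorphic holomorphic_on_subset by blast
 have G: "Gamma s ~= 0" if "s \<in> half_domain" for s
  using that Gamma_eq_zero_iff[of s] by (auto simp: half_domain_def elim!: nonpos_Ints_cases)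
 have "(\<lambda>s. (mellin_half (1 / 2) theta1 s + 1 / (s - 1 / 2) - 1 / s) / (Gamma s * of_real pi powr (- s))) holomorphic_on half_domain"
 proof -
  have nz: "s ~= 0" "s - 1 / 2 ~= 0" "s \<notin> \<int>\<^sub>\<le>\<^sub>0" if "s \<in> half_domain" for s
   using that by (auto simp: half_domain_def complex_eq_iff elim!: nonpos_Ints_cases)
  have "Gamma holomorphic_on half_domain" by (rule holomorphic_Gamma) (use nz(3) in blast)
  then show ?thesis
   using h G nz by (intro holomorphic_intros) auto
 qed
 then show ?thesis
 proof (rule holomorphic_transform)
  fix s assume s: "s \<in> half_domain"
  then show "(mellin_half (1 / 2) theta1 s + 1 / (s - 1 / 2) - 1 / s) / (Gamma s * of_real pi powr (- s)) = dzeta s"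
   using Xi_series(2)[of s] G[OF s] unfolding Xi_def by (simp add: half_domain_def)
 qed
qed

lemma eisenstein_holomorphic: "Im z > 0 ==> eisenstein z holomorphic_on half_domain"
 by (rule holomorphic_transform[OF eisenstein_quotient_holomorphic[of z, folded half_domain_def]])
  (auto simp: half_domain_def eisenstein_eq(2))

text \<open>The comparison of qform with lsize is uniform in z on compact sets, hence so is the decay of the theta series.\<close>
lemma mellin_half_theta2_bound:
 assumes a: "a > 0"
 shows "\<exists>C. \<forall>z s. Im z >= a --> norm z <= R --> \<bar>Re s\<bar> <= B --> norm (mellin_half 1 (theta2 z) s) <= C"
proof -
 define A where "A = \<bar>B\<bar> + 2"
 have A: "A > 1" "A > 0" by (auto simp: A_def)
 define C where "C = A powr A * pi powr (- A) * (lconst a R powr A * (\<Sum>\<^sub>\<infinity>v\<in>lat. lsize v powr (- A)))"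
 have "norm (mellin_half 1 (theta2 z) s) <= 2 * C * (\<integral>x. indicator {0..} x * exp (- x) \<partial>lborel)"
  if z: "Im z >= a" "norm z <= R" and s: "\<bar>Re s\<bar> <= B" for z s
 proof -
  have z0: "Im z > 0" using z a by simp
  have sum: "(\<Sum>\<^sub>\<infinity>v\<in>lat. qform z v powr (- A)) <= lconst a R powr A * (\<Sum>\<^sub>\<infinity>v\<in>lat. lsize v powr (- A))"
   unfolding infsum_cmult_right'[symmetric]
  proof (rule infsum_mono[OF qform_summable[OF z0 A(1)]])
   show "(\<lambda>v. lconst a R powr A * lsize v powr (- A)) summable_on lat"
    by (intro summable_on_cmult_right summable_on_subset_banach[OF lsize_summable[OF A(1)]]) auto
  qed (use qform_powr_le[OF a z] A in auto)
  have G: "\<bar>theta2 z x\<bar> <= C * exp (- A * x)" for x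
  proof -
   note b = theta_bound(2,3)[OF qform_pos[OF z0] A(2) qform_summable[OF z0 A(1)], of x]
   have "theta2 z x <= A powr A * pi powr (- A) * (lconst a R powr A * (\<Sum>\<^sub>\<infinity>v\<in>lat. lsize v powr (- A))) * exp (- A * x)"
    using sum by (intro order.trans[OF b(2)] mult_right_mono mult_left_mono) auto
   then show ?thesis using b(1) by (simp add: C_def)
  qed
  have int: "integrable lborel (\<lambda>x::real. indicator {0..} x * exp (- x))"
   using integrable_norm[OF exp_half_line(1)[of 1]] by (simp add: norm_mult)
  define F where "F x = complex_of_real (indicator {0..} x * theta2 z x) * (exp (s * of_real x) + exp ((of_real 1 - s) * of_real x))" for x
  have bound: "norm (F x) <= 2 * C * (indicator {0..} x * exp (- x))" for x
   unfolding F_def by (rule mellin_half_bound[of _ _ A]) (use G s in \<open>auto simp: A_def\<close>)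
  note [measurable] = theta2_props(1)[OF z0]
  have [measurable]: "(\<lambda>x. exp (w * complex_of_real x)) \<in> borel_fun" for w
   by (intro borel_measurable_continuous_onI continuous_intros)
  have meas: "F \<in> borel_measurable lborel"
   unfolding F_def by measurable
  have int2: "integrable lborel (\<lambda>x. 2 * C * (indicator {0..} x * exp (- x)))"
   using int by simp
  have "integrable lborel F"
  proof (rule lint_bound[OF int2 meas], rule AE_I2)
   show "norm (F x) <= norm (2 * C * (indicator {0..} x * exp (- x)))" for x
    using bound[of x] by (rule order.trans) simp
  qed
  then have "norm (\<integral>x. F x \<partial>lborel) <= (\<integral>x. 2 * C * (indicator {0..} x * exp (- x)) \<partial>lborel)"
   using int2 bound by (intro lint_norm_bound)
  then have "norm (mellin_half 1 (theta2 z) s) <= (\<integral>x. 2 * C * (indicator {0..} x * exp (- x)) \<partial>lborel)"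
   by (simp only: mellin_half_def F_def)
  then show ?thesis using int by simp
 qed
 then show ?thesis by blast
qed

lemma eisenstein_locally_bounded:
 assumes a: "a > 0" and K: "compact K" "K \<subseteq> half_domain"
 shows "\<exists>C. \<forall>z s. Im z >= a --> norm z <= R --> s \<in> K --> norm (eisenstein z s) <= C"
proof -
 have "bounded (Re ` K)"
  using K(1) by (intro compact_imp_bounded compact_continuous_image continuous_intros)
 then obtain B where B: "\<And>s. s \<in> K ==> \<bar>Re s\<bar> <= B" by (auto simp: bounded_iff)
 obtain C where C: "\<And>z s. Im z >= a ==> norm z <= R ==> \<bar>Re s\<bar> <= B ==> norm (mellin_half 1 (theta2 z) s) <= C"
  using mellin_half_theta2_bound[OF a, of R B] by blast
 have nz: "s ~= 0 \<and> s - 1 ~= 0 \<and> s - 1/2 ~= 0 \<and> Xi s ~= 0" if "s \<in> K" for s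
  using that K(2) Xi_nonzero[of s] by (auto simp: half_domain_def complex_eq_iff)
 have "continuous_on K (\<lambda>s. 1 / (s - 1) - 1 / s)"
  using nz by (intro continuous_intros) auto
 then obtain D where D: "\<And>s. s \<in> K ==> norm (1 / (s - 1) - 1 / s) <= D"
  using compact_continuous_image[OF _ K(1)] compact_imp_bounded by (fastforce simp: bounded_iff)
 have "mellin_half (1/2) theta1 holomorphic_on K"
  using mellin_half_theta1_holomorphic holomorphic_on_subset by blast
 then have "continuous_on K (\<lambda>s. 1 / Xi s)"
  unfolding Xi_def using nz by (intro continuous_intros holomorphic_on_imp_continuous_on) (auto simp: Xi_def)
 then obtain M where M: "\<And>s. s \<in> K ==> norm (1 / Xi s) <= M"
  using compact_continuous_image[OF _ K(1)] compact_imp_bounded by (fastforce simp: bounded_iff)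
 have "norm (eisenstein z s) <= (C + D) * M" if z: "Im z >= a" "norm z <= R" and s: "s \<in> K" for z s
 proof -
  have "eisenstein z s = Lam z s * (1 / Xi s)"
   using eisenstein_eq(2)[of z s] z s a K(2) by (auto simp: half_domain_def)
  moreover have L: "norm (Lam z s) <= C + D"
   using norm_triangle_ineq[of "mellin_half 1 (theta2 z) s" "1 / (s - 1) - 1 / s"] C[OF z B[OF s]] D[OF s]
   by (simp add: Lam_def add_diff_eq[symmetric])
  moreover have "norm (Lam z s * (1 / Xi s)) <= (C + D) * M"
   unfolding norm_mult by (intro mult_mono L M[OF s] order.trans[OF norm_ge_zero L] norm_ge_zero)
  ultimately show ?thesis by simp
 qed
 then show ?thesis by blast
qed

lemma dzeta_nonzero: "Re s > 1 / 2 ==> dzeta s ~= 0"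
 using dzeta_lower_bound[of s] by auto

lemma eisenstein_lat_eq:
 assumes "Im z > 0" "Re s > 1"
 shows "eisenstein z s = (\<Sum>\<^sub>\<infinity>v\<in>lat. of_real (qform z v) powr (- s)) / dzeta s"
 using infsumI[OF eisenstein_lat[OF assms]] dzeta_nonzero[of s] assms by simp

text \<open>Vitali along z: the values at a convergent sequence of points are locally bounded holomorphic functions of s that converge where the series does.\<close>
lemma eisenstein_continuous:
 assumes s: "s \<in> half_domain"
 shows "continuous_on uhp (\<lambda>z. eisenstein z s)"
 unfolding continuous_on_sequentially
proof (intro allI ballI impI)
 fix x :: "nat => complex" and z assume z: "z \<in> uhp" and "(\<forall>n. x n \<in> uhp) \<and> x \<longlonglongrightarrow> z"
 then have xu: "\<And>n. Im (x n) > 0" and lim: "x \<longlonglongrightarrow> z" by auto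
 define a where "a = Im z / 2"
 have a: "a > 0" using z by (simp add: a_def)
 have "\<forall>\<^sub>F n in sequentially. Im (x n) > a"
  using order_tendstoD(1)[OF tendsto_Im[OF lim], of a] z by (simp add: a_def)
 then obtain N where "\<And>n. n >= N ==> Im (x n) > a" by (auto simp: eventually_sequentially)
 then have N: "\<And>n. n >= N ==> Im (x n) >= a"
  using less_imp_le by blast
 obtain R where R: "\<And>n. norm (x n) <= R"
  using convergent_imp_Bseq[OF convergentI[OF lim]] by (auto simp: Bseq_def)
 define y where "y n = x (n + N)" for n
 have y: "Im (y n) >= a" "norm (y n) <= R" "Im (y n) > 0" for n
  using N[of "n + N"] R xu by (auto simp: y_def)
 have ylim: "y \<longlonglongrightarrow> z" unfolding y_def using lim by (rule LIMSEQ_ignore_initial_segment)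
 have "(\<lambda>n. eisenstein (y n) s) \<longlonglongrightarrow> eisenstein z s"
 proof (rule Vitali_tendsto[OF half_domain, where f = "\<lambda>n. eisenstein (y n)" and U = "{s. Re s > 1}"])
  show "eisenstein (y n) holomorphic_on half_domain" for n by (rule eisenstein_holomorphic[OF y(3)])
  show "eisenstein z holomorphic_on half_domain"
   using z by (intro eisenstein_holomorphic) auto
  show "\<exists>B. \<forall>n. \<forall>s\<in>K. cmod (eisenstein (y n) s) <= B" if "compact K" "K \<subseteq> half_domain" for K
   using eisenstein_locally_bounded[OF a that, of R] y by blast
  show "open {s. Re s > 1}" by (rule open_halfspace_Re_gt)
  show "{s. Re s > 1} \<subseteq> half_domain" by (auto intro: half_domainI)
  have "2 \<in> {s. Re s > 1}" by simp
  then show "{s. Re s > 1} ~= {}" by blast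
  show "(\<lambda>n. eisenstein (y n) s) \<longlonglongrightarrow> eisenstein z s" if "s \<in> {s. Re s > 1}" for s
  proof -
   have s: "Re s > 1" using that by simp
   have z0: "Im z > 0" using z by simp
   have "(\<lambda>n. \<Sum>\<^sub>\<infinity>v\<in>lat. complex_of_real (qform (y n) v) powr (- s)) \<longlonglongrightarrow> (\<Sum>\<^sub>\<infinity>v\<in>lat. of_real (qform z v) powr (- s))"
   proof (rule infsum_tendsto_dominated)
    show "(\<lambda>v. lconst a R powr (Re s) * lsize v powr (- Re s)) summable_on lat"
     by (intro summable_on_cmult_right summable_on_subset_banach[OF lsize_summable[OF s]]) auto
    show "\<forall>\<^sub>F n in sequentially. \<forall>v\<in>lat. norm (complex_of_real (qform (y n) v) powr (- s)) <= lconst a R powr (Re s) * lsize v powr (- Re s)"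
     using qform_powr_le[OF a y(1,2), of _ "Re s"] qform_pos[OF y(3)] s
     by (intro always_eventually) (auto simp: norm_powr_of_real)
    show "(\<lambda>n. complex_of_real (qform (y n) v) powr (- s)) \<longlonglongrightarrow> of_real (qform z v) powr (- s)" if v: "v \<in> lat" for v
    proof (rule tendsto_powr_complex)
     show "(\<lambda>n. complex_of_real (qform (y n) v)) \<longlonglongrightarrow> of_real (qform z v)"
      unfolding qform_def using z0 by (intro tendsto_intros ylim) auto
     show "complex_of_real (qform z v) \<notin> \<real>\<^sub>\<le>\<^sub>0"
      using qform_pos[OF z0 v] by simp
    qed auto
   qed auto
   then have "(\<lambda>n. (\<Sum>\<^sub>\<infinity>v\<in>lat. complex_of_real (qform (y n) v) powr (- s)) / dzeta s) \<longlonglongrightarrow> (\<Sum>\<^sub>\<infinity>v\<in>lat. of_real (qform z v) powr (- s)) / dzeta s"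
    using dzeta_nonzero[of s] s by (intro tendsto_intros) auto
   then show ?thesis
    using eisenstein_lat_eq[OF y(3) s] eisenstein_lat_eq[OF z0 s] by simp
  qed
 qed (use s in auto)
 then have "(\<lambda>n. eisenstein (x n) s) \<longlonglongrightarrow> eisenstein z s"
  unfolding y_def by (rule LIMSEQ_offset)
 then show "((\<lambda>z. eisenstein z s) \<circ> x) \<longlonglongrightarrow> eisenstein z s" by (simp add: o_def)
qed

text \<open>The function on a horizontal line from which every lattice term is obtained by scaling; its modulus depends on Re s only.\<close>
definition bracket :: "complex => real => complex" where
 "bracket s u = of_real (1 + u\<^sup>2) powr (- s)"

lemma norm_bracket: "norm (bracket s u) = (1 + u\<^sup>2) powr (- Re s)"
 unfolding bracket_def by (rule norm_powr_of_real) (simp add: add_pos_nonneg)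

lemma bracket_measurable [measurable]: "bracket s \<in> borel_fun"
proof -
 have "bracket s = (\<lambda>u. exp (- s * of_real (ln (1 + u\<^sup>2))))"
 proof
  fix u :: real
  have "1 + u\<^sup>2 > 0" by (simp add: add_pos_nonneg)
  then show "bracket s u = exp (- s * of_real (ln (1 + u\<^sup>2)))"
   unfolding bracket_def powr_def by (simp add: Ln_of_real del: of_real_add of_real_power)
 qed
 then show ?thesis by (simp add: borel_measurable_exp)
qed

lemma integrable_bracket_real:
 assumes "\<sigma> > 1 / 2"
 shows "integrable lborel (\<lambda>u::real. (1 + u\<^sup>2) powr (- \<sigma>))"
proof -
 have "((\<lambda>x. x powr (- 2 * \<sigma>)) has_integral - (1 powr (- 2 * \<sigma> + 1)) / (- 2 * \<sigma> + 1)) {1..}"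
  using assms by (intro has_integral_powr_to_inf) auto
 then have "(\<lambda>x. x powr (- 2 * \<sigma>)) absolutely_integrable_on {1..}"
  by (intro nonnegative_absolutely_integrable_1) (auto simp: integrable_on_def)
 then have i: "integrable lborel (\<lambda>x. indicator {1..} x * x powr (- 2 * \<sigma>))"
  by (simp add: set_integrable_def integrable_completion)
 then have i': "integrable lborel (\<lambda>x. indicator {1..} (0 + (-1) * x) * (0 + (-1) * x) powr (- 2 * \<sigma>))"
  by (rule lborel_integrable_real_affine) simp
 have i0: "integrable lborel (\<lambda>x::real. indicator {-1..1} x :: real)"
  by (rule integrable_real_indicator) (auto simp: emeasure_lborel_Icc_eq)
 have "integrable lborel (\<lambda>x. (indicator {1..} x * x powr (- 2 * \<sigma>) + indicator {1..} (0 + (-1) * x) * (0 + (-1) * x) powr (- 2 * \<sigma>)) + indicator {-1..1} x)"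
  by (intro Bochner_Integration.integrable_add i i' i0)
 then show ?thesis
 proof (rule lint_bound)
  have le: "(1 + u\<^sup>2) powr (- \<sigma>) <= \<bar>u\<bar> powr (- 2 * \<sigma>)" if "\<bar>u\<bar> >= 1" for u :: real
  proof -
   have "(1 + u\<^sup>2) powr (- \<sigma>) <= (\<bar>u\<bar> powr 2) powr (- \<sigma>)"
    using assms that by (intro powr_mono2') (auto simp: powr_numeral)
   also have "... = \<bar>u\<bar> powr (2 * - \<sigma>)" by (rule powr_powr)
   finally show ?thesis by simp
  qed
  have le1: "(1 + u\<^sup>2) powr (- \<sigma>) <= 1" for u :: real
  proof -
   have "(1 + u\<^sup>2) powr (- \<sigma>) <= (1 + u\<^sup>2) powr 0"
    using assms by (intro powr_mono) auto
   also have "... = 1" by (simp add: add_pos_nonneg less_imp_neq[symmetric])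
   finally show ?thesis .
  qed
  show "AE u in lborel. norm ((1 + u\<^sup>2) powr (- \<sigma>)) <= norm ((indicator {1..} u * u powr (- 2 * \<sigma>) + indicator {1..} (0 + (-1) * u) * (0 + (-1) * u) powr (- 2 * \<sigma>)) + indicator {-1..1} u)"
  proof (intro AE_I2)
   fix u :: real
   consider "u > 1" | "u < -1" | "\<bar>u\<bar> <= 1" by linarith
   then show "norm ((1 + u\<^sup>2) powr (- \<sigma>)) <= norm ((indicator {1..} u * u powr (- 2 * \<sigma>) + indicator {1..} (0 + (-1) * u) * (0 + (-1) * u) powr (- 2 * \<sigma>)) + indicator {-1..1} u)"
    by cases (use le[of u] le1[of u] in \<open>auto simp: indicator_def\<close>)
  qed
 qed simp
qed

lemma integrable_bracket: "Re s > 1 / 2 ==> integrable lborel (bracket s)"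
 using integrable_bracket_real[of "Re s"] by (rule lint_bound) (auto simp: norm_bracket)

definition bracket_hat :: "complex => real => complex" where
 "bracket_hat s \<eta> = fourier (bracket s) \<eta>"

lemma bracket_hat_holomorphic: "(\<lambda>s. bracket_hat s \<eta>) holomorphic_on half_domain"
 unfolding bracket_hat_def fourier_def
proof (rule holomorphic_on_lebesgue_integral)
 show "(\<lambda>s. bracket s u * cis (- (2 * pi * \<eta> * u))) holomorphic_on half_domain" for u
 proof -
  have "1 + (of_real u)\<^sup>2 ~= (0::complex)"
   by (metis add_pos_nonneg less_irrefl of_real_1 of_real_add of_real_eq_0_iff of_real_power zero_le_power2 zero_less_one)
  then show ?thesis
   unfolding bracket_def by (intro holomorphic_intros)
 qed
 show "(\<lambda>u. bracket s u * cis (- (2 * pi * \<eta> * u))) \<in> borel_measurable lborel" for s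
 proof -
  have [measurable]: "(\<lambda>u. cis (- (2 * pi * \<eta> * u))) \<in> borel_fun"
   by (intro borel_measurable_continuous_onI continuous_intros)
  show ?thesis by measurable
 qed
 fix s assume s: "s \<in> half_domain"
 obtain r where r: "r > 0" "cball s r \<subseteq> half_domain"
  using half_domain(1) s open_contains_cball by blast
 define r' where "r' = min r ((Re s - 1/2) / 2)"
 have sr: "Re s > 1/2" using s by (simp add: half_domain_def)
 have r': "r' > 0" "cball s r' \<subseteq> half_domain" "Re s - r' > 1/2"
  using r sr by (auto simp: r'_def min_def subset_iff field_simps)
 have "norm (bracket w u * cis (- (2 * pi * \<eta> * u))) <= (1 + u\<^sup>2) powr (- (Re s - r'))" if "w \<in> cball s r'" for w u
 proof -
  have "Re w >= Re s - r'" using that abs_Re_le_cmod[of "s - w"] by (simp add: dist_norm)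
  then show ?thesis by (simp add: norm_mult norm_bracket) (intro powr_mono; simp)
 qed
 then show "\<exists>r>0. \<exists>g. integrable lborel g \<and> cball s r \<subseteq> half_domain \<and> (\<forall>w\<in>cball s r. \<forall>u\<in>space lborel. cmod (bracket w u * cis (- (2 * pi * \<eta> * u))) <= g u)"
  using r' integrable_bracket_real[OF r'(3)] by (intro exI[of _ r'] conjI exI[of _ "\<lambda>u. (1 + u\<^sup>2) powr (- (Re s - r'))"]) auto
qed

section \<open>Fourier expansion of the Eisenstein series\<close>

lemma complex_xy_continuous [continuous_intros]: "continuous_on A (\<lambda>x. Complex x y)"
 unfolding Complex_eq by (intro continuous_intros)

abbreviation eisenstein_line :: "real => complex => real => complex" where
  "eisenstein_line y s \<equiv> (\<lambda>x. eisenstein (Complex x y) s)"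

lemma eisenstein_x_continuous:
 assumes "y > 0" "s \<in> half_domain"
 shows "continuous_on UNIV (eisenstein_line y s)"
 by (rule continuous_on_compose2[OF eisenstein_continuous[OF assms(2)]])
  (use assms in \<open>auto intro!: continuous_intros\<close>)

lemma eisenstein_periodic:
 assumes "y > 0"
 shows "eisenstein (Complex (x + 1) y) s = eisenstein (Complex x y) s"
proof -
 have "moebius 1 1 0 1 (Complex x y) = Complex (x + 1) y"
  using assms by (simp add: moebius_apply complex_eq_iff)
 then show ?thesis
  using eisenstein_invariant[of "Complex x y" 1 1 1 0] assms by simp
qed

lemma qform_Complex: "qform (Complex x y) (m, n) = ((of_int m * x + of_int n)\<^sup>2 + (of_int m)\<^sup>2 * y\<^sup>2) / y"
 by (simp add: qform_def norm_lattice_sq)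

lemma qform_term_continuous:
 assumes y: "y > 0" and v: "v \<in> lat"
 shows "continuous_on UNIV (\<lambda>x. complex_of_real (qform (Complex x y) v) powr (- s))"
proof -
 have pos: "qform (Complex x y) v > 0" for x
  using qform_pos[of "Complex x y" v] y v by simp
 have eq: "complex_of_real (qform (Complex x y) v) powr (- s) = exp (- s * of_real (ln (qform (Complex x y) v)))" for x
  using pos[of x] by (simp add: powr_def Ln_of_real)
 have "continuous_on UNIV (\<lambda>x. qform (Complex x y) v)"
  by (cases v) (simp add: qform_Complex divide_inverse, intro continuous_intros)
 then have L: "continuous_on UNIV (\<lambda>x. ln (qform (Complex x y) v))"
  using pos by (intro continuous_on_ln) (auto simp: less_imp_neq[symmetric])
 show ?thesis
  unfolding eq by (rule continuous_on_exp, rule continuous_on_mult, rule continuous_on_const, rule continuous_on_of_real, rule L)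
qed

lemma dzeta_fcoeff_eisenstein_sum:
 fixes k :: int
 assumes y: "y > 0" and s: "Re s > 1"
 defines "c \<equiv> \<lambda>v. \<integral>x. complex_of_real (qform (Complex x y) v) powr (- s) * char_neg k x \<partial>unit_leb"
 shows "(c has_sum dzeta s * fcoeff (eisenstein_line y s) k) lat"
  and "(\<lambda>v. norm (c v)) summable_on lat"
proof -
 interpret finite_measure unit_leb by (rule finite_measure_unit_leb)
 define f where "f v x = complex_of_real (qform (Complex x y) v) powr (- s) * char_neg k x" for v x
 have fc: "continuous_on UNIV (f v)" if "v \<in> lat" for v
  unfolding f_def by (intro continuous_intros qform_term_continuous y that)
 have fb: "norm (f v x) <= lconst y (1 + y) powr (Re s) * lsize v powr (- Re s)" if "v \<in> lat" "x \<in> {0..<1}" for v x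
 proof -
  have "norm (Complex x y) <= 1 + y"
   using cmod_le[of "Complex x y"] that y by simp
  then show ?thesis
   using qform_powr_le[of y "Complex x y" "1 + y" v "Re s"] qform_pos[of "Complex x y" v] that y s
   by (simp add: f_def norm_mult norm_powr_of_real)
 qed
 have sm: "(\<lambda>v. lconst y (1 + y) powr (Re s) * lsize v powr (- Re s)) summable_on lat"
  by (intro summable_on_cmult_right summable_on_subset_banach[OF lsize_summable[OF s]]) auto
 have int: "integrable unit_leb (f v)" if "v \<in> lat" for v
  using fc[OF that] by (rule integrable_unit_leb_continuous)
 have nint: "(\<integral>x. norm (f v x) \<partial>unit_leb) <= lconst y (1 + y) powr (Re s) * lsize v powr (- Re s)" if "v \<in> lat" for v
 proof -
  have "(\<integral>x. norm (f v x) \<partial>unit_leb) <= (\<integral>x. lconst y (1 + y) powr (Re s) * lsize v powr (- Re s) \<partial>unit_leb)"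
   using int[OF that] fb[OF that] by (intro integral_mono) auto
  then show ?thesis by (simp add: measure_def)
 qed
 have S: "((\<lambda>v. \<integral>x. f v x \<partial>unit_leb) has_sum (\<integral>x. (\<Sum>\<^sub>\<infinity>v\<in>lat. f v x) \<partial>unit_leb)) lat"
 proof (rule has_sum_integral(2)[OF countable_lat int])
  show "(\<lambda>v. norm (f v x)) summable_on lat" if "x \<in> space unit_leb" for x
   by (rule summable_on_comparison_test[OF sm]) (use fb that in auto)
  show "(\<lambda>v. \<integral>x. norm (f v x) \<partial>unit_leb) summable_on lat"
   by (rule summable_on_comparison_test[OF sm]) (use nint in auto)
 qed
 have "(\<Sum>\<^sub>\<infinity>v\<in>lat. f v x) = dzeta s * (eisenstein (Complex x y) s * char_neg k x)" for x
  using infsumI[OF eisenstein_lat[of "Complex x y" s]] y s by (simp add: f_def infsum_cmult_left' mult_ac)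
 then show "(c has_sum dzeta s * fcoeff (eisenstein_line y s) k) lat"
  using S by (simp add: c_def f_def fcoeff_def)
 show "(\<lambda>v. norm (c v)) summable_on lat"
 proof (rule summable_on_comparison_test[OF sm])
  show "norm (c v) <= lconst y (1 + y) powr (Re s) * lsize v powr (- Re s)" if "v \<in> lat" for v
   using order.trans[OF integral_norm_bound nint[OF that]] by (simp add: c_def f_def)
 qed auto
qed

lemma cis_eq_1_int: "cis (2 * pi * x) = 1 \<longleftrightarrow> x \<in> \<int>"
proof
 assume "cis (2 * pi * x) = 1"
 then have "cos (2 * pi * x) = 1" by (simp add: complex_eq_iff)
 then obtain n :: int where "2 * pi * x = of_int n * 2 * pi" by (auto simp: cos_one_2pi_int)
 then have "x = of_int n" by simp
 then show "x \<in> \<int>" by simp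
next
 assume "x \<in> \<int>"
 then show "cis (2 * pi * x) = 1" by (rule cis_multiple_2pi)
qed

text \<open>Detects divisibility of the frequency by the first coordinate, which produces the divisor sum.\<close>
lemma sum_roots_of_unity:
 fixes m k :: int
 assumes m: "m ~= 0"
 shows "(\<Sum>r<nat \<bar>m\<bar>. cis (2 * pi * of_int k * of_nat r / of_int m)) = (if m dvd k then of_int \<bar>m\<bar> else 0)"
proof -
 define w where "w = cis (2 * pi * (of_int k / of_int m))"
 have wr: "cis (2 * pi * of_int k * of_nat r / of_int m) = w ^ r" for r
  unfolding w_def Complex.DeMoivre by (rule arg_cong[of _ _ cis]) simp
 have "w ^ nat \<bar>m\<bar> = cis (2 * pi * (of_nat (nat \<bar>m\<bar>) * of_int k / of_int m))"
  unfolding w_def Complex.DeMoivre by (rule arg_cong[of _ _ cis]) simp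
 also have "... = 1"
 proof (subst cis_eq_1_int)
  have "of_nat (nat \<bar>m\<bar>) * of_int k / of_int m = (of_int (sgn m * k) :: real)"
   using m by (cases "m > 0") (auto simp: sgn_if)
  then show "of_nat (nat \<bar>m\<bar>) * of_int k / of_int m \<in> (\<int> :: real set)" by simp
 qed
 finally have wm: "w ^ nat \<bar>m\<bar> = 1" .
 have w1: "w = 1 \<longleftrightarrow> m dvd k"
 proof -
  have "w = 1 \<longleftrightarrow> (of_int k / of_int m :: real) \<in> \<int>"
   unfolding w_def by (rule cis_eq_1_int)
  also have "... \<longleftrightarrow> m dvd k"
  proof
   assume "(of_int k / of_int m :: real) \<in> \<int>"
   then obtain n where "(of_int k / of_int m :: real) = of_int n" by (auto elim: Ints_cases)
   then have "(of_int k :: real) = of_int (n * m)" using m by (simp add: field_simps)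
   then have "k = n * m" by (simp only: of_int_eq_iff)
   then show "m dvd k" by simp
  qed (use m in \<open>auto elim!: dvdE\<close>)
  finally show ?thesis .
 qed
 show ?thesis
 proof (cases "w = 1")
  case True
  then show ?thesis using w1 unfolding wr by simp
 next
  case False
  then show ?thesis
   using w1 geometric_sum[OF False, of "nat \<bar>m\<bar>"] wm unfolding wr by simp
 qed
qed

lemma bij_residue:
 assumes m: "m ~= (0::int)"
 shows "bij_betw (\<lambda>(r, q). m * q + int r) ({..<nat \<bar>m\<bar>} \<times> UNIV) UNIV"
proof (rule bij_betwI[where g = "\<lambda>n. (nat (n mod \<bar>m\<bar>), sgn m * (n div \<bar>m\<bar>))"])
 have am: "\<bar>m\<bar> > 0" using m by simp
 have ms: "m * (sgn m * q) = \<bar>m\<bar> * q" for q by (metis abs_sgn mult.assoc mult.commute)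
 show "(\<lambda>n. (nat (n mod \<bar>m\<bar>), sgn m * (n div \<bar>m\<bar>))) \<in> UNIV \<rightarrow> {..<nat \<bar>m\<bar>} \<times> UNIV"
  using am by (auto simp: nat_less_iff)
 show "(case (nat (n mod \<bar>m\<bar>), sgn m * (n div \<bar>m\<bar>)) of (r, q) => m * q + int r) = n" for n
  using am by (simp add: ms)
 show "(nat ((case p of (r, q) => m * q + int r) mod \<bar>m\<bar>), sgn m * ((case p of (r, q) => m * q + int r) div \<bar>m\<bar>)) = p"
  if "p \<in> {..<nat \<bar>m\<bar>} \<times> UNIV" for p
 proof -
  obtain r q where p: "p = (r, q)" by (cases p)
  have r: "int r < \<bar>m\<bar>" "int r >= 0" using that p by auto
  have mq: "m * q + int r = int r + \<bar>m\<bar> * (sgn m * q)"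
   by (simp add: mult.assoc[symmetric] mult_sgn_abs abs_mult_sgn mult.commute[of "\<bar>m\<bar>"])
  have ss: "sgn m * sgn m = 1" using m by (simp add: sgn_if)
  have md: "(m * q + int r) mod \<bar>m\<bar> = int r"
   unfolding mq mod_mult_self2 using r by (rule_tac mod_pos_pos_trivial)
  have dv: "(m * q + int r) div \<bar>m\<bar> = sgn m * q"
   unfolding mq using r am by (subst div_mult_self2) auto
  show ?thesis
   unfolding p prod.case md dv using ss by (simp add: mult.assoc[symmetric])
 qed
qed auto

text \<open>The vectors (m, n) with n in a fixed residue class modulo m unfold the unit interval to the whole line.\<close>
lemma integral_lattice_row:
 fixes m r :: int
 assumes y: "y > 0" and s: "Re s > 1" and m: "m ~= 0"
 shows "((\<lambda>q::int. \<integral>x. complex_of_real (qform (Complex x y) (m, m * q + r)) powr (- s) * char_neg k x \<partial>unit_leb)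
  has_sum (of_real y powr (1 - s) * of_real ((of_int m)\<^sup>2) powr (- s) * bracket_hat s (of_int k * y) * cis (2 * pi * of_int k * of_int r / of_int m))) UNIV"
proof -
 define H where "H x = complex_of_real (((of_int m * x + of_int r)\<^sup>2 + (of_int m)\<^sup>2 * y\<^sup>2) / y) powr (- s) * char_neg k x" for x
 define C where "C = complex_of_real ((of_int m)\<^sup>2 * y) powr (- s) * cis (2 * pi * of_int k * of_int r / of_int m)"
 define t where "t = - (of_int r / of_int m :: real)"
 have Hsub: "H (t + y * u) = C * (bracket s u * cis (- (2 * pi * (of_int k * y) * u)))" for u
 proof -
  have 1: "of_int m * (t + y * u) + of_int r = of_int m * y * u"
   using m by (simp add: t_def field_simps)
  have "((of_int m * (t + y * u) + of_int r)\<^sup>2 + (of_int m)\<^sup>2 * y\<^sup>2) / y = ((of_int m)\<^sup>2 * y) * (1 + u\<^sup>2)"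
   unfolding 1 using y by (simp add: power_mult_distrib field_simps power2_eq_square)
  then have "complex_of_real (((of_int m * (t + y * u) + of_int r)\<^sup>2 + (of_int m)\<^sup>2 * y\<^sup>2) / y) powr (- s)
   = complex_of_real ((of_int m)\<^sup>2 * y) powr (- s) * bracket s u"
   unfolding bracket_def using m y by (simp only:) (rule powr_of_real_mult, auto simp: add_pos_nonneg)
  moreover have "cis (- (2 * pi * of_int k * (t + y * u))) = cis (2 * pi * of_int k * of_int r / of_int m) * cis (- (2 * pi * (of_int k * y) * u))"
   unfolding cis_mult by (simp add: t_def algebra_simps)
  ultimately show ?thesis by (simp add: H_def C_def mult_ac)
 qed
 have [measurable]: "(\<lambda>u. cis (- (2 * pi * (of_int k * y) * u))) \<in> borel_fun"
  by (intro borel_measurable_continuous_onI continuous_intros)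
 have ib: "integrable lborel (\<lambda>u. bracket s u * cis (- (2 * pi * (of_int k * y) * u)))"
  by (rule lint_bound[OF integrable_bracket[of s]]) (use s in \<open>auto simp: norm_mult\<close>)
 then have "integrable lborel (\<lambda>u. H (t + y * u))"
  unfolding Hsub by (rule integrable_mult_right)
 then have Hi: "integrable lborel H"
  using lborel_integrable_real_affine_iff[of y H t] y by simp
 have "(\<integral>x. H x \<partial>lborel) = \<bar>y\<bar> *\<^sub>R (\<integral>u. H (t + y * u) \<partial>lborel)"
  by (rule lborel_integral_real_affine) (use y in simp)
 also have "... = of_real y * (C * bracket_hat s (of_int k * y))"
  unfolding Hsub using y by (simp add: bracket_hat_def fourier_def scaleR_conv_of_real)
 also have "... = of_real y powr (1 - s) * of_real ((of_int m)\<^sup>2) powr (- s) * bracket_hat s (of_int k * y) * cis (2 * pi * of_int k * of_int r / of_int m)"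
 proof -
  have "complex_of_real ((of_int m)\<^sup>2 * y) powr (- s) = of_real ((of_int m)\<^sup>2) powr (- s) * of_real y powr (- s)"
   using m y by (intro powr_of_real_mult) auto
  moreover have "of_real y powr (1 - s) = of_real y * complex_of_real y powr (- s)"
   using y powr_add[of "complex_of_real y" 1 "- s"] by simp
  ultimately show ?thesis by (simp add: C_def mult_ac)
 qed
 finally have int: "(\<integral>x. H x \<partial>lborel) = of_real y powr (1 - s) * of_real ((of_int m)\<^sup>2) powr (- s) * bracket_hat s (of_int k * y) * cis (2 * pi * of_int k * of_int r / of_int m)" .
 have "H (x + of_int q) = complex_of_real (qform (Complex x y) (m, m * q + r)) powr (- s) * char_neg k x" for x and q :: int
 proof -
  have "cis (- (2 * pi * of_int k * (x + of_int q))) = char_neg k x * cis (2 * pi * of_int (- k * q))"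
   by (simp add: cis_mult algebra_simps)
  also have "cis (2 * pi * of_int (- k * q)) = 1" by (rule cis_multiple_2pi) auto
  finally show ?thesis by (simp add: H_def qform_Complex algebra_simps)
 qed
 then show ?thesis
  using has_sum_unfold_unit_leb[OF Hi] unfolding int by simp
qed

text \<open>The divisor function of the Fourier coefficients: the summand is |m| powr (1 - 2 s), and divisors of both signs occur.\<close>
definition dsum :: "int => complex => complex" where
 "dsum k s = (\<Sum>\<^sub>\<infinity>m\<in>{m. m ~= 0 \<and> m dvd k}. of_real \<bar>of_int m\<bar> * of_real ((of_int m)\<^sup>2) powr (- s))"

text \<open>Multiplying by dzeta replaces primitive vectors by all lattice vectors; the row m = 0 contributes only to the zeroth coefficient.\<close>
lemma dzeta_fcoeff_eisenstein:
 assumes y: "y > 0" and s: "Re s > 1"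
 shows "dzeta s * fcoeff (eisenstein_line y s) k =
   (if k = 0 then of_real y powr s * dzeta s else 0) + of_real y powr (1 - s) * bracket_hat s (of_int k * y) * dsum k s"
proof -
 define c where "c v = (\<integral>x. complex_of_real (qform (Complex x y) v) powr (- s) * char_neg k x \<partial>unit_leb)" for v
 have S: "(c has_sum dzeta s * fcoeff (eisenstein_line y s) k) lat" and sm: "(\<lambda>v. norm (c v)) summable_on lat"
  using dzeta_fcoeff_eisenstein_sum[OF y s, of k] by (simp_all add: c_def[abs_def])
 have sub: "c summable_on B" if "B \<subseteq> lat" for B
  using abs_summable_summable[OF summable_on_subset_banach[OF sm that]] .
 define L0 where "L0 = {0::int} \<times> (UNIV - {0::int})"
 define L1 where "L1 = (UNIV - {0::int}) \<times> (UNIV :: int set)"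
 have L: "lat = L0 \<union> L1" "L0 \<inter> L1 = {}" "L0 \<subseteq> lat" "L1 \<subseteq> lat"
  by (auto simp: lat_def L0_def L1_def)
 have "infsum c lat = infsum c L0 + infsum c L1"
  unfolding L(1) by (rule infsum_Un_disjoint[OF sub[OF L(3)] sub[OF L(4)] L(2)])
 also have "infsum c L0 = (if k = 0 then of_real y powr s * dzeta s else 0)"
 proof -
  have c0: "c (0, n) = of_real ((of_int n)\<^sup>2) powr (- s) * (if k = 0 then of_real y powr s else 0)" if "n ~= 0" for n
  proof -
   have "c (0, n) = complex_of_real ((of_int n)\<^sup>2 / y) powr (- s) * (\<integral>x. cis (2 * pi * of_int (- k) * x) \<partial>unit_leb)"
    unfolding c_def qform_Complex by simp
   also have "(\<integral>x. cis (2 * pi * of_int (- k) * x) \<partial>unit_leb) = (if k = 0 then 1 else 0)"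
    unfolding integral_cis_int by simp
   also have "complex_of_real ((of_int n)\<^sup>2 / y) powr (- s) = of_real ((of_int n)\<^sup>2) powr (- s) * of_real y powr s"
   proof -
    have "complex_of_real ((of_int n)\<^sup>2 * (1 / y)) powr (- s) = of_real ((of_int n)\<^sup>2) powr (- s) * of_real (1 / y) powr (- s)"
     using y that by (intro powr_of_real_mult) auto
    then show ?thesis using powr_one_divide[OF y, of "- s"] by simp
   qed
   finally show ?thesis by simp
  qed
  have "infsum c L0 = (\<Sum>\<^sub>\<infinity>n\<in>UNIV - {0}. c (0, n))"
   by (rule infsum_reindex_bij_witness[of _ "\<lambda>n. (0, n)" snd]) (auto simp: L0_def)
  also have "... = (\<Sum>\<^sub>\<infinity>n\<in>UNIV - {0}. of_real ((of_int n)\<^sup>2) powr (- s) * (if k = 0 then of_real y powr s else 0))"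
   by (intro infsum_cong c0) auto
  also have "... = dzeta s * (if k = 0 then of_real y powr s else 0)"
   unfolding dzeta_def by (rule infsum_cmult_left')
  finally show ?thesis by (simp add: mult_ac)
 qed
 also have "infsum c L1 = of_real y powr (1 - s) * bracket_hat s (of_int k * y) * dsum k s"
 proof -
  define B where "B = of_real y powr (1 - s) * bracket_hat s (of_int k * y)"
  have row: "(\<Sum>\<^sub>\<infinity>n. c (m, n)) = B * (if m dvd k then of_real \<bar>of_int m\<bar> * of_real ((of_int m)\<^sup>2) powr (- s) else 0)" if m: "m ~= 0" for m
  proof -
   have "(\<lambda>n. (m, n)) ` UNIV \<subseteq> lat" using m by (auto simp: lat_def)
   from sub[OF this] have "(\<lambda>n. c (m, n)) summable_on UNIV"
    by (subst (asm) summable_on_reindex) (auto simp: inj_on_def o_def)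
   then have sm2: "(\<lambda>p. c (m, case p of (r, q) => m * q + int r)) summable_on {..<nat \<bar>m\<bar>} \<times> UNIV"
    by (subst summable_on_reindex_bij_betw[OF bij_residue[OF m]])
   have "(\<Sum>\<^sub>\<infinity>n. c (m, n)) = (\<Sum>\<^sub>\<infinity>p\<in>{..<nat \<bar>m\<bar>} \<times> UNIV. c (m, case p of (r, q) => m * q + int r))"
    by (rule infsum_reindex_bij_betw[OF bij_residue[OF m], symmetric])
   also have "... = (\<Sum>\<^sub>\<infinity>r\<in>{..<nat \<bar>m\<bar>}. \<Sum>\<^sub>\<infinity>q. c (m, m * q + int r))"
    using infsum_Sigma_banach[OF sm2] by simp
   also have "... = (\<Sum>r<nat \<bar>m\<bar>. B * of_real ((of_int m)\<^sup>2) powr (- s) * cis (2 * pi * of_int k * of_nat r / of_int m))"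
   proof (subst infsum_finite, simp, rule sum.cong[OF refl])
    fix r
    show "(\<Sum>\<^sub>\<infinity>q. c (m, m * q + int r)) = B * of_real ((of_int m)\<^sup>2) powr (- s) * cis (2 * pi * of_int k * of_nat r / of_int m)"
     using infsumI[OF integral_lattice_row[OF y s m, of "int r" k]] by (simp add: c_def B_def mult_ac)
   qed
   also have "... = B * of_real ((of_int m)\<^sup>2) powr (- s) * (if m dvd k then of_int \<bar>m\<bar> else 0)"
    unfolding sum_distrib_left[symmetric] sum_roots_of_unity[OF m] ..
   moreover have "complex_of_real \<bar>real_of_int m\<bar> = of_int \<bar>m\<bar>" by (simp flip: of_int_abs)
   ultimately show ?thesis by (simp add: mult_ac)
  qed
  have "infsum c L1 = (\<Sum>\<^sub>\<infinity>m\<in>UNIV - {0}. \<Sum>\<^sub>\<infinity>n. c (m, n))"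
   unfolding L1_def using infsum_Sigma_banach[OF sub[OF L(4), unfolded L1_def]] by simp
  also have "... = (\<Sum>\<^sub>\<infinity>m\<in>UNIV - {0}. B * (if m dvd k then of_real \<bar>of_int m\<bar> * of_real ((of_int m)\<^sup>2) powr (- s) else 0))"
   by (intro infsum_cong row) auto
  also have "... = B * (\<Sum>\<^sub>\<infinity>m\<in>UNIV - {0}. (if m dvd k then of_real \<bar>of_int m\<bar> * of_real ((of_int m)\<^sup>2) powr (- s) else 0))"
   by (rule infsum_cmult_right')
  also have "(\<Sum>\<^sub>\<infinity>m\<in>UNIV - {0}. (if m dvd k then of_real \<bar>of_int m\<bar> * of_real ((of_int m)\<^sup>2) powr (- s) else 0)) = dsum k s"
   unfolding dsum_def by (rule infsum_cong_neutral) auto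
  finally show ?thesis by (simp add: B_def)
 qed
 finally show ?thesis
  using infsumI[OF S] by simp
qed

lemma fcoeff_eisenstein_holomorphic:
 assumes y: "y > 0"
 shows "(\<lambda>s. fcoeff (eisenstein_line y s) k) holomorphic_on half_domain"
 unfolding fcoeff_def
proof (rule holomorphic_on_lebesgue_integral)
 interpret finite_measure unit_leb by (rule finite_measure_unit_leb)
 show "(\<lambda>s. eisenstein (Complex x y) s * char_neg k x) holomorphic_on half_domain" for x
  using y by (intro holomorphic_intros eisenstein_holomorphic) auto
 show "(\<lambda>x. eisenstein (Complex x y) s * char_neg k x) \<in> borel_measurable unit_leb" if "s \<in> half_domain" for s
  by (intro measurable_unit_leb borel_measurable_continuous_onI continuous_intros eisenstein_x_continuous y that)
 fix s assume "s \<in> half_domain"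
 then obtain r where r: "r > 0" "cball s r \<subseteq> half_domain"
  using half_domain(1) open_contains_cball by blast
 obtain C where C: "\<And>z w. Im z >= y ==> norm z <= 1 + y ==> w \<in> cball s r ==> norm (eisenstein z w) <= C"
  using eisenstein_locally_bounded[OF y compact_cball r(2), of "1 + y"] by blast
 have "norm (Complex x y) <= 1 + y" if "x \<in> {0..<1}" for x
  using cmod_le[of "Complex x y"] that y by simp
 then show "\<exists>r>0. \<exists>g. integrable unit_leb g \<and> cball s r \<subseteq> half_domain \<and>
   (\<forall>w\<in>cball s r. \<forall>x\<in>space unit_leb. cmod (eisenstein (Complex x y) w * char_neg k x) <= g x)"
  using r C by (intro exI[of _ r] conjI exI[of _ "\<lambda>_. C"]) (auto simp: norm_mult)
qed

lemma finite_divisors: "(k::int) ~= 0 ==> finite {m. m ~= 0 \<and> m dvd k}"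
 by (rule finite_subset[of _ "{- \<bar>k\<bar>..\<bar>k\<bar>}"]) (auto dest!: dvd_imp_le_int simp: abs_le_iff)

lemma dzeta_fcoeff_eisenstein_continued:
 assumes y: "y > 0" and s: "s \<in> half_domain" and k: "k ~= 0"
 shows "dzeta s * fcoeff (eisenstein_line y s) k = of_real y powr (1 - s) * bracket_hat s (of_int k * y) * dsum k s"
proof (rule analytic_continuation_open[of "{s. Re s > 1}" half_domain _ "\<lambda>s. of_real y powr (1 - s) * bracket_hat s (of_int k * y) * dsum k s"])
 show "open {s. Re s > 1}" by (rule open_halfspace_Re_gt)
 have "2 \<in> {s. Re s > 1}" by simp
 then show "{s. Re s > 1} ~= {}" by blast
 show "{s. Re s > 1} \<subseteq> half_domain" by (auto intro: half_domainI)
 show "(\<lambda>s. dzeta s * fcoeff (eisenstein_line y s) k) holomorphic_on half_domain"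
  by (intro holomorphic_intros holomorphic_dzeta fcoeff_eisenstein_holomorphic y)
 have "dsum k = (\<lambda>s. \<Sum>m\<in>{m. m ~= 0 \<and> m dvd k}. of_real \<bar>of_int m\<bar> * of_real ((of_int m)\<^sup>2) powr (- s))"
  unfolding dsum_def using finite_divisors[OF k] by simp
 then have "dsum k holomorphic_on half_domain" by (auto intro!: holomorphic_intros)
 then show "(\<lambda>s. of_real y powr (1 - s) * bracket_hat s (of_int k * y) * dsum k s) holomorphic_on half_domain"
  using y by (intro holomorphic_intros bracket_hat_holomorphic) auto
 show "dzeta s * fcoeff (eisenstein_line y s) k = of_real y powr (1 - s) * bracket_hat s (of_int k * y) * dsum k s"
  if "s \<in> {s. Re s > 1}" for s
  using dzeta_fcoeff_eisenstein[OF y, of s k] that k by simp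
qed (use half_domain s in auto)

text \<open>Solved for at height y = 1, where both powers of y are 1; this defines phi on the whole half-plane at once.\<close>
definition phi :: "complex => complex" where
 "phi s = fcoeff (\<lambda>x. eisenstein (Complex x 1) s) 0 - 1"

lemma constant_term_eisenstein:
 assumes y: "y > 0" and s: "s \<in> half_domain"
 shows "fcoeff (eisenstein_line y s) 0 = of_real y powr s + phi s * of_real y powr (1 - s)"
proof (rule analytic_continuation_open[of "{s. Re s > 1}" half_domain _ "\<lambda>s. of_real y powr s + phi s * of_real y powr (1 - s)"])
 show "open {s. Re s > 1}" by (rule open_halfspace_Re_gt)
 have "2 \<in> {s. Re s > 1}" by simp
 then show "{s. Re s > 1} ~= {}" by blast
 show "{s. Re s > 1} \<subseteq> half_domain" by (auto intro: half_domainI)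
 show "(\<lambda>s. fcoeff (eisenstein_line y s) 0) holomorphic_on half_domain"
  by (intro holomorphic_intros fcoeff_eisenstein_holomorphic y)
 show "(\<lambda>s. of_real y powr s + phi s * of_real y powr (1 - s)) holomorphic_on half_domain"
  unfolding phi_def using y by (intro holomorphic_intros fcoeff_eisenstein_holomorphic) auto
 show "fcoeff (eisenstein_line y s) 0 = of_real y powr s + phi s * of_real y powr (1 - s)"
  if "s \<in> {s. Re s > 1}" for s
 proof -
  have s: "Re s > 1" "dzeta s ~= 0" using that dzeta_nonzero[of s] by auto
  have "fcoeff (eisenstein_line y s) 0 = of_real y powr s + of_real y powr (1 - s) * (bracket_hat s 0 * dsum 0 s / dzeta s)"
   using dzeta_fcoeff_eisenstein[OF y s(1), of 0] s(2) by (simp add: field_simps)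
  moreover have "phi s = bracket_hat s 0 * dsum 0 s / dzeta s"
   using dzeta_fcoeff_eisenstein[OF zero_less_one s(1), of 0] s(2) by (simp add: phi_def field_simps)
  ultimately show ?thesis by (simp add: mult_ac)
 qed
qed (use half_domain s in auto)

section \<open>Mean square of the non-constant terms\<close>

abbreviation count_int :: "int measure" where
  "count_int \<equiv> count_space UNIV"

text \<open>A majorant of norm (dsum k s) that is uniform in Re s >= 1/2 + \<delta>.\<close>
definition divsum :: "real => int => ennreal" where
 "divsum \<delta> k = (\<integral>\<^sup>+m. (if m dvd k then ennreal (\<bar>of_int m\<bar> powr (- (2 * \<delta>))) else 0) \<partial>count_int)"

lemma norm_dsum_le_divsum:
 assumes k: "k ~= 0" and s: "Re s >= 1 / 2 + \<delta>"
 shows "ennreal (norm (dsum k s)) <= divsum \<delta> k"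
proof -
 define D where "D = {m. m ~= 0 \<and> m dvd k}"
 have fin: "finite D" unfolding D_def by (rule finite_divisors[OF k])
 have "norm (of_real \<bar>of_int m\<bar> * complex_of_real ((of_int m)\<^sup>2) powr (- s)) <= \<bar>of_int m\<bar> powr (- (2 * \<delta>))" if "m \<in> D" for m
 proof -
  define a where "a = \<bar>real_of_int m\<bar>"
  have a: "a >= 1" using that by (auto simp: D_def a_def)
  have "norm (of_real \<bar>of_int m\<bar> * complex_of_real ((of_int m)\<^sup>2) powr (- s)) = a * (a\<^sup>2) powr (- Re s)"
   using a by (simp add: norm_mult norm_powr_of_real a_def power2_abs del: of_real_power)
  also have "(a\<^sup>2) powr (- Re s) = a powr (- (2 * Re s))"
  proof -
   have "a\<^sup>2 = a powr 2" using a by (simp add: powr_numeral)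
   then show ?thesis by (simp add: powr_powr)
  qed
  also have "a * a powr (- (2 * Re s)) = a powr (1 + - (2 * Re s))"
   using a powr_add[of a 1 "- (2 * Re s)"] by simp
  also have "... <= a powr (- (2 * \<delta>))"
   using a s by (intro powr_mono) auto
  finally show ?thesis by (simp add: a_def)
 qed
 then have "norm (dsum k s) <= (\<Sum>m\<in>D. \<bar>of_int m\<bar> powr (- (2 * \<delta>)))"
  unfolding dsum_def D_def[symmetric] using fin by (simp add: sum_norm_le)
 then have "ennreal (norm (dsum k s)) <= ennreal (\<Sum>m\<in>D. \<bar>of_int m\<bar> powr (- (2 * \<delta>)))"
  by (rule ennreal_leI)
 also have "... = (\<Sum>m\<in>D. (if m dvd k then ennreal (\<bar>of_int m\<bar> powr (- (2 * \<delta>))) else 0))"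
  by (subst sum_ennreal[symmetric]) (auto simp: D_def intro!: sum.cong)
 also have "... <= divsum \<delta> k"
  unfolding divsum_def by (rule sum_le_nn_integral_count_space[OF fin])
 finally show ?thesis .
qed

text \<open>On the window a <= \<eta>/k <= b all k have the size of \<eta>, so the harmonic sum over multiples of l is at most 1/l up to a constant.\<close>
lemma sum_reciprocal_multiples:
 assumes ab: "0 < a" "a <= b" and l: "l > (0::int)"
 shows "(\<integral>\<^sup>+k. (if l dvd k \<and> k ~= 0 \<and> a <= \<eta> / of_int k \<and> \<eta> / of_int k <= b then ennreal (1 / \<bar>of_int k\<bar>) else 0) \<partial>count_int)
  <= ennreal (b / (a * of_int l))"
proof -
 define K where "K = {k. l dvd k \<and> k ~= 0 \<and> a <= \<eta> / of_int k \<and> \<eta> / of_int k <= b}"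
 have kK: "\<eta> ~= 0" "sgn (real_of_int k) = sgn \<eta>" "\<bar>real_of_int k\<bar> <= \<bar>\<eta>\<bar> / a" "1 / \<bar>real_of_int k\<bar> <= b / \<bar>\<eta>\<bar>" if "k \<in> K" for k
 proof -
  define r where "r = \<eta> / of_int k"
  have k: "real_of_int k ~= 0" and r: "a <= r" "r <= b" "r > 0" and e: "\<eta> = r * of_int k"
   using that ab by (auto simp: K_def r_def)
  show "\<eta> ~= 0" using k r e by simp
  show "sgn (real_of_int k) = sgn \<eta>" using r unfolding e by (simp add: sgn_mult)
  have ae: "\<bar>\<eta>\<bar> = r * \<bar>real_of_int k\<bar>" using r unfolding e by (simp add: abs_mult)
  have "a * \<bar>real_of_int k\<bar> <= \<bar>\<eta>\<bar>" unfolding ae using r by (intro mult_right_mono) auto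
  then show "\<bar>real_of_int k\<bar> <= \<bar>\<eta>\<bar> / a" using ab by (simp add: field_simps)
  have "\<bar>\<eta>\<bar> <= b * \<bar>real_of_int k\<bar>" unfolding ae using r by (intro mult_right_mono) auto
  then show "1 / \<bar>real_of_int k\<bar> <= b / \<bar>\<eta>\<bar>" using k \<open>\<eta> ~= 0\<close> by (simp add: field_simps)
 qed
 define N where "N = nat \<lfloor>\<bar>\<eta>\<bar> / (a * of_int l)\<rfloor>"
 define h where "h k = nat (\<bar>k\<bar> div l)" for k
 have hK: "h ` K \<subseteq> {1..N}"
 proof
  fix j assume "j \<in> h ` K"
  then obtain k where k: "k \<in> K" "j = h k" by auto
  obtain q where q: "k = l * q" "q ~= 0" using k(1) by (auto simp: K_def elim!: dvdE)
  have j: "j = nat \<bar>q\<bar>" using l unfolding k(2) h_def q by (simp add: abs_mult)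
  have "of_int l * \<bar>real_of_int q\<bar> <= \<bar>\<eta>\<bar> / a"
   using kK(3)[OF k(1)] l unfolding q by (simp add: abs_mult)
  then have "\<bar>real_of_int q\<bar> <= \<bar>\<eta>\<bar> / (a * of_int l)" using l ab by (simp add: field_simps)
  then have "\<bar>q\<bar> <= \<lfloor>\<bar>\<eta>\<bar> / (a * of_int l)\<rfloor>" by (simp add: le_floor_iff)
  then show "j \<in> {1..N}" using q unfolding j N_def by auto
 qed
 have inj: "inj_on h K"
 proof (rule inj_onI)
  fix k k' assume k: "k \<in> K" "k' \<in> K" "h k = h k'"
  obtain q q' where q: "k = l * q" "k' = l * q'" using k by (auto simp: K_def elim!: dvdE)
  have "\<bar>q\<bar> = \<bar>q'\<bar>" using k(3) l unfolding h_def q by (simp add: abs_mult)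
  moreover have "sgn (real_of_int k) = sgn (real_of_int k')" using kK(2)[OF k(1)] kK(2)[OF k(2)] by simp
  then have "sgn (real_of_int q) = sgn (real_of_int q')" using l unfolding q by (simp add: sgn_mult)
  ultimately have "q = q'" by (auto simp: sgn_if abs_if split: if_splits)
  then show "k = k'" by (simp add: q)
 qed
 have fin: "finite K" by (rule inj_on_finite[OF inj hK]) simp
 have card: "card K <= N" using card_inj_on_le[OF inj hK] by simp
 have "(\<integral>\<^sup>+k. (if l dvd k \<and> k ~= 0 \<and> a <= \<eta> / of_int k \<and> \<eta> / of_int k <= b then ennreal (1 / \<bar>of_int k\<bar>) else 0) \<partial>count_int)
   = (\<integral>\<^sup>+k. ennreal (1 / \<bar>of_int k\<bar>) * indicator K k \<partial>count_int)"
  by (intro nn_integral_cong) (auto simp: K_def indicator_def)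
 also have "... = (\<Sum>k\<in>K. ennreal (1 / \<bar>of_int k\<bar>))"
  using fin by (simp add: nn_integral_count_space_indicator[symmetric] nn_integral_count_space_finite)
 also have "... = ennreal (\<Sum>k\<in>K. 1 / \<bar>of_int k\<bar>)" by (rule sum_ennreal) simp
 also have "(\<Sum>k\<in>K. 1 / \<bar>real_of_int k\<bar>) <= b / (a * of_int l)"
 proof (cases "K = {}")
  case True
  then show ?thesis using ab l by simp
 next
  case False
  then have e: "\<eta> ~= 0" using kK by auto
  have "(\<Sum>k\<in>K. 1 / \<bar>real_of_int k\<bar>) <= (\<Sum>k\<in>K. b / \<bar>\<eta>\<bar>)" by (rule sum_mono) (use kK in auto)
  also have "... = real (card K) * (b / \<bar>\<eta>\<bar>)" by simp
  also have "... <= (\<bar>\<eta>\<bar> / (a * of_int l)) * (b / \<bar>\<eta>\<bar>)"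
  proof (rule mult_right_mono)
   have "real (card K) <= real N" using card by simp
   also have "... <= \<bar>\<eta>\<bar> / (a * of_int l)" using ab l unfolding N_def by (intro of_nat_floor) auto
   finally show "real (card K) <= \<bar>\<eta>\<bar> / (a * of_int l)" .
  qed (use ab in auto)
  also have "... = b / (a * of_int l)" using e by simp
  finally show ?thesis .
 qed
 finally show ?thesis by (simp add: ennreal_leI)
qed

lemma sum_powr_finite:
 fixes e :: real
 assumes "e > 1"
 shows "(\<integral>\<^sup>+m. ennreal (\<bar>real_of_int m\<bar> powr (- e)) \<partial>count_int) < \<infinity>"
proof -
 have "(\<lambda>m::int. \<bar>real_of_int m\<bar> powr (- e)) summable_on UNIV"
 proof (rule summable_on_int_symmetric)
  show "summable (\<lambda>n. \<bar>real_of_int (int n)\<bar> powr (- e))"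
   using assms by (simp add: summable_real_powr_iff)
 qed auto
 then have "(\<lambda>m::int. norm (\<bar>real_of_int m\<bar> powr (- e))) summable_on UNIV" by simp
 then have "Infinite_Set_Sum.abs_summable_on (\<lambda>m::int. \<bar>real_of_int m\<bar> powr (- e)) UNIV"
  by (simp only: abs_summable_equivalent)
 then have "integrable (count_space UNIV) (\<lambda>m::int. \<bar>real_of_int m\<bar> powr (- e))"
  by (simp add: Infinite_Set_Sum.abs_summable_on_def)
 then show ?thesis by (simp add: integrable_iff_bounded)
qed

abbreviation lcm_weight :: "real => int => int => ennreal" where
  "lcm_weight \<delta> m m' \<equiv> (if m ~= 0 \<and> m' ~= 0 then ennreal (\<bar>of_int m\<bar> powr (- (2 * \<delta>)) * \<bar>of_int m'\<bar> powr (- (2 * \<delta>)) / of_int (lcm m m')) else 0)"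

text \<open>Writing 1 / lcm m m' as gcd m m' / |m m'| and summing over all common divisors g instead of the greatest one separates the two sums.\<close>
lemma gcd_lcm_sum_finite:
 assumes \<delta>: "\<delta> > 0"
 shows "(\<integral>\<^sup>+m. (\<integral>\<^sup>+m'. (lcm_weight \<delta> m m')
   \<partial>count_int) \<partial>count_int) < \<infinity>"
proof -
 define e where "e = 1 + 2 * \<delta>"
 have e: "e > 1" using \<delta> by (simp add: e_def)
 define w where "w g m = (if g dvd m then ennreal (\<bar>real_of_int m\<bar> powr (- e)) else 0)" for g m :: int
 define Z where "Z = (\<integral>\<^sup>+m. ennreal (\<bar>real_of_int m\<bar> powr (- e)) \<partial>count_int)"
 have Z: "Z < \<infinity>" unfolding Z_def by (rule sum_powr_finite[OF e])
 have wg: "(\<integral>\<^sup>+m. w g m \<partial>count_int) = ennreal (\<bar>real_of_int g\<bar> powr (- e)) * Z" if g: "g ~= 0" for g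
 proof -
  have "(\<integral>\<^sup>+m. w g m \<partial>count_int) = (\<integral>\<^sup>+m. ennreal (\<bar>real_of_int m\<bar> powr (- e)) * indicator (range (\<lambda>j. g * j)) m \<partial>count_int)"
   by (intro nn_integral_cong) (auto simp: w_def indicator_def)
  also have "... = (\<integral>\<^sup>+m. ennreal (\<bar>real_of_int m\<bar> powr (- e)) \<partial>count_space (range (\<lambda>j. g * j)))"
   by (rule nn_integral_count_space_indicator[symmetric]) simp
  also have "... = (\<integral>\<^sup>+j. ennreal (\<bar>real_of_int (g * j)\<bar> powr (- e)) \<partial>count_int)"
   using g by (subst nn_integral_bij_count_space[of "\<lambda>j. g * j" UNIV, symmetric]) (auto simp: bij_betw_def inj_on_def)
  also have "... = (\<integral>\<^sup>+j. ennreal (\<bar>real_of_int g\<bar> powr (- e)) * ennreal (\<bar>real_of_int j\<bar> powr (- e)) \<partial>count_int)"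
   by (intro nn_integral_cong) (simp add: abs_mult powr_mult ennreal_mult)
  also have "... = ennreal (\<bar>real_of_int g\<bar> powr (- e)) * Z"
   unfolding Z_def by (rule nn_integral_cmult) simp
  finally show ?thesis .
 qed
 have termle: "(lcm_weight \<delta> m m')
   <= (\<integral>\<^sup>+g. ennreal \<bar>real_of_int g\<bar> * (w g m * w g m') \<partial>count_int)" for m m' :: int
 proof (cases "m ~= 0 \<and> m' ~= 0")
  case True
  define d where "d = gcd m m'"
  define M M' where "M = \<bar>real_of_int m\<bar>" and "M' = \<bar>real_of_int m'\<bar>"
  have M: "M > 0" "M' > 0" using True by (auto simp: M_def M'_def)
  have "of_int (lcm m m') * real_of_int d = M * M'"
   unfolding d_def M_def M'_def of_int_mult[symmetric] of_int_abs[symmetric] abs_mult[symmetric]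
   using prod_gcd_lcm_int[of m m'] by (simp add: mult.commute abs_mult)
  moreover have "d > 0" "lcm m m' > 0" using True by (auto simp: d_def lcm_pos_int)
  ultimately have l: "1 / real_of_int (lcm m m') = real_of_int d / (M * M')"
   using M True by (simp add: divide_eq_eq eq_divide_eq mult.commute)
  have "- e = - (2 * \<delta>) - 1" by (simp add: e_def)
  then have pe: "M powr (- (2 * \<delta>)) / M = M powr (- e)" "M' powr (- (2 * \<delta>)) / M' = M' powr (- e)"
   using M by (simp_all add: powr_diff)
  have "M powr (- (2 * \<delta>)) * M' powr (- (2 * \<delta>)) / of_int (lcm m m') = M powr (- (2 * \<delta>)) * M' powr (- (2 * \<delta>)) * (1 / of_int (lcm m m'))"
   by simp
  also have "... = real_of_int d * ((M powr (- (2 * \<delta>)) / M) * (M' powr (- (2 * \<delta>)) / M'))"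
   unfolding l by simp
  also have "ennreal ... = ennreal \<bar>real_of_int d\<bar> * (w d m * w d m')"
   unfolding pe using \<open>d > 0\<close> by (simp add: w_def d_def M_def M'_def ennreal_mult)
  also have "... <= (\<integral>\<^sup>+g. ennreal \<bar>real_of_int g\<bar> * (w g m * w g m') \<partial>count_int)"
   using sum_le_nn_integral_count_space[of "{d}" "\<lambda>g. ennreal \<bar>real_of_int g\<bar> * (w g m * w g m')"] by simp
  finally show ?thesis using True by (simp add: M_def M'_def)
 qed auto
 have cs: "countable (UNIV :: int set)" by simp
 have "(\<integral>\<^sup>+m. (\<integral>\<^sup>+m'. (lcm_weight \<delta> m m')
   \<partial>count_int) \<partial>count_int) <= 
   (\<integral>\<^sup>+m. (\<integral>\<^sup>+m'. (\<integral>\<^sup>+g. ennreal \<bar>real_of_int g\<bar> * (w g m * w g m') \<partial>count_int) \<partial>count_int) \<partial>count_int)"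
  by (intro nn_integral_mono termle)
 also have "... = (\<integral>\<^sup>+m. (\<integral>\<^sup>+g. (\<integral>\<^sup>+m'. ennreal \<bar>real_of_int g\<bar> * (w g m * w g m') \<partial>count_int) \<partial>count_int) \<partial>count_int)"
  by (intro nn_integral_cong nn_integral_count_space_nn_integral) auto
 also have "... = (\<integral>\<^sup>+g. (\<integral>\<^sup>+m. (\<integral>\<^sup>+m'. ennreal \<bar>real_of_int g\<bar> * (w g m * w g m') \<partial>count_int) \<partial>count_int) \<partial>count_int)"
  by (intro nn_integral_count_space_nn_integral) auto
 also have "... = (\<integral>\<^sup>+g. ennreal \<bar>real_of_int g\<bar> * ((\<integral>\<^sup>+m. w g m \<partial>count_int) * (\<integral>\<^sup>+m'. w g m' \<partial>count_int)) \<partial>count_int)"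
  by (intro nn_integral_cong) (simp add: nn_integral_cmult nn_integral_multc)
 also have "... <= (\<integral>\<^sup>+g. (Z * Z) * ennreal (\<bar>real_of_int g\<bar> powr (- (2 * e - 1))) \<partial>count_int)"
 proof (rule nn_integral_mono)
  fix g :: int
  show "ennreal \<bar>real_of_int g\<bar> * ((\<integral>\<^sup>+m. w g m \<partial>count_int) * (\<integral>\<^sup>+m'. w g m' \<partial>count_int)) <= (Z * Z) * ennreal (\<bar>real_of_int g\<bar> powr (- (2 * e - 1)))"
  proof (cases "g = 0")
   case False
   define G where "G = \<bar>real_of_int g\<bar>"
   have G: "G > 0" using False by (simp add: G_def)
   have "G * (G powr (- e) * G powr (- e)) = G powr (- (2 * e - 1))"
    using G powr_add[of G 1 "- e + - e"] powr_add[of G "- e" "- e"] by (simp add: algebra_simps)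
   then have "ennreal G * (ennreal (G powr (- e)) * ennreal (G powr (- e))) = ennreal (G powr (- (2 * e - 1)))"
    using G by (simp add: ennreal_mult[symmetric])
   then show ?thesis
    unfolding wg[OF False] G_def[symmetric] by (metis (no_types, lifting) mult.assoc mult.left_commute order_refl mult.commute)
  qed simp
 qed
 also have "... = (Z * Z) * (\<integral>\<^sup>+g. ennreal (\<bar>real_of_int g\<bar> powr (- (2 * e - 1))) \<partial>count_int)"
  by (rule nn_integral_cmult) simp
 also have "... < \<infinity>"
  using Z sum_powr_finite[of "2 * e - 1"] e by (simp add: ennreal_mult_less_top)
 finally show ?thesis .
qed

abbreviation window_weight :: "real => real => real => real => int => ennreal" where
  "window_weight \<delta> a b \<eta> k \<equiv> (if k ~= 0 \<and> a <= \<eta> / of_int k \<and> \<eta> / of_int k <= b then (divsum \<delta> k)\<^sup>2 * ennreal (1 / \<bar>of_int k\<bar>) else 0)"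

text \<open>Expanding the square, the pair (m, m') selects the multiples of lcm m m'; so the average is bounded uniformly in the frequency \<eta>.\<close>
lemma divsum_square_average:
 fixes a b :: real
 assumes \<delta>: "\<delta> > 0" and ab: "0 < a" "a <= b"
 shows "\<exists>C. C < \<infinity> \<and> (\<forall>\<eta>. (\<integral>\<^sup>+k. (window_weight \<delta> a b \<eta> k) \<partial>count_int) <= C)"
proof -
 define L where "L = (\<integral>\<^sup>+m. (\<integral>\<^sup>+m'. (lcm_weight \<delta> m m')
   \<partial>count_int) \<partial>count_int)"
 have L: "L < \<infinity>" unfolding L_def by (rule gcd_lcm_sum_finite[OF \<delta>])
 define p where "p m = ennreal (\<bar>real_of_int m\<bar> powr (- (2 * \<delta>)))" for m
 have "(\<integral>\<^sup>+k. (window_weight \<delta> a b \<eta> k) \<partial>count_int) <= ennreal (b / a) * L" for \<eta>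
 proof -
  define q where "q k = (if k ~= 0 \<and> a <= \<eta> / of_int k \<and> \<eta> / of_int k <= b then ennreal (1 / \<bar>real_of_int k\<bar>) else 0)" for k :: int
  define i where "i m k = (if m dvd k then 1 else 0 :: ennreal)" for m k :: int
  have ds: "divsum \<delta> k = (\<integral>\<^sup>+m. i m k * p m \<partial>count_int)" for k
   unfolding divsum_def i_def p_def by (intro nn_integral_cong) auto
  have "(\<integral>\<^sup>+k. (window_weight \<delta> a b \<eta> k) \<partial>count_int)
    = (\<integral>\<^sup>+k. (\<integral>\<^sup>+m. (\<integral>\<^sup>+m'. (i m k * p m) * (i m' k * p m') * q k \<partial>count_int) \<partial>count_int) \<partial>count_int)"
  proof (rule nn_integral_cong)
   fix k
   have "(window_weight \<delta> a b \<eta> k) = divsum \<delta> k * divsum \<delta> k * q k"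
    by (simp add: q_def power2_eq_square)
   then show "(window_weight \<delta> a b \<eta> k)
    = (\<integral>\<^sup>+m. (\<integral>\<^sup>+m'. (i m k * p m) * (i m' k * p m') * q k \<partial>count_int) \<partial>count_int)"
    unfolding ds by (simp add: nn_integral_cmult nn_integral_multc)
  qed
  also have "... = (\<integral>\<^sup>+m. (\<integral>\<^sup>+k. (\<integral>\<^sup>+m'. (i m k * p m) * (i m' k * p m') * q k \<partial>count_int) \<partial>count_int) \<partial>count_int)"
   by (intro nn_integral_count_space_nn_integral) auto
  also have "... = (\<integral>\<^sup>+m. (\<integral>\<^sup>+m'. (\<integral>\<^sup>+k. (i m k * p m) * (i m' k * p m') * q k \<partial>count_int) \<partial>count_int) \<partial>count_int)"
   by (intro nn_integral_cong nn_integral_count_space_nn_integral) auto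
  also have "... <= (\<integral>\<^sup>+m. (\<integral>\<^sup>+m'. ennreal (b / a) * (lcm_weight \<delta> m m') \<partial>count_int) \<partial>count_int)"
  proof (intro nn_integral_mono)
   fix m m' :: int
   show "(\<integral>\<^sup>+k. (i m k * p m) * (i m' k * p m') * q k \<partial>count_int) <= ennreal (b / a) * (lcm_weight \<delta> m m')"
   proof (cases "m ~= 0 \<and> m' ~= 0")
    case True
    have l: "lcm m m' > 0" using True by (simp add: lcm_pos_int)
    have "(\<integral>\<^sup>+k. (i m k * p m) * (i m' k * p m') * q k \<partial>count_int) = (\<integral>\<^sup>+k. (p m * p m') * (if lcm m m' dvd k \<and> k ~= 0 \<and> a <= \<eta> / of_int k \<and> \<eta> / of_int k <= b then ennreal (1 / \<bar>of_int k\<bar>) else 0) \<partial>count_int)"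
     by (intro nn_integral_cong) (auto simp: i_def q_def lcm_least_iff)
    also have "... = (p m * p m') * (\<integral>\<^sup>+k. (if lcm m m' dvd k \<and> k ~= 0 \<and> a <= \<eta> / of_int k \<and> \<eta> / of_int k <= b then ennreal (1 / \<bar>of_int k\<bar>) else 0) \<partial>count_int)"
     by (rule nn_integral_cmult) simp
    also have "... <= (p m * p m') * ennreal (b / (a * of_int (lcm m m')))"
     by (intro mult_left_mono sum_reciprocal_multiples ab l) simp
    also have "... = ennreal (b / a) * ennreal (\<bar>of_int m\<bar> powr (- (2 * \<delta>)) * \<bar>of_int m'\<bar> powr (- (2 * \<delta>)) / of_int (lcm m m'))"
     unfolding p_def using ab l by (simp add: ennreal_mult[symmetric] mult_ac)
    finally show ?thesis using True by simp
   next
    case False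
    then have e: "(\<lambda>k. i m k * p m * (i m' k * p m') * q k) = (\<lambda>_. 0)" by (auto simp: p_def)
    show ?thesis unfolding e using False by auto
   qed
  qed
  also have "... = ennreal (b / a) * L"
   unfolding L_def by (simp add: nn_integral_cmult)
  finally show ?thesis .
 qed
 moreover have "ennreal (b / a) * L < \<infinity>" using L by (simp add: ennreal_mult_less_top)
 ultimately show ?thesis by blast
qed

definition rest :: "complex => real => real => complex" where
 "rest s y x = eisenstein (Complex x y) s - of_real y powr s - phi s * of_real y powr (1 - s)"

abbreviation rest_row :: "complex => real => ennreal" where
  "rest_row s y \<equiv> \<integral>\<^sup>+x. sqnorm (rest s y x) \<partial>unit_leb"

lemma bracket_hat_measurable:
 assumes "Re s > 1 / 2"
 shows "bracket_hat s \<in> borel_measurable lborel"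
  and "(\<integral>\<^sup>+\<eta>. sqnorm (bracket_hat s \<eta>) \<partial>lborel) <= ennreal (\<integral>u. (1 + u\<^sup>2) powr (- (2 * Re s)) \<partial>lborel)"
proof -
 have sq: "(norm (bracket s u))\<^sup>2 = (1 + u\<^sup>2) powr (- (2 * Re s))" for u
  unfolding norm_bracket power2_eq_square by (simp add: powr_add[symmetric])
 have i2: "integrable lborel (\<lambda>u. (norm (bracket s u))\<^sup>2)"
  unfolding sq using integrable_bracket_real[of "2 * Re s"] assms by simp
 show "bracket_hat s \<in> borel_measurable lborel"
  using plancherel_le_gauss(3)[OF integrable_bracket[OF assms] i2, of 1] by (simp add: bracket_hat_def[abs_def])
 show "(\<integral>\<^sup>+\<eta>. sqnorm (bracket_hat s \<eta>) \<partial>lborel) <= ennreal (\<integral>u. (1 + u\<^sup>2) powr (- (2 * Re s)) \<partial>lborel)"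
  using plancherel_le[OF integrable_bracket[OF assms] i2] unfolding sq bracket_hat_def .
qed

text \<open>Parseval on a horizontal line together with the lower bound for dzeta.\<close>
lemma rest_row_le:
 assumes y: "y > 0" and s: "s \<in> half_domain" "Re s >= 1 / 2 + \<delta>" "\<delta> > 0" and M: "y powr (1 - Re s) <= M"
 shows "(rest_row s y) \<le>
  (\<integral>\<^sup>+k. (if k ~= 0 then ennreal ((M * exp (dzeta_real (1 / 2 + \<delta>)))\<^sup>2) * ((divsum \<delta> k)\<^sup>2 * sqnorm (bracket_hat s (of_int k * y))) else 0) \<partial>count_int)"
proof -
 define f where "f x = eisenstein (Complex x y) s" for x
 define c where "c = of_real y powr s + phi s * of_real y powr (1 - s)"
 have f: "continuous_on UNIV f" "\<And>x. f (x + 1) = f x"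
  unfolding f_def using eisenstein_x_continuous[OF y s(1)] eisenstein_periodic[OF y] by auto
 have r: "rest s y x = f x - c" for x by (simp add: rest_def f_def c_def)
 have "integrable unit_leb (\<lambda>x. f x * char_neg k x)" "integrable unit_leb (\<lambda>x. c * char_neg k x)" for k
  by (intro integrable_unit_leb_continuous continuous_intros f)+
 then have fr: "fcoeff (rest s y) k = fcoeff f k - (if k = 0 then c else 0)" for k
  using integral_cis_int[of "- k"] by (simp add: fcoeff_def r left_diff_distrib)
 have f0: "fcoeff f 0 = c"
  unfolding f_def c_def by (rule constant_term_eisenstein[OF y s(1)])
 define M0 where "M0 = exp (dzeta_real (1 / 2 + \<delta>))"
 have M0: "M >= 0" using M powr_ge_zero[of y "1 - Re s"] by linarith
 have le: "sqnorm (fcoeff (rest s y) k) <= (if k ~= 0 then ennreal ((M * M0)\<^sup>2) * ((divsum \<delta> k)\<^sup>2 * sqnorm (bracket_hat s (of_int k * y))) else 0)" for k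
 proof (cases "k = 0")
  case True
  then show ?thesis by (simp add: fr f0)
 next
  case False
  have dz: "2 <= M0 * norm (dzeta s)"
  proof -
   have "2 <= exp (dzeta_real (Re s)) * norm (dzeta s)" using s by (intro dzeta_lower_bound) (auto simp: half_domain_def)
   also have "... <= M0 * norm (dzeta s)"
    unfolding M0_def using dzeta_real_antimono[of "1 / 2 + \<delta>" "Re s"] s by (intro mult_right_mono) auto
   finally show ?thesis .
  qed
  have "norm (fcoeff f k) <= M0 * norm (dzeta s) * norm (fcoeff f k)"
   using mult_right_mono[OF dz, of "norm (fcoeff f k)"] norm_ge_zero[of "fcoeff f k"] by linarith
  also have "... = M0 * norm (dzeta s * fcoeff f k)" by (simp add: norm_mult)
  also have "... = M0 * (y powr (1 - Re s) * norm (bracket_hat s (of_int k * y)) * norm (dsum k s))"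
  proof -
   have "dzeta s * fcoeff f k = of_real y powr (1 - s) * bracket_hat s (of_int k * y) * dsum k s"
    using dzeta_fcoeff_eisenstein_continued[OF y s(1) False] by (simp add: f_def[abs_def])
   then show ?thesis using y by (simp only: norm_mult) (simp add: norm_powr_real_powr)
  qed
  also have "... <= M0 * (M * norm (bracket_hat s (of_int k * y)) * norm (dsum k s))"
   unfolding M0_def using M by (intro mult_left_mono mult_right_mono) auto
  finally have "norm (fcoeff f k) <= (M * M0) * (norm (dsum k s) * norm (bracket_hat s (of_int k * y)))"
   by (simp add: mult_ac)
  then have "(norm (fcoeff f k))\<^sup>2 <= ((M * M0) * (norm (dsum k s) * norm (bracket_hat s (of_int k * y))))\<^sup>2"
   by (rule power_mono) simp
  also have "... = (M * M0)\<^sup>2 * ((norm (dsum k s))\<^sup>2 * (norm (bracket_hat s (of_int k * y)))\<^sup>2)"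
   by (simp add: power_mult_distrib)
  finally have "sqnorm (fcoeff f k) <= ennreal ((M * M0)\<^sup>2) * ((ennreal (norm (dsum k s)))\<^sup>2 * sqnorm (bracket_hat s (of_int k * y)))"
   by (simp add: ennreal_mult[symmetric] ennreal_power ennreal_leI)
  also have "... <= ennreal ((M * M0)\<^sup>2) * ((divsum \<delta> k)\<^sup>2 * sqnorm (bracket_hat s (of_int k * y)))"
   using norm_dsum_le_divsum[OF False s(2)] by (intro mult_left_mono mult_right_mono power_mono) auto
  finally show ?thesis using False by (simp add: fr)
 qed
 have rc: "continuous_on UNIV (rest s y)" "\<And>x. rest s y (x + 1) = rest s y x"
  using f by (auto simp: r[abs_def] intro!: continuous_intros)
 show ?thesis
  using order.trans[OF parseval_le[OF rc] nn_integral_mono[OF le]] unfolding M0_def .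
qed

lemma bracket_hat_dilate:
 assumes s: "Re s > 1 / 2" and k: "k ~= (0::int)"
 shows "(\<integral>\<^sup>+y. sqnorm (bracket_hat s (of_int k * y)) * indicator {a..b} y \<partial>lborel)
  = ennreal (1 / \<bar>of_int k\<bar>) * (\<integral>\<^sup>+\<eta>. sqnorm (bracket_hat s \<eta>) * indicator {a..b} (\<eta> / of_int k) \<partial>lborel)"
proof -
 have [measurable]: "bracket_hat s \<in> borel_fun"
  using bracket_hat_measurable(1)[OF s] by simp
 have "(\<integral>\<^sup>+\<eta>. sqnorm (bracket_hat s \<eta>) * indicator {a..b} (\<eta> / of_int k) \<partial>lborel)
   = ennreal \<bar>of_int k\<bar> * (\<integral>\<^sup>+y. sqnorm (bracket_hat s (0 + of_int k * y)) * indicator {a..b} ((0 + of_int k * y) / of_int k) \<partial>lborel)"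
  by (rule nn_integral_real_affine) (use k in auto)
 also have "... = ennreal \<bar>of_int k\<bar> * (\<integral>\<^sup>+y. sqnorm (bracket_hat s (of_int k * y)) * indicator {a..b} y \<partial>lborel)"
  using k by simp
 finally show ?thesis
  using k by (simp add: mult.assoc[symmetric] ennreal_mult[symmetric])
qed

lemma powr_strip_le:
 fixes a b y e K :: real
 assumes a: "0 < a" and y: "y \<in> {a..b}" and e: "\<bar>e\<bar> <= K"
 shows "y powr e <= (max b (1 / a) + 1) powr K"
proof -
 have b: "b > 0" using a y by simp
 define m where "m = max b (1 / a)"
 have m: "b <= m" "1 / a <= m" unfolding m_def by auto
 have "1 / y <= 1 / a" using y a by (simp add: frac_le)
 then have y': "y > 0" "y <= max b (1 / a) + 1" "1 / y <= max b (1 / a) + 1"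
  unfolding m_def[symmetric] using y a m by auto
 have m1: "max b (1 / a) + 1 >= 1" unfolding m_def[symmetric] using b m by linarith
 show ?thesis
 proof (cases "e >= 0")
  case True
  have "y powr e <= (max b (1 / a) + 1) powr e" using True y' by (intro powr_mono2) auto
  also have "... <= (max b (1 / a) + 1) powr K" using m1 e by (intro powr_mono) auto
  finally show ?thesis .
 next
  case False
  have "y powr e = (1 / y) powr (- e)" using y' by (simp add: powr_divide powr_minus)
  also have "... <= (max b (1 / a) + 1) powr (- e)" using False y' by (intro powr_mono2) auto
  also have "... <= (max b (1 / a) + 1) powr K" using m1 e by (intro powr_mono) auto
  finally show ?thesis .
 qed
qed

text \<open>Substituting \<eta> = k y in the k-th summand gives one integral over \<eta> against the averaged divisor sums; these are bounded, and Plancherel bounds the rest by a quantity that depends on Re s alone.\<close>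
lemma rest_strip_bound:
 fixes a b :: real
 assumes \<delta>: "\<delta> > 0" and ab: "0 < a" "a <= b"
 shows "\<exists>C<\<infinity>. \<forall>s\<in>half_domain. 1 / 2 + \<delta> <= Re s --> Re s <= B \<longrightarrow>
  (\<integral>\<^sup>+y. (rest_row s y) * indicator {a..b} y \<partial>lborel) <= C"
proof -
 define M where "M = (max b (1 / a) + 1) powr (\<bar>B\<bar> + 1)"
 have M: "y powr (1 - \<sigma>) <= M" if "y \<in> {a..b}" "1 / 2 <= \<sigma>" "\<sigma> <= B" for y \<sigma>
  unfolding M_def using that by (intro powr_strip_le ab(1)) auto
 obtain D where D: "D < \<infinity>" "\<And>\<eta>. (\<integral>\<^sup>+k. (window_weight \<delta> a b \<eta> k) \<partial>count_int) <= D"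
  using divsum_square_average[OF \<delta> ab] by blast
 define Q where "Q = ennreal ((M * exp (dzeta_real (1 / 2 + \<delta>)))\<^sup>2)"
 define P where "P = ennreal (\<integral>u. (1 + u\<^sup>2) powr (- (1 + 2 * \<delta>)) \<partial>lborel)"
 have main: "(\<integral>\<^sup>+y. (rest_row s y) * indicator {a..b} y \<partial>lborel) <= Q * (D * P)"
  if s: "s \<in> half_domain" "1 / 2 + \<delta> <= Re s" "Re s <= B" for s
 proof -
  have s12: "Re s > 1 / 2" using s \<delta> by simp
  have [measurable]: "bracket_hat s \<in> borel_fun"
   using bracket_hat_measurable(1)[OF s12] by simp
  define W where "W \<eta> = sqnorm (bracket_hat s \<eta>)" for \<eta>
  have [measurable]: "W \<in> borel_fun" unfolding W_def by measurable
  have "(\<integral>\<^sup>+y. (rest_row s y) * indicator {a..b} y \<partial>lborel)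
   <= (\<integral>\<^sup>+y. (\<integral>\<^sup>+k. (if k ~= 0 then Q * ((divsum \<delta> k)\<^sup>2 * (W (of_int k * y) * indicator {a..b} y)) else 0) \<partial>count_int) \<partial>lborel)"
  proof (rule nn_integral_mono)
   fix y
   show "(rest_row s y) * indicator {a..b} y <= (\<integral>\<^sup>+k. (if k ~= 0 then Q * ((divsum \<delta> k)\<^sup>2 * (W (of_int k * y) * indicator {a..b} y)) else 0) \<partial>count_int)"
   proof (cases "y \<in> {a..b}")
    case True
    then have "y > 0" "y powr (1 - Re s) <= M" using ab M[of y "Re s"] s \<delta> by auto
    from rest_row_le[OF this(1) s(1,2) \<delta> this(2)] show ?thesis
     using True unfolding Q_def W_def by (simp cong: if_cong)
   qed simp
  qed
  also have "... = (\<integral>\<^sup>+k. (\<integral>\<^sup>+y. (if k ~= 0 then Q * ((divsum \<delta> k)\<^sup>2 * (W (of_int k * y) * indicator {a..b} y)) else 0) \<partial>lborel) \<partial>count_int)"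
   by (rule nn_integral_count_space_nn_integral) auto
  also have "... = (\<integral>\<^sup>+k. (\<integral>\<^sup>+\<eta>. (if k ~= 0 then Q * ((divsum \<delta> k)\<^sup>2 * ennreal (1 / \<bar>of_int k\<bar>) * (W \<eta> * indicator {a..b} (\<eta> / of_int k))) else 0) \<partial>lborel) \<partial>count_int)"
  proof (rule nn_integral_cong)
   fix k :: int
   show "(\<integral>\<^sup>+y. (if k ~= 0 then Q * ((divsum \<delta> k)\<^sup>2 * (W (of_int k * y) * indicator {a..b} y)) else 0) \<partial>lborel) = (\<integral>\<^sup>+\<eta>. (if k ~= 0 then Q * ((divsum \<delta> k)\<^sup>2 * ennreal (1 / \<bar>of_int k\<bar>) * (W \<eta> * indicator {a..b} (\<eta> / of_int k))) else 0) \<partial>lborel)"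
    using bracket_hat_dilate[OF s12, of k a b] unfolding W_def[symmetric]
    by (cases "k = 0") (simp_all add: nn_integral_cmult mult.assoc)
  qed
  also have "... = (\<integral>\<^sup>+\<eta>. (\<integral>\<^sup>+k. (if k ~= 0 then Q * ((divsum \<delta> k)\<^sup>2 * ennreal (1 / \<bar>of_int k\<bar>) * (W \<eta> * indicator {a..b} (\<eta> / of_int k))) else 0) \<partial>count_int) \<partial>lborel)"
   by (rule nn_integral_count_space_nn_integral[symmetric]) auto
  also have "... = (\<integral>\<^sup>+\<eta>. Q * (W \<eta> * (\<integral>\<^sup>+k. (window_weight \<delta> a b \<eta> k) \<partial>count_int)) \<partial>lborel)"
   by (intro nn_integral_cong) (simp add: nn_integral_cmult[symmetric], intro nn_integral_cong, auto simp: indicator_def mult_ac)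
  also have "... <= (\<integral>\<^sup>+\<eta>. Q * (W \<eta> * D) \<partial>lborel)"
   by (intro nn_integral_mono mult_left_mono D(2)) auto
  also have "... = Q * (D * (\<integral>\<^sup>+\<eta>. W \<eta> \<partial>lborel))"
   by (simp add: nn_integral_cmult nn_integral_multc mult.commute)
  also have "... <= Q * (D * P)"
  proof -
   have "(\<integral>u. (1 + u\<^sup>2) powr (- (2 * Re s)) \<partial>lborel) <= (\<integral>u. (1 + u\<^sup>2) powr (- (1 + 2 * \<delta>)) \<partial>lborel)"
   proof (rule integral_mono)
    show "integrable lborel (\<lambda>u::real. (1 + u\<^sup>2) powr (- (2 * Re s)))" using s12 by (intro integrable_bracket_real) auto
    show "integrable lborel (\<lambda>u::real. (1 + u\<^sup>2) powr (- (1 + 2 * \<delta>)))" using \<delta> by (intro integrable_bracket_real) auto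
    show "(1 + u\<^sup>2) powr (- (2 * Re s)) <= (1 + u\<^sup>2) powr (- (1 + 2 * \<delta>))" for u :: real
     using s(2) by (intro powr_mono) auto
   qed
   then have "(\<integral>\<^sup>+\<eta>. W \<eta> \<partial>lborel) <= P"
    using bracket_hat_measurable(2)[OF s12] unfolding W_def P_def by (meson ennreal_leI order_trans)
   then show ?thesis by (intro mult_left_mono) auto
  qed
  finally show ?thesis .
 qed
 have "Q * (D * P) < \<infinity>" using D(1) by (simp add: Q_def P_def ennreal_mult_less_top)
 then show ?thesis using main by blast
qed

section \<open>Bound for the scattering coefficient\<close>

lemma nn_integral_unit_leb:
 "f \<in> borel_fun ==> (\<integral>\<^sup>+x. f x \<partial>unit_leb) = (\<integral>\<^sup>+x. f x * indicator {0..<1} x \<partial>lborel)"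
 unfolding unit_leb_def by (subst nn_integral_restrict_space) auto

text \<open>An interval of length |c| is covered by boundedly many periods.\<close>
lemma nn_integral_periodic_dilate:
 fixes f :: "real => ennreal"
 assumes f [measurable]: "f \<in> borel_fun" and per: "\<And>x. f (x + 1) = f x"
  and c: "c ~= 0" "\<bar>c\<bar> <= real N"
 shows "(\<integral>\<^sup>+x. f (c * x) \<partial>unit_leb) <= ennreal (real (2 * N + 1) / \<bar>c\<bar>) * (\<integral>\<^sup>+x. f x \<partial>unit_leb)"
proof -
 have shift: "(\<integral>\<^sup>+x. f x * indicator {of_int j..<of_int j + 1} x \<partial>lborel) = (\<integral>\<^sup>+x. f x \<partial>unit_leb)" for j :: int
 proof -
  have "(\<integral>\<^sup>+x. f x * indicator {of_int j..<of_int j + 1} x \<partial>lborel) = ennreal \<bar>1\<bar> * (\<integral>\<^sup>+x. f (of_int j + 1 * x) * indicator {of_int j..<of_int j + 1} (of_int j + 1 * x) \<partial>lborel)"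
   by (rule nn_integral_real_affine) auto
  also have "... = (\<integral>\<^sup>+x. f x * indicator {0..<1} x \<partial>lborel)"
   using periodic_int[of f, OF per] by (simp add: indicator_def add.commute)
  finally show ?thesis by (simp add: nn_integral_unit_leb)
 qed
 define J where "J = {- int N..int N}"
 have "ennreal \<bar>c\<bar> * (\<integral>\<^sup>+x. f (c * x) \<partial>unit_leb) = ennreal \<bar>c\<bar> * (\<integral>\<^sup>+x. f (0 + c * x) * indicator {0..<1} ((0 + c * x) / c) \<partial>lborel)"
  using c by (simp add: nn_integral_unit_leb)
 also have "... = (\<integral>\<^sup>+x. f x * indicator {0..<1} (x / c) \<partial>lborel)"
  by (rule nn_integral_real_affine[symmetric]) (use c in auto)
 also have "... <= (\<integral>\<^sup>+x. (\<Sum>j\<in>J. f x * indicator {of_int j..<of_int j + 1} x) \<partial>lborel)"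
 proof (rule nn_integral_mono)
  fix x
  show "f x * indicator {0..<1} (x / c) <= (\<Sum>j\<in>J. f x * indicator {of_int j..<of_int j + 1} x)"
  proof (cases "x / c \<in> {0..<1}")
   case True
   define q where "q = x / c"
   have q: "x = q * c" using c by (simp add: q_def)
   have q1: "\<bar>q\<bar> <= 1" using True unfolding q_def[symmetric] by auto
   have "\<bar>x\<bar> <= 1 * real N" unfolding q abs_mult using q1 c(2) by (intro mult_mono) auto
   then have "\<lfloor>x\<rfloor> \<in> J" unfolding J_def by (auto simp: floor_le_iff le_floor_iff)
   then have "f x * indicator {of_int \<lfloor>x\<rfloor>..<of_int \<lfloor>x\<rfloor> + 1} x <= (\<Sum>j\<in>J. f x * indicator {of_int j..<of_int j + 1} x)"
    by (intro member_le_sum) (auto simp: J_def)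
   then show ?thesis using True by (simp add: indicator_def)
  qed simp
 qed
 also have "... = (\<Sum>j\<in>J. (\<integral>\<^sup>+x. f x \<partial>unit_leb))"
  by (subst nn_integral_sum) (auto simp: shift)
 also have "... = ennreal (real (2 * N + 1)) * (\<integral>\<^sup>+x. f x \<partial>unit_leb)"
 proof -
  have "card J = 2 * N + 1" by (simp add: J_def nat_add_distrib nat_mult_distrib)
  then show ?thesis by (simp only: sum_constant ennreal_of_nat_eq_real_of_nat)
 qed
 finally have "ennreal (1 / \<bar>c\<bar>) * (ennreal \<bar>c\<bar> * (\<integral>\<^sup>+x. f (c * x) \<partial>unit_leb)) <= ennreal (1 / \<bar>c\<bar>) * (ennreal (real (2 * N + 1)) * (\<integral>\<^sup>+x. f x \<partial>unit_leb))"
  by (rule mult_left_mono) simp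
 moreover have "ennreal (1 / \<bar>c\<bar>) * ennreal (real (2 * N + 1)) = ennreal (real (2 * N + 1) / \<bar>c\<bar>)"
  by (subst ennreal_mult[symmetric]) auto
 moreover have "ennreal (1 / \<bar>c\<bar>) * ennreal \<bar>c\<bar> = 1"
  using c by (simp add: ennreal_mult[symmetric])
 ultimately show ?thesis by (simp only: mult.assoc[symmetric] mult_1_left)
qed

lemma uhp_xy_continuous:
 fixes f :: "'a::topological_space => real"
 assumes s: "s \<in> half_domain" and f: "continuous_on UNIV f" and g: "continuous_on UNIV g" "\<And>p. g p > 0"
 shows "continuous_on UNIV (\<lambda>p. eisenstein (Complex (f p) (g p)) s)"
proof (rule continuous_on_compose2[OF eisenstein_continuous[OF s]])
 show "continuous_on UNIV (\<lambda>p. Complex (f p) (g p))"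
  unfolding Complex_eq by (intro continuous_intros f g)
qed (use g in auto)

lemma rest_continuous:
 fixes f :: "'a::topological_space => real"
 assumes s: "s \<in> half_domain" and f: "continuous_on UNIV f" and g: "continuous_on UNIV g" "\<And>p. g p > 0"
 shows "continuous_on UNIV (\<lambda>p. rest s (g p) (f p))"
proof -
 have gp: "continuous_on UNIV (\<lambda>p. complex_of_real (g p) powr w)" for w
 proof -
  have eq: "complex_of_real (g p) powr w = exp (w * of_real (ln (g p)))" for p
   using g(2)[of p] by (simp add: powr_def Ln_of_real)
  have L: "continuous_on UNIV (\<lambda>p. ln (g p))"
   using g by (intro continuous_on_ln) (auto simp: less_imp_neq[symmetric])
  show ?thesis
   unfolding eq by (rule continuous_on_exp, rule continuous_on_mult, rule continuous_on_const, rule continuous_on_of_real, rule L)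
 qed
 show ?thesis
  unfolding rest_def by (intro continuous_intros gp uhp_xy_continuous[OF s f g])
qed

lemma rest_periodic: "y > 0 ==> rest s y (x + 1) = rest s y x" by (simp add: rest_def eisenstein_periodic)

text \<open>Coordinates (log y, x/y), in which the inversion -1/z preserves the slope up to sign and reflects the height; see eisenstein_inversion.\<close>
definition rest_log :: "complex => real => real => ennreal" where
 "rest_log s t \<theta> = sqnorm (rest s (exp t) (\<theta> * exp t))"

abbreviation rest_log_row :: "complex => real => real => ennreal" where
  "rest_log_row s e t \<equiv> \<integral>\<^sup>+\<theta>. rest_log s t (e * \<theta>) \<partial>unit_leb"

lemma rest_log_measurable:
 assumes s: "s \<in> half_domain" and [measurable]: "f \<in> borel_measurable M" "g \<in> borel_measurable M"
 shows "(\<lambda>x. rest_log s (f x) (g x)) \<in> borel_measurable M"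
proof -
 have "continuous_on UNIV (\<lambda>p. rest s (exp (fst p)) (snd p * exp (fst p)))"
  by (rule rest_continuous[OF s]) (auto intro!: continuous_intros)
 then have [measurable]: "(\<lambda>p. rest s (exp (fst p)) (snd p * exp (fst p))) \<in> borel_measurable borel2"
  unfolding borel_prod by (rule borel_measurable_continuous_onI)
 have "(\<lambda>p. rest_log s (fst p) (snd p)) \<in> borel_measurable borel2"
  unfolding rest_log_def by measurable
 from measurable_compose[OF _ this, of "\<lambda>x. (f x, g x)" M] show ?thesis by simp
qed

lemma rest_row_measurable:
 assumes s: "s \<in> half_domain"
 shows "(\<lambda>y. \<integral>\<^sup>+x. sqnorm (rest s (exp (ln y)) x) \<partial>unit_leb) \<in> borel_fun"
proof -
 have "continuous_on UNIV (\<lambda>p. rest s (exp (fst p)) (snd p))"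
  by (rule rest_continuous[OF s(1)]) (auto intro!: continuous_intros)
 then have m [measurable]: "(\<lambda>p. rest s (exp (fst p)) (snd p)) \<in> borel_measurable borel2"
  unfolding borel_prod by (rule borel_measurable_continuous_onI)
 have m1: "(\<lambda>x. sqnorm (rest s (exp t) x)) \<in> borel_fun" for t
  using measurable_compose[OF measurable_Pair1'[of t borel borel] m] by simp
 have "(\<lambda>(t, x). sqnorm (rest s (exp t) x) * indicator {0..<1} x) \<in> borel_measurable (borel \<Otimes>\<^sub>M lborel)"
  unfolding split_beta' by measurable
 then have "(\<lambda>t. \<integral>\<^sup>+x. sqnorm (rest s (exp t) x) * indicator {0..<1} x \<partial>lborel) \<in> borel_fun"
  by (rule lborel.borel_measurable_nn_integral)
 then have "(\<lambda>y. \<integral>\<^sup>+x. sqnorm (rest s (exp (ln y)) x) * indicator {0..<1} x \<partial>lborel) \<in> borel_fun"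
  by measurable
 then show ?thesis by (simp add: nn_integral_unit_leb[OF m1])
qed

text \<open>The bound for rest in the new coordinates; the sign e accounts for the effect of the inversion on the slope.\<close>
lemma rest_log_bound:
 assumes \<delta>: "\<delta> > 0" and \<alpha>: "\<alpha> < \<beta>"
 shows "\<exists>C<\<infinity>. \<forall>s\<in>half_domain. 1 / 2 + \<delta> <= Re s --> Re s <= B \<longrightarrow>
  (\<forall>e\<in>{1, -1}. (\<integral>\<^sup>+t. (rest_log_row s e t) * indicator {\<alpha>..\<beta>} t \<partial>lborel) <= C)"
proof -
 obtain C where C: "C < \<infinity>" "\<And>s. s \<in> half_domain ==> 1 / 2 + \<delta> <= Re s ==> Re s <= B ==>
  (\<integral>\<^sup>+y. (rest_row s y) * indicator {exp \<alpha>..exp \<beta>} y \<partial>lborel) <= C"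
  using rest_strip_bound[OF \<delta>, of "exp \<alpha>" "exp \<beta>" B] \<alpha> by auto
 define N where "N = nat \<lceil>exp \<beta>\<rceil>"
 have N: "exp \<beta> <= real N" unfolding N_def by linarith
 define D where "D = real (2 * N + 1) / exp \<alpha> / exp \<alpha>"
 have "(\<integral>\<^sup>+t. (rest_log_row s e t) * indicator {\<alpha>..\<beta>} t \<partial>lborel) <= ennreal D * C"
  if s: "s \<in> half_domain" "1 / 2 + \<delta> <= Re s" "Re s <= B" and e: "e \<in> {1, -1}" for s and e :: real
 proof -
  define h where "h y x = sqnorm (rest s y x)" for y x
  have hm [measurable]: "h y \<in> borel_fun" if "y > 0" for y
  proof -
   have "continuous_on UNIV (\<lambda>x. rest s y x)"
    by (rule rest_continuous[OF s(1)]) (use that in \<open>auto intro!: continuous_intros\<close>)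
   from borel_measurable_continuous_onI[OF this] show ?thesis unfolding h_def by measurable
  qed
  define F where "F y = (\<integral>\<^sup>+x. h (exp (ln y)) x \<partial>unit_leb)" for y
  have Fe: "F y = (\<integral>\<^sup>+x. h y x \<partial>unit_leb)" if "y > 0" for y using that by (simp add: F_def)
  have Fm: "F \<in> borel_fun"
   unfolding F_def h_def by (rule rest_row_measurable[OF s(1)])
  have "(rest_log_row s e t) <= ennreal (real (2 * N + 1) / exp \<alpha>) * F (exp t)" if t: "t \<in> {\<alpha>..\<beta>}" for t
  proof -
   have "(\<integral>\<^sup>+\<theta>. h (exp t) ((e * exp t) * \<theta>) \<partial>unit_leb) <= ennreal (real (2 * N + 1) / \<bar>e * exp t\<bar>) * (\<integral>\<^sup>+x. h (exp t) x \<partial>unit_leb)"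
   proof (rule nn_integral_periodic_dilate)
    have "exp t <= exp \<beta>" using t by simp
    then have "exp t <= real N" using N by (rule order.trans)
    then show "\<bar>e * exp t\<bar> <= real N" using e by (auto simp: abs_mult)
   qed (use e hm[of "exp t"] in \<open>auto simp: h_def[abs_def] rest_periodic\<close>)
   also have "... <= ennreal (real (2 * N + 1) / exp \<alpha>) * F (exp t)"
    unfolding Fe[OF exp_gt_zero] using e t by (intro mult_right_mono ennreal_leI divide_left_mono) (auto simp: abs_mult)
   finally show ?thesis by (simp add: rest_log_def h_def mult_ac)
  qed
  then have "(\<integral>\<^sup>+t. (rest_log_row s e t) * indicator {\<alpha>..\<beta>} t \<partial>lborel)
    <= (\<integral>\<^sup>+t. ennreal D * (F (exp t) * ennreal (exp t) * indicator {\<alpha>..\<beta>} t) \<partial>lborel)"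
  proof (intro nn_integral_mono)
   fix t
   assume *: "\<And>t. t \<in> {\<alpha>..\<beta>} ==> (rest_log_row s e t) <= ennreal (real (2 * N + 1) / exp \<alpha>) * F (exp t)"
   show "(rest_log_row s e t) * indicator {\<alpha>..\<beta>} t <= ennreal D * (F (exp t) * ennreal (exp t) * indicator {\<alpha>..\<beta>} t)"
   proof (cases "t \<in> {\<alpha>..\<beta>}")
    case True
    have "real (2 * N + 1) / exp \<alpha> <= D * exp t"
    proof -
     have "real (2 * N + 1) / exp \<alpha> * 1 <= real (2 * N + 1) / exp \<alpha> * (exp t / exp \<alpha>)"
      using True by (intro mult_left_mono) auto
     then show ?thesis by (simp add: D_def)
    qed
    then have "ennreal (real (2 * N + 1) / exp \<alpha>) <= ennreal D * ennreal (exp t)"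
     by (subst ennreal_mult[symmetric]) (auto simp: D_def intro!: ennreal_leI)
    from mult_right_mono[OF this zero_le, of "F (exp t)"]
    have "ennreal (real (2 * N + 1) / exp \<alpha>) * F (exp t) <= ennreal D * (F (exp t) * ennreal (exp t))"
     by (simp only: mult_ac)
    then show ?thesis using *[OF True] True by simp
   qed simp
  qed
  also have "... = ennreal D * (\<integral>\<^sup>+t. F (exp t) * ennreal (exp t) * indicator {\<alpha>..\<beta>} t \<partial>lborel)"
   using Fm by (intro nn_integral_cmult) simp
  also have "(\<integral>\<^sup>+t. F (exp t) * ennreal (exp t) * indicator {\<alpha>..\<beta>} t \<partial>lborel) = (\<integral>\<^sup>+y. F y * indicator {exp \<alpha>..exp \<beta>} y \<partial>lborel)"
   by (rule nn_integral_substitution_aux[symmetric]) (use Fm \<alpha> in \<open>auto intro!: continuous_intros DERIV_exp\<close>)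
  also have "... = (\<integral>\<^sup>+y. (rest_row s y) * indicator {exp \<alpha>..exp \<beta>} y \<partial>lborel)"
  proof (rule nn_integral_cong)
   fix y
   show "F y * indicator {exp \<alpha>..exp \<beta>} y = (rest_row s y) * indicator {exp \<alpha>..exp \<beta>} y"
    using Fe[of y] exp_gt_zero[of \<alpha>] by (cases "y \<in> {exp \<alpha>..exp \<beta>}") (auto simp: h_def simp del: exp_gt_zero)
  qed
  also have "ennreal D * ... <= ennreal D * C" by (rule mult_left_mono[OF C(2)[OF s] zero_le])
  finally show ?thesis .
 qed
 moreover have "ennreal D * C < \<infinity>" using C(1) by (simp add: ennreal_mult_less_top)
 ultimately show ?thesis by blast
qed

lemma eisenstein_inversion:
 "eisenstein (Complex (\<theta> * exp t) (exp t)) s =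
  eisenstein (Complex (- \<theta> * exp (- t - ln (1 + \<theta>\<^sup>2))) (exp (- t - ln (1 + \<theta>\<^sup>2)))) s"
proof -
 define z where "z = Complex (\<theta> * exp t) (exp t)"
 define u where "u = exp (- t - ln (1 + \<theta>\<^sup>2))"
 have p: "1 + \<theta>\<^sup>2 > 0" by (simp add: add_pos_nonneg)
 have "u = exp (- t) / exp (ln (1 + \<theta>\<^sup>2))" unfolding u_def by (rule exp_diff)
 then have u: "u = 1 / (exp t * (1 + \<theta>\<^sup>2))" using p by (simp add: exp_minus field_simps)
 have z: "Im z > 0" "z ~= 0" by (auto simp: z_def complex_eq_iff)
 have "Complex (- \<theta> * u) u * z = -1"
 proof -
  have "u * exp t * (1 + \<theta>\<^sup>2) = 1" using u p by simp
  then show ?thesis by (simp add: z_def complex_eq_iff) (simp add: algebra_simps power2_eq_square)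
 qed
 then have "-1 / z = Complex (- \<theta> * u) u" using z by (simp add: field_simps)
 moreover have "moebius 0 (-1) 1 0 z = -1 / z" using z by (simp add: moebius_apply)
 ultimately have "moebius 0 (-1) 1 0 z = Complex (- \<theta> * u) u" by simp
 then show ?thesis
  using eisenstein_invariant[OF z(1), of 0 0 "-1" 1] by (simp add: z_def u_def)
qed

lemma sum3_square:
 fixes a b c :: real
 shows "(a + b + c)\<^sup>2 <= 3 * (a\<^sup>2 + b\<^sup>2 + c\<^sup>2)"
proof -
 have "0 <= (a - b)\<^sup>2 + (b - c)\<^sup>2 + (a - c)\<^sup>2" by simp
 then show ?thesis by (simp add: power2_eq_square algebra_simps)
qed

abbreviation osc :: "complex => real => real" where
  "osc w x \<equiv> norm (1 - exp (- w * of_real x))"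

text \<open>In the mean the two phases are orthogonal up to an error of order 1 / norm w, so the mean square of their difference stays away from 0 once w is large.\<close>
lemma oscillation_lower_bound:
 fixes w :: complex
 assumes K: "\<bar>Re w\<bar> <= K" and w: "norm w >= 4 * exp (3 * K)" and l: "0 <= l" "l <= 1"
 shows "1 / 2 <= (\<integral>t. (osc w (2 * t + l))\<^sup>2 \<partial>unit_leb)"
proof -
 have K0: "K >= 0" using K by linarith
 have w0: "w ~= 0" using w exp_gt_zero[of "3 * K"] by (intro notI) simp
 define u where "u t = exp (- w * of_real (2 * t + l))" for t :: real
 have uc: "continuous_on UNIV u" unfolding u_def by (intro continuous_intros)
 have ui: "integrable unit_leb u" "integrable unit_leb (\<lambda>t. (norm (1 - u t))\<^sup>2)"
  by (intro integrable_unit_leb_continuous continuous_intros uc)+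
 have "(\<integral>t. u t \<partial>unit_leb) = (\<integral>t. exp (- w * l) * exp ((- (2 * w)) * of_real t) \<partial>unit_leb)"
  by (intro lint_cong) (simp_all add: u_def exp_add[symmetric] algebra_simps)
 also have "... = exp (- w * l) * ((exp (- (2 * w)) - 1) / (- (2 * w)))"
  using integral_exp_unit_leb[of "- (2 * w)"] w0 by (subst integral_mult_right_zero) simp
 finally have "norm (\<integral>t. u t \<partial>unit_leb) = norm (exp (- w * l)) * (norm (exp (- (2 * w)) - 1) / (2 * norm w))"
  by (simp add: norm_mult norm_divide)
 also have "... <= exp K * ((2 * exp (2 * K)) / (2 * norm w))"
 proof (intro mult_mono divide_right_mono)
  have "- Re w * l <= \<bar>Re w\<bar> * 1" using l by (intro order.trans[OF _ mult_left_mono[OF l(2)]] mult_right_mono) auto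
  then show "norm (exp (- w * complex_of_real l)) <= exp K" using K by simp
  have "norm (exp (- (2 * w)) - 1) <= norm (exp (- (2 * w))) + 1" using norm_triangle_ineq4[of "exp (- (2 * w))" 1] by simp
  also have "... <= exp (2 * K) + exp (2 * K)" using K K0 by (intro add_mono) auto
  finally show "norm (exp (- (2 * w)) - 1) <= 2 * exp (2 * K)" by simp
 qed auto
 also have "... = exp (3 * K) / norm w"
  using w0 by (simp add: exp_add[symmetric])
 also have "... <= 1 / 4" using w w0 by (simp add: field_simps)
 finally have n: "norm (\<integral>t. u t \<partial>unit_leb) <= 1 / 4" .
 have "1 / 2 <= 1 - 2 * Re (\<integral>t. u t \<partial>unit_leb)"
  using n complex_Re_le_cmod[of "\<integral>t. u t \<partial>unit_leb"] by linarith
 also have "... = (\<integral>t. 1 - 2 * Re (u t) \<partial>unit_leb)"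
  using ui(1) integrable_unit_leb_continuous[of "\<lambda>_. 1::real"] by (simp add: integral_Re measure_def)
 also have "... <= (\<integral>t. (norm (1 - u t))\<^sup>2 \<partial>unit_leb)"
 proof (rule integral_mono)
  show "integrable unit_leb (\<lambda>t. 1 - 2 * Re (u t))"
   by (intro integrable_unit_leb_continuous continuous_intros uc)
  show "1 - 2 * Re (u t) <= (norm (1 - u t))\<^sup>2" for t
   unfolding cmod_power2 by (simp add: power2_eq_square algebra_simps)
 qed (rule ui)
 finally show ?thesis by (simp add: u_def)
qed

text \<open>Equating the expansions at z and -1/z expresses phi s times a difference of two phases by bounded quantities. Integrating squares over a unit square in the coordinates of rest_log bounds phi s by oscillation_lower_bound.\<close>
lemma phi_bounded:
 assumes \<delta>: "\<delta> > 0"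
 shows "\<exists>C T. \<forall>s\<in>half_domain. 1 / 2 + \<delta> <= Re s --> Re s <= B --> T <= \<bar>Im s\<bar> --> norm (phi s) <= C"
proof -
 have e3: "ennreal (3 * (x + y + z)) = ennreal 3 * (ennreal x + ennreal y + ennreal z)" if "x >= 0" "y >= 0" "z >= 0" for x y z
  using that by (subst ennreal_mult) simp_all
 have neg2_less_1: "(- 2 :: real) < 1" by simp
 obtain C where C: "C < \<infinity>" "\<And>s e. s \<in> half_domain ==> 1 / 2 + \<delta> <= Re s ==> Re s <= B ==> e \<in> {1, -1} ==>
  (\<integral>\<^sup>+t. (rest_log_row s e t) * indicator {-2..1} t \<partial>lborel) <= C"
  using rest_log_bound[OF \<delta>, of "-2" 1 B, OF neg2_less_1] by blast
 define K where "K = \<bar>B\<bar> + 1"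
 have K0: "K >= 1" by (simp add: K_def)
 \<comment> \<open>from here on oscillation_lower_bound applies to w = 1 - s, with K bounding its real part\<close>
 define T where "T = 4 * exp (3 * K)"
 define v where "v = exp K + 1"
 define c where "c = exp (- (2 * K))"
 have main: "ennreal ((norm (phi s))\<^sup>2 * c / 2) <= ennreal 3 * (ennreal (v\<^sup>2) + C + C)"
  if s: "s \<in> half_domain" "1 / 2 + \<delta> <= Re s" "Re s <= B" "T <= \<bar>Im s\<bar>" for s
 proof -
  define w where "w = 1 - s"
  have Rw: "\<bar>Re w\<bar> <= K" using s \<delta> by (auto simp: w_def K_def)
  have nw: "norm w >= 4 * exp (3 * K)" using s(4) abs_Im_le_cmod[of w] by (simp add: w_def T_def)
  note [measurable] = rest_log_measurable[OF s(1)]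
  define l where "l \<theta> = ln (1 + \<theta>\<^sup>2)" for \<theta> :: real
  have l: "0 <= l \<theta>" "l \<theta> <= 1" if "\<theta> \<in> {0..<1}" for \<theta>
  proof -
   show "0 <= l \<theta>" by (simp add: l_def)
   have "l \<theta> <= \<theta>\<^sup>2" unfolding l_def by (rule ln_add_one_self_le_self) simp
   also have "... <= 1" using that by (simp add: power_le_one)
   finally show "l \<theta> <= 1" .
  qed
  define r where "r t \<theta> = rest s (exp t) (\<theta> * exp t)" for t \<theta>
  have point: "(norm (phi s))\<^sup>2 * c * (osc w (2 * t + l \<theta>))\<^sup>2
    <= 3 * (v\<^sup>2 + (norm (r (- t - l \<theta>) (- \<theta>)))\<^sup>2 + (norm (r t \<theta>))\<^sup>2)"
   if t: "t \<in> {0..<1}" and \<theta>: "\<theta> \<in> {0..<1}" for t \<theta>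
  proof -
   define t' where "t' = - t - l \<theta>"
   have pw: "of_real (exp x) powr a = exp (a * complex_of_real x)" for x a
    by (simp add: powr_def Ln_of_real exp_of_real[symmetric] del: exp_of_real)
   have E1: "eisenstein (Complex (\<theta> * exp t) (exp t)) s = exp (s * of_real t) + phi s * exp (w * of_real t) + r t \<theta>"
    by (simp add: r_def rest_def pw w_def)
   have E2: "eisenstein (Complex (- \<theta> * exp t') (exp t')) s = exp (s * of_real t') + phi s * exp (w * of_real t') + r t' (- \<theta>)"
    by (simp add: r_def rest_def pw w_def)
   have "exp (s * of_real t) + phi s * exp (w * of_real t) + r t \<theta> = exp (s * of_real t') + phi s * exp (w * of_real t') + r t' (- \<theta>)"
    using eisenstein_inversion[of \<theta> t s] unfolding l_def[symmetric] t'_def[symmetric] E1 E2 .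
   then have pd: "phi s * (exp (w * of_real t) - exp (w * of_real t')) = (exp (s * of_real t') - exp (s * of_real t)) + r t' (- \<theta>) - r t \<theta>"
    by algebra
   have "norm (phi s) * norm (exp (w * of_real t) - exp (w * of_real t')) <= norm (exp (s * of_real t') - exp (s * of_real t)) + norm (r t' (- \<theta>)) + norm (r t \<theta>)"
    unfolding norm_mult[symmetric] pd
    by (rule order.trans[OF norm_triangle_ineq4], rule add_right_mono, rule norm_triangle_ineq)
   also have "norm (exp (s * of_real t') - exp (s * of_real t)) <= norm (exp (s * of_real t')) + norm (exp (s * of_real t))"
    by (rule norm_triangle_ineq4)
   also have "... <= 1 + exp K"
   proof (intro add_mono)
    have "Re s * t' <= 0" using s(2) \<delta> t l[OF \<theta>] by (intro mult_nonneg_nonpos) (auto simp: t'_def)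
    then show "norm (exp (s * complex_of_real t')) <= 1" by simp
    have "Re s * t <= \<bar>B\<bar> * 1" using s \<delta> t by (intro mult_mono) auto
    then show "norm (exp (s * complex_of_real t)) <= exp K" by (simp add: K_def)
   qed
   finally have "norm (phi s) * norm (exp (w * of_real t) - exp (w * of_real t')) <= v + norm (r t' (- \<theta>)) + norm (r t \<theta>)"
    by (simp add: v_def)
   then have "(norm (phi s) * norm (exp (w * of_real t) - exp (w * of_real t')))\<^sup>2 <= (v + norm (r t' (- \<theta>)) + norm (r t \<theta>))\<^sup>2"
    by (rule power_mono) simp
   also have "... <= 3 * (v\<^sup>2 + (norm (r t' (- \<theta>)))\<^sup>2 + (norm (r t \<theta>))\<^sup>2)"
    by (rule sum3_square)
   finally have 1: "(norm (phi s))\<^sup>2 * (norm (exp (w * of_real t) - exp (w * of_real t')))\<^sup>2 <= 3 * (v\<^sup>2 + (norm (r t' (- \<theta>)))\<^sup>2 + (norm (r t \<theta>))\<^sup>2)"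
    by (simp add: power_mult_distrib)
   have "exp (w * of_real t) - exp (w * of_real t') = exp (w * of_real t) * (1 - exp (- w * of_real (2 * t + l \<theta>)))"
    unfolding right_diff_distrib exp_add[symmetric] by (simp add: t'_def algebra_simps)
   then have "(norm (exp (w * of_real t) - exp (w * of_real t')))\<^sup>2 = (norm (exp (w * complex_of_real t)))\<^sup>2 * (osc w (2 * t + l \<theta>))\<^sup>2"
    by (simp only: norm_mult power_mult_distrib)
   moreover have "c <= (norm (exp (w * complex_of_real t)))\<^sup>2"
   proof -
    have "\<bar>Re w * t\<bar> <= K * 1" unfolding abs_mult using Rw t by (intro mult_mono) auto
    then have "exp (- K) <= norm (exp (w * complex_of_real t))" by simp
    then have "(exp (- K))\<^sup>2 <= (norm (exp (w * complex_of_real t)))\<^sup>2" by (rule power_mono) simp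
    then show ?thesis by (simp add: c_def power2_eq_square exp_add[symmetric])
   qed
   ultimately have "c * (osc w (2 * t + l \<theta>))\<^sup>2 <= (norm (exp (w * of_real t) - exp (w * of_real t')))\<^sup>2"
    by (simp only: mult_right_mono zero_le_power2)
   then have "(norm (phi s))\<^sup>2 * (c * (osc w (2 * t + l \<theta>))\<^sup>2) <= (norm (phi s))\<^sup>2 * (norm (exp (w * of_real t) - exp (w * of_real t')))\<^sup>2"
    by (rule mult_left_mono) simp
   then show ?thesis using 1 unfolding t'_def by (simp only: mult.assoc) 
  qed
  have lower: "ennreal ((norm (phi s))\<^sup>2 * c / 2) <= (\<integral>\<^sup>+t. ennreal ((norm (phi s))\<^sup>2 * c * (osc w (2 * t + l \<theta>))\<^sup>2) \<partial>unit_leb)"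
   if "\<theta> \<in> {0..<1}" for \<theta>
  proof -
   have i: "integrable unit_leb (\<lambda>t. (norm (phi s))\<^sup>2 * c * (osc w (2 * t + l \<theta>))\<^sup>2)"
    by (intro integrable_unit_leb_continuous continuous_intros)
   have "(norm (phi s))\<^sup>2 * c * (1 / 2) <= (norm (phi s))\<^sup>2 * c * (\<integral>t. (osc w (2 * t + l \<theta>))\<^sup>2 \<partial>unit_leb)"
    by (intro mult_left_mono oscillation_lower_bound[OF Rw nw] l[OF that]) (simp add: c_def)
   also have "... = (\<integral>t. (norm (phi s))\<^sup>2 * c * (osc w (2 * t + l \<theta>))\<^sup>2 \<partial>unit_leb)"
    by simp
   finally show ?thesis
    using i by (subst nn_integral_eq_integral) (auto simp: c_def intro!: ennreal_leI)
  qed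
  have lm [measurable]: "l \<in> borel_fun"
   unfolding l_def by measurable
  define V where "V = ennreal (v\<^sup>2)"
  have split3: "(\<integral>\<^sup>+t. ennreal 3 * (V + f t + g t) \<partial>unit_leb) = ennreal 3 * (V + (\<integral>\<^sup>+t. f t \<partial>unit_leb) + (\<integral>\<^sup>+t. g t \<partial>unit_leb))"
   if "f \<in> borel_fun" "g \<in> borel_fun" for f g :: "real => ennreal"
  proof -
   note [measurable] = that[THEN measurable_unit_leb]
   show ?thesis by (subst nn_integral_cmult, measurable) (simp add: nn_integral_add)
  qed
  have unit_measurable: "(\<lambda>\<theta>. \<integral>\<^sup>+t. f t \<theta> \<partial>unit_leb) \<in> borel_fun"
   if fm: "(\<lambda>(t, \<theta>). f t \<theta>) \<in> borel_measurable borel2" for f :: "real => real => ennreal"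
  proof -
   have [measurable]: "(\<lambda>p. f (fst p) (snd p)) \<in> borel_measurable borel2" using fm by (simp add: split_beta')
   have m1: "(\<lambda>t. f t \<theta>) \<in> borel_fun" for \<theta>
    using measurable_compose[OF measurable_Pair2'[of \<theta> borel borel] fm] by simp
   have "(\<lambda>(\<theta>, t). f t \<theta> * indicator {0..<1} t) \<in> borel_measurable (borel \<Otimes>\<^sub>M lborel)"
   proof -
    have "(\<lambda>p. (\<lambda>p. f (fst p) (snd p)) (snd p, fst p)) \<in> borel_measurable borel2" by measurable
    then have [measurable]: "(\<lambda>p. f (snd p) (fst p)) \<in> borel_measurable borel2" by simp
    show ?thesis unfolding split_beta' by measurable
   qed
   then have "(\<lambda>\<theta>. \<integral>\<^sup>+t. f t \<theta> * indicator {0..<1} t \<partial>lborel) \<in> borel_fun"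
    by (rule lborel.borel_measurable_nn_integral)
   then show ?thesis by (simp add: nn_integral_unit_leb[OF m1])
  qed
  have swap: "(\<integral>\<^sup>+\<theta>. (\<integral>\<^sup>+t. rest_log s t (e * \<theta>) * indicator {-2..1} t \<partial>lborel) \<partial>unit_leb) <= C" if e: "e \<in> {1, -1}" for e
  proof -
   have Fm: "(\<lambda>\<theta>. \<integral>\<^sup>+t. rest_log s t (e * \<theta>) * indicator {-2..1} t \<partial>lborel) \<in> borel_fun"
   proof (rule lborel.borel_measurable_nn_integral)
    show "(\<lambda>(\<theta>, t). rest_log s t (e * \<theta>) * indicator {-2..1} t) \<in> borel_measurable (borel \<Otimes>\<^sub>M lborel)"
     unfolding split_beta' by measurable
   qed
   have "(\<integral>\<^sup>+\<theta>. (\<integral>\<^sup>+t. rest_log s t (e * \<theta>) * indicator {-2..1} t \<partial>lborel) \<partial>unit_leb)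
    = (\<integral>\<^sup>+\<theta>. (\<integral>\<^sup>+t. rest_log s t (e * \<theta>) * indicator {-2..1} t * indicator {0..<1} \<theta> \<partial>lborel) \<partial>lborel)"
    by (simp add: nn_integral_unit_leb[OF Fm] nn_integral_multc)
   also have "... = (\<integral>\<^sup>+t. (\<integral>\<^sup>+\<theta>. rest_log s t (e * \<theta>) * indicator {-2..1} t * indicator {0..<1} \<theta> \<partial>lborel) \<partial>lborel)"
    by (rule lborel_pair.Fubini') (simp add: split_beta')
   also have "... = (\<integral>\<^sup>+t. (rest_log_row s e t) * indicator {-2..1} t \<partial>lborel)"
   proof (rule nn_integral_cong)
    fix t
    show "(\<integral>\<^sup>+\<theta>. rest_log s t (e * \<theta>) * indicator {-2..1} t * indicator {0..<1} \<theta> \<partial>lborel) = (rest_log_row s e t) * indicator {-2..1} t"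
     by (subst nn_integral_unit_leb) (auto simp: indicator_def)
   qed
   also have "... <= C" by (rule C(2)[OF s(1-3) e])
   finally show ?thesis .
  qed
  \<comment> \<open>both heights t and - t - l \<theta> stay in {-2..1} for t and \<theta> in the unit interval\<close>
  have boundR: "(\<integral>\<^sup>+\<theta>. (\<integral>\<^sup>+t. rest_log s t \<theta> \<partial>unit_leb) \<partial>unit_leb) <= C"
  proof (rule order.trans[OF nn_integral_mono swap[of 1]])
   show "(\<integral>\<^sup>+t. rest_log s t \<theta> \<partial>unit_leb) <= (\<integral>\<^sup>+t. rest_log s t (1 * \<theta>) * indicator {-2..1} t \<partial>lborel)" for \<theta>
    by (subst nn_integral_unit_leb) (auto simp: indicator_def intro!: nn_integral_mono)
  qed simp
  have boundRS: "(\<integral>\<^sup>+\<theta>. (\<integral>\<^sup>+t. rest_log s (- t - l \<theta>) (- \<theta>) \<partial>unit_leb) \<partial>unit_leb) <= C"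
  proof (rule order.trans[OF nn_integral_mono swap[of "-1"]])
   fix \<theta> assume "\<theta> \<in> space unit_leb"
   then have \<theta>: "\<theta> \<in> {0..<1}" by simp
   have "(\<integral>\<^sup>+t. rest_log s (- t - l \<theta>) (- \<theta>) \<partial>unit_leb) = (\<integral>\<^sup>+t. rest_log s (- t - l \<theta>) (- \<theta>) * indicator {0..<1} t \<partial>lborel)"
    by (rule nn_integral_unit_leb) measurable
   also have "... = ennreal \<bar>-1\<bar> * (\<integral>\<^sup>+t. rest_log s (- l \<theta> + (-1) * t) (- \<theta>) * indicator {0..<1} (- (- l \<theta> + (-1) * t) - l \<theta>) \<partial>lborel)"
    by (simp add: algebra_simps)
   also have "... = (\<integral>\<^sup>+x. rest_log s x (- \<theta>) * indicator {0..<1} (- x - l \<theta>) \<partial>lborel)"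
    by (rule nn_integral_real_affine[symmetric]) auto
   also have "... <= (\<integral>\<^sup>+x. rest_log s x (-1 * \<theta>) * indicator {-2..1} x \<partial>lborel)"
    using l[OF \<theta>] by (intro nn_integral_mono) (auto simp: indicator_def)
   finally show "(\<integral>\<^sup>+t. rest_log s (- t - l \<theta>) (- \<theta>) \<partial>unit_leb) <= (\<integral>\<^sup>+t. rest_log s t (-1 * \<theta>) * indicator {-2..1} t \<partial>lborel)" .
  qed simp
  have "ennreal ((norm (phi s))\<^sup>2 * c / 2) = (\<integral>\<^sup>+\<theta>. ennreal ((norm (phi s))\<^sup>2 * c / 2) \<partial>unit_leb)"
   by simp
  also have "... <= (\<integral>\<^sup>+\<theta>. (\<integral>\<^sup>+t. ennreal 3 * (V + rest_log s (- t - l \<theta>) (- \<theta>) + rest_log s t \<theta>) \<partial>unit_leb) \<partial>unit_leb)"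
  proof (rule nn_integral_mono)
   fix \<theta> assume "\<theta> \<in> space unit_leb"
   then have \<theta>: "\<theta> \<in> {0..<1}" by simp
   show "ennreal ((norm (phi s))\<^sup>2 * c / 2) <= (\<integral>\<^sup>+t. ennreal 3 * (V + rest_log s (- t - l \<theta>) (- \<theta>) + rest_log s t \<theta>) \<partial>unit_leb)"
   proof (rule order.trans[OF lower[OF \<theta>] nn_integral_mono])
    fix t assume "t \<in> space unit_leb"
    then have t: "t \<in> {0..<1}" by simp
    show "ennreal ((norm (phi s))\<^sup>2 * c * (osc w (2 * t + l \<theta>))\<^sup>2) <= ennreal 3 * (V + rest_log s (- t - l \<theta>) (- \<theta>) + rest_log s t \<theta>)"
    proof -
     show ?thesis
      using ennreal_leI[OF point[OF t \<theta>]] by (simp only: V_def rest_log_def r_def e3 zero_le_power2)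
    qed
   qed
  qed
  also have "... = ennreal 3 * (V + (\<integral>\<^sup>+\<theta>. (\<integral>\<^sup>+t. rest_log s (- t - l \<theta>) (- \<theta>) \<partial>unit_leb) \<partial>unit_leb) + (\<integral>\<^sup>+\<theta>. (\<integral>\<^sup>+t. rest_log s t \<theta> \<partial>unit_leb) \<partial>unit_leb))"
  proof -
   have "(\<integral>\<^sup>+t. ennreal 3 * (V + rest_log s (- t - l \<theta>) (- \<theta>) + rest_log s t \<theta>) \<partial>unit_leb)
    = ennreal 3 * (V + (\<integral>\<^sup>+t. rest_log s (- t - l \<theta>) (- \<theta>) \<partial>unit_leb) + (\<integral>\<^sup>+t. rest_log s t \<theta> \<partial>unit_leb))" for \<theta>
    by (rule split3) measurable
   then show ?thesis by (simp only:) (intro split3 unit_measurable; unfold split_beta'; measurable)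
  qed
  also have "... <= ennreal 3 * (V + C + C)" by (intro mult_left_mono add_mono boundR boundRS) auto
  finally show ?thesis by (simp add: V_def)
 qed
 obtain C' where C': "C = ennreal C'" "C' >= 0" using C(1) by (cases C) auto
 have c0: "c > 0" by (simp add: c_def)
 have "norm (phi s) <= 1 + 6 * (v\<^sup>2 + C' + C') / c"
  if s: "s \<in> half_domain" "1 / 2 + \<delta> <= Re s" "Re s <= B" "T <= \<bar>Im s\<bar>" for s
 proof -
  have "ennreal ((norm (phi s))\<^sup>2 * c / 2) <= ennreal (3 * (v\<^sup>2 + C' + C'))"
   using main[OF s] unfolding C'(1) by (simp only: e3 zero_le_power2 C'(2))
  then have "(norm (phi s))\<^sup>2 * c / 2 <= 3 * (v\<^sup>2 + C' + C')"
   by (subst (asm) ennreal_le_iff) (use C'(2) in auto)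
  then have "(norm (phi s))\<^sup>2 <= 6 * (v\<^sup>2 + C' + C') / c" using c0 by (simp add: pos_le_divide_eq)
  moreover have "norm (phi s) <= 1 + (norm (phi s))\<^sup>2"
  proof -
   have "0 <= (norm (phi s) - 1)\<^sup>2" by simp
   then have "2 * norm (phi s) <= 1 + (norm (phi s))\<^sup>2" unfolding power2_diff by simp
   then show ?thesis using norm_ge_zero[of "phi s"] by linarith
  qed
  ultimately show ?thesis by linarith
 qed
 then show ?thesis by (intro exI[of _ "1 + 6 * (v\<^sup>2 + C' + C') / c"] exI[of _ T] ballI impI)
qed

abbreviation eisenstein_row :: "real => complex => ennreal" where
  "eisenstein_row y s \<equiv> \<integral>\<^sup>+x. sqnorm (eisenstein (Complex x y) s) \<partial>unit_leb"

lemma eisenstein_strip_bound: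
 fixes a b :: real
 assumes \<delta>: "\<delta> > 0" and ab: "0 < a" "a <= b"
 shows "\<exists>C<\<infinity>. \<exists>T. \<forall>s\<in>half_domain. 1 / 2 + \<delta> <= Re s --> Re s <= B --> T <= \<bar>Im s\<bar> \<longrightarrow>
  (\<integral>\<^sup>+y. (eisenstein_row y s) * indicator {a..b} y \<partial>lborel) <= C"
proof -
 obtain C1 where C1: "C1 < \<infinity>" "\<And>s. s \<in> half_domain ==> 1 / 2 + \<delta> <= Re s ==> Re s <= B ==>
  (\<integral>\<^sup>+y. (rest_row s y) * indicator {a..b} y \<partial>lborel) <= C1"
  using rest_strip_bound[OF \<delta> ab, of B] by blast
 obtain C2 T where C2: "\<And>s. s \<in> half_domain ==> 1 / 2 + \<delta> <= Re s ==> Re s <= B ==> T <= \<bar>Im s\<bar> ==> norm (phi s) <= C2"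
  using phi_bounded[OF \<delta>, of B] by blast
 define M where "M = (max b (1 / a) + 1) powr (\<bar>B\<bar> + 1)"
 define V where "V = M\<^sup>2 + (C2 * M)\<^sup>2"
 have V0: "V >= 0" by (simp add: V_def)
 have main: "(\<integral>\<^sup>+y. (eisenstein_row y s) * indicator {a..b} y \<partial>lborel)
   <= ennreal 3 * (C1 + ennreal V * ennreal (b - a))"
  if s: "s \<in> half_domain" "1 / 2 + \<delta> <= Re s" "Re s <= B" "T <= \<bar>Im s\<bar>" for s
 proof -
  define F where "F y = (\<integral>\<^sup>+x. sqnorm (rest s (exp (ln y)) x) \<partial>unit_leb)" for y
  have Fm [measurable]: "F \<in> borel_fun"
   unfolding F_def by (rule rest_row_measurable[OF s(1)])
  have row: "(eisenstein_row y s) <= ennreal 3 * (F y + ennreal V)"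
   if y: "y \<in> {a..b}" for y
  proof -
   have y0: "y > 0" using ab y by simp
   have "continuous_on UNIV (rest s y)"
    using rest_continuous[OF s(1), of "\<lambda>x. x" "\<lambda>_. y"] y0 by simp
   then have [measurable]: "rest s y \<in> borel_measurable unit_leb"
    by (intro measurable_unit_leb borel_measurable_continuous_onI)
   have le: "(norm (eisenstein (Complex x y) s))\<^sup>2 <= 3 * ((norm (rest s y x))\<^sup>2 + V)" for x
   proof -
    have y1: "y powr Re s <= M" unfolding M_def using s \<delta> by (intro powr_strip_le ab y) auto
    have y2: "y powr (1 - Re s) <= M" unfolding M_def using s \<delta> by (intro powr_strip_le ab y) auto
    have c: "norm (phi s) <= C2" by (rule C2[OF s])
    have "eisenstein (Complex x y) s = rest s y x + of_real y powr s + phi s * of_real y powr (1 - s)"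
     by (simp add: rest_def)
    also have "norm ... <= norm (rest s y x) + norm (of_real y powr s) + norm (phi s * of_real y powr (1 - s))"
     by (intro norm_triangle_le add_mono) auto
    also have "norm (of_real y powr s) = y powr Re s" using y0 by (simp add: norm_powr_real_powr)
    also have "norm (phi s * of_real y powr (1 - s)) = norm (phi s) * y powr (1 - Re s)"
     using y0 by (simp add: norm_mult norm_powr_real_powr)
    finally have n: "norm (eisenstein (Complex x y) s) <= norm (rest s y x) + y powr Re s + norm (phi s) * y powr (1 - Re s)" .
    have p: "norm (phi s) * y powr (1 - Re s) <= C2 * M"
     using c y2 order.trans[OF norm_ge_zero c] by (intro mult_mono) auto
    have "norm (eisenstein (Complex x y) s) <= norm (rest s y x) + M + C2 * M" using n y1 p by linarith
    then have "(norm (eisenstein (Complex x y) s))\<^sup>2 <= (norm (rest s y x) + M + C2 * M)\<^sup>2" by (rule power_mono) simp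
    also have "... <= 3 * ((norm (rest s y x))\<^sup>2 + M\<^sup>2 + (C2 * M)\<^sup>2)" by (rule sum3_square)
    finally show ?thesis by (simp add: V_def)
   qed
   have "(eisenstein_row y s) <= (\<integral>\<^sup>+x. ennreal 3 * (sqnorm (rest s y x) + ennreal V) \<partial>unit_leb)"
   proof (rule nn_integral_mono)
    fix x
    show "sqnorm (eisenstein (Complex x y) s) <= ennreal 3 * (sqnorm (rest s y x) + ennreal V)"
     using ennreal_leI[OF le[of x]] V0 by (simp add: ennreal_mult)
   qed
   also have "... = ennreal 3 * (\<integral>\<^sup>+x. (sqnorm (rest s y x) + ennreal V) \<partial>unit_leb)"
    by (rule nn_integral_cmult) measurable
   also have "(\<integral>\<^sup>+x. (sqnorm (rest s y x) + ennreal V) \<partial>unit_leb) = F y + ennreal V"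
    using y0 by (subst nn_integral_add) (auto simp: F_def)
   finally show ?thesis .
  qed
  have "(\<integral>\<^sup>+y. (eisenstein_row y s) * indicator {a..b} y \<partial>lborel)
   <= (\<integral>\<^sup>+y. ennreal 3 * (F y * indicator {a..b} y + ennreal V * indicator {a..b} y) \<partial>lborel)"
  proof (rule nn_integral_mono)
   fix y
   show "(eisenstein_row y s) * indicator {a..b} y <= ennreal 3 * (F y * indicator {a..b} y + ennreal V * indicator {a..b} y)"
    using row[of y] by (cases "y \<in> {a..b}") auto
  qed
  also have "... = ennreal 3 * ((\<integral>\<^sup>+y. F y * indicator {a..b} y \<partial>lborel) + ennreal V * ennreal (b - a))"
   using ab by (simp add: nn_integral_cmult nn_integral_add nn_integral_cmult_indicator)
  also have "(\<integral>\<^sup>+y. F y * indicator {a..b} y \<partial>lborel) = (\<integral>\<^sup>+y. (rest_row s y) * indicator {a..b} y \<partial>lborel)"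
  proof (rule nn_integral_cong)
   fix y
   show "F y * indicator {a..b} y = (rest_row s y) * indicator {a..b} y"
    using ab by (cases "y \<in> {a..b}") (auto simp: F_def)
  qed
  also have "ennreal 3 * (... + ennreal V * ennreal (b - a)) <= ennreal 3 * (C1 + ennreal V * ennreal (b - a))"
   using C1(2)[OF s(1-3)] by (intro mult_left_mono add_mono) auto
  finally show ?thesis .
 qed
 have "ennreal 3 * (C1 + ennreal V * ennreal (b - a)) < \<infinity>" using C1(1) by (simp add: ennreal_mult_less_top)
 then show ?thesis using main
  by (intro exI[of _ "ennreal 3 * (C1 + ennreal V * ennreal (b - a))"] exI[of _ T] conjI ballI impI)
qed

section \<open>Oscillatory integrals\<close>

lemma measurable_Complex [measurable]:
 assumes [measurable]: "f \<in> borel_measurable M" "g \<in> borel_measurable M"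
 shows "(\<lambda>p. Complex (f p) (g p)) \<in> borel_measurable M"
 unfolding Complex_eq by measurable

abbreviation lborel_xy :: "complex measure" where
  "lborel_xy \<equiv> distr (lborel \<Otimes>\<^sub>M lborel) borel (\<lambda>p. Complex (fst p) (snd p))"

lemma lborel_complex:
 "(lborel :: complex measure) = lborel_xy"
proof (rule lborel_eqI)
 fix l u :: complex
 assume "\<And>b. b \<in> Basis ==> l \<bullet> b <= u \<bullet> b"
 from this[of 1] this[of \<i>] have lu: "Re l <= Re u" "Im l <= Im u" by (auto simp: Basis_complex_def inner_complex_def)
 have "emeasure lborel_xy (box l u)
  = emeasure lborel2 ({Re l<..<Re u} \<times> {Im l<..<Im u})"
  by (subst emeasure_distr) (auto intro!: arg_cong[of _ _ "emeasure _"] simp: in_box_complex_iff space_pair_measure)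
 also have "... = ennreal (Re u - Re l) * ennreal (Im u - Im l)"
  using lu by (simp add: lborel.emeasure_pair_measure_Times)
 also have "... = ennreal (\<Prod>b\<in>Basis. (u - l) \<bullet> b)"
  using lu by (simp add: Basis_complex_def inner_complex_def ennreal_mult)
 finally show "emeasure lborel_xy (box l u) = ennreal (\<Prod>b\<in>Basis. (u - l) \<bullet> b)" .
qed simp

lemma integral_complex_xy:
 fixes f :: "complex => complex"
 assumes i: "integrable lborel f"
 shows "(\<integral>z. f z \<partial>lborel) = (\<integral>x. (\<integral>y. f (Complex x y) \<partial>lborel) \<partial>lborel)"
proof -
 have [measurable]: "f \<in> borel_fun" using borel_measurable_integrable[OF i] by simp
 have "integrable lborel_xy f"
  using i unfolding lborel_complex[symmetric] .
 then have i2: "integrable lborel2 (\<lambda>p. f (Complex (fst p) (snd p)))"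
  by (subst (asm) integrable_distr_eq) auto
 have "(\<integral>z. f z \<partial>lborel) = (\<integral>z. f z \<partial>lborel_xy)"
  unfolding lborel_complex[symmetric] ..
 also have "... = (\<integral>p. f (Complex (fst p) (snd p)) \<partial>lborel2)" by (rule integral_distr) auto
 also have "... = (\<integral>x. (\<integral>y. f (Complex x y) \<partial>lborel) \<partial>lborel)"
  using lborel_pair.integral_fst'[OF i2] by simp
 finally show ?thesis .
qed

lemma nn_integral_complex_yx:
 fixes f :: "complex => ennreal"
 assumes [measurable]: "f \<in> borel_fun"
 shows "(\<integral>\<^sup>+z. f z \<partial>lborel) = (\<integral>\<^sup>+y. (\<integral>\<^sup>+x. f (Complex x y) \<partial>lborel) \<partial>lborel)"
proof -
 have "(\<integral>\<^sup>+z. f z \<partial>lborel) = (\<integral>\<^sup>+z. f z \<partial>lborel_xy)"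
  unfolding lborel_complex[symmetric] ..
 also have "... = (\<integral>\<^sup>+p. f (Complex (fst p) (snd p)) \<partial>lborel2)"
  by (rule nn_integral_distr) auto
 also have "... = (\<integral>\<^sup>+y. (\<integral>\<^sup>+x. f (Complex x y) \<partial>lborel) \<partial>lborel)"
  by (subst lborel_pair.nn_integral_snd[symmetric]) auto
 finally show ?thesis .
qed

text \<open>Kernels that are uniformly bounded and whose integrals over initial segments tend to 0 converge weakly to 0. The sets whose indicators satisfy the claim form a Dynkin system that contains the initial segments; integrable functions are L^1-limits of simple ones.\<close>
lemma kernel_tendsto_zero:
 fixes K :: "nat => real => complex" and g :: "real => complex"
 assumes meas: "\<And>n. K n \<in> borel_fun"
  and bnd: "\<And>n x. norm (K n x) <= M * indicator {a..b} x" and M: "M >= 0"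
  and lim: "\<And>c. (\<lambda>n. \<integral>x. indicator {..c} x *\<^sub>R K n x \<partial>lborel) \<longlonglongrightarrow> 0"
  and g: "integrable lborel g"
 shows "(\<lambda>n. \<integral>x. K n x * g x \<partial>lborel) \<longlonglongrightarrow> 0"
proof -
 note [measurable] = meas
 have MI: "integrable lborel (\<lambda>x. M * indicator {a..b} x)"
  by (intro integrable_mult_right integrable_real_indicator) (auto simp: emeasure_lborel_Icc_eq)
 have Kint: "integrable lborel (\<lambda>x. indicator S x *\<^sub>R K n x)" if [measurable]: "S \<in> sets borel" for S n
 proof (rule lint_bound[OF MI])
  show "AE x in lborel. norm (indicator S x *\<^sub>R K n x) <= norm (M * indicator {a..b} x)"
  proof (rule AE_I2)
   fix x show "norm (indicator S x *\<^sub>R K n x) <= norm (M * indicator {a..b} x)"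
    using bnd[of n x] M by (cases "x \<in> S") auto
  qed
 qed measurable
 have sets: "(\<lambda>n. \<integral>x. indicator S x *\<^sub>R K n x \<partial>lborel) \<longlonglongrightarrow> 0" if S: "S \<in> sets borel" for S
 proof -
  let ?G = "range (\<lambda>c::real. {..c})"
  have sG: "sigma_sets UNIV ?G = sets borel" by (subst borel_eq_atMost) (simp add: sets_measure_of)
  have "Int_stable ?G" unfolding Int_stable_def by (auto simp: image_iff intro: exI[of _ "min _ _"])
  moreover have "?G \<subseteq> Pow UNIV" by simp
  moreover have "S \<in> sigma_sets UNIV ?G" using S unfolding sG .
  ultimately show ?thesis
  proof (induction rule: sigma_sets_induct_disjoint)
   case (basic A)
   then show ?case using lim by auto
  next
   case empty
   then show ?case by simp
  next
   case (compl A)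
   then have A [measurable]: "A \<in> sets borel" unfolding sG by simp
   have "(\<integral>x. indicator (UNIV - A) x *\<^sub>R K n x \<partial>lborel) = (\<integral>x. indicator {..b} x *\<^sub>R K n x \<partial>lborel) - (\<integral>x. indicator A x *\<^sub>R K n x \<partial>lborel)" for n
   proof -
    have "indicator (UNIV - A) x *\<^sub>R K n x = indicator {..b} x *\<^sub>R K n x - indicator A x *\<^sub>R K n x" for x
     using bnd[of n x] by (cases "x \<in> {a..b}") (auto simp: indicator_def)
    then show ?thesis by (simp add: Kint)
   qed
   then show ?case using tendsto_diff[OF lim[of b] compl(2)] by simp
  next
   case (union A)
   have A [measurable]: "A i \<in> sets borel" for i using union(2) unfolding sG by auto
   define h where "h i = M * measure lborel (A i \<inter> {a..b})" for i
   have dj: "disjoint_family (\<lambda>i. A i \<inter> {a..b})" using union(1) by (auto simp: disjoint_family_on_def)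
   have "emeasure lborel (\<Union>i. A i \<inter> {a..b}) <= emeasure lborel {a..b}" by (intro emeasure_mono) auto
   also have "... < \<infinity>" by (simp add: emeasure_lborel_Icc_eq)
   finally have "emeasure lborel (\<Union>i. A i \<inter> {a..b}) ~= \<infinity>" by simp
   moreover have "range (\<lambda>i. A i \<inter> {a..b}) \<subseteq> sets lborel" by auto
   ultimately have "summable (\<lambda>i. measure lborel (A i \<inter> {a..b}))"
    using measure_UNION[OF _ dj] sums_summable by blast
   then have hs: "h summable_on UNIV"
    unfolding h_def using M by (subst summable_on_UNIV_nonneg_real_iff) auto
   have nle: "(\<integral>x. norm (indicator (A i) x *\<^sub>R K n x) \<partial>lborel) <= h i" for i n
   proof -
    have "(\<integral>x. norm (indicator (A i) x *\<^sub>R K n x) \<partial>lborel) <= (\<integral>x. M * indicator (A i \<inter> {a..b}) x \<partial>lborel)"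
    proof (rule integral_mono)
     show "integrable lborel (\<lambda>x. norm (indicator (A i) x *\<^sub>R K n x))" by (intro integrable_norm Kint A)
     have "emeasure lborel (A i \<inter> {a..b}) <= emeasure lborel {a..b}" by (intro emeasure_mono) auto
     also have "... < \<infinity>" by (simp add: emeasure_lborel_Icc_eq)
     finally show "integrable lborel (\<lambda>x. M * indicator (A i \<inter> {a..b}) x)"
      by (intro integrable_mult_right integrable_real_indicator) auto
     show "norm (indicator (A i) x *\<^sub>R K n x) <= M * indicator (A i \<inter> {a..b}) x" for x
      using bnd[of n x] by (auto simp: indicator_def split: if_splits)
    qed
    also have "... = h i" by (simp add: h_def)
    finally show ?thesis .
   qed
   have single: "\<exists>i. \<forall>j. j ~= i --> x \<notin> A j" for x
   proof (cases "\<exists>i. x \<in> A i")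
    case True
    then obtain i where "x \<in> A i" by blast
    moreover have "A i \<inter> A j = {}" if "j ~= i" for j
     using union(1) that by (simp add: disjoint_family_on_def)
    ultimately show ?thesis by blast
   qed blast
   have pt: "(\<Sum>\<^sub>\<infinity>i. indicator (A i) x *\<^sub>R K n x) = indicator (\<Union>i. A i) x *\<^sub>R K n x" for n x
   proof -
    obtain i where i: "\<And>j. j ~= i ==> x \<notin> A j" using single by blast
    have "(\<Sum>\<^sub>\<infinity>i. indicator (A i) x *\<^sub>R K n x) = (\<Sum>\<^sub>\<infinity>j\<in>{i}. indicator (A j) x *\<^sub>R K n x)"
     by (rule infsum_cong_neutral) (use i in \<open>auto simp: indicator_def\<close>)
    also have "... = indicator (\<Union>i. A i) x *\<^sub>R K n x"
    proof -
     have "x \<in> (\<Union>i. A i) \<longleftrightarrow> x \<in> A i" by (metis i UN_iff UNIV_I)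
     then show ?thesis by (simp add: indicator_def)
    qed
    finally show ?thesis .
   qed
   have ps: "(\<lambda>i. norm (indicator (A i) x *\<^sub>R K n x)) summable_on UNIV" for n x
   proof -
    obtain i where i: "\<And>j. j ~= i ==> x \<notin> A j" using single by blast
    have "(\<lambda>i. norm (indicator (A i) x *\<^sub>R K n x)) summable_on UNIV \<longleftrightarrow> (\<lambda>i. norm (indicator (A i) x *\<^sub>R K n x)) summable_on {i}"
     by (rule summable_on_cong_neutral) (use i in \<open>auto simp: indicator_def\<close>)
    then show ?thesis by simp
   qed
   have si: "(\<lambda>i. \<integral>x. norm (indicator (A i) x *\<^sub>R K n x) \<partial>lborel) summable_on UNIV" for n
    by (rule summable_on_comparison_test[OF hs]) (use nle in auto)
   have eq: "(\<integral>x. indicator (\<Union>i. A i) x *\<^sub>R K n x \<partial>lborel) = (\<Sum>\<^sub>\<infinity>i. \<integral>x. indicator (A i) x *\<^sub>R K n x \<partial>lborel)" for n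
    using infsumI[OF has_sum_integral(2)[of UNIV lborel "\<lambda>i x. indicator (A i) x *\<^sub>R K n x", OF _ Kint ps si]]
    by (simp add: pt)
   have "(\<lambda>n. \<Sum>\<^sub>\<infinity>i. \<integral>x. indicator (A i) x *\<^sub>R K n x \<partial>lborel) \<longlonglongrightarrow> (\<Sum>\<^sub>\<infinity>i::nat. 0)"
   proof (rule infsum_tendsto_dominated[OF _ hs])
    show "\<forall>\<^sub>F n in sequentially. \<forall>i\<in>UNIV. norm (\<integral>x. indicator (A i) x *\<^sub>R K n x \<partial>lborel) <= h i"
     using order.trans[OF integral_norm_bound nle] by (intro always_eventually) auto
   qed (use union(3) in auto)
   then show ?case unfolding eq by simp
  qed
 qed
 have KM: "norm (K n x) <= M" for n x using bnd[of n x] M by (cases "x \<in> {a..b}") auto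
 have Kg: "integrable lborel (\<lambda>x. K n x * f x)" if f: "integrable lborel f" for n f
 proof (rule lint_bound[OF integrable_mult_right[OF integrable_norm[OF f]]])
  have [measurable]: "f \<in> borel_fun" using borel_measurable_integrable[OF f] by simp
  show "(\<lambda>x. K n x * f x) \<in> borel_measurable lborel" by measurable
  show "AE x in lborel. norm (K n x * f x) <= norm (M * norm (f x))"
   using M KM by (auto simp: norm_mult intro!: mult_right_mono)
 qed
 from g show ?thesis
 proof (induct rule: integrable_induct)
  case (base A c)
  have "(\<integral>x. K n x * (indicator A x *\<^sub>R c) \<partial>lborel) = (\<integral>x. indicator A x *\<^sub>R K n x \<partial>lborel) * c" for n
   by (subst integral_mult_left_zero[symmetric]) (auto intro!: lint_cong)
  then show ?case using tendsto_mult_right[OF sets[of A], of c] base by simp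
 next
  case (add f g)
  then show ?case using tendsto_add[OF add(2,4)] by (simp add: distrib_left Kg)
 next
  case (lim f s)
  have [measurable]: "f \<in> borel_fun" "s i \<in> borel_fun" for i
   using borel_measurable_integrable[OF lim(5)] borel_measurable_integrable[OF lim(1)[of i]] by auto
  have d: "(\<lambda>i. \<integral>x. norm (f x - s i x) \<partial>lborel) \<longlonglongrightarrow> (\<integral>x. 0 \<partial>(lborel::real measure))"
  proof (rule integral_dominated_convergence[where w = "\<lambda>x. 3 * norm (f x)"])
   show "AE x in lborel. (\<lambda>i. norm (f x - s i x)) \<longlonglongrightarrow> 0"
   proof (rule AE_I2)
    fix x
    have "(\<lambda>i. norm (f x - s i x)) \<longlonglongrightarrow> norm (f x - f x)"
     by (intro tendsto_intros lim(3)) simp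
    then show "(\<lambda>i. norm (f x - s i x)) \<longlonglongrightarrow> 0" by simp
   qed
   show "AE x in lborel. norm (norm (f x - s i x)) <= 3 * norm (f x)" for i
   proof (rule AE_I2)
    fix x
    have "norm (f x - s i x) <= norm (f x) + norm (s i x)" by (rule norm_triangle_ineq4)
    then show "norm (norm (f x - s i x)) <= 3 * norm (f x)" using lim(4)[of x i] by simp
   qed
  qed (use lim(5) in auto)
  show ?case
  proof (rule LIMSEQ_I)
   fix e :: real assume e: "e > 0"
   have "e / (2 * (M + 1)) > 0" using e M by simp
   from LIMSEQ_D[OF d this] obtain i where "norm ((\<integral>x. norm (f x - s i x) \<partial>lborel) - (\<integral>x. 0 \<partial>(lborel::real measure))) < e / (2 * (M + 1))" by blast
   then have i: "(\<integral>x. norm (f x - s i x) \<partial>lborel) < e / (2 * (M + 1))" by simp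
   have fs: "integrable lborel (\<lambda>x. f x - s i x)" using lim(1,5) by auto
   obtain N where N: "\<And>n. n >= N ==> norm (\<integral>x. K n x * s i x \<partial>lborel) < e / 2"
    using LIMSEQ_D[OF lim(2)[of i], of "e / 2"] e by auto
   have "norm ((\<integral>x. K n x * f x \<partial>lborel) - 0) < e" if n: "n >= N" for n
   proof -
    have "(\<integral>x. K n x * f x \<partial>lborel) = (\<integral>x. K n x * s i x \<partial>lborel) + (\<integral>x. K n x * (f x - s i x) \<partial>lborel)"
     using Kg[OF lim(5)] Kg[OF lim(1)] by (simp add: right_diff_distrib)
    moreover have "norm (\<integral>x. K n x * (f x - s i x) \<partial>lborel) <= (\<integral>x. M * norm (f x - s i x) \<partial>lborel)"
    proof (rule lint_norm_bound)
     show "integrable lborel (\<lambda>x. K n x * (f x - s i x))" by (rule Kg[OF fs])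
     show "integrable lborel (\<lambda>x. M * norm (f x - s i x))" using fs by (intro integrable_mult_right integrable_norm)
     show "norm (K n x * (f x - s i x)) <= M * norm (f x - s i x)" for x
      unfolding norm_mult by (intro mult_right_mono KM) auto
    qed
    moreover have "(\<integral>x. M * norm (f x - s i x) \<partial>lborel) <= e / 2"
    proof -
     have "(\<integral>x. M * norm (f x - s i x) \<partial>lborel) = M * (\<integral>x. norm (f x - s i x) \<partial>lborel)" by simp
     also have "... <= (M + 1) * (e / (2 * (M + 1)))"
      using i M by (intro mult_mono) auto
     also have "... = e / 2"
     proof -
      have "N * (e / (2 * N)) = e / 2" if "N ~= 0" for N :: real using that by simp
      from this[of "M + 1"] show ?thesis using M by linarith
     qed
     finally show ?thesis .
    qed
    ultimately show ?thesis
     using N[OF n] norm_triangle_ineq[of "\<integral>x. K n x * s i x \<partial>lborel" "\<integral>x. K n x * (f x - s i x) \<partial>lborel"] by simp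
   qed
   then show "\<exists>N. \<forall>n\<ge>N. norm ((\<integral>x. K n x * f x \<partial>lborel) - 0) < e" by blast
  qed
 qed
qed

text \<open>The kernel \<psi>' exp (i t \<psi>) has a primitive of size 1/t; the factor \<psi>' is absorbed in g, which need not be smooth.\<close>
lemma oscillation_tendsto_zero:
 fixes \<psi> \<psi>' :: "real => real" and g :: "real => complex"
 assumes ab: "a <= b"
  and der: "\<And>y. y \<in> {a..b} ==> (\<psi> has_real_derivative \<psi>' y) (at y)"
  and cont: "continuous_on {a..b} \<psi>'" and nz: "\<And>y. y \<in> {a..b} ==> \<psi>' y ~= 0"
  and g: "integrable lborel g" and t: "filterlim t at_top sequentially"
 shows "(\<lambda>n. \<integral>y. indicator {a..b} y *\<^sub>R (cis (t n * \<psi> y) * g y) \<partial>lborel) \<longlonglongrightarrow> 0"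
proof -
 have psic: "continuous_on {a..b} \<psi>"
  using DERIV_isCont[OF der] by (intro continuous_at_imp_continuous_on ballI)
 define k where "k n y = of_real (\<psi>' y) * cis (t n * \<psi> y)" for n y
 have kc: "continuous_on {a..b} (k n)" for n
  unfolding k_def by (intro continuous_intros cont psic)
 define K where "K n y = indicator {a..b} y *\<^sub>R k n y" for n y
 have Km: "K n \<in> borel_fun" for n
  unfolding K_def by (rule borel_measurable_continuous_on_indicator[OF _ kc]) simp
 have ic: "continuous_on {a..b} (\<lambda>y. 1 / \<psi>' y)"
  using nz by (intro continuous_intros cont) auto
 obtain M where M': "\<forall>y\<in>{a..b}. \<bar>\<psi>' y\<bar> <= M"
  using compact_imp_bounded[OF compact_continuous_image[OF cont compact_Icc]] by (auto simp: bounded_iff)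
 note M = bspec[OF M']
 obtain C where C': "\<forall>y\<in>{a..b}. \<bar>1 / \<psi>' y\<bar> <= C"
  using compact_imp_bounded[OF compact_continuous_image[OF ic compact_Icc]] by (auto simp: bounded_iff)
 note C = bspec[OF C']
 define G where "G y = of_real (indicator {a..b} y *\<^sub>R (1 / \<psi>' y)) * g y" for y
 have gm [measurable]: "g \<in> borel_fun" using borel_measurable_integrable[OF g] by simp
 have [measurable]: "(\<lambda>y. indicator {a..b} y *\<^sub>R (1 / \<psi>' y)) \<in> borel_fun"
  by (rule borel_measurable_continuous_on_indicator[OF _ ic]) simp
 have C0: "C >= 0" using order.trans[OF abs_ge_zero C[of a]] ab by simp
 have G: "integrable lborel G"
 proof (rule lint_bound[OF integrable_mult_right[OF integrable_norm[OF g]]])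
  show "G \<in> borel_measurable lborel" unfolding G_def by measurable
  show "AE y in lborel. norm (G y) <= norm (C * norm (g y))"
  proof (rule AE_I2)
   fix y
   have "\<bar>indicator {a..b} y *\<^sub>R (1 / \<psi>' y)\<bar> <= C" using C[of y] C0 by (cases "y \<in> {a..b}") auto
   then show "norm (G y) <= norm (C * norm (g y))"
   proof -
    have "norm (G y) <= C * norm (g y)" unfolding G_def norm_mult norm_of_real
     using \<open>\<bar>indicator {a..b} y *\<^sub>R (1 / \<psi>' y)\<bar> <= C\<close> by (rule mult_right_mono) simp
    also have "... = norm (C * norm (g y))" using C0 by simp
    finally show ?thesis .
   qed
  qed
 qed
 have "(\<lambda>n. \<integral>y. K n y * G y \<partial>lborel) \<longlonglongrightarrow> 0"
 proof (rule kernel_tendsto_zero[OF Km _ _ _ G])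
  show "norm (K n x) <= M * indicator {a..b} x" for n x
   using M[of x] by (cases "x \<in> {a..b}") (auto simp: K_def k_def norm_mult)
  show "M >= 0" using M[of a] ab by auto
  fix c
  have int: "norm (\<integral>x. indicator {..c} x *\<^sub>R K n x \<partial>lborel) <= 2 / t n" if tn: "t n > 0" for n
  proof (cases "c < a")
   case True
   then have z: "(\<lambda>x. indicator {..c} x *\<^sub>R K n x) = (\<lambda>_. 0)" by (auto simp: K_def indicator_def)
   show ?thesis unfolding z using tn by simp
  next
   case False
   define d where "d = min b c"
   have d: "a <= d" "d <= b" using False ab by (auto simp: d_def)
   have e: "indicator {..c} x *\<^sub>R K n x = indicator {a..d} x *\<^sub>R k n x" for x
    by (auto simp: K_def indicator_def d_def)
   define P where "P y = cis (t n * \<psi> y) / (\<i> * of_real (t n))" for y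
   have dP: "(P has_vector_derivative k n y) (at y within {a..d})" if y: "a <= y" "y <= d" for y
   proof -
    have "((\<lambda>y. t n * \<psi> y) has_real_derivative (t n * \<psi>' y)) (at y within {a..d})"
    proof (rule DERIV_cmult[OF has_field_derivative_at_within[OF der]])
     show "y \<in> {a..b}" using y d by simp
    qed
    then have "((\<lambda>y. \<i> * complex_of_real (t n * \<psi> y)) has_vector_derivative (\<i> * of_real (t n * \<psi>' y))) (at y within {a..d})"
     by (intro has_vector_derivative_mult_right has_vector_derivative_of_real)
    note field_vector_diff_chain_within[OF this has_field_derivative_at_within[OF DERIV_exp]]
    then
    have "((\<lambda>y. exp (\<i> * of_real (t n * \<psi> y))) has_vector_derivative ((\<i> * of_real (t n * \<psi>' y)) * exp (\<i> * complex_of_real (t n * \<psi> y)))) (at y within {a..d})"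
     by (simp only: o_def)
    then have "((\<lambda>y. cis (t n * \<psi> y)) has_vector_derivative (cis (t n * \<psi> y) * (\<i> * of_real (t n * \<psi>' y)))) (at y within {a..d})"
     by (simp only: cis_conv_exp mult.commute)
    then have "((\<lambda>y. cis (t n * \<psi> y) * (1 / (\<i> * of_real (t n)))) has_vector_derivative (cis (t n * \<psi> y) * (\<i> * of_real (t n * \<psi>' y)) * (1 / (\<i> * of_real (t n))))) (at y within {a..d})"
     by (rule has_vector_derivative_mult_left)
    moreover have "cis (t n * \<psi> y) * (\<i> * of_real (t n * \<psi>' y)) * (1 / (\<i> * of_real (t n))) = k n y"
     using tn by (simp add: k_def field_simps)
    ultimately show ?thesis by (simp add: P_def[abs_def])
   qed
   have "(\<integral>x. indicator {..c} x *\<^sub>R K n x \<partial>lborel) = P d - P a"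
    unfolding e by (rule integral_FTC_atLeastAtMost[OF d(1)])
     (use dP d in \<open>auto intro: continuous_on_subset[OF kc]\<close>)
   moreover have "norm (P y) = 1 / t n" for y using tn by (simp add: P_def norm_divide norm_mult)
   ultimately show ?thesis using norm_triangle_ineq4[of "P d" "P a"] by simp
  qed
  have "(\<lambda>n. 2 / t n) \<longlonglongrightarrow> 0"
   using t by (intro tendsto_divide_0[OF tendsto_const] filterlim_at_top_imp_at_infinity)
  then show "(\<lambda>n. \<integral>x. indicator {..c} x *\<^sub>R K n x \<partial>lborel) \<longlonglongrightarrow> 0"
  proof (rule Lim_null_comparison[rotated])
   have "\<forall>\<^sub>F n in sequentially. t n > 0" using t by (simp add: filterlim_at_top_dense)
   then show "\<forall>\<^sub>F n in sequentially. norm (\<integral>x. indicator {..c} x *\<^sub>R K n x \<partial>lborel) <= 2 / t n"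
    by eventually_elim (rule int)
  qed
 qed
 moreover have "K n y * G y = indicator {a..b} y *\<^sub>R (cis (t n * \<psi> y) * g y)" for n y
  using nz[of y] by (cases "y \<in> {a..b}") (auto simp: K_def k_def G_def)
 ultimately show ?thesis by simp
qed

text \<open>A compact set that contains the part of the fundamental domain below height b.\<close>
definition strip :: "real => complex set" where
 "strip b = {z. \<bar>Re z\<bar> <= 1 / 2 \<and> 1 / 2 <= Im z \<and> Im z <= b}"

text \<open>For distinct primitive vectors the ratio of the two forms is constant along at most one vertical line.\<close>
lemma prim_exceptional:
 assumes v: "(m, n) \<in> prim" "(m', n') \<in> prim" "(m, n) ~= (m', n')"
  and x: "(of_int m')\<^sup>2 * (of_int m * x + of_int n)\<^sup>2 = (of_int m)\<^sup>2 * (of_int m' * x + of_int n')\<^sup>2"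
 shows "x = - (of_int (m' * n + m * n')) / (2 * real_of_int (m * m'))"
proof -
 have ne: "m' * n ~= m * n'"
 proof
  assume e: "m' * n = m * n'"
  have c: "coprime m n" "coprime m' n'" "m >= 0" "m' >= 0" using v by (auto simp: prim_def)
  have "m dvd m' * n" using e by simp
  then have "m dvd m'" using c(1) by (simp add: coprime_dvd_mult_left_iff)
  moreover have "m' dvd m * n'" using e by (metis dvd_triv_left)
  then have "m' dvd m" using c(2) by (simp add: coprime_dvd_mult_left_iff)
  ultimately have mm: "m = m'" using c zdvd_antisym_nonneg by blast
  show False
  proof (cases "m = 0")
   case True
   then show ?thesis using v mm by (auto simp: prim_def)
  next
   case False
   then have "n = n'" using e mm by simp
   then show ?thesis using v mm by simp
  qed
 qed
 have "(of_int m' * (of_int m * x + of_int n))\<^sup>2 = (of_int m * (of_int m' * x + of_int n'))\<^sup>2"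
  using x by (simp add: power_mult_distrib)
 then consider "of_int m' * (of_int m * x + of_int n) = of_int m * (of_int m' * x + of_int n')"
  | "of_int m' * (of_int m * x + of_int n) = - (of_int m * (of_int m' * x + of_int n'))" by (auto simp: power2_eq_iff)
 then show ?thesis
 proof cases
  case 1
  then have "real_of_int (m' * n) = real_of_int (m * n')" by (simp add: algebra_simps)
  then show ?thesis using ne by (simp only: of_int_eq_iff)
 next
  case 2
  then have e: "2 * real_of_int (m * m') * x = - of_int (m' * n + m * n')" by (simp add: algebra_simps)
  show ?thesis
  proof (cases "m * m' = 0")
   case True
   then have "real_of_int (m' * n + m * n') = 0" using e by (cases "m = 0") auto
   then have "m' * n + m * n' = 0" by (simp only: of_int_eq_0_iff)
   then show ?thesis using ne True by auto
  next
   case False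
   then have "2 * real_of_int (m * m') ~= 0" by simp
   then show ?thesis using e by (simp add: eq_divide_eq mult.commute)
  qed
 qed
qed

lemma qform_measurable [measurable]: "(\<lambda>z. qform z v) \<in> borel_fun"
 unfolding qform_def by measurable

lemma log_quotient_derivative:
 fixes A C A' C' y :: real
 assumes p: "A + C * y\<^sup>2 > 0" "A' + C' * y\<^sup>2 > 0"
 shows "((\<lambda>y. ln (A' + C' * y\<^sup>2) - ln (A + C * y\<^sup>2)) has_real_derivative (2 * y * (C' * A - C * A') / ((A + C * y\<^sup>2) * (A' + C' * y\<^sup>2)))) (at y)"
proof -
 have d: "((\<lambda>y. ln (a + c * y\<^sup>2)) has_real_derivative ((2 * c * y) / (a + c * y\<^sup>2))) (at y)" if "a + c * y\<^sup>2 > 0" for a c :: real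
  using that by (auto intro!: derivative_eq_intros)
 have n: "2 * C' * y * (A + C * y\<^sup>2) - 2 * C * y * (A' + C' * y\<^sup>2) = 2 * y * (C' * A - C * A')" by algebra
 have "2 * C' * y / (A' + C' * y\<^sup>2) - 2 * C * y / (A + C * y\<^sup>2) = 2 * y * (C' * A - C * A') / ((A' + C' * y\<^sup>2) * (A + C * y\<^sup>2))"
  unfolding n[symmetric] using p by (intro diff_frac_eq) auto
 then show ?thesis
  using DERIV_diff[OF d[OF p(2)] d[OF p(1)]] by (simp only: mult.commute)
qed

lemma prim_phase:
 fixes x y :: real
 assumes v: "(m, n) \<in> lat" "(m', n') \<in> lat" and y: "y > 0"
 shows "(of_int m * x + of_int n)\<^sup>2 + (of_int m)\<^sup>2 * y\<^sup>2 > 0"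
  "ln (qform (Complex x y) (m', n')) - ln (qform (Complex x y) (m, n)) =
   ln ((of_int m' * x + of_int n')\<^sup>2 + (of_int m')\<^sup>2 * y\<^sup>2) - ln ((of_int m * x + of_int n)\<^sup>2 + (of_int m)\<^sup>2 * y\<^sup>2)"
proof -
 have p: "(of_int m * x + of_int n)\<^sup>2 + (of_int m)\<^sup>2 * y\<^sup>2 > 0" if "(m, n) \<in> lat" for m n
 proof -
  have "qform (Complex x y) (m, n) > 0" using y that by (intro qform_pos) auto
  then have "y * qform (Complex x y) (m, n) > 0" using y by simp
  then show ?thesis unfolding qform_Complex using y by simp
 qed
 show "(of_int m * x + of_int n)\<^sup>2 + (of_int m)\<^sup>2 * y\<^sup>2 > 0" by (rule p[OF v(1)])
 show "ln (qform (Complex x y) (m', n')) - ln (qform (Complex x y) (m, n)) =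
   ln ((of_int m' * x + of_int n')\<^sup>2 + (of_int m')\<^sup>2 * y\<^sup>2) - ln ((of_int m * x + of_int n)\<^sup>2 + (of_int m)\<^sup>2 * y\<^sup>2)"
  unfolding qform_Complex using y p[OF v(1)] p[OF v(2)] by (simp add: ln_div)
qed

text \<open>On all vertical lines except at most one the phase has no stationary point.\<close>
lemma oscillation_strip:
 fixes G :: "complex => complex"
 assumes b: "b >= 1 / 2" and v: "v \<in> prim" "v' \<in> prim" "v ~= v'"
  and G [measurable]: "G \<in> borel_fun" and bnd: "\<And>z. norm (G z) <= M * indicator (strip b) z"
  and t: "filterlim t at_top sequentially"
 shows "(\<lambda>k. \<integral>z. cis (t k * (ln (qform z v') - ln (qform z v))) * G z \<partial>lborel) \<longlonglongrightarrow> 0"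
proof -
 obtain m n m' n' where mn: "v = (m, n)" "v' = (m', n')" by (cases v, cases v')
 define f where "f k z = cis (t k * (ln (qform z v') - ln (qform z v))) * G z" for k z
 have cism: "(\<lambda>x. cis x) \<in> borel_fun"  by (intro borel_measurable_continuous_onI continuous_intros)
 have fm [measurable]: "f k \<in> borel_fun" for k
  unfolding f_def by (intro borel_measurable_times measurable_compose[OF _ cism]) measurable
 have "0 <= M * indicator (strip b) (Complex 0 (1/2))" by (rule order.trans[OF norm_ge_zero bnd])
 then have M0: "M >= 0" using b by (simp add: strip_def)
 have fb: "norm (f k z) <= M * indicator (strip b) z" for k z
  using bnd[of z] by (simp add: f_def norm_mult)
 have si: "indicator (strip b) (Complex x y) = (indicator {-1/2..1/2} x * indicator {1/2..b} y :: real)" for x y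
  by (auto simp: strip_def indicator_def abs_le_iff)
 have fxy: "norm (f k (Complex x y)) <= (M * indicator {-1/2..1/2} x) * indicator {1/2..b} y" for k x y
  using fb[of k "Complex x y"] by (simp add: si mult.assoc)
 have strip_eq: "strip b = cbox (Complex (-1/2) (1/2)) (Complex (1/2) b)"
  by (auto simp: strip_def in_cbox_complex_iff)
 have ind: "integrable lborel (\<lambda>z. M * indicator (strip b) z)"
  unfolding strip_eq by (intro integrable_mult_right integrable_real_indicator emeasure_bounded_finite bounded_cbox) auto
 have fi: "integrable lborel (f k)" for k
  by (rule lint_bound[OF ind]) (use fb M0 in \<open>auto intro!: AE_I2\<close>)
 have indI: "integrable lborel (\<lambda>y. c * indicator {\<alpha>..\<beta>} y)" for c \<alpha> \<beta> :: real
  by (intro integrable_mult_right integrable_real_indicator) (auto simp: emeasure_lborel_Icc_eq)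
 have "(\<lambda>k. \<integral>x. (\<integral>y. f k (Complex x y) \<partial>lborel) \<partial>lborel) \<longlonglongrightarrow> (\<integral>x. 0 \<partial>(lborel :: real measure))"
 proof (rule integral_dominated_convergence[where w = "\<lambda>x. (M * (b - 1/2)) * indicator {-1/2..1/2} x"])
  have "(\<lambda>p. f k (Complex (fst p) (snd p))) \<in> borel_measurable lborel2" for k by measurable
  then show "(\<lambda>x. \<integral>y. f k (Complex x y) \<partial>lborel) \<in> borel_measurable lborel" for k
   by (intro lborel.borel_measurable_lebesgue_integral) (simp add: split_beta')
  show "AE x in lborel. norm (\<integral>y. f k (Complex x y) \<partial>lborel) <= M * (b - 1/2) * indicator {-1/2..1/2} x" for k
  proof (rule AE_I2)
   fix x
   have "norm (\<integral>y. f k (Complex x y) \<partial>lborel) <= (\<integral>y. (M * indicator {-1/2..1/2} x) * indicator {1/2..b} y \<partial>lborel)"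
   proof (rule lint_norm_bound)
    show "integrable lborel (\<lambda>y. f k (Complex x y))"
     by (rule lint_bound[OF indI[of "M * indicator {-1/2..1/2} x" "1/2" b]]) (use fxy[of k x] M0 in \<open>auto intro!: AE_I2\<close>)
   qed (use fxy indI in auto)
   also have "... = M * (b - 1/2) * indicator {-1/2..1/2} x" using b by simp
   finally show "norm (\<integral>y. f k (Complex x y) \<partial>lborel) <= M * (b - 1/2) * indicator {-1/2..1/2} x" .
  qed
  show "AE x in lborel. (\<lambda>k. \<integral>y. f k (Complex x y) \<partial>lborel) \<longlonglongrightarrow> 0"
   using AE_lborel_singleton[of "- (of_int (m' * n + m * n')) / (2 * real_of_int (m * m'))"]
  proof eventually_elim
   fix x :: real assume x: "x ~= - (of_int (m' * n + m * n')) / (2 * real_of_int (m * m'))"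
   define A A' C C' where "A = (of_int m * x + of_int n)\<^sup>2" and "A' = (of_int m' * x + of_int n')\<^sup>2"
    and "C = (real_of_int m)\<^sup>2" and "C' = (real_of_int m')\<^sup>2"
   have D: "C' * A - C * A' ~= 0"
    using prim_exceptional[of m n m' n' x] v x unfolding mn A_def A'_def C_def C'_def by auto
   have "v \<in> lat" "v' \<in> lat" using v prim_lat by auto
   then have ph: "A + C * y\<^sup>2 > 0" "A' + C' * y\<^sup>2 > 0"
    "ln (qform (Complex x y) v') - ln (qform (Complex x y) v) = ln (A' + C' * y\<^sup>2) - ln (A + C * y\<^sup>2)" if "y > 0" for y
    using prim_phase[OF _ _ that] unfolding mn A_def A'_def C_def C'_def by blast+
   have gI: "integrable lborel (\<lambda>y. G (Complex x y))"
   proof (rule lint_bound[OF indI[of M "1/2" b]])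
    show "AE y in lborel. norm (G (Complex x y)) <= norm (M * indicator {1/2..b} y)"
    proof (rule AE_I2)
     fix y show "norm (G (Complex x y)) <= norm (M * indicator {1/2..b} y)"
      using bnd[of "Complex x y"] M0 unfolding si by (cases "x \<in> {-1/2..1/2}") (auto simp del: atLeastAtMost_iff)
    qed
   qed measurable
   have "(\<lambda>k. \<integral>y. indicator {1/2..b} y *\<^sub>R (cis (t k * (ln (A' + C' * y\<^sup>2) - ln (A + C * y\<^sup>2))) * G (Complex x y)) \<partial>lborel) \<longlonglongrightarrow> 0"
   proof (rule oscillation_tendsto_zero[OF b _ _ _ gI t])
    fix y assume "y \<in> {1/2..b}"
    then have y: "y > 0" by auto
    show "((\<lambda>y. ln (A' + C' * y\<^sup>2) - ln (A + C * y\<^sup>2)) has_real_derivative (2 * y * (C' * A - C * A') / ((A + C * y\<^sup>2) * (A' + C' * y\<^sup>2)))) (at y)"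
     by (rule log_quotient_derivative[OF ph(1,2)[OF y]])
    show "2 * y * (C' * A - C * A') / ((A + C * y\<^sup>2) * (A' + C' * y\<^sup>2)) ~= 0"
     using ph(1,2)[OF y] y D by simp
   next
    have "(A + C * y\<^sup>2) * (A' + C' * y\<^sup>2) ~= 0" if "y \<in> {1/2..b}" for y
     using ph(1,2)[of y] that by auto
    then show "continuous_on {1/2..b} (\<lambda>y. 2 * y * (C' * A - C * A') / ((A + C * y\<^sup>2) * (A' + C' * y\<^sup>2)))"
     by (intro continuous_intros) auto
   qed
   moreover have "indicator {1/2..b} y *\<^sub>R (cis (t k * (ln (A' + C' * y\<^sup>2) - ln (A + C * y\<^sup>2))) * G (Complex x y)) = f k (Complex x y)" for k y
   proof (cases "y \<in> {1/2..b}")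
    case True
    then have y: "y > 0" by auto
    show ?thesis using True ph(3)[OF y] by (simp add: f_def)
   next
    case False
    then have "G (Complex x y) = 0" using bnd[of "Complex x y"] unfolding si by simp
    then show ?thesis by (simp add: f_def)
   qed
   ultimately show "(\<lambda>k. \<integral>y. f k (Complex x y) \<partial>lborel) \<longlonglongrightarrow> 0" by simp
  qed
 qed (use indI in auto)
 then show ?thesis
  unfolding f_def[symmetric] using integral_complex_xy[OF fi] by simp
qed

section \<open>The limit in the region of convergence\<close>

definition strip_leb :: "real => complex measure" where
 "strip_leb b = restrict_space lborel (strip b)"

lemma strip_cbox: "strip b = cbox (Complex (-1/2) (1/2)) (Complex (1/2) b)"
 by (auto simp: strip_def in_cbox_complex_iff)

lemma strip_sets [measurable]: "strip b \<in> sets borel" by (simp add: strip_cbox)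

lemma space_strip_leb [simp]: "space (strip_leb b) = strip b" by (simp add: strip_leb_def space_restrict_space)

lemma stripD: "z \<in> strip b ==> Im z >= 1 / 2" "z \<in> strip b ==> Im z > 0" "z \<in> strip b ==> norm z <= b + 1"
 using cmod_le[of z] by (auto simp: strip_def)

lemma finite_measure_strip_leb: "finite_measure (strip_leb b)"
proof (rule finite_measureI)
 have "emeasure lborel (strip b) < \<infinity>"
  unfolding strip_cbox by (intro emeasure_bounded_finite bounded_cbox)
 then show "emeasure (strip_leb b) (space (strip_leb b)) ~= \<infinity>"
  by (simp add: strip_leb_def emeasure_restrict_space space_restrict_space)
qed

lemma measurable_strip_leb: "f \<in> borel_fun ==> f \<in> borel_measurable (strip_leb b)"
 unfolding strip_leb_def by (rule measurable_restrict_space1) simp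

lemma continuous_measurable_strip_leb:
 fixes f :: "complex => complex"
 assumes "continuous_on uhp f"
 shows "f \<in> borel_measurable (strip_leb b)"
proof -
 have "continuous_on (strip b) f" using assms by (rule continuous_on_subset) (use stripD in auto)
 then have "f \<in> borel_measurable (restrict_space borel (strip b))" by (rule borel_measurable_continuous_on_restrict)
 moreover have "sets (restrict_space borel (strip b)) = sets (strip_leb b)"
  unfolding strip_leb_def by (intro sets_restrict_space_cong) simp
 ultimately show ?thesis using measurable_cong_sets[OF _ refl] by blast
qed

lemma integral_strip_leb:
 fixes f :: "complex => complex"
 shows "(\<integral>z. f z \<partial>strip_leb b) = (\<integral>z. indicator (strip b) z *\<^sub>R f z \<partial>lborel)"
 unfolding strip_leb_def by (rule integral_restrict_space) simp

lemma strip_integral_bound: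
 fixes f :: "complex => complex"
 assumes f: "f \<in> borel_measurable (strip_leb b)" and C: "\<And>z. z \<in> strip b ==> norm (f z) <= C"
 shows "integrable (strip_leb b) f"
  and "(\<integral>z. norm (f z) \<partial>strip_leb b) <= C * measure (strip_leb b) (strip b)"
proof -
 interpret finite_measure "strip_leb b" by (rule finite_measure_strip_leb)
 show i: "integrable (strip_leb b) f"
  by (rule integrable_const_bound[of _ C]) (use C f in \<open>auto intro!: AE_I2\<close>)
 have "(\<integral>z. norm (f z) \<partial>strip_leb b) <= (\<integral>z. C \<partial>strip_leb b)"
  using C by (intro integral_mono integrable_norm i) auto
 then show "(\<integral>z. norm (f z) \<partial>strip_leb b) <= C * measure (strip_leb b) (strip b)"
  by (simp add: mult.commute)
qed

lemma ln_qform_bounded: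
 assumes v: "v \<in> lat"
 shows "\<exists>L. \<forall>z\<in>strip b. \<bar>ln (qform z v)\<bar> <= L"
proof -
 have "continuous_on (strip b) (\<lambda>z. qform z v)"
  unfolding qform_def by (intro continuous_intros) (use stripD(2) in force)
 then have "continuous_on (strip b) (\<lambda>z. ln (qform z v))"
  using qform_pos[OF stripD(2) v] by (intro continuous_on_ln) (auto simp: less_imp_neq[symmetric])
 then have "compact ((\<lambda>z. ln (qform z v)) ` strip b)"
  unfolding strip_cbox by (intro compact_continuous_image compact_cbox)
 then have "bounded ((\<lambda>z. ln (qform z v)) ` strip b)" by (rule compact_imp_bounded)
 then show ?thesis by (auto simp: bounded_iff)
qed

lemma powr_of_real_exp: "q > 0 ==> complex_of_real q powr a = exp (a * of_real (ln q))"
 by (simp add: powr_def Ln_of_real)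

lemma qform_powr_measurable:
 fixes a :: complex
 shows "v \<in> lat ==> (\<lambda>z. of_real (qform z v) powr a) \<in> borel_measurable (strip_leb b)"
proof -
 assume v: "v \<in> lat"
 have [measurable]: "exp \<in> borel_measurable (borel :: complex measure)"
  by (intro borel_measurable_continuous_onI continuous_intros)
 have "(\<lambda>z. exp (a * of_real (ln (qform z v)))) \<in> borel_measurable (strip_leb b)"
  by (rule measurable_strip_leb) measurable
 then show ?thesis
  by (rule measurable_cong[THEN iffD1, rotated]) (use qform_pos[OF stripD(2) v] in \<open>simp add: powr_of_real_exp\<close>)
qed

text \<open>The real part of u k only perturbs the amplitude, which converges boundedly. Its imaginary part appears in the phase, which is absent on the diagonal and oscillates off it.\<close>
lemma prim_pair_limit:
 fixes u :: "nat => complex" and h :: "complex => real"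
 assumes b: "b >= 1 / 2" and v: "v \<in> prim" "v' \<in> prim"
  and h [measurable]: "h \<in> borel_fun" and hb: "\<And>z. z \<in> strip b ==> \<bar>h z\<bar> <= H"
  and u: "(\<lambda>k. Re (u k)) \<longlonglongrightarrow> 0" "filterlim (\<lambda>k. Im (u k)) at_top sequentially"
 shows "(\<lambda>k. \<integral>z. of_real (h z) * (of_real (qform z v) powr (- (s1 + u k)) * of_real (qform z v') powr (- (s2 + cnj (u k)))) \<partial>strip_leb b)
  \<longlonglongrightarrow> (if v = v' then \<integral>z. of_real (h z) * of_real (qform z v) powr (- (s1 + s2)) \<partial>strip_leb b else 0)"
proof -
 have vl: "v \<in> lat" "v' \<in> lat" using v prim_lat by auto
 obtain L1 where L1: "\<And>z. z \<in> strip b ==> \<bar>ln (qform z v)\<bar> <= L1" using ln_qform_bounded[OF vl(1)] by blast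
 obtain L2 where L2: "\<And>z. z \<in> strip b ==> \<bar>ln (qform z v')\<bar> <= L2" using ln_qform_bounded[OF vl(2)] by blast
 obtain D where D: "\<And>k. \<bar>Re (u k)\<bar> <= D"
  using convergent_imp_Bseq[of "\<lambda>k. Re (u k)"] u(1) by (auto simp: convergent_def Bseq_def)
 have cism: "cis \<in> borel_fun" by (intro borel_measurable_continuous_onI continuous_intros)
 have [measurable]: "exp \<in> borel_measurable (borel :: complex measure)"
  by (intro borel_measurable_continuous_onI continuous_intros)
 define F where "F a q = exp (- a * complex_of_real (ln q))" for a q
 have Fb: "norm (F a q) <= exp (P * L)" if "\<bar>Re a\<bar> <= P" "\<bar>ln q\<bar> <= L" for a q P L
 proof -
  have "\<bar>Re a * ln q\<bar> <= P * L" unfolding abs_mult using that by (intro mult_mono) auto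
  then show ?thesis by (simp add: F_def)
 qed
 define w0 where "w0 z = of_real (h z) * (F s1 (qform z v) * F s2 (qform z v'))" for z
 define w where "w k z = of_real (h z) * (F (s1 + of_real (Re (u k))) (qform z v) * F (s2 + of_real (Re (u k))) (qform z v'))" for k z
 define e where "e k z = cis (Im (u k) * (ln (qform z v') - ln (qform z v)))" for k z
 have wm [measurable]: "w0 \<in> borel_fun" "w k \<in> borel_fun" for k
  unfolding w0_def w_def F_def by measurable
 have em [measurable]: "e k \<in> borel_fun" for k
  unfolding e_def by (intro measurable_compose[OF _ cism]) measurable
 define M where "M = H * (exp ((\<bar>Re s1\<bar> + D) * L1) * exp ((\<bar>Re s2\<bar> + D) * L2))"
 have D0: "D >= 0" using D[of 0] by linarith
 have w0b: "norm (w0 z) <= M" and wb: "norm (w k z) <= M" if z: "z \<in> strip b" for z k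
 proof -
  have r: "\<bar>Re (s1 + of_real (Re (u k)))\<bar> <= \<bar>Re s1\<bar> + D" "\<bar>Re (s2 + of_real (Re (u k)))\<bar> <= \<bar>Re s2\<bar> + D"
   using D[of k] by auto
  have H: "H >= 0" using hb[OF z] by linarith
  show "norm (w0 z) <= M" unfolding w0_def M_def norm_mult norm_of_real
   by (intro mult_mono Fb L1 L2 hb z mult_nonneg_nonneg) (use D0 H in auto)
  show "norm (w k z) <= M" unfolding w_def M_def norm_mult norm_of_real
   by (intro mult_mono Fb L1 L2 hb z mult_nonneg_nonneg r) (use H in auto)
 qed
 have en: "norm (e k z) = 1" for k z by (simp add: e_def)
 have M2: "norm ((w k z - w0 z) * e k z) <= 2 * M" if z: "z \<in> strip b" for z k
  using norm_triangle_ineq4[of "w k z" "w0 z"] w0b[OF z] wb[OF z, of k] by (simp add: norm_mult en)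
 have i1: "integrable (strip_leb b) (\<lambda>z. (w k z - w0 z) * e k z)" for k
  by (rule strip_integral_bound(1)[OF measurable_strip_leb M2]) measurable
 have i2: "integrable (strip_leb b) (\<lambda>z. w0 z * e k z)" for k
  by (rule strip_integral_bound(1)[OF measurable_strip_leb, of _ _ M]) (measurable, auto simp: norm_mult en w0b)
 have term_eq: "of_real (h z) * (of_real (qform z v) powr (- (s1 + u k)) * of_real (qform z v') powr (- (s2 + cnj (u k)))) = (w k z - w0 z) * e k z + w0 z * e k z"
  if z: "z \<in> strip b" for z k
 proof -
  define p p' where "p = ln (qform z v)" and "p' = ln (qform z v')"
  have "exp (- (s1 + u k) * of_real p) * exp (- (s2 + cnj (u k)) * of_real p')
   = exp (- (s1 + of_real (Re (u k))) * of_real p) * exp (- (s2 + of_real (Re (u k))) * of_real p') * exp (\<i> * of_real (Im (u k) * (p' - p)))"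
   unfolding exp_add[symmetric] by (rule arg_cong[of _ _ exp]) (simp add: complex_eq_iff algebra_simps)
  then show ?thesis
   unfolding powr_of_real_exp[OF qform_pos[OF stripD(2)[OF z] vl(1)]] powr_of_real_exp[OF qform_pos[OF stripD(2)[OF z] vl(2)]]
    w_def e_def F_def p_def[symmetric] p'_def[symmetric] cis_conv_exp by (simp add: algebra_simps)
 qed
 have split: "(\<integral>z. of_real (h z) * (of_real (qform z v) powr (- (s1 + u k)) * of_real (qform z v') powr (- (s2 + cnj (u k)))) \<partial>strip_leb b)
  = (\<integral>z. (w k z - w0 z) * e k z \<partial>strip_leb b) + (\<integral>z. w0 z * e k z \<partial>strip_leb b)" for k
  unfolding Bochner_Integration.integral_add[OF i1 i2, symmetric] by (rule lint_cong) (use term_eq in auto)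
 have l1: "(\<lambda>k. \<integral>z. (w k z - w0 z) * e k z \<partial>strip_leb b) \<longlonglongrightarrow> (\<integral>z. 0 \<partial>strip_leb b)"
 proof (rule integral_dominated_convergence[where w = "\<lambda>_. 2 * M"])
  interpret finite_measure "strip_leb b" by (rule finite_measure_strip_leb)
  show "integrable (strip_leb b) (\<lambda>_. 2 * M)" by simp
  show "(\<lambda>z. (w k z - w0 z) * e k z) \<in> borel_measurable (strip_leb b)" for k
   by (rule measurable_strip_leb) measurable
  show "AE z in strip_leb b. norm ((w k z - w0 z) * e k z) <= 2 * M" for k
   using M2 by (intro AE_I2) auto
  show "AE z in strip_leb b. (\<lambda>k. (w k z - w0 z) * e k z) \<longlonglongrightarrow> 0"
  proof (rule AE_I2)
   fix z
   have "(\<lambda>k. complex_of_real (Re (u k))) \<longlonglongrightarrow> of_real 0" by (rule tendsto_of_real[OF u(1)])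
   then have "(\<lambda>k. w k z - w0 z) \<longlonglongrightarrow> of_real (h z) * (F (s1 + of_real 0) (qform z v) * F (s2 + of_real 0) (qform z v')) - w0 z"
    unfolding w_def F_def by (intro tendsto_intros u(1))
   then have "(\<lambda>k. w k z - w0 z) \<longlonglongrightarrow> 0" by (simp add: w0_def)
   then have "(\<lambda>k. norm ((w k z - w0 z) * e k z)) \<longlonglongrightarrow> 0"
    by (simp add: norm_mult en tendsto_norm_zero)
   then show "(\<lambda>k. (w k z - w0 z) * e k z) \<longlonglongrightarrow> 0" by (rule tendsto_norm_zero_cancel)
  qed
 qed simp
 have l2: "(\<lambda>k. \<integral>z. w0 z * e k z \<partial>strip_leb b) \<longlonglongrightarrow> (if v = v' then \<integral>z. of_real (h z) * of_real (qform z v) powr (- (s1 + s2)) \<partial>strip_leb b else 0)"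
 proof (cases "v = v'")
  case True
  have "w0 z * e k z = of_real (h z) * of_real (qform z v) powr (- (s1 + s2))" if z: "z \<in> strip b" for z k
   unfolding powr_of_real_exp[OF qform_pos[OF stripD(2)[OF z] vl(1)]]
   by (simp add: w0_def e_def F_def True exp_add[symmetric] algebra_simps)
  then have "(\<integral>z. w0 z * e k z \<partial>strip_leb b) = (\<integral>z. of_real (h z) * of_real (qform z v) powr (- (s1 + s2)) \<partial>strip_leb b)" for k
   by (intro lint_cong) auto
  then show ?thesis using True by simp
 next
  case False
  have "(\<lambda>k. \<integral>z. cis (Im (u k) * (ln (qform z v') - ln (qform z v))) * (indicator (strip b) z *\<^sub>R w0 z) \<partial>lborel) \<longlonglongrightarrow> 0"
  proof (rule oscillation_strip[OF b v False _ _ u(2)])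
   show "norm (indicator (strip b) z *\<^sub>R w0 z) <= M * indicator (strip b) z" for z
    using w0b[of z] by (cases "z \<in> strip b") auto
  qed measurable
  moreover have "(\<integral>z. w0 z * e k z \<partial>strip_leb b) = (\<integral>z. cis (Im (u k) * (ln (qform z v') - ln (qform z v))) * (indicator (strip b) z *\<^sub>R w0 z) \<partial>lborel)" for k
   unfolding integral_strip_leb e_def by (rule lint_cong) (auto simp: mult.commute)
  ultimately show ?thesis using False by simp
 qed
 show ?thesis
  unfolding split using tendsto_add[OF l1 l2] by simp
qed

abbreviation strip_const :: "real => real" where
  "strip_const b \<equiv> max 1 (lconst (1 / 2) (b + 1))"

lemma prim_term_bound:
 assumes z: "z \<in> strip b" and v: "v \<in> lat" and s: "0 <= \<sigma>" "\<sigma> <= Re s" "Re s <= P"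
 shows "norm (of_real (qform z v) powr (- s)) <= strip_const b powr P * lsize v powr (- \<sigma>)"
proof -
 have z': "Im z >= 1 / 2" "norm z <= b + 1" "Im z > 0" using stripD[OF z] by auto
 note ls = lsize_le_qform[of "1 / 2" z "b + 1" v, OF _ z'(1,2) v]
 have "norm (of_real (qform z v) powr (- s)) = qform z v powr (- Re s)"
  by (rule norm_powr_of_real[OF qform_pos[OF z'(3) v]])
 also have "... <= lconst (1 / 2) (b + 1) powr Re s * lsize v powr (- Re s)"
  using z' v s by (intro qform_powr_le) auto
 also have "... <= strip_const b powr P * lsize v powr (- \<sigma>)"
 proof (intro mult_mono)
  have "lconst (1 / 2) (b + 1) powr Re s <= strip_const b powr Re s"
   using ls(4) s by (intro powr_mono2) auto
  also have "... <= strip_const b powr P" using s by (intro powr_mono) auto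
  finally show "lconst (1 / 2) (b + 1) powr Re s <= strip_const b powr P" .
  show "lsize v powr (- Re s) <= lsize v powr (- \<sigma>)" using ls(3) s by (intro powr_mono) auto
 qed auto
 finally show ?thesis .
qed

lemma eisenstein_integral_sum:
 fixes h :: "complex => real"
 assumes h [measurable]: "h \<in> borel_fun" and hb: "\<And>z. z \<in> strip b ==> \<bar>h z\<bar> <= H" and s: "Re s > 1"
 shows "(\<integral>z. of_real (h z) * eisenstein z s \<partial>strip_leb b) = (\<Sum>\<^sub>\<infinity>v\<in>prim. \<integral>z. of_real (h z) * of_real (qform z v) powr (- s) \<partial>strip_leb b)"
proof -
 define Q where "Q = strip_const b powr Re s"
 define f where "f v z = of_real (h z) * of_real (qform z v) powr (- s)" for v z
 have hm: "(\<lambda>z. complex_of_real (h z)) \<in> borel_measurable (strip_leb b)" by (rule measurable_strip_leb) measurable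
 have fm: "f v \<in> borel_measurable (strip_leb b)" if "v \<in> prim" for v
  unfolding f_def using that prim_lat by (intro borel_measurable_times hm qform_powr_measurable) auto
 have fb: "norm (f v z) <= \<bar>H\<bar> * Q * lsize v powr (- Re s)" if "v \<in> prim" "z \<in> strip b" for v z
 proof -
  have "norm (f v z) <= \<bar>H\<bar> * (Q * lsize v powr (- Re s))"
   unfolding f_def norm_mult norm_of_real Q_def
   using that prim_lat s hb[OF that(2)] by (intro mult_mono prim_term_bound) auto
  then show ?thesis by (simp add: mult.assoc)
 qed
 have sm: "(\<lambda>v. \<bar>H\<bar> * Q * lsize v powr (- Re s)) summable_on prim"
  by (intro summable_on_cmult_right summable_on_subset_banach[OF lsize_summable[OF s]]) auto
 have "((\<lambda>v. \<integral>z. f v z \<partial>strip_leb b) has_sum (\<integral>z. (\<Sum>\<^sub>\<infinity>v\<in>prim. f v z) \<partial>strip_leb b)) prim"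
 proof (rule has_sum_integral(2))
  show "countable prim" using countable_lat prim_lat countable_subset by blast
  show "integrable (strip_leb b) (f v)" if "v \<in> prim" for v
   by (rule strip_integral_bound(1)[OF fm fb]) (use that in auto)
  show "(\<lambda>v. norm (f v z)) summable_on prim" if "z \<in> space (strip_leb b)" for z
   by (rule summable_on_comparison_test[OF sm]) (use fb that in auto)
  have "(\<lambda>v. \<bar>H\<bar> * Q * lsize v powr (- Re s) * measure (strip_leb b) (strip b)) summable_on prim"
   by (rule summable_on_cmult_left[OF sm])
  then show "(\<lambda>v. \<integral>z. norm (f v z) \<partial>strip_leb b) summable_on prim"
   by (rule summable_on_comparison_test) (use strip_integral_bound(2)[OF fm fb] in auto)
 qed
 moreover have "(\<integral>z. (\<Sum>\<^sub>\<infinity>v\<in>prim. f v z) \<partial>strip_leb b) = (\<integral>z. of_real (h z) * eisenstein z s \<partial>strip_leb b)"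
 proof (rule lint_cong[OF refl])
  fix z assume "z \<in> space (strip_leb b)"
  then have "Im z > 0" using stripD by simp
  from eisenstein_prim[OF this s] show "(\<Sum>\<^sub>\<infinity>v\<in>prim. f v z) = of_real (h z) * eisenstein z s"
   by (simp add: f_def infsum_cmult_right')
 qed
 ultimately show ?thesis unfolding f_def by (simp add: infsumI)
qed

abbreviation qform_pair :: "complex => complex => (int \<times> int) \<times> (int \<times> int) => complex => complex" where
  "qform_pair \<mu> \<nu> p z \<equiv> of_real (qform z (fst p)) powr (- \<mu>) * of_real (qform z (snd p)) powr (- \<nu>)"

abbreviation lsize_pair :: "real => real => (int \<times> int) \<times> (int \<times> int) => real" where
  "lsize_pair \<alpha> \<beta> p \<equiv> lsize (fst p) powr (- \<alpha>) * lsize (snd p) powr (- \<beta>)"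

lemma eisenstein_product_integral_sum:
 fixes h :: "complex => real"
 assumes h [measurable]: "h \<in> borel_fun" and hb: "\<And>z. z \<in> strip b ==> \<bar>h z\<bar> <= H"
  and s: "1 < \<alpha>" "\<alpha> <= Re \<mu>" "Re \<mu> <= P" "1 < \<beta>" "\<beta> <= Re \<nu>" "Re \<nu> <= R"
 defines "Q \<equiv> \<bar>H\<bar> * (strip_const b powr P * strip_const b powr R)"
 shows "(\<integral>z. of_real (h z) * (eisenstein z \<mu> * eisenstein z \<nu>) \<partial>strip_leb b)
   = (\<Sum>\<^sub>\<infinity>p\<in>prim \<times> prim. \<integral>z. of_real (h z) * (qform_pair \<mu> \<nu> p z) \<partial>strip_leb b)"
  and "\<And>p. p \<in> prim \<times> prim ==> norm (\<integral>z. of_real (h z) * (qform_pair \<mu> \<nu> p z) \<partial>strip_leb b)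
   <= Q * (lsize_pair \<alpha> \<beta> p) * measure (strip_leb b) (strip b)"
  and "(\<lambda>p. Q * (lsize_pair \<alpha> \<beta> p) * measure (strip_leb b) (strip b)) summable_on (prim \<times> prim)"
proof -
 define f where "f p z = of_real (h z) * (qform_pair \<mu> \<nu> p z)" for p z
 have hm: "(\<lambda>z. complex_of_real (h z)) \<in> borel_measurable (strip_leb b)" by (rule measurable_strip_leb) measurable
 have fm: "f p \<in> borel_measurable (strip_leb b)" if "p \<in> prim \<times> prim" for p
  unfolding f_def using that prim_lat by (intro borel_measurable_times hm qform_powr_measurable) auto
 have fb: "norm (f p z) <= Q * (lsize_pair \<alpha> \<beta> p)" if "p \<in> prim \<times> prim" "z \<in> strip b" for p z
 proof -
  have "fst p \<in> lat" "snd p \<in> lat" using that(1) prim_lat by auto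
  then have "norm (f p z) <= \<bar>H\<bar> * ((strip_const b powr P * lsize (fst p) powr (- \<alpha>)) * (strip_const b powr R * lsize (snd p) powr (- \<beta>)))"
   unfolding f_def norm_mult norm_of_real
   using that s hb[OF that(2)] by (intro mult_mono prim_term_bound mult_nonneg_nonneg) auto
  then show ?thesis by (simp add: Q_def mult_ac)
 qed
 have sm: "(\<lambda>p. Q * (lsize_pair \<alpha> \<beta> p)) summable_on (prim \<times> prim)"
 proof -
  have "(\<lambda>(v, w). lsize v powr (- \<alpha>) * lsize w powr (- \<beta>)) summable_on (prim \<times> prim)"
   by (intro summable_on_product_real summable_on_subset_banach[OF lsize_summable] s) auto
  then show ?thesis by (intro summable_on_cmult_right) (simp add: split_beta')
 qed
 show sm2: "(\<lambda>p. Q * (lsize_pair \<alpha> \<beta> p) * measure (strip_leb b) (strip b)) summable_on (prim \<times> prim)"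
  by (rule summable_on_cmult_left[OF sm])
 note si = strip_integral_bound[OF fm fb]
 show "norm (\<integral>z. of_real (h z) * (qform_pair \<mu> \<nu> p z) \<partial>strip_leb b)
   <= Q * (lsize_pair \<alpha> \<beta> p) * measure (strip_leb b) (strip b)" if "p \<in> prim \<times> prim" for p
  using order.trans[OF integral_norm_bound si(2)[OF that that]] by (simp add: f_def)
 have ps: "(\<lambda>p. norm (f p z)) summable_on (prim \<times> prim)" if "z \<in> strip b" for z
  by (rule summable_on_comparison_test[OF sm]) (use fb that in auto)
 have "((\<lambda>p. \<integral>z. f p z \<partial>strip_leb b) has_sum (\<integral>z. (\<Sum>\<^sub>\<infinity>p\<in>prim \<times> prim. f p z) \<partial>strip_leb b)) (prim \<times> prim)"
 proof (rule has_sum_integral(2))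
  have "countable prim" using countable_lat prim_lat countable_subset by blast
  then show "countable (prim \<times> prim)" by simp
  show "integrable (strip_leb b) (f p)" if "p \<in> prim \<times> prim" for p by (rule si(1)[OF that that])
  show "(\<lambda>p. norm (f p z)) summable_on prim \<times> prim" if "z \<in> space (strip_leb b)" for z
   using ps that by simp
  show "(\<lambda>p. \<integral>z. norm (f p z) \<partial>strip_leb b) summable_on prim \<times> prim"
   by (rule summable_on_comparison_test[OF sm2]) (use si(2) in auto)
 qed
 moreover have "(\<integral>z. (\<Sum>\<^sub>\<infinity>p\<in>prim \<times> prim. f p z) \<partial>strip_leb b) = (\<integral>z. of_real (h z) * (eisenstein z \<mu> * eisenstein z \<nu>) \<partial>strip_leb b)"
 proof (rule lint_cong[OF refl])
  fix z assume "z \<in> space (strip_leb b)"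
  then have z: "z \<in> strip b" "Im z > 0" using stripD by simp_all
  have "(\<lambda>(v, w). f (v, w) z) summable_on (prim \<times> prim)"
   using abs_summable_summable[OF ps[OF z(1)]] by (simp add: split_beta')
  from infsum_Sigma'_banach[OF this]
  have "(\<Sum>\<^sub>\<infinity>p\<in>prim \<times> prim. f p z) = (\<Sum>\<^sub>\<infinity>v\<in>prim. \<Sum>\<^sub>\<infinity>w\<in>prim. f (v, w) z)" by (simp add: split_beta')
  also have "... = of_real (h z) * ((\<Sum>\<^sub>\<infinity>v\<in>prim. of_real (qform z v) powr (- \<mu>)) * (\<Sum>\<^sub>\<infinity>v\<in>prim. of_real (qform z v) powr (- \<nu>)))"
   by (simp add: f_def infsum_cmult_right' infsum_cmult_left' mult.assoc)
  also have "... = of_real (h z) * (eisenstein z \<mu> * eisenstein z \<nu>)"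
   using s by (simp add: eisenstein_prim[OF z(2)])
  finally show "(\<Sum>\<^sub>\<infinity>p\<in>prim \<times> prim. f p z) = of_real (h z) * (eisenstein z \<mu> * eisenstein z \<nu>)" .
 qed
 ultimately show "(\<integral>z. of_real (h z) * (eisenstein z \<mu> * eisenstein z \<nu>) \<partial>strip_leb b)
   = (\<Sum>\<^sub>\<infinity>p\<in>prim \<times> prim. \<integral>z. of_real (h z) * (qform_pair \<mu> \<nu> p z) \<partial>strip_leb b)"
  unfolding f_def by (simp add: infsumI)
qed

text \<open>For exponents beyond 1 the double series is dominated uniformly in k, so the limit can be taken term by term; only the diagonal survives.\<close>
lemma eisenstein_product_limit:
 fixes u :: "nat => complex" and h :: "complex => real"
 assumes b: "b >= 1 / 2"
  and h [measurable]: "h \<in> borel_fun" and hb: "\<And>z. z \<in> strip b ==> \<bar>h z\<bar> <= H"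
  and u: "(\<lambda>k. Re (u k)) \<longlonglongrightarrow> 0" "filterlim (\<lambda>k. Im (u k)) at_top sequentially"
  and s: "Re s1 > 1" "Re s2 > 1"
 shows "(\<lambda>k. \<integral>z. of_real (h z) * (eisenstein z (s1 + u k) * eisenstein z (s2 + cnj (u k))) \<partial>strip_leb b)
  \<longlonglongrightarrow> (\<integral>z. of_real (h z) * eisenstein z (s1 + s2) \<partial>strip_leb b)"
proof -
 define \<epsilon> where "\<epsilon> = min (Re s1 - 1) (Re s2 - 1) / 2"
 have \<epsilon>: "\<epsilon> > 0" "1 < Re s1 - \<epsilon>" "1 < Re s2 - \<epsilon>" using s by (auto simp: \<epsilon>_def min_def field_simps)
 define T where "T k p = (\<integral>z. of_real (h z) * (of_real (qform z (fst p)) powr (- (s1 + u k)) * of_real (qform z (snd p)) powr (- (s2 + cnj (u k)))) \<partial>strip_leb b)" for k p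
 define X where "X v = (\<integral>z. of_real (h z) * of_real (qform z v) powr (- (s1 + s2)) \<partial>strip_leb b)" for v
 have ev: "\<forall>\<^sub>F k in sequentially. \<bar>Re (u k)\<bar> < \<epsilon>"
  using tendstoD[OF u(1) \<epsilon>(1)] by (simp add: dist_real_def)
 define G where "G p = \<bar>H\<bar> * (strip_const b powr (Re s1 + \<epsilon>) * strip_const b powr (Re s2 + \<epsilon>)) * (lsize (fst p) powr (- (Re s1 - \<epsilon>)) * lsize (snd p) powr (- (Re s2 - \<epsilon>))) * measure (strip_leb b) (strip b)" for p
 have "(\<lambda>k. \<Sum>\<^sub>\<infinity>p\<in>prim \<times> prim. T k p) \<longlonglongrightarrow> (\<Sum>\<^sub>\<infinity>p\<in>prim \<times> prim. if fst p = snd p then X (fst p) else 0)"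
 proof (rule infsum_tendsto_dominated)
  show "(\<lambda>k. T k p) \<longlonglongrightarrow> (if fst p = snd p then X (fst p) else 0)" if "p \<in> prim \<times> prim" for p
   unfolding T_def X_def using that by (intro prim_pair_limit[OF b _ _ h hb u]) auto
  show "G summable_on prim \<times> prim"
   unfolding G_def using eisenstein_product_integral_sum(3)[OF h hb, where \<alpha> = "Re s1 - \<epsilon>" and P = "Re s1 + \<epsilon>" and \<beta> = "Re s2 - \<epsilon>" and R = "Re s2 + \<epsilon>" and \<mu> = s1 and \<nu> = s2] \<epsilon> by auto
  show "\<forall>\<^sub>F k in sequentially. \<forall>p\<in>prim \<times> prim. norm (T k p) <= G p"
   using ev
  proof eventually_elim
   fix k assume "\<bar>Re (u k)\<bar> < \<epsilon>"
   then show "\<forall>p\<in>prim \<times> prim. norm (T k p) <= G p"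
    unfolding T_def G_def using \<epsilon> by (intro ballI eisenstein_product_integral_sum(2)[OF h hb]) auto
  qed
 qed simp
 moreover have "\<forall>\<^sub>F k in sequentially. (\<Sum>\<^sub>\<infinity>p\<in>prim \<times> prim. T k p) = (\<integral>z. of_real (h z) * (eisenstein z (s1 + u k) * eisenstein z (s2 + cnj (u k))) \<partial>strip_leb b)"
  using ev
 proof eventually_elim
  fix k assume "\<bar>Re (u k)\<bar> < \<epsilon>"
  then show "(\<Sum>\<^sub>\<infinity>p\<in>prim \<times> prim. T k p) = (\<integral>z. of_real (h z) * (eisenstein z (s1 + u k) * eisenstein z (s2 + cnj (u k))) \<partial>strip_leb b)"
   unfolding T_def using \<epsilon>
   by (intro eisenstein_product_integral_sum(1)[OF h hb, symmetric, where \<alpha> = "Re s1 - \<epsilon>" and P = "Re s1 + \<epsilon>" and \<beta> = "Re s2 - \<epsilon>" and R = "Re s2 + \<epsilon>"]) auto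
 qed
 moreover have "(\<Sum>\<^sub>\<infinity>p\<in>prim \<times> prim. if fst p = snd p then X (fst p) else 0) = (\<integral>z. of_real (h z) * eisenstein z (s1 + s2) \<partial>strip_leb b)"
 proof -
  have "(\<Sum>\<^sub>\<infinity>p\<in>prim \<times> prim. if fst p = snd p then X (fst p) else 0) = (\<Sum>\<^sub>\<infinity>p\<in>(\<lambda>v. (v, v)) ` prim. X (fst p))"
   by (rule infsum_cong_neutral) auto
  also have "... = (\<Sum>\<^sub>\<infinity>v\<in>prim. X v)" by (subst infsum_reindex) (auto simp: inj_on_def o_def)
  also have "... = (\<integral>z. of_real (h z) * eisenstein z (s1 + s2) \<partial>strip_leb b)"
   unfolding X_def using s by (intro eisenstein_integral_sum[OF h hb, symmetric]) auto
  finally show ?thesis .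
 qed
 ultimately show ?thesis
  using Lim_transform_eventually by force
qed

section \<open>The limit beyond the line of convergence\<close>

lemma nn_integral_unit_shift:
 fixes g :: "real => ennreal"
 assumes g [measurable]: "g \<in> borel_fun" and per: "\<And>x. g (x + 1) = g x"
 shows "(\<integral>\<^sup>+x. g x * indicator {-1/2..1/2} x \<partial>lborel) = (\<integral>\<^sup>+x. g x \<partial>unit_leb)"
proof -
 have "(\<integral>\<^sup>+x. g x * indicator {-1/2..1/2} x \<partial>lborel) = (\<integral>\<^sup>+x. g x * indicator {0..<1/2} x + g x * indicator {-1/2..<0} x \<partial>lborel)"
 proof (rule nn_integral_cong_AE)
  show "AE x in lborel. g x * indicator {-1/2..1/2} x = g x * indicator {0..<1/2} x + g x * indicator {-1/2..<0} x"
   using AE_lborel_singleton[of "1/2 :: real"] by eventually_elim (auto simp: indicator_def)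
 qed
 also have "... = (\<integral>\<^sup>+x. g x * indicator {0..<1/2} x \<partial>lborel) + (\<integral>\<^sup>+x. g x * indicator {-1/2..<0} x \<partial>lborel)"
  by (rule nn_integral_add) auto
 also have "(\<integral>\<^sup>+x. g x * indicator {-1/2..<0} x \<partial>lborel) = ennreal \<bar>1\<bar> * (\<integral>\<^sup>+x. g (-1 + 1 * x) * indicator {-1/2..<0} (-1 + 1 * x) \<partial>lborel)"
  by (rule nn_integral_real_affine) auto
 also have "... = (\<integral>\<^sup>+x. g x * indicator {1/2..<1} x \<partial>lborel)"
 proof -
  have "g (-1 + 1 * x) * indicator {-1/2..<0} (-1 + 1 * x) = g x * indicator {1/2..<1} x" for x :: real
   using per[of "x - 1"] by (simp add: indicator_def algebra_simps)
  then show ?thesis by simp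
 qed
 also have "(\<integral>\<^sup>+x. g x * indicator {0..<1/2} x \<partial>lborel) + (\<integral>\<^sup>+x. g x * indicator {1/2..<1} x \<partial>lborel) = (\<integral>\<^sup>+x. g x * indicator {0..<1/2} x + g x * indicator {1/2..<1} x \<partial>lborel)"
  by (rule nn_integral_add[symmetric]) auto
 also have "... = (\<integral>\<^sup>+x. g x * indicator {0..<1} x \<partial>lborel)"
  by (intro nn_integral_cong) (auto simp: indicator_def)
 finally show ?thesis by (simp add: nn_integral_unit_leb)
qed

lemma eisenstein_strip_leb_bound:
 assumes \<delta>: "\<delta> > 0" and b: "b >= 1 / 2"
 shows "\<exists>C<\<infinity>. \<exists>T. \<forall>s\<in>half_domain. 1 / 2 + \<delta> <= Re s --> Re s <= B --> T <= \<bar>Im s\<bar> \<longrightarrow>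
  (\<integral>\<^sup>+z. sqnorm (eisenstein z s) \<partial>strip_leb b) <= C"
proof -
 have "(\<integral>\<^sup>+z. sqnorm (eisenstein z s) \<partial>strip_leb b)
  = (\<integral>\<^sup>+y. (eisenstein_row y s) * indicator {1 / 2..b} y \<partial>lborel)"
  if s: "s \<in> half_domain" for s
 proof -
  define E where "E z = indicator (strip b) z *\<^sub>R eisenstein z s" for z
  have "continuous_on (strip b) (\<lambda>z. eisenstein z s)"
   by (rule continuous_on_subset[OF eisenstein_continuous[OF s]]) (use stripD in auto)
  then have [measurable]: "E \<in> borel_fun"
   unfolding E_def by (intro borel_measurable_continuous_on_indicator) auto
  have "(\<integral>\<^sup>+z. sqnorm (eisenstein z s) \<partial>strip_leb b) = (\<integral>\<^sup>+z. sqnorm (eisenstein z s) * indicator (strip b) z \<partial>lborel)"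
   unfolding strip_leb_def by (rule nn_integral_restrict_space) simp
  also have "... = (\<integral>\<^sup>+z. sqnorm (E z) \<partial>lborel)"
   by (intro nn_integral_cong) (auto simp: E_def indicator_def)
  also have "... = (\<integral>\<^sup>+y. (\<integral>\<^sup>+x. sqnorm (E (Complex x y)) \<partial>lborel) \<partial>lborel)"
   by (rule nn_integral_complex_yx) measurable
  also have "... = (\<integral>\<^sup>+y. (eisenstein_row y s) * indicator {1 / 2..b} y \<partial>lborel)"
  proof (rule nn_integral_cong)
   fix y
   show "(\<integral>\<^sup>+x. sqnorm (E (Complex x y)) \<partial>lborel) = (eisenstein_row y s) * indicator {1 / 2..b} y"
   proof (cases "y \<in> {1 / 2..b}")
    case True
    then have y: "y > 0" by auto
    have c: "continuous_on UNIV (eisenstein_line y s)" by (rule eisenstein_x_continuous[OF y s])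
    then have [measurable]: "(eisenstein_line y s) \<in> borel_fun" by (rule borel_measurable_continuous_onI)
    have "sqnorm (E (Complex x y)) = sqnorm (eisenstein (Complex x y) s) * indicator {-1/2..1/2} x" for x
     using True by (auto simp: E_def strip_def indicator_def abs_le_iff)
    then have "(\<integral>\<^sup>+x. sqnorm (E (Complex x y)) \<partial>lborel) = (\<integral>\<^sup>+x. sqnorm (eisenstein (Complex x y) s) * indicator {-1/2..1/2} x \<partial>lborel)"
     by simp
    also have "... = (eisenstein_row y s)"
     by (rule nn_integral_unit_shift) (measurable, simp add: eisenstein_periodic[OF y])
    finally show ?thesis using True by simp
   next
    case False
    then have "E (Complex x y) = 0" for x by (auto simp: E_def strip_def)
    then show ?thesis using False by simp
   qed
  qed
  finally show ?thesis .
 qed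
 then show ?thesis using eisenstein_strip_bound[OF \<delta>, of "1 / 2" b B] b by auto
qed

lemma eisenstein_integral_holomorphic:
 fixes p :: "complex => complex"
 assumes p: "p \<in> borel_measurable (strip_leb b)" "\<And>z. z \<in> strip b ==> norm (p z) <= P"
  and S: "open S" "\<And>s. s \<in> S ==> s + c \<in> half_domain"
 shows "(\<lambda>s. \<integral>z. p z * eisenstein z (s + c) \<partial>strip_leb b) holomorphic_on S"
proof (rule holomorphic_on_lebesgue_integral)
 fix z assume "z \<in> space (strip_leb b)"
 then have "Im z > 0" using stripD by simp
 from eisenstein_holomorphic[OF this] have "(\<lambda>s. eisenstein z (s + c)) holomorphic_on S"
  by (intro holomorphic_on_compose_gen[of "\<lambda>s. s + c" S "eisenstein z" half_domain, unfolded o_def] holomorphic_intros) (use S(2) in auto)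
 then show "(\<lambda>s. p z * eisenstein z (s + c)) holomorphic_on S" by (intro holomorphic_intros)
next
 fix s assume s: "s \<in> S"
 show "(\<lambda>z. p z * eisenstein z (s + c)) \<in> borel_measurable (strip_leb b)"
  by (intro borel_measurable_times p(1) continuous_measurable_strip_leb eisenstein_continuous S(2) s)
next
 fix s assume s: "s \<in> S"
 obtain r where r: "r > 0" "cball s r \<subseteq> S" using S(1) s open_contains_cball by blast
 define K where "K = (\<lambda>w. w + c) ` cball s r"
 have "compact K" "K \<subseteq> half_domain"
  unfolding K_def using r S(2) by (auto intro!: compact_continuous_image continuous_intros)
 from eisenstein_locally_bounded[of "1 / 2", OF _ this, of "b + 1"] obtain C where
  C: "\<And>z w. Im z >= 1 / 2 ==> norm z <= b + 1 ==> w \<in> K ==> norm (eisenstein z w) <= C" by auto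
 interpret finite_measure "strip_leb b" by (rule finite_measure_strip_leb)
 have "norm (p z * eisenstein z (w + c)) <= P * C" if "w \<in> cball s r" "z \<in> strip b" for w z
  unfolding norm_mult using that p(2)[of z] C[of z "w + c"] stripD[of z b] order.trans[OF norm_ge_zero p(2)[of z]]
  by (intro mult_mono) (auto simp: K_def)
 then show "\<exists>r>0. \<exists>g. integrable (strip_leb b) g \<and> cball s r \<subseteq> S \<and>
   (\<forall>w\<in>cball s r. \<forall>z\<in>space (strip_leb b). norm (p z * eisenstein z (w + c)) <= g z)"
  using r by (intro exI[of _ r] conjI exI[of _ "\<lambda>_. P * C"]) auto
qed

lemma eisenstein_strip_bounded:
 assumes "w \<in> half_domain"
 shows "\<exists>Q. \<forall>z\<in>strip b. norm (eisenstein z w) <= Q"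
proof -
 have "\<exists>C. \<forall>z s. Im z >= 1 / 2 --> norm z <= b + 1 --> s \<in> {w} --> norm (eisenstein z s) <= C"
  by (rule eisenstein_locally_bounded) (use assms in auto)
 then show ?thesis using stripD(1,3) by blast
qed

text \<open>Vitali is applied first in s with s' in the region of convergence, then in s' with s = \<sigma>. Keeping s and s' near the real axis puts the large imaginary part into u and keeps the arguments away from the pole.\<close>
lemma eisenstein_square_limit_bounded:
 fixes u :: "nat => complex" and h :: "complex => real" and \<sigma> :: real
 assumes b: "b >= 1 / 2"
  and h [measurable]: "h \<in> borel_fun" and hb: "\<And>z. z \<in> strip b ==> \<bar>h z\<bar> <= H"
  and \<sigma>: "\<sigma> > 1 / 2 + 2 * \<eta>" "\<eta> > 0"
  and u: "(\<lambda>k. Re (u k)) \<longlonglongrightarrow> 0" "filterlim (\<lambda>k. Im (u k)) at_top sequentially"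
  and uk: "\<And>k. \<bar>Re (u k)\<bar> <= \<eta>" "\<And>k. Im (u k) >= T + 1" "T >= 0"
  and C: "C < \<infinity>" "\<And>s. s \<in> half_domain ==> 1 / 2 + \<eta> <= Re s ==> Re s <= \<sigma> + 3 + \<eta> ==> T <= \<bar>Im s\<bar> ==>
   (\<integral>\<^sup>+z. sqnorm (eisenstein z s) \<partial>strip_leb b) <= C"
 shows "(\<lambda>k. \<integral>z. of_real (h z) * (eisenstein z (of_real \<sigma> + u k) * eisenstein z (of_real \<sigma> + cnj (u k))) \<partial>strip_leb b)
  \<longlonglongrightarrow> (\<integral>z. of_real (h z) * eisenstein z (of_real (2 * \<sigma>)) \<partial>strip_leb b)"
proof -
 \<comment> \<open>the rectangle extends to \<sigma> + 3 so that it meets the half-plane Re s > 1\<close>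
 define S where "S = {s. 1 / 2 + 2 * \<eta> < Re s} \<inter> {s. Re s < \<sigma> + 3} \<inter> {s. Im s < 1} \<inter> {s. - 1 < Im s}"
 have So: "open S" unfolding S_def
  by (intro open_Int open_halfspace_Re_gt open_halfspace_Re_lt open_halfspace_Im_gt open_halfspace_Im_lt)
 have "convex S" unfolding S_def
  by (intro convex_Int convex_halfspace_Re_gt convex_halfspace_Re_lt convex_halfspace_Im_gt convex_halfspace_Im_lt)
 then have Sc: "connected S" by (rule convex_connected)
 define U where "U = S \<inter> {s. Re s > 1}"
 have U: "open U" "U \<subseteq> S" unfolding U_def by (intro open_Int So open_halfspace_Re_gt) auto
 have "of_real (\<sigma> + 2) \<in> U" using \<sigma> by (auto simp: U_def S_def)
 then have Une: "U ~= {}" by blast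
 have sS: "of_real \<sigma> \<in> S" using \<sigma> by (auto simp: S_def)
 have dom: "s + u k \<in> half_domain" "s + cnj (u k) \<in> half_domain" if "s \<in> S" for s k
  using that uk(1)[of k] uk(2)[of k] uk(3) \<sigma>(2) by (auto simp: S_def half_domain_def complex_eq_iff)
 have dom2: "s + s' \<in> half_domain" if "s \<in> S" "s' \<in> S" for s s'
  using that \<sigma>(2) by (intro half_domainI) (auto simp: S_def)
 have L2: "(\<integral>\<^sup>+z. sqnorm (eisenstein z (s + u k)) \<partial>strip_leb b) <= C"
  "(\<integral>\<^sup>+z. sqnorm (eisenstein z (s + cnj (u k))) \<partial>strip_leb b) <= C" if "s \<in> S" for s k
  using that uk(1)[of k] uk(2)[of k] uk(3) \<sigma>(2) by (intro C(2) dom; auto simp: S_def)+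
 define F where "F k s s' = (\<integral>z. of_real (h z) * (eisenstein z (s + u k) * eisenstein z (s' + cnj (u k))) \<partial>strip_leb b)" for k s s'
 define G where "G s s' = (\<integral>z. of_real (h z) * eisenstein z (s + s') \<partial>strip_leb b)" for s s'
 have hm: "(\<lambda>z. complex_of_real (h z)) \<in> borel_measurable (strip_leb b)" by (rule measurable_strip_leb) measurable
 have em: "(\<lambda>z. eisenstein z w) \<in> borel_measurable (strip_leb b)" if "w \<in> half_domain" for w
  by (rule continuous_measurable_strip_leb[OF eisenstein_continuous[OF that]])
 have eb: "\<exists>P. \<forall>z\<in>strip b. norm (of_real (h z) * eisenstein z w) <= P" if "w \<in> half_domain" for w
 proof -
  obtain Q where Q: "\<And>z. z \<in> strip b ==> norm (eisenstein z w) <= Q"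
   using eisenstein_strip_bounded[OF \<open>w \<in> half_domain\<close>] by blast
  have "norm (of_real (h z) * eisenstein z w) <= H * Q" if z: "z \<in> strip b" for z
   unfolding norm_mult norm_of_real using hb[OF z] Q[OF z] order.trans[OF abs_ge_zero hb[OF z]] by (intro mult_mono) auto
  then show ?thesis by blast
 qed
 have hol: "(\<lambda>s. F k s s') holomorphic_on S" "(\<lambda>s. F k s' s) holomorphic_on S" if s': "s' \<in> S" for k s'
 proof -
  obtain P where "\<And>z. z \<in> strip b ==> norm (of_real (h z) * eisenstein z (s' + cnj (u k))) <= P"
   using eb[OF dom(2)[OF s']] by blast
  from eisenstein_integral_holomorphic[OF borel_measurable_times[OF hm em[OF dom(2)[OF s', of k]]] this So dom(1)[of _ k]]
  show "(\<lambda>s. F k s s') holomorphic_on S" by (simp only: F_def mult_ac)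
  obtain P where "\<And>z. z \<in> strip b ==> norm (of_real (h z) * eisenstein z (s' + u k)) <= P"
   using eb[OF dom(1)[OF s']] by blast
  from eisenstein_integral_holomorphic[OF borel_measurable_times[OF hm em[OF dom(1)[OF s', of k]]] this So dom(2)[of _ k]]
  show "(\<lambda>s. F k s' s) holomorphic_on S" by (simp only: F_def mult.assoc)
 qed
 have Ghol: "(\<lambda>s. G s s') holomorphic_on S" "(\<lambda>s. G s' s) holomorphic_on S" if s': "s' \<in> S" for s'
 proof -
  have "\<And>z. z \<in> strip b ==> norm (complex_of_real (h z)) <= H" using hb by simp
  from eisenstein_integral_holomorphic[OF hm this So dom2[OF _ s']]
  show "(\<lambda>s. G s s') holomorphic_on S" by (simp add: G_def)
  then show "(\<lambda>s. G s' s) holomorphic_on S" by (simp add: G_def add.commute)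
 qed
 have bnd: "norm (F k s s') <= enn2real (ennreal \<bar>H\<bar> * (C + C))" if s: "s \<in> S" "s' \<in> S" for k s s'
 proof -
  define f where "f z = of_real (h z) * (eisenstein z (s + u k) * eisenstein z (s' + cnj (u k)))" for z
  obtain P where P: "\<And>z. z \<in> strip b ==> norm (of_real (h z) * eisenstein z (s + u k)) <= P"
   using eb[OF dom(1)[OF s(1)]] by blast
  obtain Q where Q: "\<And>z. z \<in> strip b ==> norm (eisenstein z (s' + cnj (u k))) <= Q"
   using eisenstein_strip_bounded[OF dom(2)[OF s(2)]] by blast
  have fm: "f \<in> borel_measurable (strip_leb b)"
   unfolding f_def by (intro borel_measurable_times hm em dom s)
  have fb: "norm (f z) <= P * Q" if z: "z \<in> strip b" for z
   unfolding f_def mult.assoc[symmetric] norm_mult[of "_ * _" "eisenstein z (s' + cnj (u k))"]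
   using P[OF z] Q[OF z] order.trans[OF norm_ge_zero P[OF z]] by (intro mult_mono) auto
  have fi: "integrable (strip_leb b) f" by (rule strip_integral_bound(1)[OF fm fb])
  have pt: "norm (f z) <= \<bar>H\<bar> * ((norm (eisenstein z (s + u k)))\<^sup>2 + (norm (eisenstein z (s' + cnj (u k))))\<^sup>2)" if z: "z \<in> strip b" for z
  proof -
   have ab: "x * y <= x\<^sup>2 + y\<^sup>2" if "x >= 0" "y >= 0" for x y :: real
   proof -
    have "2 * x * y <= x\<^sup>2 + y\<^sup>2" by (rule sum_squares_bound)
    then show ?thesis using mult_nonneg_nonneg[OF that] by linarith
   qed
   show ?thesis
    unfolding f_def norm_mult norm_of_real using hb[OF z] by (intro mult_mono ab) auto
  qed
  have "ennreal (norm (F k s s')) <= (\<integral>\<^sup>+z. ennreal (norm (f z)) \<partial>strip_leb b)"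
   unfolding F_def f_def[symmetric] by (rule integral_norm_bound_ennreal[OF fi])
  also have "... <= (\<integral>\<^sup>+z. ennreal \<bar>H\<bar> * (sqnorm (eisenstein z (s + u k)) + sqnorm (eisenstein z (s' + cnj (u k)))) \<partial>strip_leb b)"
  proof (rule nn_integral_mono)
   fix z assume "z \<in> space (strip_leb b)"
   then have z: "z \<in> strip b" by simp
   show "ennreal (norm (f z)) <= ennreal \<bar>H\<bar> * (sqnorm (eisenstein z (s + u k)) + sqnorm (eisenstein z (s' + cnj (u k))))"
    using ennreal_leI[OF pt[OF z]] by (simp add: ennreal_mult)
  qed
  also have "... = ennreal \<bar>H\<bar> * ((\<integral>\<^sup>+z. sqnorm (eisenstein z (s + u k)) \<partial>strip_leb b) + (\<integral>\<^sup>+z. sqnorm (eisenstein z (s' + cnj (u k))) \<partial>strip_leb b))"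
  proof -
   note [measurable] = em[OF dom(1)[OF s(1), of k]] em[OF dom(2)[OF s(2), of k]]
   show ?thesis by (subst nn_integral_cmult, measurable, subst nn_integral_add) auto
  qed
  also have "... <= ennreal \<bar>H\<bar> * (C + C)" by (intro mult_left_mono add_mono L2 s) auto
  finally have le: "ennreal (norm (F k s s')) <= ennreal \<bar>H\<bar> * (C + C)" .
  have fin: "ennreal \<bar>H\<bar> * (C + C) < \<top>" using C(1) by (simp add: ennreal_mult_less_top)
  have "norm (F k s s') = enn2real (ennreal (norm (F k s s')))" by simp
  also have "... <= enn2real (ennreal \<bar>H\<bar> * (C + C))" by (rule enn2real_mono[OF le fin])
  finally show ?thesis .
 qed
 have base: "(\<lambda>k. F k s s') \<longlonglongrightarrow> G s s'" if "s \<in> U" "s' \<in> U" for s s'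
  unfolding F_def G_def using that by (intro eisenstein_product_limit[OF b h hb u]) (auto simp: U_def)
 have step1: "(\<lambda>k. F k s s') \<longlonglongrightarrow> G s s'" if s: "s \<in> S" and s': "s' \<in> U" for s s'
 proof (rule Vitali_tendsto[OF So Sc, of "\<lambda>k s. F k s s'" "\<lambda>s. G s s'" U s])
  have s'S: "s' \<in> S" using s' U by auto
  show "(\<lambda>s. F k s s') holomorphic_on S" for k by (rule hol(1)[OF s'S])
  show "(\<lambda>s. G s s') holomorphic_on S" by (rule Ghol(1)[OF s'S])
  show "\<exists>B. \<forall>k. \<forall>s\<in>K. norm (F k s s') <= B" if "K \<subseteq> S" for K
   using bnd[OF _ s'S] that by (intro exI[of _ "enn2real (ennreal \<bar>H\<bar> * (C + C))"]) auto
  show "(\<lambda>k. F k s s') \<longlonglongrightarrow> G s s'" if "s \<in> U" for s by (rule base[OF that s'])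
 qed (use U Une s in auto)
 have "(\<lambda>k. F k (of_real \<sigma>) s') \<longlonglongrightarrow> G (of_real \<sigma>) s'" if s': "s' \<in> S" for s'
 proof (rule Vitali_tendsto[OF So Sc, of "\<lambda>k s'. F k (of_real \<sigma>) s'" "\<lambda>s'. G (of_real \<sigma>) s'" U s'])
  show "(\<lambda>s'. F k (of_real \<sigma>) s') holomorphic_on S" for k by (rule hol(2)[OF sS])
  show "(\<lambda>s'. G (of_real \<sigma>) s') holomorphic_on S" by (rule Ghol(2)[OF sS])
  show "\<exists>B. \<forall>k. \<forall>s'\<in>K. norm (F k (of_real \<sigma>) s') <= B" if "K \<subseteq> S" for K
   using bnd[OF sS] that by (intro exI[of _ "enn2real (ennreal \<bar>H\<bar> * (C + C))"]) auto
  show "(\<lambda>k. F k (of_real \<sigma>) s') \<longlonglongrightarrow> G (of_real \<sigma>) s'" if "s' \<in> U" for s' by (rule step1[OF sS that])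
 qed (use U Une s' in auto)
 from this[OF sS] show ?thesis by (simp add: F_def G_def)
qed

text \<open>The parameter u k combines \<sigma> k - \<sigma>' and t k; complex conjugation of E turns the product into a square.\<close>
lemma eisenstein_square_limit:
 fixes t \<sigma> :: "nat => real" and h :: "complex => real"
 assumes b: "b >= 1 / 2"
  and h [measurable]: "h \<in> borel_fun" and hb: "\<And>z. z \<in> strip b ==> \<bar>h z\<bar> <= H"
  and \<sigma>: "\<sigma> \<longlonglongrightarrow> \<sigma>'" "\<sigma>' > 1 / 2" and t: "filterlim t at_top sequentially"
 shows "(\<lambda>k. \<integral>z. h z * (norm (eisenstein z (Complex (\<sigma> k) (t k))))\<^sup>2 \<partial>strip_leb b)
  \<longlonglongrightarrow> (\<integral>z. h z * Re (eisenstein z (of_real (2 * \<sigma>'))) \<partial>strip_leb b)"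
proof -
 define \<eta> where "\<eta> = (\<sigma>' - 1 / 2) / 3"
 have \<eta>: "\<eta> > 0" "\<sigma>' > 1 / 2 + 2 * \<eta>" using \<sigma>(2) by (auto simp: \<eta>_def field_simps)
 obtain C T0 where C: "C < \<infinity>" "\<forall>s\<in>half_domain. 1 / 2 + \<eta> <= Re s --> Re s <= \<sigma>' + 3 + \<eta> --> T0 <= \<bar>Im s\<bar> \<longrightarrow>
   (\<integral>\<^sup>+z. sqnorm (eisenstein z s) \<partial>strip_leb b) <= C"
  using eisenstein_strip_leb_bound[OF \<eta>(1) b, of "\<sigma>' + 3 + \<eta>"] by blast
 define T where "T = max 0 T0"
 define u where "u k = Complex (\<sigma> k - \<sigma>') (t k)" for k
 have u: "(\<lambda>k. Re (u k)) \<longlonglongrightarrow> 0" "filterlim (\<lambda>k. Im (u k)) at_top sequentially"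
  using \<sigma>(1) t by (auto simp: u_def LIM_zero)
 have "\<forall>\<^sub>F k in sequentially. \<bar>Re (u k)\<bar> < \<eta>" using tendstoD[OF u(1) \<eta>(1)] by (simp add: dist_real_def)
 moreover have "\<forall>\<^sub>F k in sequentially. Im (u k) >= T + 1" using u(2) by (simp add: filterlim_at_top)
 ultimately have "\<forall>\<^sub>F k in sequentially. \<bar>Re (u k)\<bar> < \<eta> \<and> Im (u k) >= T + 1" by eventually_elim simp
 then obtain N where N: "\<And>k. k >= N ==> \<bar>Re (u k)\<bar> < \<eta> \<and> Im (u k) >= T + 1" by (auto simp: eventually_sequentially)
 define v where "v k = u (k + N)" for k
 have v: "(\<lambda>k. Re (v k)) \<longlonglongrightarrow> 0" "filterlim (\<lambda>k. Im (v k)) at_top sequentially"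
  unfolding v_def using LIMSEQ_ignore_initial_segment[OF u(1)] filterlim_compose[OF u(2) filterlim_add_const_nat_at_top]
  by auto
 have vk: "\<bar>Re (v k)\<bar> <= \<eta>" "Im (v k) >= T + 1" for k using N[of "k + N"] by (auto simp: v_def)
 have "(\<lambda>k. \<integral>z. of_real (h z) * (eisenstein z (of_real \<sigma>' + v k) * eisenstein z (of_real \<sigma>' + cnj (v k))) \<partial>strip_leb b)
  \<longlonglongrightarrow> (\<integral>z. of_real (h z) * eisenstein z (of_real (2 * \<sigma>')) \<partial>strip_leb b)"
  by (rule eisenstein_square_limit_bounded[OF b h hb \<eta>(2,1) v vk _ C(1)]) (use C(2) in \<open>auto simp: T_def\<close>)
 moreover have "(\<integral>z. of_real (h z) * (eisenstein z (of_real \<sigma>' + v k) * eisenstein z (of_real \<sigma>' + cnj (v k))) \<partial>strip_leb b)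
  = of_real (\<integral>z. h z * (norm (eisenstein z (Complex (\<sigma> (k + N)) (t (k + N)))))\<^sup>2 \<partial>strip_leb b)" for k
  unfolding integral_complex_of_real[symmetric]
 proof (rule lint_cong[OF refl])
  fix z assume "z \<in> space (strip_leb b)"
  then have z: "Im z > 0" using stripD by simp
  define s where "s = Complex (\<sigma> (k + N)) (t (k + N))"
  have s1: "of_real \<sigma>' + v k = s" by (simp add: s_def v_def u_def complex_eq_iff)
  have s2: "of_real \<sigma>' + cnj (v k) = cnj s" unfolding s1[symmetric] by simp
  have "Re s > 1 / 2" unfolding s1[symmetric] using vk(1)[of k] \<eta> by auto
  moreover have "s ~= 1" unfolding s1[symmetric] using vk(2)[of k] by (auto simp: complex_eq_iff T_def)
  ultimately have "eisenstein z (cnj s) = cnj (eisenstein z s)" by (rule eisenstein_cnj[OF z])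
  then show "of_real (h z) * (eisenstein z (of_real \<sigma>' + v k) * eisenstein z (of_real \<sigma>' + cnj (v k))) = of_real (h z * (norm (eisenstein z (Complex (\<sigma> (k + N)) (t (k + N)))))\<^sup>2)"
   unfolding s1 s2 s_def[symmetric] by (simp only: of_real_mult complex_norm_square)
 qed
 ultimately have "(\<lambda>k. complex_of_real (\<integral>z. h z * (norm (eisenstein z (Complex (\<sigma> (k + N)) (t (k + N)))))\<^sup>2 \<partial>strip_leb b))
  \<longlonglongrightarrow> (\<integral>z. of_real (h z) * eisenstein z (of_real (2 * \<sigma>')) \<partial>strip_leb b)" by simp
 from tendsto_Re[OF this]
 have lim: "(\<lambda>k. \<integral>z. h z * (norm (eisenstein z (Complex (\<sigma> (k + N)) (t (k + N)))))\<^sup>2 \<partial>strip_leb b)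
  \<longlonglongrightarrow> Re (\<integral>z. of_real (h z) * eisenstein z (of_real (2 * \<sigma>')) \<partial>strip_leb b)" by simp
 have d: "complex_of_real (2 * \<sigma>') \<in> half_domain" using \<sigma>(2) by (intro half_domainI) simp
 obtain Q where Q: "\<And>z. z \<in> strip b ==> norm (eisenstein z (of_real (2 * \<sigma>'))) <= Q"
  using eisenstein_strip_bounded[OF d] by blast
 have "integrable (strip_leb b) (\<lambda>z. of_real (h z) * eisenstein z (of_real (2 * \<sigma>')))"
 proof (rule strip_integral_bound(1))
  have "(\<lambda>z. complex_of_real (h z)) \<in> borel_measurable (strip_leb b)" by (rule measurable_strip_leb) measurable
  then show "(\<lambda>z. of_real (h z) * eisenstein z (of_real (2 * \<sigma>'))) \<in> borel_measurable (strip_leb b)"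
   by (rule borel_measurable_times[OF _ continuous_measurable_strip_leb[OF eisenstein_continuous[OF d]]])
  show "norm (of_real (h z) * eisenstein z (of_real (2 * \<sigma>'))) <= H * Q" if z: "z \<in> strip b" for z
   unfolding norm_mult norm_of_real using hb[OF z] Q[OF z] order.trans[OF abs_ge_zero hb[OF z]] by (intro mult_mono) auto
 qed
 then have "Re (\<integral>z. of_real (h z) * eisenstein z (of_real (2 * \<sigma>')) \<partial>strip_leb b) = (\<integral>z. h z * Re (eisenstein z (of_real (2 * \<sigma>'))) \<partial>strip_leb b)"
  by (simp only: integral_Re[symmetric]) simp
 then show ?thesis
  using lim LIMSEQ_offset by (simp only:)
qed

section \<open>Passage to the quotient\<close>

lemma open_uhp: "open uhp"
 unfolding uhp_def by (rule open_halfspace_Im_gt)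

lemma eisenstein_modular_proj:
 assumes "Im z > 0"
 shows "eisenstein_modular (modular_proj z) = eisenstein z"
proof -
 have p: "modular_proj z = {moebius a b c d z | a b c d. a * d - b * c = 1}"
  unfolding modular_proj_def orbit_def carrier_PSL2Z by blast
 have "(1::int) * 1 - 0 * 0 = 1" by simp
 then have "moebius 1 0 0 1 z \<in> modular_proj z" unfolding p by blast
 then have "(SOME w. w \<in> modular_proj z) \<in> modular_proj z" by (rule someI)
 then obtain a b c d where "(SOME w. w \<in> modular_proj z) = moebius a b c d z" "a * d - b * c = 1"
  unfolding p by blast
 then show ?thesis unfolding eisenstein_modular_def using eisenstein_invariant[OF assms] by simp
qed

lemma modular_carrier_eq: "modular_carrier = modular_proj ` uhp"
 unfolding modular_carrier_def orbits_def modular_proj_def by auto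

lemma topspace_modular_curve: "topspace modular_curve = modular_carrier"
 using quotient_imp_surjective_map[OF modular_proj_quotient_map] by (simp add: modular_carrier_eq)

lemma openin_modular_curveD:
 assumes "openin modular_curve U"
 shows "U \<subseteq> modular_carrier" "open (modular_proj -` U \<inter> uhp)"
proof -
 show U: "U \<subseteq> modular_carrier" using openin_subset[OF assms] by (simp add: topspace_modular_curve)
 have "openin (top_of_set uhp) {z \<in> topspace (top_of_set uhp). modular_proj z \<in> U}"
  using modular_proj_quotient_map assms U unfolding quotient_map_def topspace_modular_curve by blast
 moreover have "{z \<in> topspace (top_of_set uhp). modular_proj z \<in> U} = modular_proj -` U \<inter> uhp" by auto
 ultimately show "open (modular_proj -` U \<inter> uhp)" by (simp only: openin_open_eq[OF open_uhp])
qed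

lemma continuous_eisenstein_modular:
 assumes "s \<in> half_domain"
 shows "continuous_map modular_curve euclidean (\<lambda>p. eisenstein_modular p s)"
proof -
 have "continuous_map (top_of_set uhp) euclidean (\<lambda>z. eisenstein z s)"
  using eisenstein_continuous[OF assms] by (simp add: continuous_map_iff_continuous)
 then have "continuous_map (top_of_set uhp) euclidean ((\<lambda>p. eisenstein_modular p s) \<circ> modular_proj)"
  by (rule continuous_map_eq) (auto simp: eisenstein_modular_proj)
 then show ?thesis
  unfolding continuous_compose_quotient_map_eq[OF modular_proj_quotient_map] .
qed

abbreviation modular_borel :: "complex set measure" where
 "modular_borel \<equiv> sigma modular_carrier {U. openin modular_curve U}"

lemma open_sets_modular: "{U. openin modular_curve U} \<subseteq> Pow modular_carrier"
 using openin_modular_curveD(1) by blast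

lemma modular_proj_measurable: "modular_proj \<in> restrict_space borel uhp \<rightarrow>\<^sub>M modular_borel"
proof (rule measurable_measure_of[OF open_sets_modular])
 show "modular_proj \<in> space (restrict_space borel uhp) \<rightarrow> modular_carrier"
  unfolding modular_carrier_eq by (intro funcsetI imageI) (simp add: space_restrict_space)
 fix U assume "U \<in> {U. openin modular_curve U}"
 then have "openin modular_curve U" by (rule CollectD)
 then have "modular_proj -` U \<inter> uhp \<in> sets borel" by (intro borel_open openin_modular_curveD(2))
 then show "modular_proj -` U \<inter> space (restrict_space borel uhp) \<in> sets (restrict_space borel uhp)"
  using open_uhp by (subst sets_restrict_space_iff) (auto simp: space_restrict_space)
qed

lemma sets_modular_measure: "sets modular_measure = sets modular_borel" by (simp add: modular_measure_def)

lemma eisenstein_modular_measurable: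
 assumes "s \<in> half_domain"
 shows "(\<lambda>p. eisenstein_modular p s) \<in> borel_measurable modular_measure"
proof -
 have "(\<lambda>p. eisenstein_modular p s) \<in> borel_measurable modular_borel"
 proof (rule borel_measurableI)
  fix V :: "complex set" assume "open V"
  then have "openin modular_curve {p \<in> topspace modular_curve. eisenstein_modular p s \<in> V}"
   by (intro openin_continuous_map_preimage[OF continuous_eisenstein_modular[OF assms]]) simp
  moreover have "{p \<in> topspace modular_curve. eisenstein_modular p s \<in> V} = (\<lambda>p. eisenstein_modular p s) -` V \<inter> space modular_borel"
   using open_sets_modular by (auto simp: topspace_modular_curve space_measure_of)
  ultimately show "(\<lambda>p. eisenstein_modular p s) -` V \<inter> space modular_borel \<in> sets modular_borel"
   using open_sets_modular by (auto simp: sets_measure_of)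
 qed
 then show ?thesis using measurable_cong_sets[OF sets_modular_measure refl] by blast
qed

lemma fundamental_domain_sets: "fundamental_domain \<in> sets borel"
proof -
 have "fundamental_domain = {z. Im z > 0} \<inter> {z. \<bar>Re z\<bar> <= 1 / 2} \<inter> {z. norm z >= 1}"
  by (auto simp: fundamental_domain_def)
 also have "... \<in> sets borel" by (intro sets.Int) measurable
 finally show ?thesis .
qed

lemma nn_integral_modular_measure:
 assumes \<phi>: "\<phi> \<in> borel_measurable modular_measure"
 shows "(\<integral>\<^sup>+p. \<phi> p \<partial>modular_measure) = (\<integral>\<^sup>+z. ennreal (1 / (Im z)\<^sup>2) * \<phi> (modular_proj z) * indicator fundamental_domain z \<partial>lborel)"
proof -
 have F: "fundamental_domain \<subseteq> uhp" by (auto simp: fundamental_domain_def)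
 have ss: "sets (restrict_space lborel uhp) = sets (restrict_space borel uhp)" by (rule sets_restrict_space_cong) simp
 have sh: "sets hyperbolic_measure = sets (restrict_space borel uhp)" "space hyperbolic_measure = uhp"
  by (simp_all add: hyperbolic_measure_def ss space_restrict_space)
 have FS: "fundamental_domain \<in> sets hyperbolic_measure"
  unfolding sh using F fundamental_domain_sets open_uhp by (subst sets_restrict_space_iff) auto
 have pm: "modular_proj \<in> restrict_space hyperbolic_measure fundamental_domain \<rightarrow>\<^sub>M modular_borel"
  by (rule measurable_restrict_space1) (use modular_proj_measurable measurable_cong_sets[OF sh(1) refl] in blast)
 have \<phi>': "\<phi> \<in> borel_measurable modular_borel"
  using \<phi> measurable_cong_sets[OF sets_modular_measure refl] by blast
 have \<phi>p: "(\<lambda>z. \<phi> (modular_proj z)) \<in> borel_measurable (restrict_space lborel uhp)"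
  using measurable_compose[OF modular_proj_measurable \<phi>'] measurable_cong_sets[OF ss refl] by blast
 have Fm: "indicator fundamental_domain \<in> borel_measurable (restrict_space lborel uhp)"
  by (rule measurable_restrict_space1) (use fundamental_domain_sets in simp)
 have wm: "(\<lambda>z. ennreal (1 / (Im z)\<^sup>2)) \<in> borel_measurable (restrict_space lborel uhp)"
  by (rule measurable_restrict_space1) measurable
 have "(\<integral>\<^sup>+p. \<phi> p \<partial>modular_measure) = (\<integral>\<^sup>+z. \<phi> (modular_proj z) \<partial>restrict_space hyperbolic_measure fundamental_domain)"
  unfolding modular_measure_def by (rule nn_integral_distr[OF pm \<phi>[unfolded modular_measure_def]])
 also have "... = (\<integral>\<^sup>+z. \<phi> (modular_proj z) * indicator fundamental_domain z \<partial>hyperbolic_measure)"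
  using FS by (intro nn_integral_restrict_space) auto
 also have "... = (\<integral>\<^sup>+z. ennreal (1 / (Im z)\<^sup>2) * (\<phi> (modular_proj z) * indicator fundamental_domain z) \<partial>restrict_space lborel uhp)"
  unfolding hyperbolic_measure_def by (rule nn_integral_density[OF wm borel_measurable_times_ennreal[OF \<phi>p Fm]])
 also have "... = (\<integral>\<^sup>+z. ennreal (1 / (Im z)\<^sup>2) * (\<phi> (modular_proj z) * indicator fundamental_domain z) * indicator uhp z \<partial>lborel)"
  using open_uhp by (intro nn_integral_restrict_space) auto
 also have "... = (\<integral>\<^sup>+z. ennreal (1 / (Im z)\<^sup>2) * \<phi> (modular_proj z) * indicator fundamental_domain z \<partial>lborel)"
  using F by (intro nn_integral_cong) (auto simp: indicator_def mult.assoc)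
 finally show ?thesis .
qed

text \<open>All terms are positive, and the vector (0, 1) alone contributes Im z powr \<sigma>.\<close>
lemma eisenstein_real_lower_bound:
 assumes z: "Im z > 0" and \<sigma>: "\<sigma> > 1"
 shows "eisenstein z (of_real \<sigma>) = of_real (Re (eisenstein z (of_real \<sigma>)))"
  and "Im z powr \<sigma> <= Re (eisenstein z (of_real \<sigma>))"
proof -
 have sm: "(\<lambda>v. qform z v powr (- \<sigma>)) summable_on prim"
  by (rule summable_on_subset_banach[OF qform_summable[OF z \<sigma>]]) (use prim_lat in auto)
 have "eisenstein z (of_real \<sigma>) = (\<Sum>\<^sub>\<infinity>v\<in>prim. of_real (qform z v) powr (- of_real \<sigma>))"
  by (rule eisenstein_prim[OF z]) (use \<sigma> in simp)
 also have "... = (\<Sum>\<^sub>\<infinity>v\<in>prim. of_real (qform z v powr (- \<sigma>)))"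
 proof (rule infsum_cong)
  fix v assume "v \<in> prim"
  then have "qform z v > 0" using qform_pos[OF z] prim_lat by blast
  then show "complex_of_real (qform z v) powr (- of_real \<sigma>) = of_real (qform z v powr (- \<sigma>))"
   using powr_of_real[of "qform z v" "- \<sigma>"] by simp
 qed
 also have "... = of_real (\<Sum>\<^sub>\<infinity>v\<in>prim. qform z v powr (- \<sigma>))"
  by (rule infsumI[OF has_sum_of_real[OF has_sum_infsum[OF sm]]])
 finally have E: "eisenstein z (of_real \<sigma>) = of_real (\<Sum>\<^sub>\<infinity>v\<in>prim. qform z v powr (- \<sigma>))" .
 then show "eisenstein z (of_real \<sigma>) = of_real (Re (eisenstein z (of_real \<sigma>)))" by simp
 have "(0, 1) \<in> prim" by (simp add: prim_def)
 then have "(\<Sum>v\<in>{(0, 1)}. qform z v powr (- \<sigma>)) <= (\<Sum>\<^sub>\<infinity>v\<in>prim. qform z v powr (- \<sigma>))"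
  by (intro finite_sum_le_infsum sm) auto
 moreover have "qform z (0, 1) powr (- \<sigma>) = Im z powr \<sigma>"
  using z by (simp add: qform_def powr_divide powr_minus)
 ultimately show "Im z powr \<sigma> <= Re (eisenstein z (of_real \<sigma>))" by (simp add: E)
qed

lemma fundamental_domain_strip:
 assumes "z \<in> fundamental_domain" "Im z <= b"
 shows "z \<in> strip b"
proof -
 have z: "\<bar>Re z\<bar> <= 1 / 2" "norm z >= 1" "Im z > 0" using assms by (auto simp: fundamental_domain_def)
 have "\<bar>Re z\<bar>\<^sup>2 <= (1 / 2)\<^sup>2" using z(1) by (intro power_mono) auto
 then have "(Re z)\<^sup>2 <= 1 / 4" by (simp add: power_divide)
 moreover have "1 <= (Re z)\<^sup>2 + (Im z)\<^sup>2" unfolding cmod_power2[symmetric] using z(2) by simp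
 ultimately have "(1 / 2)\<^sup>2 <= (Im z)\<^sup>2" unfolding power_divide by simp
 then have "1 / 2 <= Im z" using z(3) by (intro power2_le_imp_le[of "1 / 2"]) auto
 then show ?thesis using z assms(2) by (simp add: strip_def)
qed

text \<open>Transfers integrals over part of the quotient to the strip, both for the hyperbolic measure itself and for the weighted one.\<close>
lemma modular_integral_strip:
 fixes \<rho> :: "complex => real"
 assumes A: "A \<in> sets modular_measure" and b: "\<And>z. z \<in> fundamental_domain ==> modular_proj z \<in> A ==> z \<in> strip b"
  and \<phi>: "\<phi> \<in> borel_measurable modular_measure"
  and h [measurable]: "h \<in> borel_fun" and hb: "\<And>z. z \<in> strip b ==> 0 <= h z \<and> h z <= H"
  and \<rho>: "\<rho> \<in> borel_measurable (strip_leb b)" "\<And>z. z \<in> strip b ==> 0 <= \<rho> z \<and> \<rho> z <= Q"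
  and eq: "\<And>z. z \<in> strip b ==> z \<in> fundamental_domain ==> modular_proj z \<in> A ==> ennreal (1 / (Im z)\<^sup>2) * \<phi> (modular_proj z) = ennreal (h z * \<rho> z)"
  and zero: "\<And>z. \<not> (z \<in> fundamental_domain \<and> modular_proj z \<in> A) ==> h z = 0"
 shows "(\<integral>\<^sup>+p. \<phi> p * indicator A p \<partial>modular_measure) = ennreal (\<integral>z. h z * \<rho> z \<partial>strip_leb b)"
proof -
 interpret finite_measure "strip_leb b" by (rule finite_measure_strip_leb)
 have "(\<integral>\<^sup>+p. \<phi> p * indicator A p \<partial>modular_measure)
  = (\<integral>\<^sup>+z. ennreal (1 / (Im z)\<^sup>2) * (\<phi> (modular_proj z) * indicator A (modular_proj z)) * indicator fundamental_domain z \<partial>lborel)"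
  using A \<phi> by (intro nn_integral_modular_measure borel_measurable_times_ennreal) auto
 also have "... = (\<integral>\<^sup>+z. ennreal (h z * \<rho> z) * indicator (strip b) z \<partial>lborel)"
 proof (rule nn_integral_cong)
  fix z
  show "ennreal (1 / (Im z)\<^sup>2) * (\<phi> (modular_proj z) * indicator A (modular_proj z)) * indicator fundamental_domain z = ennreal (h z * \<rho> z) * indicator (strip b) z"
  proof (cases "z \<in> fundamental_domain \<and> modular_proj z \<in> A")
   case True
   then show ?thesis using b[of z] eq[of z] by simp
  next
   case False
   then show ?thesis using zero[OF False] by (auto simp: indicator_def)
  qed
 qed
 also have "... = (\<integral>\<^sup>+z. ennreal (h z * \<rho> z) \<partial>strip_leb b)"
  unfolding strip_leb_def by (rule nn_integral_restrict_space[symmetric]) simp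
 also have "... = ennreal (\<integral>z. h z * \<rho> z \<partial>strip_leb b)"
 proof (rule nn_integral_eq_integral)
  show "integrable (strip_leb b) (\<lambda>z. h z * \<rho> z)"
  proof (rule integrable_const_bound[of _ "H * Q"])
   show "(\<lambda>z. h z * \<rho> z) \<in> borel_measurable (strip_leb b)"
    by (intro borel_measurable_times \<rho>(1) measurable_strip_leb h)
   show "AE z in strip_leb b. norm (h z * \<rho> z) <= H * Q"
   proof (rule AE_I2)
    fix z assume "z \<in> space (strip_leb b)"
    then have "0 <= h z \<and> h z <= H" "0 <= \<rho> z \<and> \<rho> z <= Q" using hb \<rho>(2) by auto
    then show "norm (h z * \<rho> z) <= H * Q" by (simp add: abs_mult mult_mono)
   qed
  qed
  show "AE z in strip_leb b. 0 <= h z * \<rho> z"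
   using hb \<rho>(2) by (intro AE_I2) auto
 qed
 finally show ?thesis .
qed

theorem corollary1p5:
  fixes \<sigma> :: "real \<Rightarrow> real" and \<sigma>inf :: real and A :: "complex set set"
  assumes "\<forall>\<^sub>F t in at_top. \<sigma> t > 1 / 2"
    and "(\<sigma> \<longlongrightarrow> \<sigma>inf) at_top"
    and "\<sigma>inf > 1 / 2"
    and "jordan_measurable_modular A"
  shows "((\<lambda>t. emeasure (eisenstein_measure \<sigma>inf (Complex (\<sigma> t) t)) A)
           \<longlongrightarrow> emeasure modular_measure A) at_top"
proof (cases "A \<in> sets modular_measure")
 case False
 \<comment> \<open>outside the \<sigma>-algebra both sides are 0 by convention\<close>
 then have "emeasure (eisenstein_measure \<sigma>inf s) A = 0" "emeasure modular_measure A = 0" for s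
  by (auto simp: eisenstein_measure_def intro!: emeasure_notin_sets)
 then show ?thesis by simp
next
 case A: True
 define w where "w = complex_of_real (2 * \<sigma>inf)"
 have w: "w \<in> half_domain" unfolding w_def using assms(3) by (intro half_domainI) simp
 define e where "e z = Re (eisenstein z w)" for z
 have e: "eisenstein z w = of_real (e z)" "Im z powr (2 * \<sigma>inf) <= e z" "e z > 0" if "Im z > 0" for z
 proof -
  show "eisenstein z w = of_real (e z)" "Im z powr (2 * \<sigma>inf) <= e z"
   using eisenstein_real_lower_bound[OF that, of "2 * \<sigma>inf"] assms(3) by (simp_all add: e_def w_def)
  then show "e z > 0" using that powr_gt_zero[of "Im z" "2 * \<sigma>inf"] by linarith
 qed
 obtain R where R: "\<And>p. p \<in> A ==> norm (eisenstein_modular p w) <= R"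
 proof -
  have "compactin modular_curve A" using assms(4) by (simp add: jordan_measurable_modular_def)
  then have "compactin euclidean ((\<lambda>p. eisenstein_modular p w) ` A)"
   by (rule image_compactin[OF _ continuous_eisenstein_modular[OF w]])
  then have "bounded ((\<lambda>p. eisenstein_modular p w) ` A)" by (simp add: compact_imp_bounded)
  then show ?thesis using that by (auto simp: bounded_iff)
 qed
 \<comment> \<open>the height of a point over A is at most b, since its 2 \<sigma>inf-th power is at most R\<close>
 define b where "b = max 1 R"
 have b: "b >= 1 / 2" by (simp add: b_def)
 have Ab: "z \<in> strip b" if z: "z \<in> fundamental_domain" "modular_proj z \<in> A" for z
 proof -
  have z0: "Im z > 0" using z(1) by (simp add: fundamental_domain_def)
  have "e z <= R" using R[OF z(2)] e(3)[OF z0] by (simp add: eisenstein_modular_proj[OF z0] e(1)[OF z0])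
  then have le: "Im z powr (2 * \<sigma>inf) <= R" using e(2)[OF z0] by simp
  have "Im z <= b"
  proof (cases "Im z <= 1")
   case False
   then have "Im z powr 1 <= Im z powr (2 * \<sigma>inf)" using assms(3) by (intro powr_mono) auto
   then show ?thesis using le False by (simp add: b_def)
  qed (simp add: b_def)
  then show ?thesis by (rule fundamental_domain_strip[OF z(1)])
 qed
 define B where "B = {z \<in> fundamental_domain. modular_proj z \<in> A}"
 have Bs: "B \<subseteq> strip b" using Ab by (auto simp: B_def)
 have [measurable]: "B \<in> sets borel"
 proof -
  have "modular_proj -` A \<inter> space (restrict_space borel uhp) \<in> sets (restrict_space borel uhp)"
   using A by (intro measurable_sets[OF modular_proj_measurable]) (simp add: sets_modular_measure)
  then have "modular_proj -` A \<inter> uhp \<in> sets borel"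
   using open_uhp by (subst (asm) sets_restrict_space_iff) (auto simp: space_restrict_space)
  then have "(modular_proj -` A \<inter> uhp) \<inter> fundamental_domain \<in> sets borel" using fundamental_domain_sets by (rule sets.Int)
  also have "(modular_proj -` A \<inter> uhp) \<inter> fundamental_domain = B" by (auto simp: B_def fundamental_domain_def)
  finally show ?thesis .
 qed
 define k where "k z = indicator (strip b) z *\<^sub>R (1 / ((Im z)\<^sup>2 * e z))" for z
 define h where "h z = indicator B z * k z" for z
 have ec: "continuous_on (strip b) e"
  unfolding e_def by (intro continuous_intros continuous_on_subset[OF eisenstein_continuous[OF w]]) (use stripD in auto)
 have km [measurable]: "k \<in> borel_fun"
  unfolding k_def
 proof (rule borel_measurable_continuous_on_indicator)
  show "continuous_on (strip b) (\<lambda>z. 1 / ((Im z)\<^sup>2 * e z))"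
   using stripD(2) e(3) by (intro continuous_intros ec) force
 qed simp
 have hm: "h \<in> borel_fun" unfolding h_def by measurable
 define m where "m = (1 / 2) powr (2 * \<sigma>inf) / 4"
 have m: "m > 0" by (simp add: m_def)
 have hb: "0 <= h z \<and> h z <= 1 / m" if z: "z \<in> strip b" for z
 proof -
  have "(1 / 2) powr (2 * \<sigma>inf) <= Im z powr (2 * \<sigma>inf)" using stripD(1)[OF z] assms(3) by (intro powr_mono2) auto
  then have "(1 / 2) powr (2 * \<sigma>inf) <= e z" using e(2)[OF stripD(2)[OF z]] by simp
  moreover have "(1 / 2)\<^sup>2 <= (Im z)\<^sup>2" using stripD(1)[OF z] by (intro power_mono) auto
  ultimately have "(1 / 2)\<^sup>2 * (1 / 2) powr (2 * \<sigma>inf) <= (Im z)\<^sup>2 * e z" by (intro mult_mono) auto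
  then have "m <= (Im z)\<^sup>2 * e z" by (simp add: m_def power2_eq_square)
  then have "1 / ((Im z)\<^sup>2 * e z) <= 1 / m" "0 <= 1 / ((Im z)\<^sup>2 * e z)" using m by (auto intro!: divide_left_mono)
  then show ?thesis using m by (auto simp: h_def k_def indicator_def)
 qed
 have hB: "h z = 1 / ((Im z)\<^sup>2 * e z)" if "z \<in> B" for z
  using that Bs by (auto simp: h_def k_def)
 have h0: "h z = 0" if "\<not> (z \<in> fundamental_domain \<and> modular_proj z \<in> A)" for z
  using that by (simp add: h_def B_def)
 obtain Q where Q: "\<forall>z\<in>strip b. norm (eisenstein z w) <= Q" using eisenstein_strip_bounded[OF w] by blast
 have limit: "emeasure modular_measure A = ennreal (\<integral>z. h z * e z \<partial>strip_leb b)"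
 proof -
  have "emeasure modular_measure A = (\<integral>\<^sup>+p. 1 * indicator A p \<partial>modular_measure)" using A by simp
  also have "... = ennreal (\<integral>z. h z * e z \<partial>strip_leb b)"
  proof (rule modular_integral_strip[OF A Ab _ hm hb _ _ _ h0])
   show "e \<in> borel_measurable (strip_leb b)"
    unfolding e_def using measurable_compose[OF continuous_measurable_strip_leb[OF eisenstein_continuous[OF w]] borel_measurable_Re] by simp
   show "0 <= e z \<and> e z <= Q" if "z \<in> strip b" for z
   proof -
    have "norm (eisenstein z w) <= Q" using Q that by blast
    then show ?thesis using e(3)[OF stripD(2)[OF that]] by (simp add: e(1)[OF stripD(2)[OF that]])
   qed
   show "ennreal (1 / (Im z)\<^sup>2) * 1 = ennreal (h z * e z)" if "z \<in> strip b" "z \<in> fundamental_domain" "modular_proj z \<in> A" for z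
    using hB[of z] that e(3)[OF stripD(2)[OF that(1)]] by (simp add: B_def)
  qed auto
  finally show ?thesis .
 qed
 have value_at: "emeasure (eisenstein_measure \<sigma>inf s) A = ennreal (\<integral>z. h z * (norm (eisenstein z s))\<^sup>2 \<partial>strip_leb b)"
  if s: "s \<in> half_domain" for s
 proof -
  define \<phi> where "\<phi> p = ennreal ((cmod (eisenstein_modular p s / csqrt (eisenstein_modular p w)))\<^sup>2)" for p
  have csqm: "csqrt \<in> borel_fun"
  proof -
   have eq: "csqrt = (\<lambda>x. Complex (sqrt ((cmod x + Re x) / 2)) ((if Im x = 0 then 1 else sgn (Im x)) * sqrt ((cmod x - Re x) / 2)))"
    by (rule ext) (simp add: complex_eq_iff csqrt.sel)
   show ?thesis unfolding eq by measurable
  qed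
  have \<phi>m: "\<phi> \<in> borel_measurable modular_measure"
  proof -
   note [measurable] = eisenstein_modular_measurable[OF s] measurable_compose[OF eisenstein_modular_measurable[OF w] csqm]
   show ?thesis unfolding \<phi>_def by measurable
  qed
  obtain P where P: "\<forall>z\<in>strip b. norm (eisenstein z s) <= P" using eisenstein_strip_bounded[OF s] by blast
  have "emeasure (eisenstein_measure \<sigma>inf s) A = (\<integral>\<^sup>+p. \<phi> p * indicator A p \<partial>modular_measure)"
   unfolding eisenstein_measure_def w_def[symmetric] \<phi>_def[symmetric] by (rule emeasure_density[OF \<phi>m A])
  also have "... = ennreal (\<integral>z. h z * (norm (eisenstein z s))\<^sup>2 \<partial>strip_leb b)"
  proof (rule modular_integral_strip[OF A Ab \<phi>m hm hb _ _ _ h0])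
   show "(\<lambda>z. (norm (eisenstein z s))\<^sup>2) \<in> borel_measurable (strip_leb b)"
   proof -
    note [measurable] = continuous_measurable_strip_leb[OF eisenstein_continuous[OF s], of b]
    show ?thesis by measurable
   qed
   show "0 <= (norm (eisenstein z s))\<^sup>2 \<and> (norm (eisenstein z s))\<^sup>2 <= P\<^sup>2" if "z \<in> strip b" for z
    using P that by (auto intro!: power_mono)
   show "ennreal (1 / (Im z)\<^sup>2) * \<phi> (modular_proj z) = ennreal (h z * (norm (eisenstein z s))\<^sup>2)"
    if z: "z \<in> strip b" "z \<in> fundamental_domain" "modular_proj z \<in> A" for z
   proof -
    note z0 = stripD(2)[OF z(1)]
    have "(cmod (csqrt (eisenstein z w)))\<^sup>2 = cmod ((csqrt (eisenstein z w))\<^sup>2)" by (simp add: norm_power)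
    also have "... = e z" using e(3)[OF z0] by (simp only: power2_csqrt e(1)[OF z0]) simp
    finally have "(cmod (eisenstein z s / csqrt (eisenstein z w)))\<^sup>2 = (norm (eisenstein z s))\<^sup>2 / e z"
     using less_imp_le[OF e(3)[OF z0]] by (simp add: norm_divide power_divide)
    then have "\<phi> (modular_proj z) = ennreal ((norm (eisenstein z s))\<^sup>2 / e z)"
     by (simp add: \<phi>_def eisenstein_modular_proj[OF z0])
    moreover have "h z * (norm (eisenstein z s))\<^sup>2 = 1 / (Im z)\<^sup>2 * ((norm (eisenstein z s))\<^sup>2 / e z)"
     using hB[of z] z by (simp add: B_def)
    ultimately show ?thesis by (simp only:) (rule ennreal_mult[symmetric], use less_imp_le[OF e(3)[OF z0]] in auto)
   qed
  qed auto
  finally show ?thesis .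
 qed
 show ?thesis
 proof (rule tendsto_at_topI_sequentially)
  fix t :: "nat => real" assume t: "filterlim t at_top sequentially"
  have st: "(\<lambda>k. \<sigma> (t k)) \<longlonglongrightarrow> \<sigma>inf" by (rule filterlim_compose[OF assms(2) t])
  have "\<bar>h z\<bar> <= 1 / m" if "z \<in> strip b" for z using hb[OF that] by simp
  from eisenstein_square_limit[OF b hm this st assms(3) t]
  have "(\<lambda>k. \<integral>z. h z * (norm (eisenstein z (Complex (\<sigma> (t k)) (t k))))\<^sup>2 \<partial>strip_leb b) \<longlonglongrightarrow> (\<integral>z. h z * e z \<partial>strip_leb b)"
   by (simp add: e_def w_def)
  from tendsto_ennrealI[OF this]
  have lim: "(\<lambda>k. ennreal (\<integral>z. h z * (norm (eisenstein z (Complex (\<sigma> (t k)) (t k))))\<^sup>2 \<partial>strip_leb b)) \<longlonglongrightarrow> emeasure modular_measure A"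
   unfolding limit .
  have "\<forall>\<^sub>F k in sequentially. \<sigma> (t k) > 1 / 2 \<and> t k > 0"
   using eventually_compose_filterlim[OF assms(1) t] filterlim_at_top_dense[THEN iffD1, OF t, rule_format, of 0]
   by eventually_elim simp
  then have "\<forall>\<^sub>F k in sequentially. ennreal (\<integral>z. h z * (norm (eisenstein z (Complex (\<sigma> (t k)) (t k))))\<^sup>2 \<partial>strip_leb b)
   = emeasure (eisenstein_measure \<sigma>inf (Complex (\<sigma> (t k)) (t k))) A"
   by eventually_elim (rule value_at[symmetric], auto simp: half_domain_def complex_eq_iff)
  with lim show "(\<lambda>k. emeasure (eisenstein_measure \<sigma>inf (Complex (\<sigma> (t k)) (t k))) A) \<longlonglongrightarrow> emeasure modular_measure A"
   by (rule Lim_transform_eventually)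
 qed
qed

end
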